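(* Consider the financial wealth $W$ (under any control $(c,B,\theta)$) and the labor income $y$ with initial data $w\in\mathbb R$, $x\in M_2$ at time $0$, and the human capital $$H(s):=\xi(s)^{-1}\,\mathbb E\Big(\int_s^{+\infty}\xi(u)(1-R(u))y(u)\,\mathrm du\,\Big|\,\mathcal F_s\Big).$$ For any $s\in[0,+\infty)$, the constraint $W(s)+H(s)\ge0$ can be equivalently rewritten ($\mathbb P$-a.s.) as $$W(s)+g(s)X_0(s)+\langle h(s),X_1(s)\rangle\ge0 .$$
   Context: Let $Z$ be an $n$-dimensional standard Brownian motion on $(\Omega,\mathcal F,\mathbb P)$ and $\mathbb F=(\mathcal F_s)_{s\ge0}$ the augmentation of its natural filtration. Parameters: $r\in\mathbb R$, $\mu\in\mathbb R^n$, $\sigma\in\mathbb R^{n\times n}$ invertible, $\delta>0$, $\tau_R>0$, $d>0$, $\mu_y\in\mathbb R$, $\sigma_y\in\mathbb R^n$, $\phi\in L^2(-d,0;\mathbb R)$; $\mathbf 1=(1,\dots,1)^\top$; $\kappa:=\sigma^{-1}(\mu-r\mathbf 1)$; $\beta:=r+\delta-\mu_y+\sigma_y^\top\kappa$, with the standing assumption $\beta>0$; $R(s):=\mathbb I_{\{\tau_R\le s\}}$. $M_2:=\mathbb R\times L^2(-d,0;\mathbb R)$, $\langle\cdot,\cdot\rangle$ the $L^2(-d,0)$ inner product. For $w\in\mathbb R$, $x=(x_0,x_1)\in M_2$ and $\mathbb F$-predictable controls $c,B\ge0$, $\theta\in\mathbb R^n$ with $\mathbb E\int_0^T(c+B+|\theta|^2)\mathrm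 ds<\infty$ for all $T>0$: $$\mathrm dW(s)=[(r+\delta)W(s)+\theta(s)^\top(\mu-r\mathbf 1)+(1-R(s))y(s)-c(s)-\delta B(s)]\mathrm ds+\theta(s)^\top\sigma\,\mathrm dZ(s),\quad W(0)=w,$$ $$\mathrm dy(s)=\Big[\mu_yy(s)+\int_{-d}^0\phi(\zeta)y(s+\zeta)\mathrm d\zeta\Big]\mathrm ds+y(s)\sigma_y^\top\mathrm dZ(s),\quad y(0)=x_0,\ y(\zeta)=x_1(\zeta),\ \zeta\in[-d,0).$$ $X_0(s)=y(s)$, $X_1(s)(\zeta)=y(s+\zeta)$, $\zeta\in[-d,0)$. The state-price density is $\mathrm d\xi(s)=-\xi(s)(r+\delta)\mathrm ds-\xi(s)\kappa^\top\mathrm dZ(s)$, $\xi(0)=1$. $(g,h)$, with $g:[0,\infty)\to\mathbb R$, $h:[0,\infty)\times[-d,0]\to\mathbb R$ continuous, is the unique continuous solution of $$g(t)=\mathbb I_{\{t<\tau_R\}}\int_t^{\tau_R}e^{-\beta(\tau-t)}(h(\tau,0)+1)\,\mathrm d\tau,\qquad h(t,\zeta)=\mathbb I_{\{t<\tau_R\}}\int_{(\zeta+t-\tau_R)\vee(-d)}^{\zeta}e^{-(r+\delta)(\zeta-\tau)}g(t+\zeta-\tau)\phi(\tau)\,\mathrm d\tau,$$ and $h(s):=h(s,\cdot)$. *)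

theory Defs
  imports "HOL-Probability.Probability"
begin

section \<open>Filtration, Brownian motion, predictability\<close>

text \<open>All processes are indexed by real time; only times \<open>t \<ge> 0\<close> are relevant,
  except for the labor income, whose initial history lives on \<open>{-d..<0}\<close>.\<close>

definition natural_filtration ::
    "'w measure \<Rightarrow> (real \<Rightarrow> 'w \<Rightarrow> 'b::topological_space) \<Rightarrow> real \<Rightarrow> 'w measure" where
  "natural_filtration M Z s =
     sigma (space M) (\<Union>u\<in>{0..s}. {Z u -` A \<inter> space M | A. A \<in> sets borel})"

definition augmented_filtration ::
    "'w measure \<Rightarrow> (real \<Rightarrow> 'w \<Rightarrow> 'b::topological_space) \<Rightarrow> real \<Rightarrow> 'w measure" where
  "augmented_filtration M Z s =
     sigma (space M) (sets (natural_filtration M Z s) \<union> null_sets M)"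

definition standard_brownian_motion :: "'w measure \<Rightarrow> (real \<Rightarrow> 'w \<Rightarrow> real^'n) \<Rightarrow> bool" where
  "standard_brownian_motion M Z \<longleftrightarrow>
     (\<forall>t\<ge>0. Z t \<in> borel_measurable M) \<and>
     (AE \<omega> in M. Z 0 \<omega> = 0) \<and>
     (AE \<omega> in M. continuous_on {0..} (\<lambda>t. Z t \<omega>)) \<and>
     (\<forall>s t. 0 \<le> s \<and> s < t \<longrightarrow>
        prob_space.indep_set M (sets (natural_filtration M Z s))
          {(\<lambda>\<omega>. Z t \<omega> - Z s \<omega>) -` A \<inter> space M | A. A \<in> sets borel} \<and>
        prob_space.indep_vars M (\<lambda>_. borel) (\<lambda>i \<omega>. (Z t \<omega> - Z s \<omega>) $ i) UNIV \<and>
        (\<forall>i. distributed M lborel (\<lambda>\<omega>. (Z t \<omega> - Z s \<omega>) $ i) (normal_density 0 (sqrt (t - s)))))"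

definition predictable_algebra :: "'w measure \<Rightarrow> (real \<Rightarrow> 'w measure) \<Rightarrow> (real \<times> 'w) measure" where
  "predictable_algebra M F = sigma ({0..} \<times> space M)
     ({{0} \<times> A | A. A \<in> sets (F 0)} \<union> {{s<..t} \<times> A | s t A. 0 \<le> s \<and> s \<le> t \<and> A \<in> sets (F s)})"

definition predictable ::
    "'w measure \<Rightarrow> (real \<Rightarrow> 'w measure) \<Rightarrow> (real \<Rightarrow> 'w \<Rightarrow> 'b::topological_space) \<Rightarrow> bool" where
  "predictable M F X \<longleftrightarrow> (\<lambda>(s, \<omega>). X s \<omega>) \<in> borel_measurable (predictable_algebra M F)"

definition continuous_adapted ::
    "'w measure \<Rightarrow> (real \<Rightarrow> 'w measure) \<Rightarrow> (real \<Rightarrow> 'w \<Rightarrow> 'b::topological_space) \<Rightarrow> bool" where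
  "continuous_adapted M F X \<longleftrightarrow>
     (\<forall>t\<ge>0. X t \<in> borel_measurable (F t)) \<and>
     (\<forall>\<omega>\<in>space M. continuous_on {0..} (\<lambda>t. X t \<omega>))"


section \<open>Ito integral and Ito differentials\<close>

text \<open>The data \<open>k\<close>, \<open>t\<close>, \<open>\<eta>\<close> encode the simple process \<open>\<Sum>i<k. \<eta> i\<close> on \<open>{t i <.. t (Suc i)}\<close>.\<close>

definition simple_data ::
    "'w measure \<Rightarrow> (real \<Rightarrow> 'w measure) \<Rightarrow> nat \<Rightarrow> (nat \<Rightarrow> real) \<Rightarrow> (nat \<Rightarrow> 'w \<Rightarrow> real^'n) \<Rightarrow> bool" where
  "simple_data M F k t \<eta> \<longleftrightarrow>
     0 \<le> t 0 \<and> (\<forall>i<k. t i < t (Suc i)) \<and>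
     (\<forall>i<k. \<eta> i \<in> borel_measurable (F (t i)) \<and> bounded (\<eta> i ` space M))"

definition simple_process ::
    "nat \<Rightarrow> (nat \<Rightarrow> real) \<Rightarrow> (nat \<Rightarrow> 'w \<Rightarrow> real^'n) \<Rightarrow> real \<Rightarrow> 'w \<Rightarrow> real^'n" where
  "simple_process k t \<eta> s \<omega> = (\<Sum>i<k. indicator {t i<..t (Suc i)} s *\<^sub>R \<eta> i \<omega>)"

definition simple_integral ::
    "(real \<Rightarrow> 'w \<Rightarrow> real^'n) \<Rightarrow> nat \<Rightarrow> (nat \<Rightarrow> real) \<Rightarrow> (nat \<Rightarrow> 'w \<Rightarrow> real^'n) \<Rightarrow> real \<Rightarrow> 'w \<Rightarrow> real" where
  "simple_integral Z k t \<eta> s \<omega> =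
     (\<Sum>i<k. \<eta> i \<omega> \<bullet> (Z (min (t (Suc i)) s) \<omega> - Z (min (t i) s) \<omega>))"

text \<open>\<open>I\<close> is (a continuous version of) the process \<open>\<integral>\<^sub>0 v\<^sup>T dZ\<close>, for predictable \<open>v\<close> with
  pathwise locally square integrable norm: the limit in probability of the integrals of simple
  processes that converge to \<open>v\<close> in \<open>L\<^sup>2(0,T)\<close> in probability for every \<open>T\<close>. Extended
  nonnegative integrals are used so that no integrability has to be presupposed.\<close>

definition has_ito_integral ::
    "'w measure \<Rightarrow> (real \<Rightarrow> 'w measure) \<Rightarrow> (real \<Rightarrow> 'w \<Rightarrow> real^'n) \<Rightarrow>
     (real \<Rightarrow> 'w \<Rightarrow> real^'n) \<Rightarrow> (real \<Rightarrow> 'w \<Rightarrow> real) \<Rightarrow> bool" where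
  "has_ito_integral M F Z v I \<longleftrightarrow>
     predictable M F v \<and>
     (AE \<omega> in M. \<forall>T\<ge>0. (\<integral>\<^sup>+ s\<in>{0..T}. ennreal ((norm (v s \<omega>))\<^sup>2) \<partial>lborel) < \<infinity>) \<and>
     continuous_adapted M F I \<and>
     (\<exists>k t \<eta>. (\<forall>m. simple_data M F (k m) (t m) (\<eta> m)) \<and>
        (\<forall>T\<ge>0. \<forall>\<epsilon>>0.
           (\<lambda>m. measure M {\<omega> \<in> space M.
              (\<integral>\<^sup>+ s\<in>{0..T}. ennreal ((norm (v s \<omega> - simple_process (k m) (t m) (\<eta> m) s \<omega>))\<^sup>2) \<partial>lborel)
                > ennreal \<epsilon>}) \<longlonglongrightarrow> 0) \<and>
        (\<forall>T\<ge>0. \<forall>\<epsilon>>0.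
           (\<lambda>m. measure M {\<omega> \<in> space M.
              \<bar>I T \<omega> - simple_integral Z (k m) (t m) (\<eta> m) T \<omega>\<bar> > \<epsilon>}) \<longlonglongrightarrow> 0))"

text \<open>\<open>dX = b ds + v\<^sup>T dZ\<close>, \<open>X 0 = x\<close>, with \<open>X\<close> continuous and adapted. An SDE is obtained by
  letting \<open>b\<close> and \<open>v\<close> depend on \<open>X\<close>.\<close>

definition has_ito_differential ::
    "'w measure \<Rightarrow> (real \<Rightarrow> 'w measure) \<Rightarrow> (real \<Rightarrow> 'w \<Rightarrow> real^'n) \<Rightarrow> (real \<Rightarrow> 'w \<Rightarrow> real) \<Rightarrow>
     real \<Rightarrow> (real \<Rightarrow> 'w \<Rightarrow> real) \<Rightarrow> (real \<Rightarrow> 'w \<Rightarrow> real^'n) \<Rightarrow> bool" where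
  "has_ito_differential M F Z X x b v \<longleftrightarrow>
     continuous_adapted M F X \<and>
     (AE \<omega> in M. \<forall>t\<ge>0. set_integrable lborel {0..t} (\<lambda>s. b s \<omega>)) \<and>
     (\<exists>I. has_ito_integral M F Z v I \<and>
        (AE \<omega> in M. \<forall>t\<ge>0. X t \<omega> = x + (LBINT s:{0..t}. b s \<omega>) + I t \<omega>))"


section \<open>The space \<open>M\<^sub>2 = \<real> \<times> L\<^sup>2(-d,0)\<close>\<close>

text \<open>Elements of \<open>L\<^sup>2(-d,0)\<close> are given by Borel representatives on the real line.\<close>

definition L2_fun :: "real \<Rightarrow> (real \<Rightarrow> real) set" where
  "L2_fun d = {f. set_borel_measurable lborel {-d<..<0} f \<and>
                  set_integrable lborel {-d<..<0} (\<lambda>\<zeta>. (f \<zeta>)\<^sup>2)}"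

definition L2_inner :: "real \<Rightarrow> (real \<Rightarrow> real) \<Rightarrow> (real \<Rightarrow> real) \<Rightarrow> real" where
  "L2_inner d f g = (LBINT \<zeta>:{-d<..<0}. f \<zeta> * g \<zeta>)"

definition M2 :: "real \<Rightarrow> (real \<times> (real \<Rightarrow> real)) set" where
  "M2 d = UNIV \<times> L2_fun d"

definition X0 :: "(real \<Rightarrow> 'w \<Rightarrow> real) \<Rightarrow> real \<Rightarrow> 'w \<Rightarrow> real" where
  "X0 y s \<omega> = y s \<omega>"

definition X1 :: "(real \<Rightarrow> 'w \<Rightarrow> real) \<Rightarrow> real \<Rightarrow> 'w \<Rightarrow> real \<Rightarrow> real" where
  "X1 y s \<omega> = (\<lambda>\<zeta>. y (s + \<zeta>) \<omega>)"


section \<open>The market model\<close>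

definition excess_return :: "real \<Rightarrow> real^'n \<Rightarrow> real^'n" where
  "excess_return r \<mu> = \<mu> - r *\<^sub>R 1"

definition kappa :: "real \<Rightarrow> real^'n \<Rightarrow> real^'n^'n \<Rightarrow> real^'n" where
  "kappa r \<mu> \<sigma> = matrix_inv \<sigma> *v excess_return r \<mu>"

definition beta ::
    "real \<Rightarrow> real \<Rightarrow> real^'n \<Rightarrow> real^'n^'n \<Rightarrow> real \<Rightarrow> real^'n \<Rightarrow> real" where
  "beta r \<delta> \<mu> \<sigma> \<mu>y \<sigma>y = r + \<delta> - \<mu>y + \<sigma>y \<bullet> kappa r \<mu> \<sigma>"

definition retired :: "real \<Rightarrow> real \<Rightarrow> real" where
  "retired \<tau>R s = indicator {\<tau>R..} s"

definition admissible_control ::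
    "'w measure \<Rightarrow> (real \<Rightarrow> 'w measure) \<Rightarrow> (real \<Rightarrow> 'w \<Rightarrow> real) \<Rightarrow> (real \<Rightarrow> 'w \<Rightarrow> real) \<Rightarrow>
     (real \<Rightarrow> 'w \<Rightarrow> real^'n) \<Rightarrow> bool" where
  "admissible_control M F c B \<theta> \<longleftrightarrow>
     predictable M F c \<and> predictable M F B \<and> predictable M F \<theta> \<and>
     (\<forall>s\<ge>0. \<forall>\<omega>\<in>space M. c s \<omega> \<ge> 0 \<and> B s \<omega> \<ge> 0) \<and>
     (\<forall>T>0. (\<integral>\<^sup>+ \<omega>. (\<integral>\<^sup>+ s\<in>{0..T}. ennreal (c s \<omega> + B s \<omega> + (norm (\<theta> s \<omega>))\<^sup>2) \<partial>lborel) \<partial>M) < \<infinity>)"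

definition wealth_equation ::
    "'w measure \<Rightarrow> (real \<Rightarrow> 'w measure) \<Rightarrow> (real \<Rightarrow> 'w \<Rightarrow> real^'n) \<Rightarrow>
     real \<Rightarrow> real \<Rightarrow> real \<Rightarrow> real^'n \<Rightarrow> real^'n^'n \<Rightarrow>
     (real \<Rightarrow> 'w \<Rightarrow> real) \<Rightarrow> (real \<Rightarrow> 'w \<Rightarrow> real) \<Rightarrow> (real \<Rightarrow> 'w \<Rightarrow> real^'n) \<Rightarrow> (real \<Rightarrow> 'w \<Rightarrow> real) \<Rightarrow>
     real \<Rightarrow> (real \<Rightarrow> 'w \<Rightarrow> real) \<Rightarrow> bool" where
  "wealth_equation M F Z r \<delta> \<tau>R \<mu> \<sigma> c B \<theta> y w W \<longleftrightarrow>
     has_ito_differential M F Z W w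
       (\<lambda>s \<omega>. (r + \<delta>) * W s \<omega> + \<theta> s \<omega> \<bullet> excess_return r \<mu>
               + (1 - retired \<tau>R s) * y s \<omega> - c s \<omega> - \<delta> * B s \<omega>)
       (\<lambda>s \<omega>. \<theta> s \<omega> v* \<sigma>)"

definition income_equation ::
    "'w measure \<Rightarrow> (real \<Rightarrow> 'w measure) \<Rightarrow> (real \<Rightarrow> 'w \<Rightarrow> real^'n) \<Rightarrow>
     real \<Rightarrow> real \<Rightarrow> real^'n \<Rightarrow> (real \<Rightarrow> real) \<Rightarrow> real \<times> (real \<Rightarrow> real) \<Rightarrow>
     (real \<Rightarrow> 'w \<Rightarrow> real) \<Rightarrow> bool" where
  "income_equation M F Z d \<mu>y \<sigma>y \<phi> x y \<longleftrightarrow>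
     (\<forall>\<omega>\<in>space M. \<forall>\<zeta>\<in>{-d..<0}. y \<zeta> \<omega> = snd x \<zeta>) \<and>
     has_ito_differential M F Z y (fst x)
       (\<lambda>s \<omega>. \<mu>y * y s \<omega> + (LBINT \<zeta>:{-d<..<0}. \<phi> \<zeta> * y (s + \<zeta>) \<omega>))
       (\<lambda>s \<omega>. y s \<omega> *\<^sub>R \<sigma>y)"

definition state_price_density ::
    "'w measure \<Rightarrow> (real \<Rightarrow> 'w measure) \<Rightarrow> (real \<Rightarrow> 'w \<Rightarrow> real^'n) \<Rightarrow>
     real \<Rightarrow> real \<Rightarrow> real^'n \<Rightarrow> real^'n^'n \<Rightarrow> (real \<Rightarrow> 'w \<Rightarrow> real) \<Rightarrow> bool" where
  "state_price_density M F Z r \<delta> \<mu> \<sigma> \<xi> \<longleftrightarrow>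
     has_ito_differential M F Z \<xi> 1
       (\<lambda>s \<omega>. - \<xi> s \<omega> * (r + \<delta>))
       (\<lambda>s \<omega>. - \<xi> s \<omega> *\<^sub>R kappa r \<mu> \<sigma>)"

definition human_capital ::
    "'w measure \<Rightarrow> (real \<Rightarrow> 'w measure) \<Rightarrow> real \<Rightarrow> (real \<Rightarrow> 'w \<Rightarrow> real) \<Rightarrow> (real \<Rightarrow> 'w \<Rightarrow> real) \<Rightarrow>
     real \<Rightarrow> 'w \<Rightarrow> real" where
  "human_capital M F \<tau>R \<xi> y s \<omega> =
     inverse (\<xi> s \<omega>) *
     real_cond_exp M (F s) (\<lambda>\<omega>'. LBINT u:{s..}. \<xi> u \<omega>' * (1 - retired \<tau>R u) * y u \<omega>') \<omega>"

definition gh_solution ::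
    "real \<Rightarrow> real \<Rightarrow> real \<Rightarrow> real \<Rightarrow> real \<Rightarrow> (real \<Rightarrow> real) \<Rightarrow>
     (real \<Rightarrow> real) \<Rightarrow> (real \<Rightarrow> real \<Rightarrow> real) \<Rightarrow> bool" where
  "gh_solution r \<delta> \<beta> \<tau>R d \<phi> g h \<longleftrightarrow>
     continuous_on {0..} g \<and>
     continuous_on ({0..} \<times> {-d..0}) (\<lambda>(t, \<zeta>). h t \<zeta>) \<and>
     (\<forall>t\<ge>0. g t = (if t < \<tau>R
        then LBINT \<tau>:{t..\<tau>R}. exp (- \<beta> * (\<tau> - t)) * (h \<tau> 0 + 1) else 0)) \<and>
     (\<forall>t\<ge>0. \<forall>\<zeta>\<in>{-d..0}. h t \<zeta> = (if t < \<tau>R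
        then LBINT \<tau>:{max (\<zeta> + t - \<tau>R) (-d)..\<zeta>}.
               exp (- (r + \<delta>) * (\<zeta> - \<tau>)) * g (t + \<zeta> - \<tau>) * \<phi> \<tau>
        else 0))"

end

theory Submission imports Defs begin

text \<open>A linear equation \<open>dX = b dt + X a\<^sup>T dZ\<close> has an explicit solution: multiplying by the
  exponential \<open>exp (- a \<bullet> Z t + \<bar>a\<bar>\<^sup>2 t / 2)\<close> removes the noise. This special case of the Ito formula is
  obtained by telescoping the product along a grid; the error terms vanish in probability by a
  discrete Lenglart inequality. It makes \<open>\<xi>\<close> explicit and turns the income equation into a
  pathwise Volterra equation with delay. Gronwall's inequality, applied on the events where \<open>y\<close>
  has stayed bounded, makes \<open>\<xi> y\<close> integrable. For \<open>A\<close> in \<open>F s\<close> the function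
  \<open>v \<mapsto> E (1\<^sub>A \<xi>\<^sub>v y\<^sub>v)\<close> then solves a deterministic Volterra equation with delay on \<open>[s, \<tau>]\<close>, and
  Fubini's theorem shows that the system for \<open>(g, h)\<close> is its adjoint: the integral of this
  function over \<open>[s, \<tau>]\<close> equals \<open>g(s)\<close> times its value at \<open>s\<close> plus the pairing of \<open>h(s)\<close> with
  its history. As \<open>A\<close> is arbitrary, this identifies the conditional expectation.\<close>

section \<open>The Brownian filtration and Gaussian increments\<close>

text \<open>The Ito integral is given only as a limit in probability of simple integrals, along
  partitions about which nothing is known, and its integrand is only pathwise square integrable.
  Once the equations are explicit, the noise matters only through two conditional means given
  \<open>F u\<close>: that of \<xi>(t) is exp (- (r + \<delta>) (t - u)) \<xi>(u), and that of
  \<xi>(t) times the fundamental solution of the undelayed income equation from u to t is exp (-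
  \<beta> (t - u)) \<xi>(u). This is where the two discount rates in the system for (g, h) come
  from. Both are used in weak form, tested with \<open>F u\<close>-measurable weights, and no change
  of measure is made. The delayed drift after s still sees income from before s. The equation on
  [s, \<tau>] thus has the history on [s - d, s] as additional data, and the adjoint equation must
  be paired with it: h(s) is the kernel of this pairing.\<close>

lemma norm_sq_sum: "(norm (a::real^'n))\<^sup>2 = (\<Sum>i\<in>UNIV. (a $ i)\<^sup>2)"
  by (simp only: power2_norm_eq_inner inner_vec_def) (simp add: power2_eq_square)

locale brownian = prob_space M for M :: "'w measure" +
  fixes Z :: "real \<Rightarrow> 'w \<Rightarrow> real^'n" and F :: "real \<Rightarrow> 'w measure"
  assumes bm: "standard_brownian_motion M Z"
    and F_eq: "F = augmented_filtration M Z"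
begin

abbreviation dZ :: "real \<Rightarrow> real \<Rightarrow> 'w \<Rightarrow> real^'n" where
  "dZ s t \<omega> \<equiv> Z t \<omega> - Z s \<omega>"

lemma Z_measurable_M: "0 \<le> t \<Longrightarrow> Z t \<in> borel_measurable M"
  using bm by (auto simp: standard_brownian_motion_def)

lemma dZ_measurable_M: "0 \<le> s \<Longrightarrow> 0 \<le> t \<Longrightarrow> dZ s t \<in> borel_measurable M"
  using Z_measurable_M by (intro borel_measurable_diff) auto

lemma natural_gen_subset:
  "(\<Union>u\<in>{0..s}. {Z u -` A \<inter> space M | A. A \<in> sets borel}) \<subseteq> sets M"
  using Z_measurable_M by (auto intro!: measurable_sets)

lemma space_natural: "space (natural_filtration M Z s) = space M"
  by (simp add: natural_filtration_def space_measure_of_conv)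

lemma sets_natural:
  "sets (natural_filtration M Z s) =
     sigma_sets (space M) (\<Union>u\<in>{0..s}. {Z u -` A \<inter> space M | A. A \<in> sets borel})"
  unfolding natural_filtration_def using natural_gen_subset sets.space_closed
  by (subst sets_measure_of) auto

lemma sets_natural_subset: "sets (natural_filtration M Z s) \<subseteq> sets M"
  unfolding sets_natural by (rule sets.sigma_sets_subset[OF natural_gen_subset])

lemma space_F [simp]: "space (F s) = space M"
  by (simp add: F_eq augmented_filtration_def space_measure_of_conv)

lemma sets_F: "sets (F s) = sigma_sets (space M) (sets (natural_filtration M Z s) \<union> null_sets M)"
  unfolding F_eq augmented_filtration_def
  using sets_natural_subset[of s] sets.space_closed[of M] by (subst sets_measure_of) auto

lemma sets_F_subset: "sets (F s) \<subseteq> sets M"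
  unfolding sets_F by (rule sets.sigma_sets_subset) (use sets_natural_subset in auto)

lemma subalgebra_F: "subalgebra M (F s)"
  by (simp add: subalgebra_def sets_F_subset)

lemma F_imp_M: "f \<in> measurable (F s) N \<Longrightarrow> f \<in> measurable M N"
  using measurable_from_subalg[OF subalgebra_F] by blast

lemma F_mono: "s \<le> t \<Longrightarrow> sets (F s) \<subseteq> sets (F t)"
  unfolding sets_F sets_natural
  by (intro sigma_sets_subseteq Un_mono order.refl UN_mono) auto

lemma F_measurable_mono: "f \<in> measurable (F s) N \<Longrightarrow> s \<le> t \<Longrightarrow> f \<in> measurable (F t) N"
  using F_mono[of s t] by (auto simp: measurable_def)

lemma null_in_F: "N \<in> null_sets M \<Longrightarrow> N \<in> sets (F s)"
  unfolding sets_F by (rule sigma_sets.Basic) auto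

lemma Z_measurable: "0 \<le> u \<Longrightarrow> u \<le> s \<Longrightarrow> Z u \<in> borel_measurable (F s)"
proof (rule measurableI)
  fix A :: "(real^'n) set" assume "0 \<le> u" "u \<le> s" and A: "A \<in> sets borel"
  then have "Z u -` A \<inter> space M \<in> sets (natural_filtration M Z s)"
    unfolding sets_natural by (intro sigma_sets.Basic UN_I[of u]) auto
  then show "Z u -` A \<inter> space (F s) \<in> sets (F s)"
    by (simp add: sets_F sigma_sets.Basic)
qed simp

text \<open>Independence of increments is postulated for the natural filtration only. The sets that
  agree almost surely with a set of the natural filtration form a sigma-algebra, and null sets
  belong to it with the empty set as companion; so independence passes to the augmentation.\<close>

lemma F_approx_natural:
  assumes "A \<in> sets (F s)"
  shows "\<exists>A'\<in>sets (natural_filtration M Z s). AE \<omega> in M. \<omega> \<in> A \<longleftrightarrow> \<omega> \<in> A'"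
  using assms[unfolded sets_F]
proof induction
  case (Basic a)
  then show ?case
  proof
    assume "a \<in> null_sets M"
    then have "AE \<omega> in M. \<omega> \<notin> a" by (rule AE_not_in)
    then show ?thesis by (intro bexI[of _ "{}"]) auto
  qed auto
next
  case Empty then show ?case by (intro bexI[of _ "{}"]) auto
next
  case (Compl a)
  then obtain a' where a': "a' \<in> sets (natural_filtration M Z s)" and AE: "AE \<omega> in M. \<omega> \<in> a \<longleftrightarrow> \<omega> \<in> a'"
    by blast
  have "space M - a' \<in> sets (natural_filtration M Z s)"
    using sets.compl_sets[OF a'] by (simp add: space_natural)
  with AE show ?case by (intro bexI[of _ "space M - a'"]) auto
next
  case (Union a)
  then obtain a' where a': "\<And>i::nat. a' i \<in> sets (natural_filtration M Z s)"
     and AE: "\<And>i. AE \<omega> in M. \<omega> \<in> a i \<longleftrightarrow> \<omega> \<in> a' i"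
    by metis
  have "AE \<omega> in M. \<forall>i. \<omega> \<in> a i \<longleftrightarrow> \<omega> \<in> a' i" using AE by (simp add: AE_all_countable)
  then have "AE \<omega> in M. \<omega> \<in> (\<Union>i. a i) \<longleftrightarrow> \<omega> \<in> (\<Union>i. a' i)" by eventually_elim auto
  with a' show ?case by (intro bexI[of _ "\<Union>i. a' i"]) auto
qed

lemma F_indep_dZ:
  assumes "0 \<le> s" "s < t" "A \<in> sets (F s)" "B \<in> sets borel"
  shows "prob (A \<inter> (dZ s t -` B \<inter> space M)) = prob A * prob (dZ s t -` B \<inter> space M)"
proof -
  obtain A' where A': "A' \<in> sets (natural_filtration M Z s)" and AE: "AE \<omega> in M. \<omega> \<in> A \<longleftrightarrow> \<omega> \<in> A'"
    using F_approx_natural[OF assms(3)] by blast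
  have m: "A \<in> sets M" "A' \<in> sets M" "dZ s t -` B \<inter> space M \<in> sets M"
    using assms A' sets_F_subset[of s] sets_natural_subset[of s] dZ_measurable_M[of s t]
    by (auto intro: measurable_sets)
  have "indep_set (sets (natural_filtration M Z s)) {dZ s t -` A \<inter> space M | A. A \<in> sets borel}"
    using bm assms by (auto simp: standard_brownian_motion_def)
  then have "prob (A' \<inter> (dZ s t -` B \<inter> space M)) = prob A' * prob (dZ s t -` B \<inter> space M)"
    using A' assms(4) by (intro indep_setD) auto
  moreover have "prob (A \<inter> (dZ s t -` B \<inter> space M)) = prob (A' \<inter> (dZ s t -` B \<inter> space M))"
    using AE m by (intro measure_eq_AE) auto
  moreover have "prob A = prob A'" using AE m by (intro measure_eq_AE) auto
  ultimately show ?thesis by simp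
qed

lemma F_indep_var:
  fixes X :: "'w \<Rightarrow> 'b::topological_space" and G :: "real^'n \<Rightarrow> 'b"
  assumes "0 \<le> s" "s < t" "X \<in> borel_measurable (F s)" "G \<in> borel_measurable borel"
  shows "indep_var borel X borel (\<lambda>\<omega>. G (dZ s t \<omega>))"
proof -
  note dZ_measurable_M[of s t, measurable] assms(4)[measurable]
  have st: "0 \<le> s" "0 \<le> t" using assms by auto
  have X: "X \<in> borel_measurable M" using assms(3) by (rule F_imp_M)
  have 1: "sigma_sets (space M) {X -` A \<inter> space M | A. A \<in> sets borel} \<subseteq> sets (F s)"
    using assms(3) measurable_sets[of X "F s" borel]
    by (subst space_F[of s, symmetric], intro sets.sigma_sets_subset) auto
  \<comment> \<open>The preimages of Borel sets under the increment already form a sigma-algebra, so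
    every set generated by \<open>G (dZ s t)\<close> is itself such a preimage and
    \<open>F_indep_dZ\<close> applies to it.\<close>
  have 2: "sigma_sets (space M) {(\<lambda>\<omega>. G (dZ s t \<omega>)) -` A \<inter> space M | A. A \<in> sets borel}
     \<subseteq> {dZ s t -` A \<inter> space M | A. A \<in> sets borel}"
  proof -
    have *: "{(\<lambda>\<omega>. G (dZ s t \<omega>)) -` A \<inter> space M | A. A \<in> sets borel} \<subseteq> sets (vimage_algebra (space M) (dZ s t) borel)"
      unfolding sets_vimage_algebra2[of "dZ s t" "space M" borel, simplified]
    proof safe
      fix A :: "'b set" assume "A \<in> sets borel"
      then have "G -` A \<in> sets borel" using measurable_sets_borel[OF assms(4)] by simp
      then show "\<exists>B. (\<lambda>\<omega>. G (dZ s t \<omega>)) -` A \<inter> space M = dZ s t -` B \<inter> space M \<and> B \<in> sets borel"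
        by (intro exI[of _ "G -` A"]) auto
    qed
    have "sigma_sets (space M) {(\<lambda>\<omega>. G (dZ s t \<omega>)) -` A \<inter> space M | A. A \<in> sets borel} \<subseteq> sets (vimage_algebra (space M) (dZ s t) borel)"
      using sets.sigma_sets_subset[OF *] by simp
    then show ?thesis unfolding sets_vimage_algebra2[of "dZ s t" "space M" borel, simplified] .
  qed
  have 3: "{dZ s t -` A \<inter> space M | A. A \<in> sets borel} \<subseteq> sets M"
    using dZ_measurable_M[OF st] by (auto intro: measurable_sets)
  show ?thesis unfolding indep_var_eq
  proof (intro conjI)
    show "random_variable borel X" by fact
    show "random_variable borel (\<lambda>\<omega>. G (dZ s t \<omega>))" using st by measurable
    show "indep_set (sigma_sets (space M) {X -` A \<inter> space M |A. A \<in> sets borel})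
     (sigma_sets (space M) {(\<lambda>\<omega>. G (dZ s t \<omega>)) -` A \<inter> space M |A. A \<in> sets borel})"
    proof (rule indep_setI)
      show "sigma_sets (space M) {X -` A \<inter> space M |A. A \<in> sets borel} \<subseteq> events"
        using 1 sets_F_subset[of s] by blast
      show "sigma_sets (space M) {(\<lambda>\<omega>. G (dZ s t \<omega>)) -` A \<inter> space M |A. A \<in> sets borel} \<subseteq> events"
        using 2 3 by (rule order_trans)
    next
      fix a b assume "a \<in> sigma_sets (space M) {X -` A \<inter> space M |A. A \<in> sets borel}"
        "b \<in> sigma_sets (space M) {(\<lambda>\<omega>. G (dZ s t \<omega>)) -` A \<inter> space M |A. A \<in> sets borel}"
      then have "a \<in> sets (F s)" "b \<in> {dZ s t -` A \<inter> space M | A. A \<in> sets borel}"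
        using 1 2 by blast+
      then show "prob (a \<inter> b) = prob a * prob b"
        using F_indep_dZ[OF assms(1,2)] by blast
    qed
  qed
qed


lemma expectation_dZ_mult:
  fixes X :: "'w \<Rightarrow> real" and G :: "real^'n \<Rightarrow> real"
  assumes "0 \<le> s" "s < t" "X \<in> borel_measurable (F s)" "G \<in> borel_measurable borel"
    and "integrable M X" "integrable M (\<lambda>\<omega>. G (dZ s t \<omega>))"
  shows "integrable M (\<lambda>\<omega>. X \<omega> * G (dZ s t \<omega>))"
    and "expectation (\<lambda>\<omega>. X \<omega> * G (dZ s t \<omega>)) = expectation X * expectation (\<lambda>\<omega>. G (dZ s t \<omega>))"
  using indep_var_integrable[OF F_indep_var[OF assms(1-4)] assms(5,6)]
    indep_var_lebesgue_integral[OF F_indep_var[OF assms(1-4)] assms(5,6)] by auto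

text \<open>The version in \<open>ennreal\<close> presupposes no integrability. The moment bounds
  depend on this, since they come before the integrability of \<xi> y is known.\<close>

lemma nn_expectation_dZ_mult:
  fixes X :: "'w \<Rightarrow> ennreal" and G :: "real^'n \<Rightarrow> ennreal"
  assumes "0 \<le> s" "s < t" "X \<in> borel_measurable (F s)" "G \<in> borel_measurable borel"
  shows "(\<integral>\<^sup>+\<omega>. X \<omega> * G (dZ s t \<omega>) \<partial>M) = (\<integral>\<^sup>+\<omega>. X \<omega> \<partial>M) * (\<integral>\<^sup>+\<omega>. G (dZ s t \<omega>) \<partial>M)"
proof -
  have **: "(\<lambda>_. borel) = case_bool borel (borel :: ennreal measure)"
    by (rule ext) (simp split: bool.split)
  have "indep_vars (\<lambda>_. borel) (case_bool X (\<lambda>\<omega>. G (dZ s t \<omega>))) UNIV"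
    unfolding ** using F_indep_var[OF assms] by (simp add: indep_var_def)
  from indep_vars_nn_integral[OF _ this]
  show ?thesis by (simp add: UNIV_bool mult.commute)
qed

end

section \<open>Exponential and polynomial moments of Gaussian increments\<close>

lemma normal_density_exp:
  assumes "0 < \<sigma>"
  shows "normal_density 0 \<sigma> x * exp (l * x) = exp (l\<^sup>2 * \<sigma>\<^sup>2 / 2) * normal_density (l * \<sigma>\<^sup>2) \<sigma> x"
proof -
  \<comment> \<open>Completing the square: an exponential factor tilts the Gaussian density to one
    with mean \<open>l * \<sigma>\<^sup>2\<close>, so exponential moments reduce to ordinary moments
    of a shifted Gaussian.\<close>
  have *: "- (x\<^sup>2 / (2 * \<sigma>\<^sup>2)) + l * x = l\<^sup>2 * \<sigma>\<^sup>2 / 2 - (x - l * \<sigma>\<^sup>2)\<^sup>2 / (2 * \<sigma>\<^sup>2)"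
    using assms by (simp add: field_simps power2_eq_square)
  have "exp (- (x\<^sup>2 / (2 * \<sigma>\<^sup>2))) * exp (l * x) = exp (l\<^sup>2 * \<sigma>\<^sup>2 / 2) * exp (- ((x - l * \<sigma>\<^sup>2)\<^sup>2 / (2 * \<sigma>\<^sup>2)))"
    unfolding exp_add[symmetric] * by simp
  then show ?thesis by (simp add: normal_density_def)
qed

context prob_space
begin

lemma normal_exp_moment:
  assumes D: "distributed M lborel X (normal_density 0 \<sigma>)" and \<sigma>: "0 < \<sigma>"
  shows "integrable M (\<lambda>\<omega>. exp (l * X \<omega>))" "expectation (\<lambda>\<omega>. exp (l * X \<omega>)) = exp (l\<^sup>2 * \<sigma>\<^sup>2 / 2)"
proof -
  show "integrable M (\<lambda>\<omega>. exp (l * X \<omega>))"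
    by (subst distributed_integrable[OF D, symmetric]) (auto simp: normal_density_exp \<sigma>)
  show "expectation (\<lambda>\<omega>. exp (l * X \<omega>)) = exp (l\<^sup>2 * \<sigma>\<^sup>2 / 2)"
    by (subst distributed_integral[OF D, symmetric]) (auto simp: normal_density_exp \<sigma>)
qed

lemma normal_exp_moment1:
  assumes D: "distributed M lborel X (normal_density 0 \<sigma>)" and \<sigma>: "0 < \<sigma>"
  shows "integrable M (\<lambda>\<omega>. X \<omega> * exp (l * X \<omega>))"
    "expectation (\<lambda>\<omega>. X \<omega> * exp (l * X \<omega>)) = l * \<sigma>\<^sup>2 * exp (l\<^sup>2 * \<sigma>\<^sup>2 / 2)"
proof -
  have *: "normal_density 0 \<sigma> x * (x * exp (l * x)) =
      exp (l\<^sup>2 * \<sigma>\<^sup>2 / 2) * (normal_density (l * \<sigma>\<^sup>2) \<sigma> x * x)" for x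
    using normal_density_exp[OF \<sigma>, of x l] by (simp add: mult_ac)
  show "integrable M (\<lambda>\<omega>. X \<omega> * exp (l * X \<omega>))"
    by (subst distributed_integrable[OF D, symmetric]) (auto simp: * \<sigma> integrable_normal_moment_nz_1)
  show "expectation (\<lambda>\<omega>. X \<omega> * exp (l * X \<omega>)) = l * \<sigma>\<^sup>2 * exp (l\<^sup>2 * \<sigma>\<^sup>2 / 2)"
    by (subst distributed_integral[OF D, symmetric]) (auto simp: * \<sigma> integral_normal_moment_nz_1)
qed

lemma normal_moment2:
  assumes D: "distributed M lborel X (normal_density 0 \<sigma>)" and \<sigma>: "0 < \<sigma>"
  shows "integrable M (\<lambda>\<omega>. (X \<omega>)\<^sup>2)" "expectation (\<lambda>\<omega>. (X \<omega>)\<^sup>2) = \<sigma>\<^sup>2"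
proof -
  show "integrable M (\<lambda>\<omega>. (X \<omega>)\<^sup>2)"
    using integrable_normal_moment[OF \<sigma>, of 0 2]
    by (subst distributed_integrable[OF D, symmetric]) auto
  have "(\<integral>x. normal_density 0 \<sigma> x * x\<^sup>2 \<partial>lborel) = \<sigma>\<^sup>2"
    using integral_normal_moment_even[OF \<sigma>, of 0 1] by simp
  then show "expectation (\<lambda>\<omega>. (X \<omega>)\<^sup>2) = \<sigma>\<^sup>2"
    by (subst distributed_integral[OF D, symmetric]) auto
qed

end

context brownian
begin

context
  fixes s t :: real
  assumes st: "0 \<le> s" "s < t"
begin

lemma dZ_component:
  shows "distributed M lborel (\<lambda>\<omega>. dZ s t \<omega> $ i) (normal_density 0 (sqrt (t - s)))"
  using bm st by (auto simp: standard_brownian_motion_def)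

lemma dZ_prod:
  fixes f :: "'n \<Rightarrow> real \<Rightarrow> real"
  assumes f: "\<And>i. f i \<in> borel_measurable borel" and int: "\<And>i. integrable M (\<lambda>\<omega>. f i (dZ s t \<omega> $ i))"
  shows "integrable M (\<lambda>\<omega>. \<Prod>i\<in>UNIV. f i (dZ s t \<omega> $ i))"
    "expectation (\<lambda>\<omega>. \<Prod>i\<in>UNIV. f i (dZ s t \<omega> $ i)) = (\<Prod>i\<in>UNIV. expectation (\<lambda>\<omega>. f i (dZ s t \<omega> $ i)))"
proof -
  have "indep_vars (\<lambda>_. borel) (\<lambda>i \<omega>. dZ s t \<omega> $ i) UNIV"
    using bm st by (auto simp: standard_brownian_motion_def)
  then have *: "indep_vars (\<lambda>_. borel) (\<lambda>i \<omega>. f i (dZ s t \<omega> $ i)) UNIV"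
    by (rule indep_vars_compose2) (use f in auto)
  show "integrable M (\<lambda>\<omega>. \<Prod>i\<in>UNIV. f i (dZ s t \<omega> $ i))"
    using indep_vars_integrable[OF _ *] int by simp
  show "expectation (\<lambda>\<omega>. \<Prod>i\<in>UNIV. f i (dZ s t \<omega> $ i)) = (\<Prod>i\<in>UNIV. expectation (\<lambda>\<omega>. f i (dZ s t \<omega> $ i)))"
    using indep_vars_lebesgue_integral[OF _ *] int by simp
qed

lemma exp_inner_dZ: "exp (a \<bullet> dZ s t \<omega>) = (\<Prod>i\<in>UNIV. exp (a $ i * dZ s t \<omega> $ i))"
  by (simp add: inner_vec_def exp_sum)

lemma dZ_exp:
  shows "integrable M (\<lambda>\<omega>. exp (a \<bullet> dZ s t \<omega>))"
    "expectation (\<lambda>\<omega>. exp (a \<bullet> dZ s t \<omega>)) = exp ((norm a)\<^sup>2 * (t - s) / 2)"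
proof -
  note N = normal_exp_moment[OF dZ_component]
  show "integrable M (\<lambda>\<omega>. exp (a \<bullet> dZ s t \<omega>))"
    unfolding exp_inner_dZ by (rule dZ_prod) (use st N in auto)
  have "expectation (\<lambda>\<omega>. exp (a \<bullet> dZ s t \<omega>)) = (\<Prod>i\<in>UNIV. exp ((a $ i)\<^sup>2 * (t - s) / 2))"
    unfolding exp_inner_dZ using st N by (subst dZ_prod) auto
  also have "\<dots> = exp ((norm a)\<^sup>2 * (t - s) / 2)"
    by (simp add: norm_sq_sum exp_sum sum_distrib_right sum_divide_distrib)
  finally show "expectation (\<lambda>\<omega>. exp (a \<bullet> dZ s t \<omega>)) = exp ((norm a)\<^sup>2 * (t - s) / 2)" .
qed

lemma dZ_component_exp:
  shows "integrable M (\<lambda>\<omega>. dZ s t \<omega> $ j * exp (a \<bullet> dZ s t \<omega>))"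
    "expectation (\<lambda>\<omega>. dZ s t \<omega> $ j * exp (a \<bullet> dZ s t \<omega>)) = a $ j * (t - s) * exp ((norm a)\<^sup>2 * (t - s) / 2)"
proof -
  note N = normal_exp_moment[OF dZ_component] normal_exp_moment1[OF dZ_component]
  \<comment> \<open>The expression is a product of functions of single components, in which only the
    factor number j carries the additional x; so \<open>dZ_prod\<close> applies.\<close>
  define f where "f i x = (if i = j then x else 1) * exp (a $ i * x)" for i and x :: real
  have fm: "f i \<in> borel_measurable borel" for i
    unfolding f_def by simp
  have fi: "integrable M (\<lambda>\<omega>. f i (dZ s t \<omega> $ i))" for i
    unfolding f_def using N st by (cases "i = j") auto
  have *: "dZ s t \<omega> $ j * exp (a \<bullet> dZ s t \<omega>) = (\<Prod>i\<in>UNIV. f i (dZ s t \<omega> $ i))" for \<omega>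
    unfolding f_def prod.distrib exp_inner_dZ by (simp add: prod.delta)
  show "integrable M (\<lambda>\<omega>. dZ s t \<omega> $ j * exp (a \<bullet> dZ s t \<omega>))"
    unfolding * by (rule dZ_prod) (use fm fi in auto)
  have "expectation (\<lambda>\<omega>. dZ s t \<omega> $ j * exp (a \<bullet> dZ s t \<omega>)) = (\<Prod>i\<in>UNIV. expectation (\<lambda>\<omega>. f i (dZ s t \<omega> $ i)))"
    unfolding * by (rule dZ_prod) (use fm fi in auto)
  also have "\<dots> = (\<Prod>i\<in>UNIV. (if i = j then a $ j * (t - s) else 1) * exp ((a $ i)\<^sup>2 * (t - s) / 2))"
    using N st by (intro prod.cong) (auto simp: f_def)
  also have "\<dots> = a $ j * (t - s) * exp ((norm a)\<^sup>2 * (t - s) / 2)"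
    by (simp add: prod.distrib prod.delta norm_sq_sum exp_sum sum_distrib_right sum_divide_distrib)
  finally show "expectation (\<lambda>\<omega>. dZ s t \<omega> $ j * exp (a \<bullet> dZ s t \<omega>)) = a $ j * (t - s) * exp ((norm a)\<^sup>2 * (t - s) / 2)" .
qed

text \<open>The value is the derivative at c = 1 of the moment generating function exp (c^2 |a|^2 (t
  - s) / 2) of the inner product. It is the cross term in the square computed in
  \<open>compensated_exp_moments\<close>.\<close>

lemma dZ_inner_exp:
  shows "integrable M (\<lambda>\<omega>. (a \<bullet> dZ s t \<omega>) * exp (a \<bullet> dZ s t \<omega>))"
    "expectation (\<lambda>\<omega>. (a \<bullet> dZ s t \<omega>) * exp (a \<bullet> dZ s t \<omega>)) = (norm a)\<^sup>2 * (t - s) * exp ((norm a)\<^sup>2 * (t - s) / 2)"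
proof -
  have *: "(a \<bullet> dZ s t \<omega>) * exp (a \<bullet> dZ s t \<omega>) = (\<Sum>j\<in>UNIV. a $ j * (dZ s t \<omega> $ j * exp (a \<bullet> dZ s t \<omega>)))" for \<omega>
    unfolding inner_vec_def[of a] by (simp add: sum_distrib_right mult_ac)
  note N = dZ_component_exp[of _ a]
  show "integrable M (\<lambda>\<omega>. (a \<bullet> dZ s t \<omega>) * exp (a \<bullet> dZ s t \<omega>))"
    unfolding * using N by auto
  show "expectation (\<lambda>\<omega>. (a \<bullet> dZ s t \<omega>) * exp (a \<bullet> dZ s t \<omega>)) = (norm a)\<^sup>2 * (t - s) * exp ((norm a)\<^sup>2 * (t - s) / 2)"
  proof -
    have "expectation (\<lambda>\<omega>. (a \<bullet> dZ s t \<omega>) * exp (a \<bullet> dZ s t \<omega>)) =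
        (\<Sum>j\<in>UNIV. (a $ j)\<^sup>2 * ((t - s) * exp ((norm a)\<^sup>2 * (t - s) / 2)))"
      unfolding * using N by (simp add: power2_eq_square mult_ac)
    then show ?thesis by (simp only: norm_sq_sum sum_distrib_right mult.assoc)
  qed
qed

lemma dZ_component_mean:
  shows "integrable M (\<lambda>\<omega>. dZ s t \<omega> $ j)" "expectation (\<lambda>\<omega>. dZ s t \<omega> $ j) = 0"
  using dZ_component_exp[of j 0] by auto

lemma dZ_covariance:
  shows "integrable M (\<lambda>\<omega>. dZ s t \<omega> $ j * dZ s t \<omega> $ k)"
    "expectation (\<lambda>\<omega>. dZ s t \<omega> $ j * dZ s t \<omega> $ k) = (if j = k then t - s else 0)"
proof -
  have sq: "integrable M (\<lambda>\<omega>. (dZ s t \<omega> $ j)\<^sup>2)" "expectation (\<lambda>\<omega>. (dZ s t \<omega> $ j)\<^sup>2) = t - s" for j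
    using normal_moment2[OF dZ_component] st by auto
  \<comment> \<open>One product covers both cases: the factors are x^2 and 1 if j = k, and x, x and
    1 otherwise.\<close>
  define f where "f i x = (if i = j then x else 1) * (if i = k then x else 1)" for i and x :: real
  have fm: "f i \<in> borel_measurable borel" for i
    unfolding f_def by simp
  have fi: "integrable M (\<lambda>\<omega>. f i (dZ s t \<omega> $ i))" for i
    unfolding f_def using sq[of i] dZ_component_mean[of i]
    by (cases "i = j"; cases "i = k") (auto simp: power2_eq_square)
  have *: "dZ s t \<omega> $ j * dZ s t \<omega> $ k = (\<Prod>i\<in>UNIV. f i (dZ s t \<omega> $ i))" for \<omega>
    by (simp add: f_def prod.distrib prod.delta)
  show "integrable M (\<lambda>\<omega>. dZ s t \<omega> $ j * dZ s t \<omega> $ k)"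
    unfolding * by (rule dZ_prod) (use fm fi in auto)
  show "expectation (\<lambda>\<omega>. dZ s t \<omega> $ j * dZ s t \<omega> $ k) = (if j = k then t - s else 0)"
  proof (cases "j = k")
    case True
    then show ?thesis using sq[of k] by (simp add: power2_eq_square)
  next
    case False
    have "expectation (\<lambda>\<omega>. dZ s t \<omega> $ j * dZ s t \<omega> $ k) = (\<Prod>i\<in>UNIV. expectation (\<lambda>\<omega>. f i (dZ s t \<omega> $ i)))"
      unfolding * by (rule dZ_prod) (use fm fi in auto)
    also have "\<dots> = 0"
      using False dZ_component_mean(2)[of j] by (intro prod_zero) (auto intro!: exI[of _ j] simp: f_def)
    finally show ?thesis using False by simp
  qed
qed

end

end

section \<open>A discrete Lenglart inequality\<close>

context prob_space
begin

lemma integrable_product_of_squares: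
  fixes f g :: "'a \<Rightarrow> real"
  assumes [measurable]: "f \<in> borel_measurable M" "g \<in> borel_measurable M"
    and "integrable M (\<lambda>\<omega>. (f \<omega>)\<^sup>2)" "integrable M (\<lambda>\<omega>. (g \<omega>)\<^sup>2)"
  shows "integrable M (\<lambda>\<omega>. f \<omega> * g \<omega>)"
proof (rule Bochner_Integration.integrable_bound)
  show "integrable M (\<lambda>\<omega>. (f \<omega>)\<^sup>2 + (g \<omega>)\<^sup>2)" using assms by simp
  show "AE \<omega> in M. norm (f \<omega> * g \<omega>) \<le> norm ((f \<omega>)\<^sup>2 + (g \<omega>)\<^sup>2)"
  proof (rule AE_I2)
    fix \<omega>
    have "2 * \<bar>f \<omega>\<bar> * \<bar>g \<omega>\<bar> \<le> \<bar>f \<omega>\<bar>\<^sup>2 + \<bar>g \<omega>\<bar>\<^sup>2" by (rule sum_squares_bound)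
    moreover have "0 \<le> \<bar>f \<omega>\<bar> * \<bar>g \<omega>\<bar>" by simp
    ultimately show "norm (f \<omega> * g \<omega>) \<le> norm ((f \<omega>)\<^sup>2 + (g \<omega>)\<^sup>2)"
      unfolding real_norm_def abs_mult power2_abs by linarith
  qed
qed measurable

lemma indicator_sq: "(indicator A x :: real)\<^sup>2 = indicator A x"
  by (simp add: indicator_def)

lemma prob_greater_Markov:
  assumes "integrable M V" "\<And>\<omega>. 0 \<le> V \<omega>" "expectation V \<le> d" "0 < e"
  shows "prob {\<omega>\<in>space M. V \<omega> > e} \<le> d / e"
proof -
  have [measurable]: "V \<in> borel_measurable M" using assms by auto
  have "prob {\<omega>\<in>space M. V \<omega> > e} \<le> prob {\<omega>\<in>space M. e \<le> V \<omega>}"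
    by (intro finite_measure_mono) auto
  also have "\<dots> \<le> expectation V / e"
    using assms by (intro integral_Markov_inequality_measure[where A="{}"]) auto
  also have "\<dots> \<le> d / e" using assms by (intro divide_right_mono) auto
  finally show ?thesis .
qed

end

context brownian
begin

text \<open>Lenglart's inequality in discrete time. The increments \<open>Y i\<close>, which live on the disjoint
  intervals between \<open>a i\<close> and \<open>b i\<close>, are switched off as soon as the cumulated conditional
  variances \<open>q i\<close> exceed \<open>\<delta>\<close>; what remains is an \<open>L\<^sup>2\<close> martingale. Summing squares over the
  classes of \<open>lab\<close> covers both a single martingale (constant \<open>lab\<close>) and quadratic variations.\<close>

lemma discrete_lenglart:
  fixes Y q :: "'i \<Rightarrow> 'w \<Rightarrow> real" and lab :: "'i \<Rightarrow> nat"
  assumes fin: "finite I" "finite L"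
    and ab: "\<And>i. i \<in> I \<Longrightarrow> 0 \<le> a i \<and> a i < b i"
    and sep: "\<And>i j. i \<in> I \<Longrightarrow> j \<in> I \<Longrightarrow> i \<noteq> j \<Longrightarrow> b i \<le> a j \<or> b j \<le> a i"
    and Ym: "\<And>i. i \<in> I \<Longrightarrow> Y i \<in> borel_measurable (F (b i))"
    and qm: "\<And>i. i \<in> I \<Longrightarrow> q i \<in> borel_measurable (F (a i))"
    and q0: "\<And>i \<omega>. i \<in> I \<Longrightarrow> 0 \<le> q i \<omega>"
    and sq: "\<And>i A C. i \<in> I \<Longrightarrow> A \<in> sets (F (a i)) \<Longrightarrow> \<forall>\<omega>\<in>A. q i \<omega> \<le> C \<Longrightarrow>
       integrable M (\<lambda>\<omega>. indicator A \<omega> * (Y i \<omega>)\<^sup>2) \<and>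
       expectation (\<lambda>\<omega>. indicator A \<omega> * (Y i \<omega>)\<^sup>2) \<le> expectation (\<lambda>\<omega>. indicator A \<omega> * q i \<omega>)"
    and orth: "\<And>i j A C U. i \<in> I \<Longrightarrow> j \<in> I \<Longrightarrow> i \<noteq> j \<Longrightarrow> lab i = lab j \<Longrightarrow> A \<in> sets (F (a i)) \<Longrightarrow>
       \<forall>\<omega>\<in>A. q i \<omega> \<le> C \<Longrightarrow> U \<in> borel_measurable (F (a i)) \<Longrightarrow> integrable M (\<lambda>\<omega>. (U \<omega>)\<^sup>2) \<Longrightarrow>
       expectation (\<lambda>\<omega>. U \<omega> * (indicator A \<omega> * Y i \<omega>)) = 0"
    and \<delta>: "0 \<le> \<delta>" and \<epsilon>: "0 < \<epsilon>"
  shows "prob {\<omega>\<in>space M. (\<Sum>l\<in>L. (\<Sum>i\<in>{i\<in>I. lab i = l}. Y i \<omega>)\<^sup>2) > \<epsilon>} \<le>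
         prob {\<omega>\<in>space M. (\<Sum>i\<in>I. q i \<omega>) > \<delta>} + \<delta> / \<epsilon>"
proof -
  \<comment> \<open>The event that the variance budget is not exceeded up to and including i. Since
    \<open>q i\<close> is known at the start of its interval it may be included in the sum; this
    keeps the event in \<open>F (a i)\<close> and gives q i \<le> \<delta> on it, so the truncated
    increments are square integrable.\<close>
  define A where "A i = {\<omega>\<in>space M. (\<Sum>e\<in>{e\<in>I. a e \<le> a i}. q e \<omega>) \<le> \<delta>}" for i
  define Y' where "Y' i \<omega> = indicator (A i) \<omega> * Y i \<omega>" for i \<omega>
  have A_F: "A i \<in> sets (F (a i))" if "i \<in> I" for i
  proof -
    have [measurable]: "(\<lambda>\<omega>. (\<Sum>e\<in>{e\<in>I. a e \<le> a i}. q e \<omega>)) \<in> borel_measurable (F (a i))"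
      using that qm by (intro borel_measurable_sum) (auto intro: F_measurable_mono)
    have "A i = {\<omega>\<in>space (F (a i)). (\<Sum>e\<in>{e\<in>I. a e \<le> a i}. q e \<omega>) \<le> \<delta>}"
      by (simp add: A_def)
    also have "\<dots> \<in> sets (F (a i))" by measurable
    finally show ?thesis .
  qed
  have A_q: "\<forall>\<omega>\<in>A i. q i \<omega> \<le> \<delta>" if "i \<in> I" for i
  proof
    fix \<omega> assume "\<omega> \<in> A i"
    have "q i \<omega> \<le> (\<Sum>e\<in>{e\<in>I. a e \<le> a i}. q e \<omega>)"
      using that fin q0 by (intro member_le_sum) auto
    with \<open>\<omega> \<in> A i\<close> show "q i \<omega> \<le> \<delta>" by (simp add: A_def)
  qed
  have Ym_M: "Y i \<in> borel_measurable M" if "i \<in> I" for i using Ym[OF that] by (rule F_imp_M)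
  have qm_M: "q i \<in> borel_measurable M" if "i \<in> I" for i using qm[OF that] by (rule F_imp_M)
  have A_M: "A i \<in> sets M" if "i \<in> I" for i using A_F[OF that] sets_F_subset by blast
  have Y'_F: "Y' i \<in> borel_measurable (F (b i))" if "i \<in> I" for i
    unfolding Y'_def using that A_F[OF that] F_mono[of "a i" "b i"] ab[OF that] Ym[OF that]
    by (intro borel_measurable_times borel_measurable_indicator) auto
  have Y'_M: "Y' i \<in> borel_measurable M" if "i \<in> I" for i using Y'_F[OF that] by (rule F_imp_M)
  have Y'_sq: "integrable M (\<lambda>\<omega>. (Y' i \<omega>)\<^sup>2)" if "i \<in> I" for i
    using sq[OF that A_F[OF that] A_q[OF that]]
    by (auto simp: Y'_def power_mult_distrib indicator_sq)
  have Y'_int: "integrable M (\<lambda>\<omega>. Y' i \<omega> * Y' j \<omega>)" if "i \<in> I" "j \<in> I" for i j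
    using that by (intro integrable_product_of_squares Y'_M Y'_sq)
  have orth1: "expectation (\<lambda>\<omega>. Y' i \<omega> * Y' j \<omega>) = 0"
    if "i \<in> I" "j \<in> I" "i \<noteq> j" "lab i = lab j" "b i \<le> a j" for i j
  proof -
    have "Y' i \<in> borel_measurable (F (a j))"
      using Y'_F[OF that(1)] that(5) by (rule F_measurable_mono)
    from orth[OF that(2,1) that(3)[symmetric] that(4)[symmetric] A_F[OF that(2)] A_q[OF that(2)] this Y'_sq[OF that(1)]]
    show ?thesis by (simp add: Y'_def[of j])
  qed
  have orth2: "expectation (\<lambda>\<omega>. Y' i \<omega> * Y' j \<omega>) = 0"
    if "i \<in> I" "j \<in> I" "i \<noteq> j" "lab i = lab j" for i j
    using sep[OF that(1-3)] orth1[of i j] orth1[of j i] that by (auto simp: mult.commute)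
  define V where "V \<omega> = (\<Sum>l\<in>L. (\<Sum>i\<in>{i\<in>I. lab i = l}. Y' i \<omega>)\<^sup>2)" for \<omega>
  have V_eq: "V = (\<lambda>\<omega>. \<Sum>l\<in>L. \<Sum>i\<in>{i\<in>I. lab i = l}. \<Sum>j\<in>{i\<in>I. lab i = l}. Y' i \<omega> * Y' j \<omega>)"
    by (simp add: V_def power2_eq_square sum_product fun_eq_iff)
  have V_int: "integrable M V"
    unfolding V_eq using Y'_int by (intro Bochner_Integration.integrable_sum) auto
  \<comment> \<open>Within a class distinct truncated increments are orthogonal, so only the
    diagonal of the squared sum contributes.\<close>
  have row: "expectation (\<lambda>\<omega>. \<Sum>j\<in>{i\<in>I. lab i = l}. Y' i \<omega> * Y' j \<omega>) = expectation (\<lambda>\<omega>. (Y' i \<omega>)\<^sup>2)"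
    if "i \<in> {i\<in>I. lab i = l}" for i l
  proof -
    have "expectation (\<lambda>\<omega>. \<Sum>j\<in>{i\<in>I. lab i = l}. Y' i \<omega> * Y' j \<omega>) =
        (\<Sum>j\<in>{i\<in>I. lab i = l}. expectation (\<lambda>\<omega>. Y' i \<omega> * Y' j \<omega>))"
      using Y'_int that by (intro Bochner_Integration.integral_sum) auto
    also have "\<dots> = (\<Sum>j\<in>{i\<in>I. lab i = l}. if j = i then expectation (\<lambda>\<omega>. (Y' i \<omega>)\<^sup>2) else 0)"
      using that orth2 by (intro sum.cong) (auto simp: power2_eq_square)
    also have "\<dots> = expectation (\<lambda>\<omega>. (Y' i \<omega>)\<^sup>2)"
      using that fin by (simp add: sum.delta)
    finally show ?thesis .
  qed
  have "expectation V = (\<Sum>l\<in>L. \<Sum>i\<in>{i\<in>I. lab i = l}. expectation (\<lambda>\<omega>. (Y' i \<omega>)\<^sup>2))"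
    unfolding V_eq
    using Y'_int row
    by (subst Bochner_Integration.integral_sum, force intro!: Bochner_Integration.integrable_sum,
        intro sum.cong refl, subst Bochner_Integration.integral_sum,
        force intro!: Bochner_Integration.integrable_sum, intro sum.cong refl) auto
  also have "\<dots> = (\<Sum>i\<in>{i\<in>I. lab i \<in> L}. expectation (\<lambda>\<omega>. (Y' i \<omega>)\<^sup>2))"
    using sum.group[of "{i\<in>I. lab i \<in> L}" L lab "\<lambda>i. expectation (\<lambda>\<omega>. (Y' i \<omega>)\<^sup>2)"] fin
    by (intro trans[OF _ sum.group[of "{i\<in>I. lab i \<in> L}" L lab]] sum.cong) auto
  also have "\<dots> \<le> (\<Sum>i\<in>I. expectation (\<lambda>\<omega>. (Y' i \<omega>)\<^sup>2))"
    using fin by (intro sum_mono2) auto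
  also have "\<dots> \<le> (\<Sum>i\<in>I. expectation (\<lambda>\<omega>. indicator (A i) \<omega> * q i \<omega>))"
    using sq[OF _ A_F A_q] by (intro sum_mono) (auto simp: Y'_def power_mult_distrib indicator_sq)
  also have "\<dots> = expectation (\<lambda>\<omega>. \<Sum>i\<in>I. indicator (A i) \<omega> * q i \<omega>)"
  proof (intro Bochner_Integration.integral_sum[symmetric])
    fix i assume "i \<in> I"
    then show "integrable M (\<lambda>\<omega>. indicator (A i) \<omega> * q i \<omega>)"
      using A_M[of i] qm_M[of i] A_q[of i] q0[of i]
      by (intro integrable_const_bound[where B=\<delta>]) (auto simp: \<delta> indicator_def)
  qed
  also have "\<dots> \<le> \<delta>"
  proof -
    have "(\<Sum>i\<in>I. indicator (A i) \<omega> * q i \<omega>) \<le> \<delta>" if "\<omega> \<in> space M" for \<omega>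
    proof (cases "{i\<in>I. \<omega> \<in> A i} = {}")
      case True
      then have "(\<Sum>i\<in>I. indicator (A i) \<omega> * q i \<omega>) = 0" by (intro sum.neutral) auto
      then show ?thesis using \<delta> by simp
    next
      case False
      then have "Max (a ` {i\<in>I. \<omega> \<in> A i}) \<in> a ` {i\<in>I. \<omega> \<in> A i}"
        using fin by (intro Max_in) auto
      \<comment> \<open>The last increment still switched on at \<omega>. All active indices start
        no later, so their variances are among those that the budget of k counts, and the sum is at
        most \<delta>.\<close>
      then obtain k where k: "k \<in> I" "\<omega> \<in> A k" "a k = Max (a ` {i\<in>I. \<omega> \<in> A i})" by auto
      have "(\<Sum>i\<in>I. indicator (A i) \<omega> * q i \<omega>) = (\<Sum>i\<in>{i\<in>I. \<omega> \<in> A i}. q i \<omega>)"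
        using fin by (intro sum.mono_neutral_cong_right) auto
      also have "\<dots> \<le> (\<Sum>e\<in>{e\<in>I. a e \<le> a k}. q e \<omega>)"
        using fin q0 k by (intro sum_mono2) auto
      also have "\<dots> \<le> \<delta>" using k(2) by (simp add: A_def)
      finally show ?thesis .
    qed
    then show ?thesis
      by (intro integral_le_const Bochner_Integration.integrable_sum)
         (use A_M qm_M A_q q0 in \<open>auto intro!: integrable_const_bound[where B=\<delta>] simp: \<delta> indicator_def\<close>)
  qed
  finally have EV: "expectation V \<le> \<delta>" .
  have V_nn: "0 \<le> V \<omega>" for \<omega> unfolding V_def by (intro sum_nonneg) simp
  have [measurable]: "V \<in> borel_measurable M" using V_int by auto
  note Ym_M[measurable] qm_M[measurable]
  \<comment> \<open>If the total variance stays below \<delta>, every \<open>A i\<close> occurs and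
    nothing was switched off, so V is the original sum there; the remaining event is covered by
    Markov's inequality.\<close>
  have "prob {\<omega>\<in>space M. (\<Sum>l\<in>L. (\<Sum>i\<in>{i\<in>I. lab i = l}. Y i \<omega>)\<^sup>2) > \<epsilon>} \<le>
     prob ({\<omega>\<in>space M. (\<Sum>i\<in>I. q i \<omega>) > \<delta>} \<union> {\<omega>\<in>space M. V \<omega> > \<epsilon>})"
  proof (intro finite_measure_mono)
    show "{\<omega>\<in>space M. (\<Sum>l\<in>L. (\<Sum>i\<in>{i\<in>I. lab i = l}. Y i \<omega>)\<^sup>2) > \<epsilon>} \<subseteq>
      {\<omega>\<in>space M. (\<Sum>i\<in>I. q i \<omega>) > \<delta>} \<union> {\<omega>\<in>space M. V \<omega> > \<epsilon>}"
    proof safe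
      fix \<omega> assume \<omega>: "\<omega> \<in> space M" "(\<Sum>l\<in>L. (\<Sum>i\<in>{i\<in>I. lab i = l}. Y i \<omega>)\<^sup>2) > \<epsilon>" "\<not> V \<omega> > \<epsilon>"
      show "(\<Sum>i\<in>I. q i \<omega>) > \<delta>"
      proof (rule ccontr)
        assume *: "\<not> ?thesis"
        have "\<omega> \<in> A i" if "i \<in> I" for i
        proof -
          have "(\<Sum>e\<in>{e\<in>I. a e \<le> a i}. q e \<omega>) \<le> (\<Sum>i\<in>I. q i \<omega>)"
            using fin q0 by (intro sum_mono2) auto
          with * \<omega>(1) show ?thesis by (simp add: A_def)
        qed
        then have "V \<omega> = (\<Sum>l\<in>L. (\<Sum>i\<in>{i\<in>I. lab i = l}. Y i \<omega>)\<^sup>2)"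
          unfolding V_def Y'_def by (intro sum.cong arg_cong[where f="\<lambda>x. x\<^sup>2"]) auto
        with \<omega> show False by simp
      qed
    qed
    show "{\<omega>\<in>space M. (\<Sum>i\<in>I. q i \<omega>) > \<delta>} \<union> {\<omega>\<in>space M. V \<omega> > \<epsilon>} \<in> events"
      using qm_M by measurable
  qed
  also have "\<dots> \<le> prob {\<omega>\<in>space M. (\<Sum>i\<in>I. q i \<omega>) > \<delta>} + prob {\<omega>\<in>space M. V \<omega> > \<epsilon>}"
    using qm_M by (intro measure_Un_le) measurable
  also have "prob {\<omega>\<in>space M. V \<omega> > \<epsilon>} \<le> \<delta> / \<epsilon>"
    by (rule prob_greater_Markov[OF V_int V_nn EV \<epsilon>])
  finally show ?thesis by simp
qed

lemma indicator_bounded_integrable: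
  assumes "A \<in> sets (F s)" "X \<in> borel_measurable (F s)" "\<And>\<omega>. \<omega> \<in> A \<Longrightarrow> \<bar>X \<omega>\<bar> \<le> C"
  shows "integrable M (\<lambda>\<omega>. indicator A \<omega> * X \<omega> :: real)"
    "(\<lambda>\<omega>. indicator A \<omega> * X \<omega> :: real) \<in> borel_measurable (F s)"
proof -
  show *: "(\<lambda>\<omega>. indicator A \<omega> * X \<omega> :: real) \<in> borel_measurable (F s)"
    using assms by (intro borel_measurable_times borel_measurable_indicator) auto
  show "integrable M (\<lambda>\<omega>. indicator A \<omega> * X \<omega> :: real)"
    using F_imp_M[OF *] assms(3)
    by (intro integrable_const_bound[where B="\<bar>C\<bar>"]) (auto simp: indicator_def intro!: AE_I2, fastforce)
qed

lemma lenglart_scalar: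
  fixes W :: "'i \<Rightarrow> 'w \<Rightarrow> real" and lab :: "'i \<Rightarrow> nat" and G :: "'i \<Rightarrow> real^'n \<Rightarrow> real"
  assumes fin: "finite I" "finite L"
    and ab: "\<And>i. i \<in> I \<Longrightarrow> 0 \<le> a i \<and> a i < b i"
    and sep: "\<And>i j. i \<in> I \<Longrightarrow> j \<in> I \<Longrightarrow> i \<noteq> j \<Longrightarrow> b i \<le> a j \<or> b j \<le> a i"
    and Wm: "\<And>i. i \<in> I \<Longrightarrow> W i \<in> borel_measurable (F (a i))"
    and Gm: "\<And>i. i \<in> I \<Longrightarrow> G i \<in> borel_measurable borel"
    and G2: "\<And>i. i \<in> I \<Longrightarrow> integrable M (\<lambda>\<omega>. (G i (dZ (a i) (b i) \<omega>))\<^sup>2)"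
    and Gv: "\<And>i. i \<in> I \<Longrightarrow> expectation (\<lambda>\<omega>. (G i (dZ (a i) (b i) \<omega>))\<^sup>2) \<le> v i"
    and v: "\<And>i. i \<in> I \<Longrightarrow> 0 < v i"
    and G0: "\<And>i j. i \<in> I \<Longrightarrow> j \<in> I \<Longrightarrow> i \<noteq> j \<Longrightarrow> lab i = lab j \<Longrightarrow> expectation (\<lambda>\<omega>. G i (dZ (a i) (b i) \<omega>)) = 0"
    and \<delta>: "0 \<le> \<delta>" and \<epsilon>: "0 < \<epsilon>"
  shows "prob {\<omega>\<in>space M. (\<Sum>l\<in>L. (\<Sum>i\<in>{i\<in>I. lab i = l}. W i \<omega> * G i (dZ (a i) (b i) \<omega>))\<^sup>2) > \<epsilon>} \<le>
         prob {\<omega>\<in>space M. (\<Sum>i\<in>I. (W i \<omega>)\<^sup>2 * v i) > \<delta>} + \<delta> / \<epsilon>"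
proof (rule discrete_lenglart[where a=a and b=b])
  fix i assume i: "i \<in> I"
  note ab[OF i]
  have "dZ (a i) (b i) \<in> borel_measurable (F (b i))"
    using ab[OF i] by (intro borel_measurable_diff Z_measurable) auto
  then have "(\<lambda>\<omega>. G i (dZ (a i) (b i) \<omega>)) \<in> borel_measurable (F (b i))"
    using Gm[OF i] by (rule measurable_compose)
  moreover have "W i \<in> borel_measurable (F (b i))"
    using Wm[OF i] ab[OF i] by (auto intro: F_measurable_mono)
  ultimately show "(\<lambda>\<omega>. W i \<omega> * G i (dZ (a i) (b i) \<omega>)) \<in> borel_measurable (F (b i))"
    by (intro borel_measurable_times)
  show "(\<lambda>\<omega>. (W i \<omega>)\<^sup>2 * v i) \<in> borel_measurable (F (a i))"
    using Wm[OF i] by measurable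
  show "0 \<le> (W i \<omega>)\<^sup>2 * v i" for \<omega> using v[OF i] by simp
  have G1: "integrable M (\<lambda>\<omega>. G i (dZ (a i) (b i) \<omega>))"
  proof (rule square_integrable_imp_integrable[OF _ G2[OF i]])
    have "dZ (a i) (b i) \<in> borel_measurable M" using ab[OF i] by (intro dZ_measurable_M) auto
    then show "(\<lambda>\<omega>. G i (dZ (a i) (b i) \<omega>)) \<in> borel_measurable M"
      using Gm[OF i] by (rule measurable_compose)
  qed
  fix A C assume A: "A \<in> sets (F (a i))" "\<forall>\<omega>\<in>A. (W i \<omega>)\<^sup>2 * v i \<le> C"
  \<comment> \<open>Because v i > 0, a bound on the conditional variance bounds the weight itself.
    This makes the truncated weight integrable, as the factorization of expectations
    requires.\<close>
  have C: "\<bar>(W i \<omega>)\<^sup>2\<bar> \<le> C / v i" if "\<omega> \<in> A" for \<omega>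
    using A(2) that v[OF i] by (simp add: pos_le_divide_eq)
  have C': "\<bar>W i \<omega>\<bar> \<le> sqrt (C / v i)" if "\<omega> \<in> A" for \<omega>
    using C[OF that] by (intro real_le_rsqrt) simp
  have X: "integrable M (\<lambda>\<omega>. indicator A \<omega> * (W i \<omega>)\<^sup>2)" "(\<lambda>\<omega>. indicator A \<omega> * (W i \<omega>)\<^sup>2) \<in> borel_measurable (F (a i))"
    using indicator_bounded_integrable[OF A(1) _ C] Wm[OF i] by auto
  have E: "integrable M (\<lambda>\<omega>. indicator A \<omega> * (W i \<omega>)\<^sup>2 * (G i (dZ (a i) (b i) \<omega>))\<^sup>2)"
    "expectation (\<lambda>\<omega>. indicator A \<omega> * (W i \<omega>)\<^sup>2 * (G i (dZ (a i) (b i) \<omega>))\<^sup>2) =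
     expectation (\<lambda>\<omega>. indicator A \<omega> * (W i \<omega>)\<^sup>2) * expectation (\<lambda>\<omega>. (G i (dZ (a i) (b i) \<omega>))\<^sup>2)"
    using expectation_dZ_mult[of "a i" "b i" _ "\<lambda>x. (G i x)\<^sup>2", OF _ _ X(2) _ X(1) G2[OF i]] ab[OF i] Gm[OF i] by auto
  have "expectation (\<lambda>\<omega>. indicator A \<omega> * (W i \<omega>)\<^sup>2) * expectation (\<lambda>\<omega>. (G i (dZ (a i) (b i) \<omega>))\<^sup>2)
     \<le> expectation (\<lambda>\<omega>. indicator A \<omega> * (W i \<omega>)\<^sup>2) * v i"
    using Gv[OF i] by (intro mult_left_mono integral_nonneg_AE) auto
  with E show "integrable M (\<lambda>\<omega>. indicator A \<omega> * (W i \<omega> * G i (dZ (a i) (b i) \<omega>))\<^sup>2) \<and>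
      expectation (\<lambda>\<omega>. indicator A \<omega> * (W i \<omega> * G i (dZ (a i) (b i) \<omega>))\<^sup>2)
      \<le> expectation (\<lambda>\<omega>. indicator A \<omega> * ((W i \<omega>)\<^sup>2 * v i))"
    by (simp add: power_mult_distrib mult.assoc[symmetric])
  fix j and U :: "'w \<Rightarrow> real" assume j: "j \<in> I" "i \<noteq> j" "lab i = lab j"
    and U: "U \<in> borel_measurable (F (a i))" "integrable M (\<lambda>\<omega>. (U \<omega>)\<^sup>2)"
  have Y: "(\<lambda>\<omega>. indicator A \<omega> * W i \<omega>) \<in> borel_measurable (F (a i))"
    using indicator_bounded_integrable[OF A(1) Wm[OF i] C'] by auto
  have Y2: "(\<lambda>\<omega>. U \<omega> * (indicator A \<omega> * W i \<omega>)) \<in> borel_measurable (F (a i))"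
    using U(1) Y by (rule borel_measurable_times)
  have Y3: "integrable M (\<lambda>\<omega>. U \<omega> * (indicator A \<omega> * W i \<omega>))"
    using U Y X by (intro integrable_product_of_squares F_imp_M[OF U(1)] F_imp_M[OF Y])
      (auto simp: power_mult_distrib indicator_sq)
  show "expectation (\<lambda>\<omega>. U \<omega> * (indicator A \<omega> * (W i \<omega> * G i (dZ (a i) (b i) \<omega>)))) = 0"
    using expectation_dZ_mult(2)[of "a i" "b i" _ "G i", OF _ _ Y2 _ Y3 G1] ab[OF i] Gm[OF i] G0[OF i j]
    by (simp add: mult_ac)
qed (use assms in auto)

text \<open>The covariance matrix of the increment is (b i - a i) times the identity, so the
  conditional variance of the inner product is exactly |W i|^2 (b i - a i). Summed over a partition
  this is the time integral of a squared step process.\<close>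

lemma lenglart_vector:
  fixes W :: "'i \<Rightarrow> 'w \<Rightarrow> real^'n" and lab :: "'i \<Rightarrow> nat"
  assumes fin: "finite I" "finite L"
    and ab: "\<And>i. i \<in> I \<Longrightarrow> 0 \<le> a i \<and> a i < b i"
    and sep: "\<And>i j. i \<in> I \<Longrightarrow> j \<in> I \<Longrightarrow> i \<noteq> j \<Longrightarrow> b i \<le> a j \<or> b j \<le> a i"
    and Wm: "\<And>i. i \<in> I \<Longrightarrow> W i \<in> borel_measurable (F (a i))"
    and \<delta>: "0 \<le> \<delta>" and \<epsilon>: "0 < \<epsilon>"
  shows "prob {\<omega>\<in>space M. (\<Sum>l\<in>L. (\<Sum>i\<in>{i\<in>I. lab i = l}. W i \<omega> \<bullet> dZ (a i) (b i) \<omega>)\<^sup>2) > \<epsilon>} \<le>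
         prob {\<omega>\<in>space M. (\<Sum>i\<in>I. (norm (W i \<omega>))\<^sup>2 * (b i - a i)) > \<delta>} + \<delta> / \<epsilon>"
proof (rule discrete_lenglart[where a=a and b=b])
  fix i assume i: "i \<in> I"
  have dm: "dZ (a i) (b i) \<in> borel_measurable (F (b i))"
    using ab[OF i] by (intro borel_measurable_diff Z_measurable) auto
  have "W i \<in> borel_measurable (F (b i))"
    using Wm[OF i] ab[OF i] by (auto intro: F_measurable_mono)
  with dm show "(\<lambda>\<omega>. W i \<omega> \<bullet> dZ (a i) (b i) \<omega>) \<in> borel_measurable (F (b i))"
    by (intro borel_measurable_inner)
  show "(\<lambda>\<omega>. (norm (W i \<omega>))\<^sup>2 * (b i - a i)) \<in> borel_measurable (F (a i))"
    using Wm[OF i] by measurable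
  show "0 \<le> (norm (W i \<omega>))\<^sup>2 * (b i - a i)" for \<omega> using ab[OF i] by simp
  have Wc: "(\<lambda>\<omega>. W i \<omega> $ k) \<in> borel_measurable (F (a i))" for k
    using Wm[OF i] borel_measurable_continuous_onI[of "\<lambda>x::real^'n. x $ k"]
    by (intro measurable_compose[OF Wm[OF i]]) (auto intro: continuous_intros)
  note cov = dZ_covariance[of "a i" "b i"] and mean = dZ_component_mean[of "a i" "b i"]
  fix A C assume A: "A \<in> sets (F (a i))" "\<forall>\<omega>\<in>A. (norm (W i \<omega>))\<^sup>2 * (b i - a i) \<le> C"
  define K where "K = sqrt (C / (b i - a i))"
  have K: "norm (W i \<omega>) \<le> K" if "\<omega> \<in> A" for \<omega>
    using A that ab[OF i] unfolding K_def by (intro real_le_rsqrt) (auto simp: field_simps)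
  have K1: "\<bar>W i \<omega> $ k\<bar> \<le> K" if "\<omega> \<in> A" for \<omega> k
    using K[OF that] component_le_norm_cart[of "W i \<omega>" k] by linarith
  have K2: "\<bar>W i \<omega> $ k * W i \<omega> $ l\<bar> \<le> K * K" if "\<omega> \<in> A" for \<omega> k l
    using K1[OF that] unfolding abs_mult by (intro mult_mono) (auto intro: order_trans[OF abs_ge_zero])
  have X: "integrable M (\<lambda>\<omega>. indicator A \<omega> * (W i \<omega> $ k * W i \<omega> $ l))"
    "(\<lambda>\<omega>. indicator A \<omega> * (W i \<omega> $ k * W i \<omega> $ l)) \<in> borel_measurable (F (a i))" for k l
    using indicator_bounded_integrable[OF A(1) _ K2] Wc by auto
  have E: "integrable M (\<lambda>\<omega>. indicator A \<omega> * (W i \<omega> $ k * W i \<omega> $ l) * (dZ (a i) (b i) \<omega> $ k * dZ (a i) (b i) \<omega> $ l))"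
    "expectation (\<lambda>\<omega>. indicator A \<omega> * (W i \<omega> $ k * W i \<omega> $ l) * (dZ (a i) (b i) \<omega> $ k * dZ (a i) (b i) \<omega> $ l)) =
     expectation (\<lambda>\<omega>. indicator A \<omega> * (W i \<omega> $ k * W i \<omega> $ l)) * (if k = l then b i - a i else 0)" for k l
    using expectation_dZ_mult[of "a i" "b i" _ "\<lambda>x. x $ k * x $ l", OF _ _ X(2)[of k l] _ X(1)[of k l]] cov[of k l] ab[OF i] by auto
  have eq: "indicator A \<omega> * (W i \<omega> \<bullet> dZ (a i) (b i) \<omega>)\<^sup>2 =
      (\<Sum>k\<in>UNIV. \<Sum>l\<in>UNIV. indicator A \<omega> * (W i \<omega> $ k * W i \<omega> $ l) * (dZ (a i) (b i) \<omega> $ k * dZ (a i) (b i) \<omega> $ l))" for \<omega>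
  proof -
    have "(W i \<omega> \<bullet> dZ (a i) (b i) \<omega>)\<^sup>2 =
       (\<Sum>k\<in>UNIV. \<Sum>l\<in>UNIV. (W i \<omega> $ k * dZ (a i) (b i) \<omega> $ k) * (W i \<omega> $ l * dZ (a i) (b i) \<omega> $ l))"
      unfolding inner_vec_def power2_eq_square sum_product by simp
    then show ?thesis by (simp only: sum_distrib_left) (simp only: mult_ac)
  qed
  have "expectation (\<lambda>\<omega>. indicator A \<omega> * (W i \<omega> \<bullet> dZ (a i) (b i) \<omega>)\<^sup>2) =
     (\<Sum>k\<in>UNIV. \<Sum>l\<in>UNIV. expectation (\<lambda>\<omega>. indicator A \<omega> * (W i \<omega> $ k * W i \<omega> $ l)) * (if k = l then b i - a i else 0))"
    unfolding eq using E by simp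
  also have "\<dots> = (\<Sum>k\<in>UNIV. expectation (\<lambda>\<omega>. indicator A \<omega> * (W i \<omega> $ k * W i \<omega> $ k)) * (b i - a i))"
    by (simp add: if_distrib[of "\<lambda>x. _ * x"] cong: if_cong)
  also have "\<dots> = expectation (\<lambda>\<omega>. \<Sum>k\<in>UNIV. indicator A \<omega> * (W i \<omega> $ k * W i \<omega> $ k) * (b i - a i))"
    using X(1) by simp
  also have "\<dots> = expectation (\<lambda>\<omega>. indicator A \<omega> * ((norm (W i \<omega>))\<^sup>2 * (b i - a i)))"
  proof -
    have "(\<Sum>k\<in>UNIV. indicator A \<omega> * (W i \<omega> $ k * W i \<omega> $ k) * (b i - a i)) =
        indicator A \<omega> * ((norm (W i \<omega>))\<^sup>2 * (b i - a i))" for \<omega>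
      unfolding norm_sq_sum by (simp only: sum_distrib_left sum_distrib_right power2_eq_square mult.assoc)
    then show ?thesis by simp
  qed
  finally show "integrable M (\<lambda>\<omega>. indicator A \<omega> * (W i \<omega> \<bullet> dZ (a i) (b i) \<omega>)\<^sup>2) \<and>
      expectation (\<lambda>\<omega>. indicator A \<omega> * (W i \<omega> \<bullet> dZ (a i) (b i) \<omega>)\<^sup>2)
      \<le> expectation (\<lambda>\<omega>. indicator A \<omega> * ((norm (W i \<omega>))\<^sup>2 * (b i - a i)))"
    unfolding eq using E by auto
  fix U :: "'w \<Rightarrow> real" assume U: "U \<in> borel_measurable (F (a i))" "integrable M (\<lambda>\<omega>. (U \<omega>)\<^sup>2)"
  have Y: "(\<lambda>\<omega>. indicator A \<omega> * W i \<omega> $ k) \<in> borel_measurable (F (a i))" for k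
    using indicator_bounded_integrable[OF A(1) Wc K1] by auto
  have Y2: "(\<lambda>\<omega>. U \<omega> * (indicator A \<omega> * W i \<omega> $ k)) \<in> borel_measurable (F (a i))" for k
    using U(1) Y by (rule borel_measurable_times)
  have "(indicator A \<omega> * W i \<omega> $ k)\<^sup>2 = indicator A \<omega> * (W i \<omega> $ k * W i \<omega> $ k)" for \<omega> k
    by (simp add: indicator_def power2_eq_square)
  then have Y3: "integrable M (\<lambda>\<omega>. U \<omega> * (indicator A \<omega> * W i \<omega> $ k))" for k
    using U(2) X(1)[of k k] by (intro integrable_product_of_squares F_imp_M[OF U(1)] F_imp_M[OF Y]) simp_all
  have E1: "integrable M (\<lambda>\<omega>. U \<omega> * (indicator A \<omega> * W i \<omega> $ k) * dZ (a i) (b i) \<omega> $ k)"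
     "expectation (\<lambda>\<omega>. U \<omega> * (indicator A \<omega> * W i \<omega> $ k) * dZ (a i) (b i) \<omega> $ k) = 0" for k
    using expectation_dZ_mult[of "a i" "b i" _ "\<lambda>x. x $ k", OF _ _ Y2[of k] _ Y3[of k]] ab[OF i] mean[of k] by auto
  have "expectation (\<lambda>\<omega>. \<Sum>k\<in>UNIV. U \<omega> * (indicator A \<omega> * W i \<omega> $ k) * dZ (a i) (b i) \<omega> $ k) = 0"
    using E1 by simp
  then show "expectation (\<lambda>\<omega>. U \<omega> * (indicator A \<omega> * (W i \<omega> \<bullet> dZ (a i) (b i) \<omega>))) = 0"
    unfolding inner_vec_def sum_distrib_left by (simp add: mult_ac)
qed (use assms in auto)

end

section \<open>Simple integrands\<close>

text \<open>The jump times of a simple integrand have to be merged with a prescribed grid. As finite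
  sets the two are merged by a union, and a successor function on sets avoids sorting the
  result.\<close>

definition nxt :: "real set \<Rightarrow> real \<Rightarrow> real" where
  "nxt P p = Min {q\<in>P. p < q}"

lemma nxt_props:
  assumes "finite P" "b \<in> P" "p < b"
  shows nxt_in: "nxt P p \<in> P" and nxt_greater: "p < nxt P p" and nxt_le: "nxt P p \<le> b"
proof -
  have "nxt P p \<in> {q\<in>P. p < q}" unfolding nxt_def using assms by (intro Min_in) auto
  then show "nxt P p \<in> P" "p < nxt P p" by auto
  show "nxt P p \<le> b" unfolding nxt_def using assms by (intro Min_le) auto
qed

lemma telescope_nxt:
  fixes f :: "real \<Rightarrow> 'a::ab_group_add"
  assumes "finite P" "b \<in> P" "a \<in> P" "a \<le> b"
  shows "(\<Sum>p\<in>{p\<in>P. a \<le> p \<and> p < b}. f (nxt P p) - f p) = f b - f a"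
  using assms
proof (induction "card {p\<in>P. a \<le> p \<and> p < b}" arbitrary: a rule: less_induct)
  case less
  show ?case
  proof (cases "a = b")
    case True
    then have "{p\<in>P. a \<le> p \<and> p < b} = {}" by auto
    with True show ?thesis by (simp only: sum.empty) simp
  next
    case False
    then have ab: "a < b" using less by auto
    note n = nxt_in[OF less(2,3) ab] nxt_greater[OF less(2,3) ab] nxt_le[OF less(2,3) ab]
    define R where "R = {p\<in>P. nxt P a \<le> p \<and> p < b}"
    have le: "nxt P a \<le> q" if "q \<in> P" "a < q" for q using nxt_le[OF less(2) that] .
    have eq: "{p\<in>P. a \<le> p \<and> p < b} = insert a R"
    proof (intro set_eqI iffI)
      fix p assume p: "p \<in> {p\<in>P. a \<le> p \<and> p < b}"
      then have "p = a \<or> a < p" by auto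
      then show "p \<in> insert a R" using p le[of p] unfolding R_def by blast
    next
      fix p assume "p \<in> insert a R"
      then show "p \<in> {p\<in>P. a \<le> p \<and> p < b}" using n(2) ab less(4) unfolding R_def by auto
    qed
    have aR: "a \<notin> R" using n(2) unfolding R_def by simp
    have finR: "finite R" using less(2) unfolding R_def by simp
    have "card R < card {p\<in>P. a \<le> p \<and> p < b}"
      unfolding eq using aR finR by simp
    from less(1)[OF this[unfolded R_def] less(2,3) n(1) n(3)]
    have "(\<Sum>p\<in>R. f (nxt P p) - f p) = f b - f (nxt P a)" unfolding R_def .
    moreover have "(\<Sum>p\<in>{p\<in>P. a \<le> p \<and> p < b}. f (nxt P p) - f p) =
        f (nxt P a) - f a + (\<Sum>p\<in>R. f (nxt P p) - f p)"
      unfolding eq by (rule sum.insert[OF finR aR])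
    ultimately show ?thesis by simp
  qed
qed

lemma sum_Sigma':
  fixes H :: "'a \<times> 'b \<Rightarrow> 'c::comm_monoid_add"
  assumes "finite A" "\<And>i. i \<in> A \<Longrightarrow> finite (B i)"
  shows "sum H (Sigma A B) = (\<Sum>i\<in>A. \<Sum>p\<in>B i. H (i, p))"
proof -
  have "(\<Sum>i\<in>A. \<Sum>p\<in>B i. H (i, p)) = (\<Sum>(i, p)\<in>Sigma A B. H (i, p))"
    using assms by (intro sum.Sigma) auto
  also have "(\<lambda>(i, p). H (i, p)) = H" by (rule ext) auto
  finally show ?thesis by (rule sym)
qed

text \<open>The half-open intervals are closed on the left here, unlike in
  \<open>simple_process\<close>: evaluated at a left end point p of a refining partition this gives
  the value that the simple process takes just after p, and it is known at time p.\<close>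

definition simple_value :: "nat \<Rightarrow> (nat \<Rightarrow> real) \<Rightarrow> (nat \<Rightarrow> 'w \<Rightarrow> real^'n) \<Rightarrow> real \<Rightarrow> 'w \<Rightarrow> real^'n" where
  "simple_value k t \<eta> p \<omega> = (\<Sum>i<k. indicator {t i..<t (Suc i)} p *\<^sub>R \<eta> i \<omega>)"

lemma simple_data_nonneg:
  assumes "simple_data M F k t \<eta>" "i \<le> k" shows "0 \<le> t i"
  using assms(2)
proof (induction i)
  case (Suc i)
  then have "0 \<le> t i" "t i < t (Suc i)" using assms(1) by (auto simp: simple_data_def)
  then show ?case by simp
qed (use assms in \<open>auto simp: simple_data_def\<close>)

text \<open>Each summand of the simple integral telescopes over the points of P between its end
  points. Jump times after T may be missing from P, because \<open>min\<close> replaces those after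
  b by b, which is a point of P.\<close>

lemma simple_integral_grid:
  fixes Z :: "real \<Rightarrow> 'w \<Rightarrow> real^'n"
  assumes sd: "simple_data M F k t \<eta>" and P: "finite P" "b \<in> P" "t ` {..k} \<inter> {..T} \<subseteq> P" "b \<le> T"
  shows "simple_integral Z k t \<eta> b \<omega> =
    (\<Sum>p\<in>{p\<in>P. p < b}. simple_value k t \<eta> p \<omega> \<bullet> (Z (nxt P p) \<omega> - Z p \<omega>))"
proof -
  have "simple_integral Z k t \<eta> b \<omega> =
     (\<Sum>i<k. \<Sum>p\<in>{p\<in>P. p < b}. (indicator {t i..<t (Suc i)} p *\<^sub>R \<eta> i \<omega>) \<bullet> (Z (nxt P p) \<omega> - Z p \<omega>))"
    unfolding simple_integral_def
  proof (intro sum.cong refl)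
    fix i assume i: "i \<in> {..<k}"
    have m: "min (t (Suc i)) b \<in> P" "min (t i) b \<in> P" "min (t i) b \<le> min (t (Suc i)) b"
      using i P sd by (auto simp: min_def simple_data_def intro!: subsetD[OF P(3)] intro: less_imp_le)
    have "Z (min (t (Suc i)) b) \<omega> - Z (min (t i) b) \<omega> =
       (\<Sum>p\<in>{p\<in>P. min (t i) b \<le> p \<and> p < min (t (Suc i)) b}. Z (nxt P p) \<omega> - Z p \<omega>)"
      by (rule telescope_nxt[OF P(1) m, symmetric])
    then have "\<eta> i \<omega> \<bullet> (Z (min (t (Suc i)) b) \<omega> - Z (min (t i) b) \<omega>) =
       (\<Sum>p\<in>{p\<in>P. min (t i) b \<le> p \<and> p < min (t (Suc i)) b}. \<eta> i \<omega> \<bullet> (Z (nxt P p) \<omega> - Z p \<omega>))"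
      by (simp only: inner_sum_right)
    also have "\<dots> = (\<Sum>p\<in>{p\<in>P. p < b}. (indicator {t i..<t (Suc i)} p *\<^sub>R \<eta> i \<omega>) \<bullet> (Z (nxt P p) \<omega> - Z p \<omega>))"
      using P(1) by (intro sum.mono_neutral_cong_left) (auto simp: min_def indicator_def split: if_splits)
    finally show "\<eta> i \<omega> \<bullet> (Z (min (t (Suc i)) b) \<omega> - Z (min (t i) b) \<omega>) = \<dots>" .
  qed
  also have "\<dots> = (\<Sum>p\<in>{p\<in>P. p < b}. simple_value k t \<eta> p \<omega> \<bullet> (Z (nxt P p) \<omega> - Z p \<omega>))"
    unfolding simple_value_def inner_sum_left by (rule sum.swap)
  finally show ?thesis .
qed

lemma simple_process_grid:
  assumes "simple_data M F k t \<eta>" "finite P" "b \<in> P" "t ` {..k} \<inter> {..T} \<subseteq> P" "b \<le> T"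
    and p: "p \<in> P" "p < b" "p < x" "x \<le> nxt P p"
  shows "simple_process k t \<eta> x \<omega> = simple_value k t \<eta> p \<omega>"
  unfolding simple_process_def simple_value_def
proof (intro sum.cong refl arg_cong2[where f=scaleR])
  fix i assume i: "i \<in> {..<k}"
  note n = nxt_props[OF assms(2,3) p(2)]
  \<comment> \<open>Between two consecutive points of P there is no jump time: one before x would
    lie below T, hence in P, and so could not exceed p.\<close>
  have *: "t j < x \<longleftrightarrow> t j \<le> p" if "j \<le> k" for j
  proof
    assume "t j < x"
    then have "t j \<in> P" using that n p assms(5) by (intro subsetD[OF assms(4)]) auto
    show "t j \<le> p"
    proof (rule ccontr)
      assume "\<not> t j \<le> p"
      then have "nxt P p \<le> t j" using \<open>t j \<in> P\<close> assms(2) by (intro nxt_le) auto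
      with \<open>t j < x\<close> p show False by auto
    qed
  qed (use p in auto)
  have "t (Suc i) < x \<longleftrightarrow> t (Suc i) \<le> p" "t i < x \<longleftrightarrow> t i \<le> p" using i by (auto intro!: *)
  then show "(indicator {t i<..t (Suc i)} x :: real) = indicator {t i..<t (Suc i)} p"
    by (auto simp: indicator_def)
qed

context brownian
begin

lemma simple_eta_measurable:
  assumes "simple_data M F k t \<eta>" "i < k" shows "\<eta> i \<in> borel_measurable M"
  using assms by (auto simp: simple_data_def intro: F_imp_M)

lemma simple_process_measurable:
  assumes "simple_data M F k t \<eta>"
  shows "(\<lambda>(\<omega>, x). simple_process k t \<eta> x \<omega>) \<in> borel_measurable (M \<Otimes>\<^sub>M lborel)"
  unfolding simple_process_def case_prod_beta
proof (intro borel_measurable_sum)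
  fix i assume i: "i \<in> {..<k}"
  have [measurable]: "\<eta> i \<in> borel_measurable M" using simple_eta_measurable[OF assms] i by simp
  show "(\<lambda>p. indicat_real {t i<..t (Suc i)} (snd p) *\<^sub>R \<eta> i (fst p)) \<in> borel_measurable (M \<Otimes>\<^sub>M lborel)"
    by measurable
qed

lemma simple_integral_measurable:
  assumes "simple_data M F k t \<eta>" "0 \<le> T"
  shows "simple_integral Z k t \<eta> T \<in> borel_measurable M"
  unfolding simple_integral_def[abs_def]
proof (intro borel_measurable_sum borel_measurable_inner borel_measurable_diff Z_measurable_M)
  fix i assume i: "i \<in> {..<k}"
  show "\<eta> i \<in> borel_measurable M" using simple_eta_measurable[OF assms(1)] i by simp
  show "0 \<le> min (t (Suc i)) T" "0 \<le> min (t i) T"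
    using simple_data_nonneg[OF assms(1), of i] simple_data_nonneg[OF assms(1), of "Suc i"] i assms(2) by auto
qed

text \<open>On the common refinement of the grid \<open>tt\<close> and the jump times, the block
  errors are sums of adapted vectors times Brownian increments, so \<open>lenglart_vector\<close>
  applies. The resulting bound knows the simple process only through its distance in L2 from the
  step values \<open>u i\<close>, not through its partition; hence it can pass to the limit over
  simple processes.\<close>

lemma simple_block_lenglart:
  fixes tt :: "nat \<Rightarrow> real" and w :: "nat \<Rightarrow> 'w \<Rightarrow> real" and u :: "nat \<Rightarrow> 'w \<Rightarrow> real^'n" and lab :: "nat \<Rightarrow> nat"
  assumes sd: "simple_data M F k t \<eta>"
    and tt: "strict_mono tt" "0 \<le> tt 0"
    and w: "\<And>i. w i \<in> borel_measurable (F (tt i))"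
    and u: "\<And>i. u i \<in> borel_measurable (F (tt i))"
    and L: "finite L" and \<delta>: "0 \<le> \<delta>" and \<epsilon>: "0 < \<epsilon>"
  shows "prob {\<omega>\<in>space M. (\<Sum>l\<in>L. (\<Sum>i\<in>{i. i < N \<and> lab i = l}. w i \<omega> *
            (simple_integral Z k t \<eta> (tt (Suc i)) \<omega> - simple_integral Z k t \<eta> (tt i) \<omega>
              - u i \<omega> \<bullet> dZ (tt i) (tt (Suc i)) \<omega>))\<^sup>2) > \<epsilon>}
     \<le> prob {\<omega>\<in>space M. (\<Sum>i<N. ennreal ((w i \<omega>)\<^sup>2) *
            (\<integral>\<^sup>+x\<in>{tt i<..tt (Suc i)}. ennreal ((norm (simple_process k t \<eta> x \<omega> - u i \<omega>))\<^sup>2) \<partial>lborel)) > ennreal \<delta>}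
       + \<delta> / \<epsilon>"
proof -
  define T where "T = tt N"
  define P where "P = tt ` {..N} \<union> (t ` {..k} \<inter> {..T})"
  \<comment> \<open>A refining point is stored together with the number of its block, from which the
    weight, the step value and the label are read off.\<close>
  define I where "I = Sigma {..<N} (\<lambda>i. {p\<in>P. tt i \<le> p \<and> p < tt (Suc i)})"
  define W where "W = (\<lambda>(i, p) \<omega>. w i \<omega> *\<^sub>R (simple_value k t \<eta> p \<omega> - u i \<omega>))"
  define a where "a = (snd :: nat \<times> real \<Rightarrow> real)"
  define b where "b e = nxt P (snd e)" for e :: "nat \<times> real"
  define lb where "lb e = lab (fst e)" for e :: "nat \<times> real"
  have finP: "finite P" unfolding P_def by auto
  have tP: "t ` {..k} \<inter> {..T} \<subseteq> P" unfolding P_def by auto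
  have ttP: "tt i \<in> P" if "i \<le> N" for i using that unfolding P_def by auto
  have tt_less: "tt i < tt (Suc i)" "tt i \<le> tt (Suc i)" for i
    using tt(1) by (auto simp: strict_mono_def less_imp_le)
  have tt_mono: "tt i \<le> tt j" if "i \<le> j" for i j
    using strict_mono_mono[OF tt(1)] that by (auto simp: mono_def)
  have ttT: "tt i \<le> T" if "i \<le> N" for i using tt_mono[OF that] by (simp add: T_def)
  have tt0: "0 \<le> tt i" for i using tt_mono[of 0 i] tt(2) by simp
  have finI: "finite I" unfolding I_def using finP by auto
  have nx: "p < nxt P p" "nxt P p \<le> tt (Suc i)" "nxt P p \<in> P" if "(i, p) \<in> I" for i p
    using nxt_props[OF finP ttP[of "Suc i"], of p] that by (auto simp: I_def)
  have block: "simple_integral Z k t \<eta> (tt (Suc i)) \<omega> - simple_integral Z k t \<eta> (tt i) \<omega>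
      - u i \<omega> \<bullet> dZ (tt i) (tt (Suc i)) \<omega>
     = (\<Sum>p\<in>{p\<in>P. tt i \<le> p \<and> p < tt (Suc i)}. (simple_value k t \<eta> p \<omega> - u i \<omega>) \<bullet> dZ p (nxt P p) \<omega>)"
    if "i < N" for i \<omega>
  proof -
    have i: "i \<le> N" "Suc i \<le> N" using that by auto
    have eq: "{p\<in>P. p < tt (Suc i)} = {p\<in>P. p < tt i} \<union> {p\<in>P. tt i \<le> p \<and> p < tt (Suc i)}"
      using tt_less[of i] by auto
    have "simple_integral Z k t \<eta> (tt (Suc i)) \<omega> = simple_integral Z k t \<eta> (tt i) \<omega>
       + (\<Sum>p\<in>{p\<in>P. tt i \<le> p \<and> p < tt (Suc i)}. simple_value k t \<eta> p \<omega> \<bullet> dZ p (nxt P p) \<omega>)"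
      unfolding simple_integral_grid[OF sd finP ttP[OF i(1)] tP ttT[OF i(1)]]
        simple_integral_grid[OF sd finP ttP[OF i(2)] tP ttT[OF i(2)]] eq
      using finP by (intro sum.union_disjoint) auto
    moreover have "u i \<omega> \<bullet> dZ (tt i) (tt (Suc i)) \<omega> =
       (\<Sum>p\<in>{p\<in>P. tt i \<le> p \<and> p < tt (Suc i)}. u i \<omega> \<bullet> dZ p (nxt P p) \<omega>)"
      unfolding telescope_nxt[OF finP ttP[OF i(2)] ttP[OF i(1)] tt_less(2), of "\<lambda>p. Z p \<omega>", symmetric]
      by (rule inner_sum_right)
    ultimately show ?thesis
      unfolding inner_diff_left sum_subtractf by simp
  qed
  have lhs: "(\<Sum>i\<in>{i. i < N \<and> lab i = l}. w i \<omega> *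
            (simple_integral Z k t \<eta> (tt (Suc i)) \<omega> - simple_integral Z k t \<eta> (tt i) \<omega>
              - u i \<omega> \<bullet> dZ (tt i) (tt (Suc i)) \<omega>)) = (\<Sum>e\<in>{e\<in>I. lb e = l}. W e \<omega> \<bullet> dZ (a e) (b e) \<omega>)" for l \<omega>
  proof -
    have "{e\<in>I. lb e = l} = Sigma {i. i < N \<and> lab i = l} (\<lambda>i. {p\<in>P. tt i \<le> p \<and> p < tt (Suc i)})"
      by (auto simp: I_def lb_def)
    then have "(\<Sum>e\<in>{e\<in>I. lb e = l}. W e \<omega> \<bullet> dZ (a e) (b e) \<omega>) =
       (\<Sum>e\<in>Sigma {i. i < N \<and> lab i = l} (\<lambda>i. {p\<in>P. tt i \<le> p \<and> p < tt (Suc i)}). W e \<omega> \<bullet> dZ (a e) (b e) \<omega>)"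
      by simp
    also have "\<dots> = (\<Sum>i\<in>{i. i < N \<and> lab i = l}. \<Sum>p\<in>{p\<in>P. tt i \<le> p \<and> p < tt (Suc i)}.
          w i \<omega> * ((simple_value k t \<eta> p \<omega> - u i \<omega>) \<bullet> dZ p (nxt P p) \<omega>))"
      using finP by (subst sum_Sigma') (simp_all add: W_def a_def b_def)
    also have "\<dots> = (\<Sum>i\<in>{i. i < N \<and> lab i = l}. w i \<omega> *
            (simple_integral Z k t \<eta> (tt (Suc i)) \<omega> - simple_integral Z k t \<eta> (tt i) \<omega>
              - u i \<omega> \<bullet> dZ (tt i) (tt (Suc i)) \<omega>))"
      by (intro sum.cong refl) (simp only: block sum_distrib_left mem_Collect_eq)
    finally show ?thesis by (rule sym)
  qed
  have main: "prob {\<omega>\<in>space M. (\<Sum>l\<in>L. (\<Sum>e\<in>{e\<in>I. lb e = l}. W e \<omega> \<bullet> dZ (a e) (b e) \<omega>)\<^sup>2) > \<epsilon>} \<le>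
         prob {\<omega>\<in>space M. (\<Sum>e\<in>I. (norm (W e \<omega>))\<^sup>2 * (b e - a e)) > \<delta>} + \<delta> / \<epsilon>"
  proof (rule lenglart_vector[OF finI L _ _ _ \<delta> \<epsilon>])
    fix e assume e: "e \<in> I"
    obtain i p where ep: "e = (i, p)" by (cases e)
    have ip: "i < N" "p \<in> P" "tt i \<le> p" "p < tt (Suc i)" using e ep by (auto simp: I_def)
    show "0 \<le> a e \<and> a e < b e"
      using nx[of i p] e ip tt0[of i] by (auto simp: ep a_def b_def)
    have "u i \<in> borel_measurable (F p)" "w i \<in> borel_measurable (F p)"
      using u w ip by (auto intro: F_measurable_mono)
    moreover have "simple_value k t \<eta> p \<in> borel_measurable (F p)"
      unfolding simple_value_def[abs_def]
    proof (intro borel_measurable_sum)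
      fix j assume j: "j \<in> {..<k}"
      show "(\<lambda>\<omega>. indicat_real {t j..<t (Suc j)} p *\<^sub>R \<eta> j \<omega>) \<in> borel_measurable (F p)"
      proof (cases "p \<in> {t j..<t (Suc j)}")
        case True
        then have "\<eta> j \<in> borel_measurable (F p)"
          using sd j by (auto simp: simple_data_def intro: F_measurable_mono)
        then show ?thesis by simp
      qed simp
    qed
    ultimately show "W e \<in> borel_measurable (F (a e))"
      unfolding W_def ep a_def by (simp add: borel_measurable_scaleR borel_measurable_diff)
  next
    fix e e' assume e: "e \<in> I" "e' \<in> I" "e \<noteq> e'"
    obtain i p where ep: "e = (i, p)" by (cases e)
    obtain i' p' where ep': "e' = (i', p')" by (cases e')
    \<comment> \<open>Blocks are disjoint, so a point determines its block and different pairs have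
      different points.\<close>
    have "p \<noteq> p'"
    proof
      assume "p = p'"
      then have "tt i < tt (Suc i')" "tt i' < tt (Suc i)" using e ep ep' by (auto simp: I_def)
      then have "i < Suc i'" "i' < Suc i" using strict_mono_less[OF tt(1)] by auto
      with \<open>p = p'\<close> e ep ep' show False by auto
    qed
    then consider "p < p'" | "p' < p" by linarith
    then show "b e \<le> a e' \<or> b e' \<le> a e"
    proof cases
      case 1
      then show ?thesis using e nxt_le[OF finP, of p' p] by (auto simp: ep ep' a_def b_def I_def)
    next
      case 2
      then show ?thesis using e nxt_le[OF finP, of p p'] by (auto simp: ep ep' a_def b_def I_def)
    qed
  qed
  have reindex: "(\<Sum>e\<in>I. H e) = (\<Sum>i<N. \<Sum>p\<in>{p\<in>P. tt i \<le> p \<and> p < tt (Suc i)}. H (i, p))"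
    for H :: "nat \<times> real \<Rightarrow> ennreal"
    unfolding I_def using finP by (intro sum_Sigma') auto
  \<comment> \<open>On each refined interval the simple process is constant, so every conditional
    variance is an integral of the squared distance; the refined intervals of a block are disjoint
    and lie inside the block.\<close>
  have Q: "ennreal (\<Sum>e\<in>I. (norm (W e \<omega>))\<^sup>2 * (b e - a e)) \<le> (\<Sum>i<N. ennreal ((w i \<omega>)\<^sup>2) *
            (\<integral>\<^sup>+x\<in>{tt i<..tt (Suc i)}. ennreal ((norm (simple_process k t \<eta> x \<omega> - u i \<omega>))\<^sup>2) \<partial>lborel))"
    if "\<omega> \<in> space M" for \<omega>
  proof -
    have [measurable]: "(\<lambda>x. simple_process k t \<eta> x \<omega>) \<in> borel_measurable lborel"
      unfolding simple_process_def by measurable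
    have "ennreal (\<Sum>e\<in>I. (norm (W e \<omega>))\<^sup>2 * (b e - a e)) =
       (\<Sum>e\<in>I. ennreal ((norm (W e \<omega>))\<^sup>2 * (b e - a e)))"
    proof (rule sum_ennreal[symmetric])
      fix e assume "e \<in> I"
      then have "a e < b e" using nx(1)[of "fst e" "snd e"] by (simp add: a_def b_def)
      then show "0 \<le> (norm (W e \<omega>))\<^sup>2 * (b e - a e)" by simp
    qed
    also have "\<dots> = (\<Sum>i<N. \<Sum>p\<in>{p\<in>P. tt i \<le> p \<and> p < tt (Suc i)}.
        ennreal ((norm (W (i, p) \<omega>))\<^sup>2 * (nxt P p - p)))"
      unfolding reindex by (simp add: a_def b_def)
    also have "\<dots> \<le> (\<Sum>i<N. ennreal ((w i \<omega>)\<^sup>2) *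
            (\<integral>\<^sup>+x\<in>{tt i<..tt (Suc i)}. ennreal ((norm (simple_process k t \<eta> x \<omega> - u i \<omega>))\<^sup>2) \<partial>lborel))"
    proof (rule sum_mono)
      fix i assume i: "i \<in> {..<N}"
      define f where "f x = ennreal ((norm (simple_process k t \<eta> x \<omega> - u i \<omega>))\<^sup>2)" for x
      have [measurable]: "f \<in> borel_measurable lborel" unfolding f_def by measurable
      let ?Pi = "{p\<in>P. tt i \<le> p \<and> p < tt (Suc i)}"
      have "(\<Sum>p\<in>?Pi. ennreal ((norm (W (i, p) \<omega>))\<^sup>2 * (nxt P p - p))) =
         (\<Sum>p\<in>?Pi. ennreal ((w i \<omega>)\<^sup>2) * (\<integral>\<^sup>+x. f x * indicator {p<..nxt P p} x \<partial>lborel))"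
      proof (intro sum.cong refl)
        fix p assume p: "p \<in> ?Pi"
        then have ip: "(i, p) \<in> I" using i by (auto simp: I_def)
        have "(\<integral>\<^sup>+x. f x * indicator {p<..nxt P p} x \<partial>lborel) =
           (\<integral>\<^sup>+x. ennreal ((norm (simple_value k t \<eta> p \<omega> - u i \<omega>))\<^sup>2) * indicator {p<..nxt P p} x \<partial>lborel)"
          using simple_process_grid[OF sd finP ttP[of "Suc i"] tP ttT[of "Suc i"], of p] p i
          by (intro nn_integral_cong) (auto simp: f_def indicator_def)
        also have "\<dots> = ennreal ((norm (simple_value k t \<eta> p \<omega> - u i \<omega>))\<^sup>2) * ennreal (nxt P p - p)"
          using nx(1)[OF ip] by (simp add: nn_integral_cmult)
        finally show "ennreal ((norm (W (i, p) \<omega>))\<^sup>2 * (nxt P p - p)) =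
           ennreal ((w i \<omega>)\<^sup>2) * (\<integral>\<^sup>+x. f x * indicator {p<..nxt P p} x \<partial>lborel)"
          using nx(1)[OF ip] by (simp add: W_def power_mult_distrib ennreal_mult' mult.assoc)
      qed
      also have "\<dots> = ennreal ((w i \<omega>)\<^sup>2) * (\<integral>\<^sup>+x. (\<Sum>p\<in>?Pi. f x * indicator {p<..nxt P p} x) \<partial>lborel)"
        by (subst nn_integral_sum) (auto simp: sum_distrib_left)
      also have "\<dots> \<le> ennreal ((w i \<omega>)\<^sup>2) * (\<integral>\<^sup>+x\<in>{tt i<..tt (Suc i)}. f x \<partial>lborel)"
      proof (intro mult_left_mono nn_integral_mono)
        fix x
        show "(\<Sum>p\<in>?Pi. f x * indicator {p<..nxt P p} x) \<le> f x * indicator {tt i<..tt (Suc i)} x"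
        \<comment> \<open>At a fixed x at most one of the refined intervals contributes to the
          sum.\<close>
        proof (cases "\<exists>q\<in>?Pi. x \<in> {q<..nxt P q}")
          case False
          then have "(\<Sum>p\<in>?Pi. f x * indicator {p<..nxt P p} x) = 0"
            by (intro sum.neutral) (auto simp: indicator_def)
          then show ?thesis by simp
        next
          case True
          then obtain q where q: "q \<in> ?Pi" "x \<in> {q<..nxt P q}" by blast
          have "indicator {p<..nxt P p} x = (0::ennreal)" if "p \<in> ?Pi - {q}" for p
          proof -
            have "p < q \<or> q < p" using that by auto
            then show ?thesis
              using that q nxt_le[OF finP, of q p] nxt_le[OF finP, of p q]
              by (elim disjE) (simp_all add: indicator_def)
          qed
          then have "(\<Sum>p\<in>?Pi. f x * indicator {p<..nxt P p} x) = f x * indicator {q<..nxt P q} x"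
            using finP q by (subst sum.remove[of _ q]) auto
          also have "\<dots> \<le> f x * indicator {tt i<..tt (Suc i)} x"
            using q nx(2)[of i q] i by (auto simp: indicator_def I_def)
          finally show ?thesis .
        qed
      qed simp
      finally show "(\<Sum>p\<in>?Pi. ennreal ((norm (W (i, p) \<omega>))\<^sup>2 * (nxt P p - p))) \<le>
         ennreal ((w i \<omega>)\<^sup>2) * (\<integral>\<^sup>+x\<in>{tt i<..tt (Suc i)}. ennreal ((norm (simple_process k t \<eta> x \<omega> - u i \<omega>))\<^sup>2) \<partial>lborel)"
        unfolding f_def .
    qed
    finally show ?thesis .
  qed
  have meas: "(\<lambda>\<omega>. \<Sum>i<N. ennreal ((w i \<omega>)\<^sup>2) *
            (\<integral>\<^sup>+x\<in>{tt i<..tt (Suc i)}. ennreal ((norm (simple_process k t \<eta> x \<omega> - u i \<omega>))\<^sup>2) \<partial>lborel)) \<in> borel_measurable M"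
  proof (intro borel_measurable_sum)
    fix i
    note [measurable] = F_imp_M[OF u[of i]] F_imp_M[OF w[of i]] simple_process_measurable[OF sd, simplified case_prod_beta]
    have "(\<lambda>p. ennreal ((norm (simple_process k t \<eta> (snd p) (fst p) - u i (fst p)))\<^sup>2) * indicator {tt i<..tt (Suc i)} (snd p))
        \<in> borel_measurable (M \<Otimes>\<^sub>M lborel)" by measurable
    from lborel.borel_measurable_nn_integral_fst[OF this]
    show "(\<lambda>\<omega>. ennreal ((w i \<omega>)\<^sup>2) *
            (\<integral>\<^sup>+x\<in>{tt i<..tt (Suc i)}. ennreal ((norm (simple_process k t \<eta> x \<omega> - u i \<omega>))\<^sup>2) \<partial>lborel)) \<in> borel_measurable M"
      by simp
  qed
  have "prob {\<omega>\<in>space M. (\<Sum>e\<in>I. (norm (W e \<omega>))\<^sup>2 * (b e - a e)) > \<delta>} \<le>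
    prob {\<omega>\<in>space M. (\<Sum>i<N. ennreal ((w i \<omega>)\<^sup>2) *
            (\<integral>\<^sup>+x\<in>{tt i<..tt (Suc i)}. ennreal ((norm (simple_process k t \<eta> x \<omega> - u i \<omega>))\<^sup>2) \<partial>lborel)) > ennreal \<delta>}"
  proof (rule finite_measure_mono)
    show "{\<omega>\<in>space M. (\<Sum>e\<in>I. (norm (W e \<omega>))\<^sup>2 * (b e - a e)) > \<delta>} \<subseteq>
      {\<omega>\<in>space M. (\<Sum>i<N. ennreal ((w i \<omega>)\<^sup>2) *
            (\<integral>\<^sup>+x\<in>{tt i<..tt (Suc i)}. ennreal ((norm (simple_process k t \<eta> x \<omega> - u i \<omega>))\<^sup>2) \<partial>lborel)) > ennreal \<delta>}"
    proof (safe del: notI)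
      fix \<omega> assume \<omega>: "\<omega> \<in> space M" "(\<Sum>e\<in>I. (norm (W e \<omega>))\<^sup>2 * (b e - a e)) > \<delta>"
      then have "ennreal \<delta> < ennreal (\<Sum>e\<in>I. (norm (W e \<omega>))\<^sup>2 * (b e - a e))"
        using \<delta> by (intro ennreal_lessI) auto
      also note Q[OF \<omega>(1)]
      finally show "ennreal \<delta> < (\<Sum>i<N. ennreal ((w i \<omega>)\<^sup>2) *
            (\<integral>\<^sup>+x\<in>{tt i<..tt (Suc i)}. ennreal ((norm (simple_process k t \<eta> x \<omega> - u i \<omega>))\<^sup>2) \<partial>lborel))" .
    qed
    show "{\<omega>\<in>space M. (\<Sum>i<N. ennreal ((w i \<omega>)\<^sup>2) *
            (\<integral>\<^sup>+x\<in>{tt i<..tt (Suc i)}. ennreal ((norm (simple_process k t \<eta> x \<omega> - u i \<omega>))\<^sup>2) \<partial>lborel)) > ennreal \<delta>} \<in> events"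
      by (rule borel_measurable_less[OF borel_measurable_const meas])
  qed
  from order_trans[OF main add_right_mono[OF this, of "\<delta> / \<epsilon>"]] show ?thesis
    by (simp only: lhs)
qed

end

section \<open>Convergence in probability\<close>

context prob_space
begin

definition vanishing_prob :: "(nat \<Rightarrow> 'a \<Rightarrow> real) \<Rightarrow> bool" where
  "vanishing_prob Y \<longleftrightarrow> (\<forall>n. Y n \<in> borel_measurable M) \<and>
     (\<forall>e>0. (\<lambda>n. prob {\<omega>\<in>space M. e < \<bar>Y n \<omega>\<bar>}) \<longlonglongrightarrow> 0)"

lemma vanishing_probD:
  assumes "vanishing_prob Y"
  shows "Y n \<in> borel_measurable M" "0 < e \<Longrightarrow> (\<lambda>n. prob {\<omega>\<in>space M. e < \<bar>Y n \<omega>\<bar>}) \<longlonglongrightarrow> 0"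
  using assms by (auto simp: vanishing_prob_def)

lemma prob_tendsto_0:
  assumes [measurable]: "\<And>n. A n \<in> events" and ev: "AE \<omega> in M. \<forall>\<^sub>F n in sequentially. \<omega> \<notin> A n"
  shows "(\<lambda>n. prob (A n)) \<longlonglongrightarrow> 0"
proof -
  have "(\<lambda>n. expectation (indicator (A n) :: 'a \<Rightarrow> real)) \<longlonglongrightarrow> expectation (\<lambda>_. 0 :: real)"
  proof (rule integral_dominated_convergence[where w="\<lambda>_. 1"])
    show "AE \<omega> in M. (\<lambda>n. indicator (A n) \<omega> :: real) \<longlonglongrightarrow> 0"
      using ev
    proof eventually_elim
      case (elim \<omega>)
      then show ?case by (intro tendsto_eventually) (auto elim!: eventually_mono)
    qed
  qed (auto simp: indicator_def)
  then show ?thesis by simp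
qed

lemma prob_squeeze_0:
  assumes "\<And>n. prob (A n) \<le> f n" "f \<longlonglongrightarrow> 0"
  shows "(\<lambda>n. prob (A n)) \<longlonglongrightarrow> 0"
  by (rule tendsto_sandwich[OF _ _ tendsto_const assms(2)]) (auto simp: assms(1))

lemma prob_le_Un:
  assumes "A \<subseteq> B \<union> C" "B \<in> events" "C \<in> events"
  shows "prob A \<le> prob B + prob C"
  using finite_measure_mono[OF assms(1)] measure_Un_le[OF assms(2,3)] assms by auto

lemma vanishing_prob_AE:
  assumes [measurable]: "\<And>n. Y n \<in> borel_measurable M" and "AE \<omega> in M. (\<lambda>n. Y n \<omega>) \<longlonglongrightarrow> 0"
  shows "vanishing_prob Y"
  unfolding vanishing_prob_def
proof (intro conjI allI impI)
  fix e :: real assume e: "0 < e"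
  show "(\<lambda>n. prob {\<omega>\<in>space M. e < \<bar>Y n \<omega>\<bar>}) \<longlonglongrightarrow> 0"
  proof (rule prob_tendsto_0)
    show "AE \<omega> in M. \<forall>\<^sub>F n in sequentially. \<omega> \<notin> {\<omega>\<in>space M. e < \<bar>Y n \<omega>\<bar>}"
      using assms(2)
    proof eventually_elim
      case (elim \<omega>)
      from tendstoD[OF this e] show ?case by eventually_elim auto
    qed
  qed measurable
qed fact

lemma vanishing_prob_bound:
  assumes [measurable]: "\<And>n. X n \<in> borel_measurable M" and Y: "vanishing_prob Y"
    and le: "\<And>n \<omega>. \<omega> \<in> space M \<Longrightarrow> \<bar>X n \<omega>\<bar> \<le> \<bar>Y n \<omega>\<bar>"
  shows "vanishing_prob X"
  unfolding vanishing_prob_def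
proof (intro conjI allI impI)
  fix e :: real assume e: "0 < e"
  note [measurable] = vanishing_probD(1)[OF Y]
  show "(\<lambda>n. prob {\<omega>\<in>space M. e < \<bar>X n \<omega>\<bar>}) \<longlonglongrightarrow> 0"
    by (rule prob_squeeze_0[OF _ vanishing_probD(2)[OF Y e]], intro finite_measure_mono)
       (use le in \<open>auto intro: less_le_trans\<close>)
qed fact

text \<open>Serves sums and products alike: if both arguments are small then so is the result, with
  threshold e / 2 for a sum and the square root of e for a product.\<close>

lemma vanishing_prob_combine:
  assumes [measurable]: "\<And>n. R n \<in> borel_measurable M"
    and X: "vanishing_prob X" and Y: "vanishing_prob Y"
    and le: "\<And>e. 0 < e \<Longrightarrow> \<exists>d>0. \<forall>n. \<forall>\<omega>\<in>space M. e < \<bar>R n \<omega>\<bar> \<longrightarrow> d < \<bar>X n \<omega>\<bar> \<or> d < \<bar>Y n \<omega>\<bar>"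
  shows "vanishing_prob R"
  unfolding vanishing_prob_def
proof (intro conjI allI impI)
  fix e :: real assume e: "0 < e"
  from le[OF this] obtain d where d: "0 < d"
    "\<And>n \<omega>. \<omega> \<in> space M \<Longrightarrow> e < \<bar>R n \<omega>\<bar> \<Longrightarrow> d < \<bar>X n \<omega>\<bar> \<or> d < \<bar>Y n \<omega>\<bar>" by blast
  note [measurable] = vanishing_probD(1)[OF X] vanishing_probD(1)[OF Y]
  have "(\<lambda>n. prob {\<omega>\<in>space M. d < \<bar>X n \<omega>\<bar>} + prob {\<omega>\<in>space M. d < \<bar>Y n \<omega>\<bar>}) \<longlonglongrightarrow> 0"
    using tendsto_add[OF vanishing_probD(2)[OF X d(1)] vanishing_probD(2)[OF Y d(1)]] by simp
  then show "(\<lambda>n. prob {\<omega>\<in>space M. e < \<bar>R n \<omega>\<bar>}) \<longlonglongrightarrow> 0"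
    by (rule prob_squeeze_0[rotated], intro prob_le_Un) (use d(2) in auto)
qed fact

lemma vanishing_prob_add:
  assumes "vanishing_prob X" "vanishing_prob Y"
  shows "vanishing_prob (\<lambda>n \<omega>. X n \<omega> + Y n \<omega>)"
proof (rule vanishing_prob_combine[OF _ assms])
  note [measurable] = vanishing_probD(1)[OF assms(1)] vanishing_probD(1)[OF assms(2)]
  show "(\<lambda>\<omega>. X n \<omega> + Y n \<omega>) \<in> borel_measurable M" for n by measurable
  fix e :: real assume "0 < e"
  then show "\<exists>d>0. \<forall>n. \<forall>\<omega>\<in>space M. e < \<bar>X n \<omega> + Y n \<omega>\<bar> \<longrightarrow> d < \<bar>X n \<omega>\<bar> \<or> d < \<bar>Y n \<omega>\<bar>"
  proof (intro exI[of _ "e / 2"] conjI allI ballI impI)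
    fix n \<omega> assume "e < \<bar>X n \<omega> + Y n \<omega>\<bar>"
    then show "e / 2 < \<bar>X n \<omega>\<bar> \<or> e / 2 < \<bar>Y n \<omega>\<bar>"
      using abs_triangle_ineq[of "X n \<omega>" "Y n \<omega>"] by linarith
  qed simp
qed

lemma vanishing_prob_minus:
  assumes "vanishing_prob X"
  shows "vanishing_prob (\<lambda>n \<omega>. - X n \<omega>)"
  using assms by (auto simp: vanishing_prob_def)

lemma vanishing_prob_diff:
  assumes "vanishing_prob X" "vanishing_prob Y"
  shows "vanishing_prob (\<lambda>n \<omega>. X n \<omega> - Y n \<omega>)"
  using vanishing_prob_add[OF assms(1) vanishing_prob_minus[OF assms(2)]] by simp

lemma vanishing_prob_mult:
  assumes "vanishing_prob X" "vanishing_prob Y"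
  shows "vanishing_prob (\<lambda>n \<omega>. X n \<omega> * Y n \<omega>)"
proof (rule vanishing_prob_combine[OF _ assms])
  note [measurable] = vanishing_probD(1)[OF assms(1)] vanishing_probD(1)[OF assms(2)]
  show "(\<lambda>\<omega>. X n \<omega> * Y n \<omega>) \<in> borel_measurable M" for n by measurable
  fix e :: real assume e: "0 < e"
  show "\<exists>d>0. \<forall>n. \<forall>\<omega>\<in>space M. e < \<bar>X n \<omega> * Y n \<omega>\<bar> \<longrightarrow> d < \<bar>X n \<omega>\<bar> \<or> d < \<bar>Y n \<omega>\<bar>"
  proof (intro exI[of _ "sqrt e"] conjI allI ballI impI)
    fix n \<omega> assume *: "e < \<bar>X n \<omega> * Y n \<omega>\<bar>"
    show "sqrt e < \<bar>X n \<omega>\<bar> \<or> sqrt e < \<bar>Y n \<omega>\<bar>"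
    proof (rule ccontr)
      assume "\<not> ?thesis"
      then have "\<bar>X n \<omega>\<bar> * \<bar>Y n \<omega>\<bar> \<le> sqrt e * sqrt e" using e by (intro mult_mono) auto
      with * e show False by (simp add: abs_mult)
    qed
  qed (use e in simp)
qed

lemma vanishing_prob_sum:
  assumes "finite A" "\<And>a. a \<in> A \<Longrightarrow> vanishing_prob (X a)"
  shows "vanishing_prob (\<lambda>n \<omega>. \<Sum>a\<in>A. X a n \<omega>)"
  using assms
proof (induction A)
  case empty
  then show ?case by (auto simp: vanishing_prob_def)
next
  case (insert a A)
  then show ?case using vanishing_prob_add[of "X a" "\<lambda>n \<omega>. \<Sum>a\<in>A. X a n \<omega>"] by simp
qed

lemma vanishing_prob_root:
  assumes "vanishing_prob (\<lambda>n \<omega>. (Y n \<omega>)\<^sup>2)" "\<And>n. Y n \<in> borel_measurable M"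
  shows "vanishing_prob Y"
  unfolding vanishing_prob_def
proof (intro conjI allI impI)
  fix e :: real assume e: "0 < e"
  have "{\<omega>\<in>space M. e < \<bar>Y n \<omega>\<bar>} = {\<omega>\<in>space M. e\<^sup>2 < \<bar>(Y n \<omega>)\<^sup>2\<bar>}" for n
    using e abs_le_square_iff[of "Y n _" e] by (auto simp: not_le[symmetric])
  then show "(\<lambda>n. prob {\<omega>\<in>space M. e < \<bar>Y n \<omega>\<bar>}) \<longlonglongrightarrow> 0"
    using vanishing_probD(2)[OF assms(1), of "e\<^sup>2"] e by simp
qed fact

lemma prob_tail_small:
  fixes W :: "'a \<Rightarrow> real"
  assumes [measurable]: "W \<in> borel_measurable M" and "0 < \<eta>"
  shows "\<exists>K>0. prob {\<omega>\<in>space M. K < \<bar>W \<omega>\<bar>} < \<eta>"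
proof -
  have "(\<lambda>n. prob {\<omega>\<in>space M. real n < \<bar>W \<omega>\<bar>}) \<longlonglongrightarrow> 0"
  proof (rule prob_tendsto_0)
    show "AE \<omega> in M. \<forall>\<^sub>F n in sequentially. \<omega> \<notin> {\<omega> \<in> space M. real n < \<bar>W \<omega>\<bar>}"
    proof (rule AE_I2)
      fix \<omega>
      obtain m where "\<bar>W \<omega>\<bar> \<le> real m" using real_arch_simple by blast
      then show "\<forall>\<^sub>F n in sequentially. \<omega> \<notin> {\<omega> \<in> space M. real n < \<bar>W \<omega>\<bar>}"
        by (intro eventually_sequentiallyI[of m]) auto
    qed
  qed measurable
  from order_tendstoD(2)[OF this assms(2)] eventually_gt_at_top[of "0::nat"]
  have "\<forall>\<^sub>F n in sequentially. prob {\<omega>\<in>space M. real n < \<bar>W \<omega>\<bar>} < \<eta> \<and> 0 < n"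
    by eventually_elim auto
  then obtain n where "prob {\<omega>\<in>space M. real n < \<bar>W \<omega>\<bar>} < \<eta>" "0 < n"
    by (auto simp: eventually_sequentially)
  then show ?thesis by (intro exI[of _ "real n"]) auto
qed

text \<open>The order of choices is what matters: K is fixed first so that b is eventually small,
  and only then n tends to infinity to make c small. In \<open>vanishing_prob_mult_tight\<close> K
  is a truncation level; in \<open>vanishing_prob_lenglart\<close> it is the variance budget
  \<delta>.\<close>

lemma tight_mult_tendsto:
  assumes tight: "\<And>\<eta>. 0 < \<eta> \<Longrightarrow> \<exists>K>0. \<forall>\<^sub>F n in sequentially. b n K < (\<eta>::real)"
    and le: "\<And>K n. 0 < K \<Longrightarrow> prob (A n) \<le> b n K + c n K"
    and c: "\<And>K. 0 < K \<Longrightarrow> (\<lambda>n. c n K) \<longlonglongrightarrow> 0"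
  shows "(\<lambda>n. prob (A n)) \<longlonglongrightarrow> 0"
proof (rule LIMSEQ_I)
  fix r :: real assume r: "0 < r"
  then obtain K where K: "0 < K" "\<forall>\<^sub>F n in sequentially. b n K < r / 2" using tight[of "r/2"] by auto
  have "\<forall>\<^sub>F n in sequentially. c n K < r / 2"
    using order_tendstoD(2)[OF c[OF K(1)], of "r / 2"] r by simp
  with K(2) have "\<forall>\<^sub>F n in sequentially. norm (prob (A n) - 0) < r"
  proof eventually_elim
    case (elim n)
    with le[OF K(1), of n] show ?case by simp
  qed
  then show "\<exists>no. \<forall>n\<ge>no. norm (prob (A n) - 0) < r" by (simp add: eventually_sequentially)
qed

lemma vanishing_prob_mult_tight:
  assumes Xm: "\<And>n. X n \<in> borel_measurable M"
    and X: "\<And>\<eta>. 0 < \<eta> \<Longrightarrow> \<exists>K>0. \<forall>\<^sub>F n in sequentially. prob {\<omega>\<in>space M. K < \<bar>X n \<omega>\<bar>} < \<eta>"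
    and Y: "vanishing_prob Y"
  shows "vanishing_prob (\<lambda>n \<omega>. X n \<omega> * Y n \<omega>)"
  unfolding vanishing_prob_def
proof (intro conjI allI impI)
  note [measurable] = Xm vanishing_probD(1)[OF Y]
  show "(\<lambda>\<omega>. X n \<omega> * Y n \<omega>) \<in> borel_measurable M" for n by measurable
  fix e :: real assume e: "0 < e"
  show "(\<lambda>n. prob {\<omega>\<in>space M. e < \<bar>X n \<omega> * Y n \<omega>\<bar>}) \<longlonglongrightarrow> 0"
  proof (rule tight_mult_tendsto[where c="\<lambda>n K. prob {\<omega>\<in>space M. e / K < \<bar>Y n \<omega>\<bar>}"])
    fix K :: real and n assume K: "0 < K"
    show "prob {\<omega>\<in>space M. e < \<bar>X n \<omega> * Y n \<omega>\<bar>} \<le>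
      prob {\<omega>\<in>space M. K < \<bar>X n \<omega>\<bar>} + prob {\<omega>\<in>space M. e / K < \<bar>Y n \<omega>\<bar>}"
    proof (rule prob_le_Un)
      show "{\<omega>\<in>space M. e < \<bar>X n \<omega> * Y n \<omega>\<bar>} \<subseteq> {\<omega>\<in>space M. K < \<bar>X n \<omega>\<bar>} \<union> {\<omega>\<in>space M. e / K < \<bar>Y n \<omega>\<bar>}"
      proof (rule subsetI, rule ccontr)
        fix \<omega> assume *: "\<omega> \<in> {\<omega>\<in>space M. e < \<bar>X n \<omega> * Y n \<omega>\<bar>}" "\<omega> \<notin> {\<omega>\<in>space M. K < \<bar>X n \<omega>\<bar>} \<union> {\<omega>\<in>space M. e / K < \<bar>Y n \<omega>\<bar>}"
        then have "\<bar>X n \<omega>\<bar> * \<bar>Y n \<omega>\<bar> \<le> K * (e / K)" using K by (intro mult_mono) auto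
        with * K show False by (simp add: abs_mult)
      qed
    qed measurable
  next
    fix K :: real assume "0 < K"
    then show "(\<lambda>n. prob {\<omega>\<in>space M. e / K < \<bar>Y n \<omega>\<bar>}) \<longlonglongrightarrow> 0"
      using vanishing_probD(2)[OF Y] e by simp
  qed (use X in auto)
qed

lemma vanishing_prob_mult_const:
  assumes W: "W \<in> borel_measurable M" and Y: "vanishing_prob Y"
  shows "vanishing_prob (\<lambda>n \<omega>. W \<omega> * Y n \<omega>)"
  using prob_tail_small[OF W] by (intro vanishing_prob_mult_tight[OF W _ Y]) auto

text \<open>Identifies limits: the difference between a limit in probability and an almost sure
  limit of one sequence is a constant sequence tending to 0 in probability.\<close>

lemma vanishing_prob_const:
  assumes "vanishing_prob (\<lambda>_. R)"
  shows "AE \<omega> in M. R \<omega> = 0"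
proof -
  have [measurable]: "R \<in> borel_measurable M" using vanishing_probD(1)[OF assms] .
  have "AE \<omega> in M. \<not> (inverse (real (Suc n)) < \<bar>R \<omega>\<bar>)" for n
  proof (rule prob_eq_0[THEN iffD1, THEN AE_mp[OF _ AE_I2]])
    show "{\<omega>\<in>space M. inverse (real (Suc n)) < \<bar>R \<omega>\<bar>} \<in> events" by measurable
    show "prob {\<omega>\<in>space M. inverse (real (Suc n)) < \<bar>R \<omega>\<bar>} = 0"
      using vanishing_probD(2)[OF assms, of "inverse (real (Suc n))"] LIMSEQ_unique[OF tendsto_const] by auto
  qed auto
  then have "AE \<omega> in M. \<forall>n. \<not> (inverse (real (Suc n)) < \<bar>R \<omega>\<bar>)" by (simp add: AE_all_countable)
  then show ?thesis
  proof eventually_elim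
    case (elim \<omega>)
    show ?case
    proof (rule ccontr)
      assume "R \<omega> \<noteq> 0"
      then obtain n where "inverse (real (Suc n)) < \<bar>R \<omega>\<bar>" using reals_Archimedean[of "\<bar>R \<omega>\<bar>"] by auto
      with elim show False by blast
    qed
  qed
qed

text \<open>Since the tail bound holds for every \<delta>, almost sure convergence of Q to 0 is
  enough: for fixed \<delta> the first term disappears as n grows, after which \<delta> is
  arbitrarily small. The factor C makes room for the constant of
  \<open>ito_block_lenglart\<close>.\<close>

lemma vanishing_prob_lenglart:
  fixes Q :: "nat \<Rightarrow> 'a \<Rightarrow> ennreal"
  assumes Ym: "\<And>n. Y n \<in> borel_measurable M" and Y0: "\<And>n \<omega>. 0 \<le> Y n \<omega>"
    and Qm [measurable]: "\<And>n. Q n \<in> borel_measurable M"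
    and le: "\<And>n \<delta> \<epsilon>. 0 < \<delta> \<Longrightarrow> 0 < \<epsilon> \<Longrightarrow> prob {\<omega>\<in>space M. \<epsilon> < Y n \<omega>} \<le>
        prob {\<omega>\<in>space M. ennreal \<delta> < Q n \<omega>} + C * \<delta> / \<epsilon>"
    and C: "0 < C"
    and Q: "AE \<omega> in M. \<forall>e>0. \<forall>\<^sub>F n in sequentially. Q n \<omega> \<le> ennreal e"
  shows "vanishing_prob Y"
  unfolding vanishing_prob_def
proof (intro conjI allI impI)
  fix e :: real assume e: "0 < e"
  have "(\<lambda>n. prob {\<omega>\<in>space M. e < Y n \<omega>}) \<longlonglongrightarrow> 0"
  proof (rule tight_mult_tendsto[where b="\<lambda>n \<delta>. C * \<delta> / e" and c="\<lambda>n \<delta>. prob {\<omega>\<in>space M. ennreal \<delta> < Q n \<omega>}"])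
    fix \<eta> :: real assume "0 < \<eta>"
    then show "\<exists>K>0. \<forall>\<^sub>F n in sequentially. C * K / e < \<eta>"
      using C e by (intro exI[of _ "\<eta> * e / (2 * C)"]) (auto simp: field_simps)
  next
    fix K :: real and n assume "0 < K"
    from le[OF this e, of n]
    show "prob {\<omega>\<in>space M. e < Y n \<omega>} \<le> C * K / e + prob {\<omega>\<in>space M. ennreal K < Q n \<omega>}" by simp
  next
    fix K :: real assume K: "0 < K"
    show "(\<lambda>n. prob {\<omega>\<in>space M. ennreal K < Q n \<omega>}) \<longlonglongrightarrow> 0"
    proof (rule prob_tendsto_0)
      show "AE \<omega> in M. \<forall>\<^sub>F n in sequentially. \<omega> \<notin> {\<omega> \<in> space M. ennreal K < Q n \<omega>}"
        using Q
      proof eventually_elim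
        case (elim \<omega>)
        then have "\<forall>\<^sub>F n in sequentially. Q n \<omega> \<le> ennreal K" using K by blast
        then show ?case by eventually_elim (auto simp: not_less)
      qed
    qed measurable
  qed
  then show "(\<lambda>n. prob {\<omega>\<in>space M. e < \<bar>Y n \<omega>\<bar>}) \<longlonglongrightarrow> 0" using Y0 by simp
qed fact

end

section \<open>Lenglart's inequality for Ito integrals\<close>

context brownian
begin

lemma ito_integral_measurable:
  assumes "has_ito_integral M F Z v I" "0 \<le> t"
  shows "I t \<in> borel_measurable (F t)"
  using assms by (auto simp: has_ito_integral_def continuous_adapted_def)

lemma square_sum_bound: "(x + y :: real)\<^sup>2 \<le> 2 * x\<^sup>2 + 2 * y\<^sup>2"
  using sum_squares_bound[of x y] by (simp add: power2_sum)

lemma norm_square_bound: "(norm (x - z))\<^sup>2 \<le> 2 * (norm (y - z))\<^sup>2 + 2 * (norm (y - x :: 'a::real_normed_vector))\<^sup>2"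
proof -
  have "norm (x - z) \<le> norm (y - z) + norm (y - x)"
    using norm_triangle_ineq4[of "y - z" "y - x"] by simp
  then have "(norm (x - z))\<^sup>2 \<le> (norm (y - z) + norm (y - x))\<^sup>2" by (intro power_mono) auto
  also note square_sum_bound
  finally show ?thesis .
qed

text \<open>The bound of \<open>simple_block_lenglart\<close> is taken along the approximating
  simple processes with the grid \<open>tt\<close> kept fixed. Only finitely many times enter the
  left side, so convergence in probability of the integrals at each of them suffices, while on the
  right the distance to the simple process is replaced by the distance to v.\<close>

lemma ito_block_lenglart:
  fixes tt :: "nat \<Rightarrow> real" and w :: "nat \<Rightarrow> 'w \<Rightarrow> real" and u :: "nat \<Rightarrow> 'w \<Rightarrow> real^'n" and lab :: "nat \<Rightarrow> nat"
  assumes I: "has_ito_integral M F Z v I"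
    and vm: "(\<lambda>(\<omega>, x). indicator {0..} x *\<^sub>R v x \<omega>) \<in> borel_measurable (M \<Otimes>\<^sub>M lborel)"
    and tt: "strict_mono tt" "0 \<le> tt 0"
    and w: "\<And>i. w i \<in> borel_measurable (F (tt i))"
    and u: "\<And>i. u i \<in> borel_measurable (F (tt i))"
    and L: "finite L" and \<delta>: "0 < \<delta>" and \<epsilon>: "0 < \<epsilon>"
  shows "prob {\<omega>\<in>space M. \<epsilon> < (\<Sum>l\<in>L. (\<Sum>i\<in>{i. i < N \<and> lab i = l}. w i \<omega> *
            (I (tt (Suc i)) \<omega> - I (tt i) \<omega> - u i \<omega> \<bullet> dZ (tt i) (tt (Suc i)) \<omega>))\<^sup>2)}
     \<le> prob {\<omega>\<in>space M. ennreal \<delta> < (\<Sum>i<N. ennreal ((w i \<omega>)\<^sup>2) *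
            (\<integral>\<^sup>+x\<in>{tt i<..tt (Suc i)}. ennreal ((norm (v x \<omega> - u i \<omega>))\<^sup>2) \<partial>lborel))}
       + 16 * \<delta> / \<epsilon>" (is "prob {\<omega>\<in>space M. \<epsilon> < ?Y \<omega>} \<le> prob {\<omega>\<in>space M. ennreal \<delta> < ?Q \<omega>} + _")
    and "(\<lambda>\<omega>. \<Sum>i<N. ennreal ((w i \<omega>)\<^sup>2) *
            (\<integral>\<^sup>+x\<in>{tt i<..tt (Suc i)}. ennreal ((norm (v x \<omega> - u i \<omega>))\<^sup>2) \<partial>lborel)) \<in> borel_measurable M"
proof -
  define T where "T = tt N"
  have tt_mono: "tt i \<le> tt j" if "i \<le> j" for i j
    using strict_mono_mono[OF tt(1)] that by (auto simp: mono_def)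
  have tt0: "0 \<le> tt i" for i using tt_mono[of 0 i] tt(2) by simp
  have ttT: "tt i \<le> T" if "i \<le> N" for i using tt_mono[OF that] by (simp add: T_def)
  \<comment> \<open>An Ito integrand is constrained at nonnegative times only; its cut-off is
    jointly measurable over the whole line and equals v at all times that occur, so that the time
    integrals are measurable in \<omega>.\<close>
  define V where "V \<omega> x = indicator {0..} x *\<^sub>R v x \<omega>" for \<omega> x
  have V: "V \<omega> x = v x \<omega>" if "0 \<le> x" for \<omega> x using that by (simp add: V_def)
  have Vm[measurable]: "(\<lambda>p. V (fst p) (snd p)) \<in> borel_measurable (M \<Otimes>\<^sub>M lborel)"
    using vm by (simp add: V_def case_prod_beta)
  have Vm2: "V \<omega> \<in> borel_measurable lborel" if "\<omega> \<in> space M" for \<omega>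
    using measurable_compose[OF measurable_Pair1' Vm] that by simp
  note wM[measurable] = F_imp_M[OF w] and uM[measurable] = F_imp_M[OF u]
  have Q_eq: "?Q = (\<lambda>\<omega>. \<Sum>i<N. ennreal ((w i \<omega>)\<^sup>2) *
      (\<integral>\<^sup>+x. ennreal ((norm (V \<omega> x - u i \<omega>))\<^sup>2) * indicator {tt i<..tt (Suc i)} x \<partial>lborel))"
  proof (intro ext sum.cong refl)
    fix \<omega> i
    have "(\<integral>\<^sup>+x\<in>{tt i<..tt (Suc i)}. ennreal ((norm (v x \<omega> - u i \<omega>))\<^sup>2) \<partial>lborel) =
      (\<integral>\<^sup>+x. ennreal ((norm (V \<omega> x - u i \<omega>))\<^sup>2) * indicator {tt i<..tt (Suc i)} x \<partial>lborel)"
    proof (rule nn_integral_cong)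
      fix x
      show "ennreal ((norm (v x \<omega> - u i \<omega>))\<^sup>2) * indicator {tt i<..tt (Suc i)} x =
         ennreal ((norm (V \<omega> x - u i \<omega>))\<^sup>2) * indicator {tt i<..tt (Suc i)} x"
        using tt0[of i] by (cases "x \<in> {tt i<..tt (Suc i)}") (auto simp: V)
    qed
    then show "ennreal ((w i \<omega>)\<^sup>2) * (\<integral>\<^sup>+x\<in>{tt i<..tt (Suc i)}. ennreal ((norm (v x \<omega> - u i \<omega>))\<^sup>2) \<partial>lborel) =
      ennreal ((w i \<omega>)\<^sup>2) * (\<integral>\<^sup>+x. ennreal ((norm (V \<omega> x - u i \<omega>))\<^sup>2) * indicator {tt i<..tt (Suc i)} x \<partial>lborel)"
      by simp
  qed
  show Qm: "?Q \<in> borel_measurable M"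
    unfolding Q_eq
  proof (intro borel_measurable_sum borel_measurable_times_ennreal)
    fix i
    have "(\<lambda>p. ennreal ((norm (V (fst p) (snd p) - u i (fst p)))\<^sup>2) * indicator {tt i<..tt (Suc i)} (snd p))
        \<in> borel_measurable (M \<Otimes>\<^sub>M lborel)" by measurable
    from lborel.borel_measurable_nn_integral_fst[OF this]
    show "(\<lambda>\<omega>. \<integral>\<^sup>+x. ennreal ((norm (V \<omega> x - u i \<omega>))\<^sup>2) * indicator {tt i<..tt (Suc i)} x \<partial>lborel) \<in> borel_measurable M"
      by simp
  qed measurable
  from I obtain k t \<eta> where sd: "\<And>m. simple_data M F (k m) (t m) (\<eta> m)"
    and conv: "\<And>T \<epsilon>. T \<ge> 0 \<Longrightarrow> \<epsilon> > 0 \<Longrightarrow> (\<lambda>m. prob {\<omega> \<in> space M.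
              (\<integral>\<^sup>+ s\<in>{0..T}. ennreal ((norm (v s \<omega> - simple_process (k m) (t m) (\<eta> m) s \<omega>))\<^sup>2) \<partial>lborel)
                > ennreal \<epsilon>}) \<longlonglongrightarrow> 0"
    and convI: "\<And>T \<epsilon>. T \<ge> 0 \<Longrightarrow> \<epsilon> > 0 \<Longrightarrow> (\<lambda>m. prob {\<omega> \<in> space M.
              \<bar>I T \<omega> - simple_integral Z (k m) (t m) (\<eta> m) T \<omega>\<bar> > \<epsilon>}) \<longlonglongrightarrow> 0"
    unfolding has_ito_integral_def by blast
  define S where "S m = simple_integral Z (k m) (t m) (\<eta> m)" for m
  define D where "D m s \<omega> = I s \<omega> - S m s \<omega>" for m s \<omega>
  have Im: "I s \<in> borel_measurable M" if "0 \<le> s" for s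
    using ito_integral_measurable[OF I that] by (rule F_imp_M)
  have Sm: "S m s \<in> borel_measurable M" if "0 \<le> s" for m s
    unfolding S_def using sd that by (rule simple_integral_measurable)
  have dZm: "dZ (tt i) (tt (Suc i)) \<in> borel_measurable M" for i
    by (intro dZ_measurable_M tt0)
  have D: "vanishing_prob (\<lambda>m. D m s)" if "0 \<le> s" for s
    unfolding vanishing_prob_def D_def using convI[OF that] Im[OF that] Sm[OF that] by (auto simp: S_def)
  \<comment> \<open>The effect of replacing the Ito integral by the m-th simple integral: a
    polynomial in finitely many sequences that vanish in probability and in weights independent of
    m.\<close>
  define Err where "Err m \<omega> = (\<Sum>l\<in>L. (\<Sum>i\<in>{i. i < N \<and> lab i = l}. w i \<omega> * (D m (tt (Suc i)) \<omega> - D m (tt i) \<omega>))\<^sup>2)" for m \<omega>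
  have Err: "vanishing_prob Err"
    unfolding Err_def[abs_def] power2_eq_square
    by (intro vanishing_prob_sum vanishing_prob_mult vanishing_prob_mult_const vanishing_prob_diff D tt0 wM L) auto
  define Ym where "Ym m \<omega> = (\<Sum>l\<in>L. (\<Sum>i\<in>{i. i < N \<and> lab i = l}. w i \<omega> *
            (S m (tt (Suc i)) \<omega> - S m (tt i) \<omega> - u i \<omega> \<bullet> dZ (tt i) (tt (Suc i)) \<omega>))\<^sup>2)" for m \<omega>
  have YmM: "Ym m \<in> borel_measurable M" for m
    unfolding Ym_def
    by (intro borel_measurable_sum borel_measurable_power borel_measurable_times borel_measurable_diff
        borel_measurable_inner Sm tt0 wM uM dZm)
  have Y_le: "?Y \<omega> \<le> 2 * Ym m \<omega> + 2 * Err m \<omega>" for m \<omega>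
    unfolding Ym_def Err_def sum_distrib_left sum.distrib[symmetric]
  proof (intro sum_mono order_trans[OF eq_refl square_sum_bound] arg_cong[where f="\<lambda>x. x\<^sup>2"])
    fix l
    show "(\<Sum>i\<in>{i. i < N \<and> lab i = l}. w i \<omega> * (I (tt (Suc i)) \<omega> - I (tt i) \<omega> - u i \<omega> \<bullet> dZ (tt i) (tt (Suc i)) \<omega>)) =
      (\<Sum>i\<in>{i. i < N \<and> lab i = l}. w i \<omega> * (S m (tt (Suc i)) \<omega> - S m (tt i) \<omega> - u i \<omega> \<bullet> dZ (tt i) (tt (Suc i)) \<omega>)) +
      (\<Sum>i\<in>{i. i < N \<and> lab i = l}. w i \<omega> * (D m (tt (Suc i)) \<omega> - D m (tt i) \<omega>))"
      unfolding sum.distrib[symmetric] distrib_left[symmetric] D_def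
      by (intro sum.cong refl arg_cong2[where f="(*)"]) simp
  qed
  define E where "E m \<omega> = (\<integral>\<^sup>+ s\<in>{0..T}. ennreal ((norm (v s \<omega> - simple_process (k m) (t m) (\<eta> m) s \<omega>))\<^sup>2) \<partial>lborel)" for m \<omega>
  have Em: "E m \<in> borel_measurable M" for m
  proof -
    have E_eq: "E m = (\<lambda>\<omega>. \<integral>\<^sup>+s. ennreal ((norm (V \<omega> s - simple_process (k m) (t m) (\<eta> m) s \<omega>))\<^sup>2) * indicator {0..T} s \<partial>lborel)"
      unfolding E_def by (intro ext nn_integral_cong) (auto simp: indicator_def V)
    note [measurable] = simple_process_measurable[OF sd[of m], simplified case_prod_beta]
    have "(\<lambda>p. ennreal ((norm (V (fst p) (snd p) - simple_process (k m) (t m) (\<eta> m) (snd p) (fst p)))\<^sup>2) * indicator {0..T} (snd p))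
        \<in> borel_measurable (M \<Otimes>\<^sub>M lborel)" by measurable
    from lborel.borel_measurable_nn_integral_fst[OF this] show ?thesis unfolding E_eq by simp
  qed
  \<comment> \<open>On every block the approximation error in L2 is bounded by the error
    \<open>E m\<close> on all of [0, T], so the weights enter only through their sum of
    squares.\<close>
  define W where "W \<omega> = (\<Sum>i<N. (w i \<omega>)\<^sup>2)" for \<omega>
  have Wm[measurable]: "W \<in> borel_measurable M" unfolding W_def by measurable
  have W0: "0 \<le> W \<omega>" for \<omega> unfolding W_def by (intro sum_nonneg) auto
  define Qm where "Qm m \<omega> = (\<Sum>i<N. ennreal ((w i \<omega>)\<^sup>2) *
            (\<integral>\<^sup>+x\<in>{tt i<..tt (Suc i)}. ennreal ((norm (simple_process (k m) (t m) (\<eta> m) x \<omega> - u i \<omega>))\<^sup>2) \<partial>lborel))" for m \<omega>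
  have Q_le: "Qm m \<omega> \<le> 2 * ?Q \<omega> + 2 * (ennreal (W \<omega>) * E m \<omega>)" if \<omega>: "\<omega> \<in> space M" for m \<omega>
  proof -
    have [measurable]: "(\<lambda>x. simple_process (k m) (t m) (\<eta> m) x \<omega>) \<in> borel_measurable lborel"
      unfolding simple_process_def by measurable
    note [measurable] = Vm2[OF \<omega>]
    let ?sp = "\<lambda>x. simple_process (k m) (t m) (\<eta> m) x \<omega>"
    have "(\<integral>\<^sup>+x. ennreal ((norm (?sp x - u i \<omega>))\<^sup>2) * indicator {tt i<..tt (Suc i)} x \<partial>lborel)
        \<le> 2 * (\<integral>\<^sup>+x. ennreal ((norm (V \<omega> x - u i \<omega>))\<^sup>2) * indicator {tt i<..tt (Suc i)} x \<partial>lborel) + 2 * E m \<omega>"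
      if i: "i < N" for i
    proof -
      have "(\<integral>\<^sup>+x. ennreal ((norm (?sp x - u i \<omega>))\<^sup>2) * indicator {tt i<..tt (Suc i)} x \<partial>lborel) \<le>
        (\<integral>\<^sup>+x. 2 * (ennreal ((norm (V \<omega> x - u i \<omega>))\<^sup>2) * indicator {tt i<..tt (Suc i)} x) +
          2 * (ennreal ((norm (V \<omega> x - ?sp x))\<^sup>2) * indicator {0..T} x) \<partial>lborel)"
      proof (rule nn_integral_mono)
        fix x
        show "ennreal ((norm (?sp x - u i \<omega>))\<^sup>2) * indicator {tt i<..tt (Suc i)} x \<le>
           2 * (ennreal ((norm (V \<omega> x - u i \<omega>))\<^sup>2) * indicator {tt i<..tt (Suc i)} x) +
          2 * (ennreal ((norm (V \<omega> x - ?sp x))\<^sup>2) * indicator {0..T} x)"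
        proof (cases "x \<in> {tt i<..tt (Suc i)}")
          case True
          then have "x \<in> {0..T}" using tt0[of i] ttT[of "Suc i"] i by auto
          have "ennreal ((norm (?sp x - u i \<omega>))\<^sup>2) \<le> ennreal (2 * (norm (V \<omega> x - u i \<omega>))\<^sup>2 + 2 * (norm (V \<omega> x - ?sp x))\<^sup>2)"
            by (intro ennreal_leI norm_square_bound)
          also have "\<dots> = 2 * ennreal ((norm (V \<omega> x - u i \<omega>))\<^sup>2) + 2 * ennreal ((norm (V \<omega> x - ?sp x))\<^sup>2)"
            by (simp add: ennreal_plus ennreal_mult')
          finally show ?thesis using True \<open>x \<in> {0..T}\<close> by simp
        qed simp
      qed
      also have "\<dots> = 2 * (\<integral>\<^sup>+x. ennreal ((norm (V \<omega> x - u i \<omega>))\<^sup>2) * indicator {tt i<..tt (Suc i)} x \<partial>lborel) +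
          2 * (\<integral>\<^sup>+x. ennreal ((norm (V \<omega> x - ?sp x))\<^sup>2) * indicator {0..T} x \<partial>lborel)"
        by (subst nn_integral_add; (subst nn_integral_cmult)?; measurable?) (simp add: nn_integral_cmult)
      also have "(\<integral>\<^sup>+x. ennreal ((norm (V \<omega> x - ?sp x))\<^sup>2) * indicator {0..T} x \<partial>lborel) = E m \<omega>"
        unfolding E_def by (intro nn_integral_cong) (auto simp: indicator_def V)
      finally show ?thesis .
    qed
    then have "Qm m \<omega> \<le> (\<Sum>i<N. ennreal ((w i \<omega>)\<^sup>2) *
       (2 * (\<integral>\<^sup>+x. ennreal ((norm (V \<omega> x - u i \<omega>))\<^sup>2) * indicator {tt i<..tt (Suc i)} x \<partial>lborel) + 2 * E m \<omega>))"
      unfolding Qm_def by (intro sum_mono mult_left_mono) auto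
    also have "\<dots> = 2 * ?Q \<omega> + 2 * ((\<Sum>i<N. ennreal ((w i \<omega>)\<^sup>2)) * E m \<omega>)"
    proof -
      have alg: "(\<Sum>i<N. c i * (2 * J i + 2 * e)) = 2 * (\<Sum>i<N. c i * J i) + 2 * ((\<Sum>i<N. c i) * e)"
        for c J :: "nat \<Rightarrow> ennreal" and e
        by (simp add: distrib_left sum.distrib sum_distrib_left sum_distrib_right mult.left_commute)
      show ?thesis unfolding fun_cong[OF Q_eq, of \<omega>] by (rule alg)
    qed
    also have "(\<Sum>i<N. ennreal ((w i \<omega>)\<^sup>2)) = ennreal (W \<omega>)"
      unfolding W_def by (intro sum_ennreal) auto
    finally show ?thesis .
  qed
  \<comment> \<open>The random factor W may be unbounded, but it does not depend on m and so is
    below some level K with probability close to one; \<open>E m\<close> tends to 0 in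
    probability.\<close>
  have WE: "(\<lambda>m. prob {\<omega>\<in>space M. ennreal \<delta> < ennreal (W \<omega>) * E m \<omega>}) \<longlonglongrightarrow> 0"
  proof (rule tight_mult_tendsto[where b="\<lambda>n K. prob {\<omega>\<in>space M. K < \<bar>W \<omega>\<bar>}" and c="\<lambda>m K. prob {\<omega>\<in>space M. ennreal (\<delta> / K) < E m \<omega>}"])
    fix K :: real and m assume K: "0 < K"
    note [measurable] = Em[of m]
    show "prob {\<omega>\<in>space M. ennreal \<delta> < ennreal (W \<omega>) * E m \<omega>} \<le>
       prob {\<omega>\<in>space M. K < \<bar>W \<omega>\<bar>} + prob {\<omega>\<in>space M. ennreal (\<delta> / K) < E m \<omega>}"
    proof (rule prob_le_Un)
      show "{\<omega>\<in>space M. ennreal \<delta> < ennreal (W \<omega>) * E m \<omega>} \<subseteq>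
        {\<omega>\<in>space M. K < \<bar>W \<omega>\<bar>} \<union> {\<omega>\<in>space M. ennreal (\<delta> / K) < E m \<omega>}"
      proof (rule subsetI, rule ccontr)
        fix \<omega> assume *: "\<omega> \<in> {\<omega>\<in>space M. ennreal \<delta> < ennreal (W \<omega>) * E m \<omega>}"
          "\<omega> \<notin> {\<omega>\<in>space M. K < \<bar>W \<omega>\<bar>} \<union> {\<omega>\<in>space M. ennreal (\<delta> / K) < E m \<omega>}"
        then have "ennreal (W \<omega>) * E m \<omega> \<le> ennreal K * ennreal (\<delta> / K)"
          using W0[of \<omega>] by (intro mult_mono ennreal_leI) (auto simp: not_less)
        also have "\<dots> = ennreal \<delta>" using K \<delta> by (subst ennreal_mult[symmetric]) auto
        finally show False using * by (simp add: not_less[symmetric])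
      qed
    qed measurable
  next
    fix K :: real assume K: "0 < K"
    show "(\<lambda>m. prob {\<omega>\<in>space M. ennreal (\<delta> / K) < E m \<omega>}) \<longlonglongrightarrow> 0"
      unfolding E_def using conv[of T "\<delta> / K"] K \<delta> tt0[of N] by (simp add: T_def)
  qed (use prob_tail_small[OF Wm] in auto)
  \<comment> \<open>The constant 16 arises from two applications of (x + y)^2 \<le> 2 x^2 + 2 y^2:
    on the left the threshold drops from \<epsilon> to \<epsilon> / 4, on the right the budget rises
    from \<delta> to 4 \<delta>, and 4 \<delta> / (\<epsilon> / 4) = 16 \<delta> /
    \<epsilon>.\<close>
  have step: "prob {\<omega>\<in>space M. \<epsilon> < ?Y \<omega>} \<le> (prob {\<omega>\<in>space M. ennreal \<delta> < ?Q \<omega>} + 16 * \<delta> / \<epsilon>) +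
      (prob {\<omega>\<in>space M. ennreal \<delta> < ennreal (W \<omega>) * E m \<omega>} + prob {\<omega>\<in>space M. \<epsilon> / 4 < \<bar>Err m \<omega>\<bar>})" for m
  proof -
    note [measurable] = Em[of m] YmM[of m] vanishing_probD(1)[OF Err, of m]
    note Qmeas = Qm
    have 1: "prob {\<omega>\<in>space M. \<epsilon> < ?Y \<omega>} \<le> prob {\<omega>\<in>space M. \<epsilon> / 4 < Ym m \<omega>} + prob {\<omega>\<in>space M. \<epsilon> / 4 < \<bar>Err m \<omega>\<bar>}"
    proof (rule prob_le_Un)
      show "{\<omega>\<in>space M. \<epsilon> < ?Y \<omega>} \<subseteq> {\<omega>\<in>space M. \<epsilon> / 4 < Ym m \<omega>} \<union> {\<omega>\<in>space M. \<epsilon> / 4 < \<bar>Err m \<omega>\<bar>}"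
      proof (rule subsetI, rule ccontr)
        fix \<omega> assume "\<omega> \<in> {\<omega>\<in>space M. \<epsilon> < ?Y \<omega>}" and
          "\<omega> \<notin> {\<omega>\<in>space M. \<epsilon> / 4 < Ym m \<omega>} \<union> {\<omega>\<in>space M. \<epsilon> / 4 < \<bar>Err m \<omega>\<bar>}"
        then have "\<epsilon> < ?Y \<omega>" "Ym m \<omega> \<le> \<epsilon> / 4" "Err m \<omega> \<le> \<epsilon> / 4" by auto
        with Y_le[of \<omega> m] show False by linarith
      qed
    qed measurable
    have 2: "prob {\<omega>\<in>space M. \<epsilon> / 4 < Ym m \<omega>} \<le> prob {\<omega>\<in>space M. ennreal (4 * \<delta>) < Qm m \<omega>} + (4 * \<delta>) / (\<epsilon> / 4)"
      unfolding Ym_def Qm_def S_def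
      using \<delta> \<epsilon> by (intro simple_block_lenglart[OF sd tt w u L]) auto
    have 3: "prob {\<omega>\<in>space M. ennreal (4 * \<delta>) < Qm m \<omega>} \<le>
      prob {\<omega>\<in>space M. ennreal \<delta> < ?Q \<omega>} + prob {\<omega>\<in>space M. ennreal \<delta> < ennreal (W \<omega>) * E m \<omega>}"
    proof (rule prob_le_Un)
      show "{\<omega>\<in>space M. ennreal (4 * \<delta>) < Qm m \<omega>} \<subseteq>
        {\<omega>\<in>space M. ennreal \<delta> < ?Q \<omega>} \<union> {\<omega>\<in>space M. ennreal \<delta> < ennreal (W \<omega>) * E m \<omega>}"
      proof (rule subsetI, rule ccontr)
        fix \<omega> assume *: "\<omega> \<in> {\<omega>\<in>space M. ennreal (4 * \<delta>) < Qm m \<omega>}" and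
          "\<omega> \<notin> {\<omega>\<in>space M. ennreal \<delta> < ?Q \<omega>} \<union> {\<omega>\<in>space M. ennreal \<delta> < ennreal (W \<omega>) * E m \<omega>}"
        then have **: "\<omega> \<in> space M" "?Q \<omega> \<le> ennreal \<delta>" "ennreal (W \<omega>) * E m \<omega> \<le> ennreal \<delta>"
          by (simp_all add: not_less)
        have "Qm m \<omega> \<le> 2 * ennreal \<delta> + 2 * ennreal \<delta>"
          using ** by (intro order_trans[OF Q_le[OF **(1)]] add_mono mult_left_mono) auto
        also have "\<dots> = ennreal (4 * \<delta>)"
        proof -
          have "2 * ennreal \<delta> = ennreal (2 * \<delta>)" using \<delta> by (simp add: ennreal_mult')
          then show ?thesis using \<delta> by (simp add: ennreal_plus[symmetric] del: ennreal_plus)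
        qed
        finally show False using * by (simp add: not_less[symmetric])
      qed
      show "{\<omega>\<in>space M. ennreal \<delta> < ?Q \<omega>} \<in> events"
        by (rule borel_measurable_less[OF borel_measurable_const Qmeas])
      show "{\<omega>\<in>space M. ennreal \<delta> < ennreal (W \<omega>) * E m \<omega>} \<in> events" by measurable
    qed
    have "(4 * \<delta>) / (\<epsilon> / 4) = 16 * \<delta> / \<epsilon>" using \<epsilon> by simp
    moreover have "a \<le> b + c \<Longrightarrow> b \<le> d + f \<Longrightarrow> d \<le> g + h \<Longrightarrow> f = k \<Longrightarrow> a \<le> (g + k) + (h + c)"
      for a b c d f g h k :: real by linarith
    ultimately show ?thesis using 1 2 3 by blast
  qed
  have "(\<lambda>m. (prob {\<omega>\<in>space M. ennreal \<delta> < ?Q \<omega>} + 16 * \<delta> / \<epsilon>) +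
      (prob {\<omega>\<in>space M. ennreal \<delta> < ennreal (W \<omega>) * E m \<omega>} + prob {\<omega>\<in>space M. \<epsilon> / 4 < \<bar>Err m \<omega>\<bar>}))
     \<longlonglongrightarrow> (prob {\<omega>\<in>space M. ennreal \<delta> < ?Q \<omega>} + 16 * \<delta> / \<epsilon>) + (0 + 0)"
    using \<epsilon> by (intro tendsto_add tendsto_const WE vanishing_probD(2)[OF Err]) auto
  from LIMSEQ_le_const[OF this, of "prob {\<omega>\<in>space M. \<epsilon> < ?Y \<omega>}"] step
  show "prob {\<omega>\<in>space M. \<epsilon> < ?Y \<omega>} \<le> prob {\<omega>\<in>space M. ennreal \<delta> < ?Q \<omega>} + 16 * \<delta> / \<epsilon>"
    by simp
qed

end

section \<open>The exponential formula for linear Ito equations\<close>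

text \<open>Time is rounded down to multiples of 1 / (n + 1). The rounded function takes its time
  argument from a countable set and is measurable; continuity in time makes these functions converge
  to f.\<close>

lemma caratheodory_measurable:
  fixes f :: "real \<Rightarrow> 'a \<Rightarrow> real"
  assumes f: "\<And>t. f t \<in> borel_measurable N" and cont: "\<And>\<omega>. \<omega> \<in> space N \<Longrightarrow> continuous_on UNIV (\<lambda>t. f t \<omega>)"
  shows "(\<lambda>p. f (snd p) (fst p)) \<in> borel_measurable (N \<Otimes>\<^sub>M borel)"
proof (rule borel_measurable_LIMSEQ_real)
  fix n
  show "(\<lambda>p. f (real_of_int \<lfloor>real (Suc n) * snd p\<rfloor> / real (Suc n)) (fst p)) \<in> borel_measurable (N \<Otimes>\<^sub>M borel)"
  proof (rule measurable_compose_countable[where f="\<lambda>i p. f (real_of_int i / real (Suc n)) (fst p)" and g="\<lambda>p. \<lfloor>real (Suc n) * snd p\<rfloor>"])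
    show "(\<lambda>p. f (real_of_int i / real (Suc n)) (fst p)) \<in> borel_measurable (N \<Otimes>\<^sub>M borel)" for i
      by (rule measurable_compose[OF measurable_fst f])
  qed measurable
next
  fix p assume p: "p \<in> space (N \<Otimes>\<^sub>M (borel::real measure))"
  let ?t = "snd p" and ?r = "\<lambda>n. real_of_int \<lfloor>real (Suc n) * snd p\<rfloor> / real (Suc n)"
  have "?r \<longlonglongrightarrow> ?t"
  proof -
    have *: "norm (?r n - ?t) \<le> 1 / real (Suc n)" for n
    proof -
      have "?r n - ?t = (real_of_int \<lfloor>real (Suc n) * ?t\<rfloor> - real (Suc n) * ?t) / real (Suc n)"
        by (simp add: field_simps)
      also have "norm \<dots> \<le> 1 / real (Suc n)"
        unfolding real_norm_def abs_divide by (intro divide_mono) (auto simp: abs_if, linarith+)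
      finally show ?thesis .
    qed
    show ?thesis
    proof (rule LIM_zero_cancel, rule tendsto_norm_zero_cancel)
      show "(\<lambda>n. norm (?r n - ?t)) \<longlonglongrightarrow> 0"
        by (rule tendsto_sandwich[OF _ _ tendsto_const LIMSEQ_Suc[OF lim_1_over_n]]) (use * in auto)
    qed
  qed
  moreover have "isCont (\<lambda>t. f t (fst p)) ?t"
    using cont[of "fst p"] p by (auto simp: space_pair_measure continuous_on_eq_continuous_at)
  ultimately show "(\<lambda>n. f (?r n) (fst p)) \<longlonglongrightarrow> f ?t (fst p)"
    by (rule isCont_tendsto_compose[rotated])
qed

lemma continuous_on_clamped:
  fixes f :: "real \<Rightarrow> 'b::topological_space"
  assumes "continuous_on {0..} f"
  shows "continuous_on UNIV (\<lambda>t. f (max 0 t))"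
  by (rule continuous_on_compose2[OF assms]) (auto intro!: continuous_intros)

text \<open>The grid number n has \<open>Suc n\<close> intervals, so its mesh is defined for every n
  and its last point has the index \<open>Suc n\<close>.\<close>

definition grid :: "real \<Rightarrow> nat \<Rightarrow> nat \<Rightarrow> real" where
  "grid T n i = real i * (T / real (Suc n))"

lemma grid_simps: "grid T n 0 = 0" "grid T n (Suc n) = T" "grid T n (Suc i) - grid T n i = T / real (Suc n)"
proof -
  show "grid T n 0 = 0" by (simp add: grid_def)
  show "grid T n (Suc n) = T" unfolding grid_def by simp
  show "grid T n (Suc i) - grid T n i = T / real (Suc n)"
    unfolding grid_def of_nat_Suc[of i] distrib_right by simp
qed

lemma grid_strict_mono: "0 < T \<Longrightarrow> strict_mono (grid T n)"
  by (auto simp: strict_mono_def grid_def intro!: divide_strict_right_mono)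

lemma grid_less: "0 < T \<Longrightarrow> grid T n i < grid T n (Suc i)"
  using strict_monoD[OF grid_strict_mono, of T i "Suc i" n] by simp

lemma grid_nonneg: "0 \<le> T \<Longrightarrow> 0 \<le> grid T n i"
  by (simp add: grid_def)

lemma grid_le: "0 \<le> T \<Longrightarrow> i \<le> Suc n \<Longrightarrow> grid T n i \<le> T"
  using mult_right_mono[of "real i" "real (Suc n)" "T / real (Suc n)"] by (simp add: grid_def)

lemma grid_in: "0 \<le> T \<Longrightarrow> i \<le> Suc n \<Longrightarrow> grid T n i \<in> {0..T}"
  using grid_nonneg grid_le by auto

lemma grid_oscillation:
  fixes f :: "real \<Rightarrow> 'a::real_normed_vector"
  assumes T: "0 < T" and f: "continuous_on {0..T} f" and e: "0 < e"
  shows "\<forall>\<^sub>F n in sequentially. \<forall>i<Suc n. \<forall>x\<in>{grid T n i..grid T n (Suc i)}. \<forall>y\<in>{grid T n i..grid T n (Suc i)}. norm (f x - f y) < e"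
proof -
  have "uniformly_continuous_on {0..T} f" using f by (rule compact_uniformly_continuous) simp
  then obtain d where d: "0 < d" "\<And>x y. x \<in> {0..T} \<Longrightarrow> y \<in> {0..T} \<Longrightarrow> dist y x < d \<Longrightarrow> dist (f y) (f x) < e"
    using e unfolding uniformly_continuous_on_def by blast
  have "(\<lambda>n. T * (1 / real (Suc n))) \<longlonglongrightarrow> T * 0"
    by (intro tendsto_intros LIMSEQ_Suc[OF lim_1_over_n])
  then have "\<forall>\<^sub>F n in sequentially. T / real (Suc n) < d"
    using order_tendstoD(2)[of "\<lambda>n. T * (1 / real (Suc n))" 0] d(1) by simp
  then show ?thesis
  proof eventually_elim
    case (elim n)
    show ?case
    proof (intro allI impI ballI)
      fix i x y assume i: "i < Suc n" and xy: "x \<in> {grid T n i..grid T n (Suc i)}" "y \<in> {grid T n i..grid T n (Suc i)}"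
      have "0 \<le> grid T n i" "grid T n (Suc i) \<le> T"
        using grid_nonneg[of T n i] grid_le[of T "Suc i" n] T i by auto
      moreover have "dist x y \<le> grid T n (Suc i) - grid T n i" using xy by (auto simp: dist_real_def)
      ultimately show "norm (f x - f y) < e"
        using d(2)[of y x] xy elim grid_simps(3)[of T n i] by (auto simp: dist_norm)
    qed
  qed
qed

lemma sum_grid_const: "(\<Sum>i<Suc n. c * (T / real (Suc n))) = c * T"
  by simp

lemma weighted_oscillation_tendsto:
  fixes f :: "real \<Rightarrow> 'a::real_normed_vector"
  assumes T: "0 < T" and f: "continuous_on {0..T} f" and e: "0 < e"
    and w: "\<And>n i. i < Suc n \<Longrightarrow> \<bar>w n i\<bar> \<le> (K::real)"
  shows "\<forall>\<^sub>F n in sequentially. (\<Sum>i<Suc n. ennreal ((w n i)\<^sup>2) *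
     (\<integral>\<^sup>+x\<in>{grid T n i<..grid T n (Suc i)}. ennreal ((norm (f x - f (grid T n i)))\<^sup>2) \<partial>lborel)) \<le> ennreal e"
proof -
  \<comment> \<open>An oscillation below d makes the whole sum at most K^2 d^2 T, which this choice
    keeps below e; the 1 in the denominator covers K = 0.\<close>
  define d where "d = sqrt (e / ((K\<^sup>2 + 1) * T))"
  have K1: "0 < K\<^sup>2 + 1" by (simp add: add_nonneg_pos)
  have d0: "0 < d" unfolding d_def using e T K1 by simp
  have d2: "K\<^sup>2 * d\<^sup>2 * T \<le> e"
  proof -
    have "d\<^sup>2 = e / ((K\<^sup>2 + 1) * T)" unfolding d_def using e T K1 by (intro real_sqrt_pow2) simp
    then have "K\<^sup>2 * d\<^sup>2 * T = K\<^sup>2 * (e / ((K\<^sup>2 + 1) * T)) * T" by simp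
    also have "\<dots> = e * (K\<^sup>2 / (K\<^sup>2 + 1))" using T by simp
    also have "\<dots> \<le> e * 1" using e K1 by (intro mult_left_mono) (auto simp: divide_le_eq)
    finally show ?thesis by simp
  qed
  show ?thesis
    using grid_oscillation[OF T f d0]
  proof eventually_elim
    case (elim n)
    have "(\<Sum>i<Suc n. ennreal ((w n i)\<^sup>2) *
     (\<integral>\<^sup>+x\<in>{grid T n i<..grid T n (Suc i)}. ennreal ((norm (f x - f (grid T n i)))\<^sup>2) \<partial>lborel))
      \<le> (\<Sum>i<Suc n. ennreal (K\<^sup>2 * d\<^sup>2 * (T / real (Suc n))))"
    proof (rule sum_mono)
      fix i assume "i \<in> {..<Suc n}"
      then have i: "i < Suc n" by simp
      have less: "grid T n i < grid T n (Suc i)" using T by (rule grid_less)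
      have "(\<integral>\<^sup>+x\<in>{grid T n i<..grid T n (Suc i)}. ennreal ((norm (f x - f (grid T n i)))\<^sup>2) \<partial>lborel)
         \<le> (\<integral>\<^sup>+x. ennreal (d\<^sup>2) * indicator {grid T n i<..grid T n (Suc i)} x \<partial>lborel)"
      proof (rule nn_integral_mono)
        fix x
        show "ennreal ((norm (f x - f (grid T n i)))\<^sup>2) * indicator {grid T n i<..grid T n (Suc i)} x \<le>
            ennreal (d\<^sup>2) * indicator {grid T n i<..grid T n (Suc i)} x"
        proof (cases "x \<in> {grid T n i<..grid T n (Suc i)}")
          case True
          then have "norm (f x - f (grid T n i)) \<le> d"
            using elim i less by (intro less_imp_le) auto
          then have "(norm (f x - f (grid T n i)))\<^sup>2 \<le> d\<^sup>2" by (intro power_mono) auto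
          with True show ?thesis by (simp add: ennreal_leI)
        qed simp
      qed
      also have "\<dots> = ennreal (d\<^sup>2) * ennreal (T / real (Suc n))"
        using less grid_simps(3)[of T n i] by (simp add: nn_integral_cmult)
      finally have *: "(\<integral>\<^sup>+x\<in>{grid T n i<..grid T n (Suc i)}. ennreal ((norm (f x - f (grid T n i)))\<^sup>2) \<partial>lborel)
         \<le> ennreal (d\<^sup>2) * ennreal (T / real (Suc n))" .
      have "\<bar>w n i\<bar>\<^sup>2 \<le> K\<^sup>2" using w[OF i] by (intro power_mono) auto
      then have "ennreal ((w n i)\<^sup>2) \<le> ennreal (K\<^sup>2)" by (intro ennreal_leI) simp
      from mult_mono[OF this *]
      have **: "ennreal ((w n i)\<^sup>2) *
        (\<integral>\<^sup>+x\<in>{grid T n i<..grid T n (Suc i)}. ennreal ((norm (f x - f (grid T n i)))\<^sup>2) \<partial>lborel)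
         \<le> ennreal (K\<^sup>2) * (ennreal (d\<^sup>2) * ennreal (T / real (Suc n)))" by simp
      show "ennreal ((w n i)\<^sup>2) *
        (\<integral>\<^sup>+x\<in>{grid T n i<..grid T n (Suc i)}. ennreal ((norm (f x - f (grid T n i)))\<^sup>2) \<partial>lborel)
         \<le> ennreal (K\<^sup>2 * d\<^sup>2 * (T / real (Suc n)))"
      proof -
        have "ennreal (K\<^sup>2) * (ennreal (d\<^sup>2) * ennreal (T / real (Suc n))) = ennreal (K\<^sup>2 * d\<^sup>2 * (T / real (Suc n)))"
          using T by (subst ennreal_mult, simp, simp, subst ennreal_mult, simp_all add: mult.assoc)
        with ** show ?thesis by metis
      qed
    qed
    also have "\<dots> = ennreal (\<Sum>i<Suc n. K\<^sup>2 * d\<^sup>2 * (T / real (Suc n)))"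
      using T by (intro sum_ennreal) auto
    also have "\<dots> = ennreal (K\<^sup>2 * d\<^sup>2 * T)" unfolding sum_grid_const ..
    also have "\<dots> \<le> ennreal e" using d2 by (rule ennreal_leI)
    finally show ?case .
  qed
qed

lemma exp_minus_one_le: "exp y - 1 \<le> y * exp (y::real)"
proof -
  have "1 - exp (- y) \<le> y" using exp_ge_add_one_self[of "- y"] by simp
  then have "(1 - exp (- y)) * exp y \<le> y * exp y" by (intro mult_right_mono) auto
  then show ?thesis by (simp add: left_diff_distrib exp_minus)
qed

lemma exp_remainder_le: "0 \<le> y \<Longrightarrow> exp y - 1 - y \<le> y\<^sup>2 * exp (y::real)"
proof -
  assume y: "0 \<le> y"
  have "exp y - 1 - y \<le> y * (exp y - 1)" using exp_minus_one_le[of y] by (simp add: algebra_simps)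
  also have "\<dots> \<le> y * (y * exp y)" using y exp_minus_one_le[of y] by (intro mult_left_mono)
  finally show ?thesis by (simp add: power2_eq_square)
qed

section \<open>Second moments of exponential increments\<close>

context brownian
begin

context
  fixes s t :: real
  assumes st: "0 \<le> s" "s < t"
begin

lemma dZ_inner_moments:
  shows "integrable M (\<lambda>\<omega>. a \<bullet> dZ s t \<omega>)" "expectation (\<lambda>\<omega>. a \<bullet> dZ s t \<omega>) = 0"
    "integrable M (\<lambda>\<omega>. (a \<bullet> dZ s t \<omega>)\<^sup>2)" "expectation (\<lambda>\<omega>. (a \<bullet> dZ s t \<omega>)\<^sup>2) = (norm a)\<^sup>2 * (t - s)"
proof -
  note m = dZ_component_mean[OF st] and c = dZ_covariance[OF st]
  have 1: "a \<bullet> dZ s t \<omega> = (\<Sum>j\<in>UNIV. a $ j * dZ s t \<omega> $ j)" for \<omega> by (simp add: inner_vec_def)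
  show "integrable M (\<lambda>\<omega>. a \<bullet> dZ s t \<omega>)" "expectation (\<lambda>\<omega>. a \<bullet> dZ s t \<omega>) = 0"
    unfolding 1 using m by auto
  have 2: "(a \<bullet> dZ s t \<omega>)\<^sup>2 = (\<Sum>j\<in>UNIV. \<Sum>k\<in>UNIV. (a $ j * a $ k) * (dZ s t \<omega> $ j * dZ s t \<omega> $ k))" for \<omega>
    unfolding 1 power2_eq_square sum_product by (simp only: mult_ac)
  show "integrable M (\<lambda>\<omega>. (a \<bullet> dZ s t \<omega>)\<^sup>2)" unfolding 2 using c by auto
  have "expectation (\<lambda>\<omega>. (a \<bullet> dZ s t \<omega>)\<^sup>2) = (\<Sum>j\<in>UNIV. \<Sum>k\<in>UNIV. (a $ j * a $ k) * (if j = k then t - s else 0))"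
    unfolding 2 using c by simp
  also have "\<dots> = (\<Sum>j\<in>UNIV. (a $ j)\<^sup>2 * (t - s))"
    by (simp add: if_distrib[of "\<lambda>x. _ * x"] power2_eq_square cong: if_cong)
  finally show "expectation (\<lambda>\<omega>. (a \<bullet> dZ s t \<omega>)\<^sup>2) = (norm a)\<^sup>2 * (t - s)"
    unfolding norm_sq_sum sum_distrib_right .
qed

text \<open>One step of the stochastic exponential minus its first order expansion is centered, and
  its second moment is exactly exp q - 1 - q, hence of second order in the length of the step. Over
  a grid of mesh h such terms add up to a variance of order h.\<close>

lemma compensated_exp_moments:
  fixes a :: "real^'n"
  defines "q \<equiv> (norm a)\<^sup>2 * (t - s)"
  shows "integrable M (\<lambda>\<omega>. (exp (a \<bullet> dZ s t \<omega> - q / 2) - 1 - a \<bullet> dZ s t \<omega>)\<^sup>2)"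
    "expectation (\<lambda>\<omega>. (exp (a \<bullet> dZ s t \<omega> - q / 2) - 1 - a \<bullet> dZ s t \<omega>)\<^sup>2) \<le> q\<^sup>2 * exp q"
    "expectation (\<lambda>\<omega>. exp (a \<bullet> dZ s t \<omega> - q / 2) - 1 - a \<bullet> dZ s t \<omega>) = 0"
proof -
  note m = dZ_inner_moments[of a] and e = dZ_exp[OF st, of a] and x = dZ_inner_exp[OF st, of a]
  have e2: "integrable M (\<lambda>\<omega>. exp (2 * (a \<bullet> dZ s t \<omega>)))" "expectation (\<lambda>\<omega>. exp (2 * (a \<bullet> dZ s t \<omega>))) = exp (2 * q)"
    using dZ_exp[OF st, of "2 *\<^sub>R a"] by (simp_all add: q_def power_mult_distrib)
  have eq: "(exp (a \<bullet> dZ s t \<omega> - q / 2) - 1 - a \<bullet> dZ s t \<omega>)\<^sup>2 =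
     exp (- q) * exp (2 * (a \<bullet> dZ s t \<omega>)) + 1 + (a \<bullet> dZ s t \<omega>)\<^sup>2 - 2 * exp (- (q / 2)) * exp (a \<bullet> dZ s t \<omega>)
      - 2 * exp (- (q / 2)) * ((a \<bullet> dZ s t \<omega>) * exp (a \<bullet> dZ s t \<omega>)) + 2 * (a \<bullet> dZ s t \<omega>)" for \<omega>
  proof -
    have 1: "exp (- q) * exp (2 * y) = (exp (- (q / 2)) * exp y)\<^sup>2" for y :: real
      by (simp add: power2_eq_square mult_exp_exp)
    have 2: "exp (y - q / 2) = exp (- (q / 2)) * exp y" for y
      by (simp add: mult_exp_exp)
    show ?thesis unfolding 1 2 by (simp add: power2_eq_square algebra_simps)
  qed
  show "integrable M (\<lambda>\<omega>. (exp (a \<bullet> dZ s t \<omega> - q / 2) - 1 - a \<bullet> dZ s t \<omega>)\<^sup>2)"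
    unfolding eq using m(1,3) e(1) x(1) e2(1) by (intro Bochner_Integration.integrable_add Bochner_Integration.integrable_diff integrable_mult_right) auto
  have "expectation (\<lambda>\<omega>. (exp (a \<bullet> dZ s t \<omega> - q / 2) - 1 - a \<bullet> dZ s t \<omega>)\<^sup>2) =
     exp (- q) * exp (2 * q) + 1 + q - 2 * exp (- (q / 2)) * exp (q / 2)
      - 2 * exp (- (q / 2)) * (q * exp (q / 2)) + 2 * 0"
    unfolding eq using m e x e2 by (simp add: q_def prob_space)
  also have "\<dots> = exp q - 1 - q"
  proof -
    have A: "exp (- (q / 2)) * exp (q / 2) = 1" by (simp add: mult_exp_exp)
    have B: "2 * exp (- (q / 2)) * exp (q / 2) = 2" by (simp only: mult.assoc A mult_1_right)
    have "2 * exp (- (q / 2)) * (q * exp (q / 2)) = 2 * q * (exp (- (q / 2)) * exp (q / 2))"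
      by (simp only: mult_ac)
    also have "\<dots> = 2 * q" by (simp only: A mult_1_right)
    finally have C: "2 * exp (- (q / 2)) * (q * exp (q / 2)) = 2 * q" .
    have D: "exp (- q) * exp (2 * q) = exp q" by (simp add: mult_exp_exp)
    show ?thesis unfolding B C D by simp
  qed
  also have "\<dots> \<le> q\<^sup>2 * exp q" using st by (intro exp_remainder_le) (simp add: q_def)
  finally show "expectation (\<lambda>\<omega>. (exp (a \<bullet> dZ s t \<omega> - q / 2) - 1 - a \<bullet> dZ s t \<omega>)\<^sup>2) \<le> q\<^sup>2 * exp q" .
  have 2: "exp (a \<bullet> dZ s t \<omega> - q / 2) = exp (- (q / 2)) * exp (a \<bullet> dZ s t \<omega>)" for \<omega>
    by (simp add: mult_exp_exp)
  have "expectation (\<lambda>\<omega>. exp (a \<bullet> dZ s t \<omega> - q / 2) - 1 - a \<bullet> dZ s t \<omega>) = exp (- (q / 2)) * exp (q / 2) - 1 - 0"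
    unfolding 2 using m e by (simp add: q_def prob_space)
  then show "expectation (\<lambda>\<omega>. exp (a \<bullet> dZ s t \<omega> - q / 2) - 1 - a \<bullet> dZ s t \<omega>) = 0"
    by (simp add: mult_exp_exp)
qed

text \<open>For the reciprocal factor only first order in the length of the step can be expected, so
  over a grid these second moments stay bounded without tending to 0.\<close>

lemma inverse_exp_moments:
  fixes a :: "real^'n"
  defines "q \<equiv> (norm a)\<^sup>2 * (t - s)"
  shows "integrable M (\<lambda>\<omega>. (exp (- (a \<bullet> dZ s t \<omega>) + q / 2) - 1)\<^sup>2)"
    "expectation (\<lambda>\<omega>. (exp (- (a \<bullet> dZ s t \<omega>) + q / 2) - 1)\<^sup>2) \<le> 3 * q * exp (3 * q)"
proof -
  have e: "integrable M (\<lambda>\<omega>. exp (- (a \<bullet> dZ s t \<omega>)))" "expectation (\<lambda>\<omega>. exp (- (a \<bullet> dZ s t \<omega>))) = exp (q / 2)"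
    using dZ_exp[OF st, of "- a"] by (simp_all add: q_def)
  have e2: "integrable M (\<lambda>\<omega>. exp (- (2 * (a \<bullet> dZ s t \<omega>))))" "expectation (\<lambda>\<omega>. exp (- (2 * (a \<bullet> dZ s t \<omega>)))) = exp (2 * q)"
    using dZ_exp[OF st, of "- (2 *\<^sub>R a)"] by (simp_all add: q_def power_mult_distrib)
  have eq: "(exp (- (a \<bullet> dZ s t \<omega>) + q / 2) - 1)\<^sup>2 =
     exp q * exp (- (2 * (a \<bullet> dZ s t \<omega>))) - 2 * exp (q / 2) * exp (- (a \<bullet> dZ s t \<omega>)) + 1" for \<omega>
  proof -
    have 1: "exp q * exp (- (2 * y)) = (exp (q / 2) * exp (- y))\<^sup>2" for y :: real
      by (simp add: power2_eq_square mult_exp_exp)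
    have 2: "exp (- y + q / 2) = exp (q / 2) * exp (- y)" for y
      by (simp add: mult_exp_exp)
    show ?thesis unfolding 1 2 by (simp add: power2_eq_square algebra_simps)
  qed
  show "integrable M (\<lambda>\<omega>. (exp (- (a \<bullet> dZ s t \<omega>) + q / 2) - 1)\<^sup>2)"
    unfolding eq using e(1) e2(1) by (intro Bochner_Integration.integrable_add Bochner_Integration.integrable_diff integrable_mult_right) auto
  have "expectation (\<lambda>\<omega>. (exp (- (a \<bullet> dZ s t \<omega>) + q / 2) - 1)\<^sup>2) =
     exp q * exp (2 * q) - 2 * exp (q / 2) * exp (q / 2) + 1"
    unfolding eq using e e2 by (simp add: prob_space)
  also have "\<dots> = exp (3 * q) - 2 * exp q + 1" by (simp add: mult_exp_exp)
  also have "\<dots> \<le> exp (3 * q) - 1"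
  proof -
    have "1 \<le> exp q" using st by (simp add: q_def)
    then show ?thesis by simp
  qed
  also have "\<dots> \<le> 3 * q * exp (3 * q)" by (rule exp_minus_one_le)
  finally show "expectation (\<lambda>\<omega>. (exp (- (a \<bullet> dZ s t \<omega>) + q / 2) - 1)\<^sup>2) \<le> 3 * q * exp (3 * q)" .
qed

end

end

context prob_space
begin

text \<open>Because the pathwise bound is uniform in n, the events that some member exceeds k
  decrease to a null set; one level then serves all n at once.\<close>

lemma bounded_sequence_tight:
  fixes Y :: "nat \<Rightarrow> 'a \<Rightarrow> real"
  assumes [measurable]: "\<And>n. Y n \<in> borel_measurable M"
    and bdd: "AE \<omega> in M. \<exists>K. \<forall>n. \<bar>Y n \<omega>\<bar> \<le> K" and \<eta>: "0 < \<eta>"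
  shows "\<exists>K>0. \<forall>n. prob {\<omega>\<in>space M. K < \<bar>Y n \<omega>\<bar>} < \<eta>"
proof -
  have "(\<lambda>k. prob {\<omega>\<in>space M. \<exists>n. real k < \<bar>Y n \<omega>\<bar>}) \<longlonglongrightarrow> 0"
  proof (rule prob_tendsto_0)
    show "AE \<omega> in M. \<forall>\<^sub>F k in sequentially. \<omega> \<notin> {\<omega> \<in> space M. \<exists>n. real k < \<bar>Y n \<omega>\<bar>}"
      using bdd
    proof eventually_elim
      case (elim \<omega>)
      then obtain K where K: "\<And>n. \<bar>Y n \<omega>\<bar> \<le> K" by blast
      obtain m where "K \<le> real m" using real_arch_simple by blast
      then show ?case using K by (intro eventually_sequentiallyI[of m]) (auto simp: not_less intro: order_trans[OF K] order_trans[of K "real m"])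
    qed
  qed measurable
  from order_tendstoD(2)[OF this \<eta>] eventually_gt_at_top[of "0::nat"]
  have "\<forall>\<^sub>F k in sequentially. prob {\<omega>\<in>space M. \<exists>n. real k < \<bar>Y n \<omega>\<bar>} < \<eta> \<and> 0 < k"
    by eventually_elim auto
  then obtain k where k: "prob {\<omega>\<in>space M. \<exists>n. real k < \<bar>Y n \<omega>\<bar>} < \<eta>" "0 < k"
    by (auto simp: eventually_sequentially)
  have "prob {\<omega>\<in>space M. real k < \<bar>Y n \<omega>\<bar>} \<le> prob {\<omega>\<in>space M. \<exists>n. real k < \<bar>Y n \<omega>\<bar>}" for n
    by (intro finite_measure_mono) auto
  with k show ?thesis by (intro exI[of _ "real k"]) (auto intro: le_less_trans)
qed

end

lemma continuous_on_bounded_real: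
  fixes f :: "real \<Rightarrow> real"
  assumes "continuous_on {a..b} f"
  obtains K where "0 < K" "\<And>x. x \<in> {a..b} \<Longrightarrow> \<bar>f x\<bar> \<le> K"
proof -
  have "compact (f ` {a..b})" using assms by (intro compact_continuous_image) auto
  then obtain K where "0 < K" "\<forall>y\<in>f ` {a..b}. norm y \<le> K"
    using compact_imp_bounded bounded_pos by metis
  then show thesis by (intro that[of K]) auto
qed

section \<open>Remainder terms along a grid\<close>

context brownian
begin

text \<open>The reciprocal of the exponential martingale exp (a . Z t - |a|^2 t / 2), which solves
  dX = X a . dZ. Multiplication by it removes the noise of a linear equation.\<close>

definition expZ :: "real^'n \<Rightarrow> real \<Rightarrow> 'w \<Rightarrow> real" where
  "expZ a t \<omega> = exp (- (a \<bullet> Z t \<omega>) + (norm a)\<^sup>2 * t / 2)"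

lemma expZ_measurable: "0 \<le> t \<Longrightarrow> expZ a t \<in> borel_measurable (F t)"
  unfolding expZ_def[abs_def] using Z_measurable[of t t] by (intro borel_measurable_exp measurable_compose[OF _ borel_measurable_exp] borel_measurable_add borel_measurable_uminus borel_measurable_inner borel_measurable_const) auto

lemma Z_continuous: "AE \<omega> in M. continuous_on {0..} (\<lambda>t. Z t \<omega>)"
  using bm by (auto simp: standard_brownian_motion_def)

lemma expZ_continuous: "AE \<omega> in M. continuous_on {0..} (\<lambda>t. expZ a t \<omega>)"
  using Z_continuous
proof eventually_elim
  case (elim \<omega>)
  then show ?case unfolding expZ_def by (intro continuous_intros) auto
qed

lemma continuous_adapted_measurable:
  fixes X :: "real \<Rightarrow> 'w \<Rightarrow> real"
  assumes "continuous_adapted M F X"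
  shows "(\<lambda>p. X (max 0 (snd p)) (fst p)) \<in> borel_measurable (M \<Otimes>\<^sub>M borel)"
proof (rule caratheodory_measurable[where f="\<lambda>t. X (max 0 t)"])
  show "X (max 0 t) \<in> borel_measurable M" for t
    using assms by (intro F_imp_M[of _ "max 0 t"]) (auto simp: continuous_adapted_def)
  show "continuous_on UNIV (\<lambda>t. X (max 0 t) \<omega>)" if "\<omega> \<in> space M" for \<omega>
    using assms that by (intro continuous_on_clamped) (auto simp: continuous_adapted_def)
qed

text \<open>By \<open>compensated_exp_moments\<close> the n + 1 conditional variances are of order
  h^2 with h = T / (n + 1), and the weights are pathwise bounded on [0, T]. The lemma is used with a
  single class, for the square of a sum, and with singleton classes, for a sum of squares.\<close>

lemma scalar_noise_vanishes:
  fixes a :: "real^'n" and W :: "real \<Rightarrow> 'w \<Rightarrow> real" and lab :: "nat \<Rightarrow> nat"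
  assumes T: "0 < T" and L: "\<And>n. finite (L n)"
    and Wm: "\<And>t. 0 \<le> t \<Longrightarrow> W t \<in> borel_measurable (F t)"
    and Wc: "AE \<omega> in M. continuous_on {0..} (\<lambda>t. W t \<omega>)"
  shows "vanishing_prob (\<lambda>n \<omega>. \<Sum>l\<in>L n. (\<Sum>i\<in>{i. i < Suc n \<and> lab i = l}. W (grid T n i) \<omega> *
     (exp (a \<bullet> dZ (grid T n i) (grid T n (Suc i)) \<omega> - (norm a)\<^sup>2 * (T / real (Suc n)) / 2) - 1
       - a \<bullet> dZ (grid T n i) (grid T n (Suc i)) \<omega>))\<^sup>2)"
proof -
  \<comment> \<open>Chosen so that q^2 exp q \<le> C h^2 for q = |a|^2 h and h \<le> T; the added 1
    keeps the variance bound positive for a = 0, as \<open>lenglart_scalar\<close> demands.\<close>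
  define C where "C = (norm a)^4 * exp ((norm a)\<^sup>2 * T) + 1"
  define h where "h n = T / real (Suc n)" for n
  define v where "v n = C * (h n)\<^sup>2" for n
  define G where "G n x = exp (a \<bullet> x - (norm a)\<^sup>2 * h n / 2) - 1 - a \<bullet> x" for n and x :: "real^'n"
  have C1: "1 \<le> C" unfolding C_def by simp
  have h0: "0 < h n" for n using T by (simp add: h_def)
  have hT: "h n \<le> T" for n using T by (simp add: h_def divide_le_eq)
  have v0: "0 < v n" for n using C1 h0[of n] by (simp add: v_def)
  have gm: "G n \<in> borel_measurable borel" for n
    unfolding G_def by measurable
  have g: "0 \<le> grid T n i" "grid T n i < grid T n (Suc i)" "grid T n (Suc i) - grid T n i = h n" for n i
    using T by (auto simp: grid_nonneg grid_less h_def grid_simps)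
  have mom: "integrable M (\<lambda>\<omega>. (G n (dZ (grid T n i) (grid T n (Suc i)) \<omega>))\<^sup>2)"
     "expectation (\<lambda>\<omega>. (G n (dZ (grid T n i) (grid T n (Suc i)) \<omega>))\<^sup>2) \<le> v n"
     "expectation (\<lambda>\<omega>. G n (dZ (grid T n i) (grid T n (Suc i)) \<omega>)) = 0" for n i
  proof -
    note m = compensated_exp_moments[OF g(1)[of n i] g(2)[of n i], of a, unfolded g(3)]
    show "integrable M (\<lambda>\<omega>. (G n (dZ (grid T n i) (grid T n (Suc i)) \<omega>))\<^sup>2)"
      "expectation (\<lambda>\<omega>. G n (dZ (grid T n i) (grid T n (Suc i)) \<omega>)) = 0"
      unfolding G_def using m(1,3) by auto
    have "((norm a)\<^sup>2 * h n)\<^sup>2 * exp ((norm a)\<^sup>2 * h n) \<le> ((norm a)\<^sup>2 * h n)\<^sup>2 * exp ((norm a)\<^sup>2 * T)"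
      using hT[of n] by (intro mult_left_mono) (auto intro: mult_left_mono)
    also have "\<dots> \<le> v n"
      unfolding v_def C_def by (simp add: power_mult_distrib power_mult[symmetric] algebra_simps)
    finally show "expectation (\<lambda>\<omega>. (G n (dZ (grid T n i) (grid T n (Suc i)) \<omega>))\<^sup>2) \<le> v n"
      unfolding G_def using m(2) by linarith
  qed
  note WM = F_imp_M[OF Wm]
  have Gm: "(\<lambda>\<omega>. G n (dZ (grid T n i) (grid T n (Suc i)) \<omega>)) \<in> borel_measurable M" for n i
    using dZ_measurable_M[OF g(1) g(1)] gm by (rule measurable_compose)
  have "vanishing_prob (\<lambda>n \<omega>. \<Sum>l\<in>L n. (\<Sum>i\<in>{i\<in>{..<Suc n}. lab i = l}. W (grid T n i) \<omega> *
     G n (dZ (grid T n i) (grid T n (Suc i)) \<omega>))\<^sup>2)"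
  proof (rule vanishing_prob_lenglart[where Q="\<lambda>n \<omega>. ennreal (\<Sum>i<Suc n. (W (grid T n i) \<omega>)\<^sup>2 * v n)" and C=1])
    fix n
    show "(\<lambda>\<omega>. \<Sum>l\<in>L n. (\<Sum>i\<in>{i\<in>{..<Suc n}. lab i = l}. W (grid T n i) \<omega> *
       G n (dZ (grid T n i) (grid T n (Suc i)) \<omega>))\<^sup>2) \<in> borel_measurable M"
      using WM[OF g(1)] Gm by (intro borel_measurable_sum borel_measurable_power borel_measurable_times) auto
    show "(\<lambda>\<omega>. ennreal (\<Sum>i<Suc n. (W (grid T n i) \<omega>)\<^sup>2 * v n)) \<in> borel_measurable M"
      using WM[OF g(1)] by (intro measurable_compose[OF _ measurable_ennreal] borel_measurable_sum borel_measurable_power borel_measurable_times) auto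
    fix \<delta> \<epsilon> :: real assume de: "0 < \<delta>" "0 < \<epsilon>"
    have "prob {\<omega>\<in>space M. (\<Sum>l\<in>L n. (\<Sum>i\<in>{i\<in>{..<Suc n}. lab i = l}. W (grid T n i) \<omega> *
       G n (dZ (grid T n i) (grid T n (Suc i)) \<omega>))\<^sup>2) > \<epsilon>} \<le>
         prob {\<omega>\<in>space M. (\<Sum>i<Suc n. (W (grid T n i) \<omega>)\<^sup>2 * v n) > \<delta>} + \<delta> / \<epsilon>"
    proof (rule lenglart_scalar)
      fix i j :: nat assume "i \<noteq> j"
      then have "Suc i \<le> j \<or> Suc j \<le> i" by auto
      then show "grid T n (Suc i) \<le> grid T n j \<or> grid T n (Suc j) \<le> grid T n i"
        using strict_mono_mono[OF grid_strict_mono[OF T], of n] by (auto simp: mono_def)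
    qed (use L g mom gm Wm v0 de in auto)
    then show "prob {\<omega>\<in>space M. \<epsilon> < (\<Sum>l\<in>L n. (\<Sum>i\<in>{i\<in>{..<Suc n}. lab i = l}. W (grid T n i) \<omega> *
       G n (dZ (grid T n i) (grid T n (Suc i)) \<omega>))\<^sup>2)} \<le>
         prob {\<omega>\<in>space M. ennreal \<delta> < ennreal (\<Sum>i<Suc n. (W (grid T n i) \<omega>)\<^sup>2 * v n)} + 1 * \<delta> / \<epsilon>"
      using de by (simp add: ennreal_less_iff del: sum.lessThan_Suc)
  next
    show "AE \<omega> in M. \<forall>e>0. \<forall>\<^sub>F n in sequentially. ennreal (\<Sum>i<Suc n. (W (grid T n i) \<omega>)\<^sup>2 * v n) \<le> ennreal e"
      using Wc
    proof eventually_elim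
      case (elim \<omega>)
      then have "continuous_on {0..T} (\<lambda>t. W t \<omega>)" by (rule continuous_on_subset) auto
      then obtain K where K: "0 < K" "\<And>x. x \<in> {0..T} \<Longrightarrow> \<bar>W x \<omega>\<bar> \<le> K"
        using continuous_on_bounded_real by blast
      show ?case
      proof (intro allI impI)
        fix e :: real assume e: "0 < e"
        have "(\<lambda>n. K\<^sup>2 * C * T\<^sup>2 * (1 / real (Suc n))) \<longlonglongrightarrow> K\<^sup>2 * C * T\<^sup>2 * 0"
          by (intro tendsto_intros LIMSEQ_Suc[OF lim_1_over_n])
        then have "\<forall>\<^sub>F n in sequentially. K\<^sup>2 * C * T\<^sup>2 * (1 / real (Suc n)) < e"
          using order_tendstoD(2)[of _ 0] e by simp
        then show "\<forall>\<^sub>F n in sequentially. ennreal (\<Sum>i<Suc n. (W (grid T n i) \<omega>)\<^sup>2 * v n) \<le> ennreal e"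
        proof eventually_elim
          case (elim n)
          have "(\<Sum>i<Suc n. (W (grid T n i) \<omega>)\<^sup>2 * v n) \<le> (\<Sum>i<Suc n. K\<^sup>2 * v n)"
          proof (intro sum_mono mult_right_mono)
            fix i assume "i \<in> {..<Suc n}"
            then have "\<bar>W (grid T n i) \<omega>\<bar> \<le> K" using T by (intro K grid_in) auto
            then have "\<bar>W (grid T n i) \<omega>\<bar>\<^sup>2 \<le> K\<^sup>2" by (intro power_mono) auto
            then show "(W (grid T n i) \<omega>)\<^sup>2 \<le> K\<^sup>2" by simp
          qed (use v0[of n] in simp)
          also have "\<dots> = K\<^sup>2 * C * T\<^sup>2 * (1 / real (Suc n))"
          proof -
            have "real (Suc n) * (h n)\<^sup>2 = T\<^sup>2 * (1 / real (Suc n))"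
              by (simp add: h_def power2_eq_square del: of_nat_Suc)
            moreover have "(\<Sum>i<Suc n. K\<^sup>2 * v n) = K\<^sup>2 * C * (real (Suc n) * (h n)\<^sup>2)"
              by (simp only: sum_constant card_lessThan v_def) (simp only: mult_ac)
            ultimately show ?thesis by simp
          qed
          finally show ?case using elim by (intro ennreal_leI) simp
        qed
      qed
    qed
  qed (auto intro!: sum_nonneg)
  then show ?thesis by (simp add: G_def h_def)
qed

text \<open>Here the conditional variances are of order h, so their sum is pathwise bounded and only
  tightness results. The increments are not centered; this is harmless because each of them forms
  its own class.\<close>

lemma inverse_noise_tight:
  fixes a :: "real^'n" and W :: "real \<Rightarrow> 'w \<Rightarrow> real"
  assumes T: "0 < T" and \<eta>: "0 < \<eta>"
    and Wm: "\<And>t. 0 \<le> t \<Longrightarrow> W t \<in> borel_measurable (F t)"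
    and Wc: "AE \<omega> in M. continuous_on {0..} (\<lambda>t. W t \<omega>)"
  shows "\<exists>K>0. \<forall>n. prob {\<omega>\<in>space M. K < (\<Sum>i<Suc n. (W (grid T n i) \<omega> *
     (exp (- (a \<bullet> dZ (grid T n i) (grid T n (Suc i)) \<omega>) + (norm a)\<^sup>2 * (T / real (Suc n)) / 2) - 1))\<^sup>2)} < \<eta>"
proof -
  define C where "C = 3 * (norm a)\<^sup>2 * exp (3 * (norm a)\<^sup>2 * T) + 1"
  define h where "h n = T / real (Suc n)" for n
  define v where "v n = C * h n" for n
  define G where "G n x = exp (- (a \<bullet> x) + (norm a)\<^sup>2 * h n / 2) - 1" for n and x :: "real^'n"
  have C1: "1 \<le> C" unfolding C_def by simp
  have h0: "0 < h n" for n using T by (simp add: h_def)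
  have hT: "h n \<le> T" for n using T by (simp add: h_def divide_le_eq)
  have v0: "0 < v n" for n using C1 h0[of n] by (simp add: v_def)
  have gm: "G n \<in> borel_measurable borel" for n
    unfolding G_def by measurable
  have g: "0 \<le> grid T n i" "grid T n i < grid T n (Suc i)" "grid T n (Suc i) - grid T n i = h n" for n i
    using T by (auto simp: grid_nonneg grid_less h_def grid_simps)
  have mom: "integrable M (\<lambda>\<omega>. (G n (dZ (grid T n i) (grid T n (Suc i)) \<omega>))\<^sup>2)"
     "expectation (\<lambda>\<omega>. (G n (dZ (grid T n i) (grid T n (Suc i)) \<omega>))\<^sup>2) \<le> v n" for n i
  proof -
    note m = inverse_exp_moments[OF g(1)[of n i] g(2)[of n i], of a, unfolded g(3)]
    show "integrable M (\<lambda>\<omega>. (G n (dZ (grid T n i) (grid T n (Suc i)) \<omega>))\<^sup>2)"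
      unfolding G_def using m(1) by auto
    have "3 * ((norm a)\<^sup>2 * h n) * exp (3 * ((norm a)\<^sup>2 * h n)) \<le> 3 * ((norm a)\<^sup>2 * h n) * exp (3 * ((norm a)\<^sup>2 * T))"
      using hT[of n] h0[of n] by (intro mult_left_mono) (auto intro: mult_left_mono)
    also have "\<dots> \<le> v n"
      unfolding v_def C_def using h0[of n] by (simp add: algebra_simps)
    finally show "expectation (\<lambda>\<omega>. (G n (dZ (grid T n i) (grid T n (Suc i)) \<omega>))\<^sup>2) \<le> v n"
      unfolding G_def using m(2) by linarith
  qed
  note WM = F_imp_M[OF Wm]
  have "\<exists>K>0. \<forall>n. prob {\<omega>\<in>space M. K < \<bar>\<Sum>i<Suc n. (W (grid T n i) \<omega>)\<^sup>2 * v n\<bar>} < \<eta> / 2"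
  proof (rule bounded_sequence_tight)
    show "(\<lambda>\<omega>. \<Sum>i<Suc n. (W (grid T n i) \<omega>)\<^sup>2 * v n) \<in> borel_measurable M" for n
      using WM[OF g(1)] by (intro borel_measurable_sum borel_measurable_power borel_measurable_times) auto
    show "AE \<omega> in M. \<exists>K. \<forall>n. \<bar>\<Sum>i<Suc n. (W (grid T n i) \<omega>)\<^sup>2 * v n\<bar> \<le> K"
      using Wc
    proof eventually_elim
      case (elim \<omega>)
      then have "continuous_on {0..T} (\<lambda>t. W t \<omega>)" by (rule continuous_on_subset) auto
      then obtain K where K: "0 < K" "\<And>x. x \<in> {0..T} \<Longrightarrow> \<bar>W x \<omega>\<bar> \<le> K"
        using continuous_on_bounded_real by blast
      have "\<bar>\<Sum>i<Suc n. (W (grid T n i) \<omega>)\<^sup>2 * v n\<bar> \<le> K\<^sup>2 * C * T" for n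
      proof -
        have "\<bar>\<Sum>i<Suc n. (W (grid T n i) \<omega>)\<^sup>2 * v n\<bar> = (\<Sum>i<Suc n. (W (grid T n i) \<omega>)\<^sup>2 * v n)"
          using v0[of n] by (intro abs_of_nonneg sum_nonneg) auto
        also have "\<dots> \<le> (\<Sum>i<Suc n. K\<^sup>2 * v n)"
        proof (intro sum_mono mult_right_mono)
          fix i assume "i \<in> {..<Suc n}"
          then have "\<bar>W (grid T n i) \<omega>\<bar> \<le> K" using T by (intro K grid_in) auto
          then have "\<bar>W (grid T n i) \<omega>\<bar>\<^sup>2 \<le> K\<^sup>2" by (intro power_mono) auto
          then show "(W (grid T n i) \<omega>)\<^sup>2 \<le> K\<^sup>2" by simp
        qed (use v0[of n] in simp)
        also have "\<dots> = K\<^sup>2 * C * T" by (simp add: v_def h_def del: of_nat_Suc)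
        finally show ?thesis .
      qed
      then show ?case by blast
    qed
  qed (use \<eta> in simp)
  then obtain K where K: "0 < K" "\<And>n. prob {\<omega>\<in>space M. K < \<bar>\<Sum>i<Suc n. (W (grid T n i) \<omega>)\<^sup>2 * v n\<bar>} < \<eta> / 2" by blast
  \<comment> \<open>With budget K and threshold 2 K / \<eta> the second term of Lenglart's
    inequality is \<eta> / 2; the other half is the choice of K.\<close>
  have "prob {\<omega>\<in>space M. 2 * K / \<eta> < (\<Sum>i<Suc n. (W (grid T n i) \<omega> * G n (dZ (grid T n i) (grid T n (Suc i)) \<omega>))\<^sup>2)} < \<eta>" for n
  proof -
    have "prob {\<omega>\<in>space M. (\<Sum>l<Suc n. (\<Sum>i\<in>{i\<in>{..<Suc n}. i = l}. W (grid T n i) \<omega> *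
       G n (dZ (grid T n i) (grid T n (Suc i)) \<omega>))\<^sup>2) > 2 * K / \<eta>} \<le>
         prob {\<omega>\<in>space M. (\<Sum>i<Suc n. (W (grid T n i) \<omega>)\<^sup>2 * v n) > K} + K / (2 * K / \<eta>)"
    proof (rule lenglart_scalar)
      fix i j :: nat assume "i \<noteq> j"
      then have "Suc i \<le> j \<or> Suc j \<le> i" by auto
      then show "grid T n (Suc i) \<le> grid T n j \<or> grid T n (Suc j) \<le> grid T n i"
        using strict_mono_mono[OF grid_strict_mono[OF T], of n] by (auto simp: mono_def)
    qed (use g mom gm Wm v0 \<eta> K(1) in auto)
    also have "{\<omega>\<in>space M. (\<Sum>i<Suc n. (W (grid T n i) \<omega>)\<^sup>2 * v n) > K} =
       {\<omega>\<in>space M. K < \<bar>\<Sum>i<Suc n. (W (grid T n i) \<omega>)\<^sup>2 * v n\<bar>}"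
    proof -
      have "\<bar>\<Sum>i<Suc n. (W (grid T n i) \<omega>)\<^sup>2 * v n\<bar> = (\<Sum>i<Suc n. (W (grid T n i) \<omega>)\<^sup>2 * v n)" for \<omega>
        using v0[of n] by (intro abs_of_nonneg sum_nonneg) auto
      then show ?thesis by simp
    qed
    also have "prob {\<omega>\<in>space M. K < \<bar>\<Sum>i<Suc n. (W (grid T n i) \<omega>)\<^sup>2 * v n\<bar>} + K / (2 * K / \<eta>) < \<eta>"
      using K(2)[of n] K(1) \<eta> by simp
    also have "(\<lambda>\<omega>. \<Sum>l<Suc n. (\<Sum>i\<in>{i\<in>{..<Suc n}. i = l}. W (grid T n i) \<omega> * G n (dZ (grid T n i) (grid T n (Suc i)) \<omega>))\<^sup>2) =
      (\<lambda>\<omega>. \<Sum>i<Suc n. (W (grid T n i) \<omega> * G n (dZ (grid T n i) (grid T n (Suc i)) \<omega>))\<^sup>2)"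
    proof (intro ext sum.cong refl)
      fix \<omega> l assume "l \<in> {..<Suc n}"
      then have "{i\<in>{..<Suc n}. i = l} = {l}" by auto
      then show "(\<Sum>i\<in>{i\<in>{..<Suc n}. i = l}. W (grid T n i) \<omega> * G n (dZ (grid T n i) (grid T n (Suc i)) \<omega>))\<^sup>2 =
        (W (grid T n l) \<omega> * G n (dZ (grid T n l) (grid T n (Suc l)) \<omega>))\<^sup>2" by simp
    qed
    finally show ?thesis .
  qed
  then show ?thesis unfolding G_def h_def using K(1) \<eta> by (intro exI[of _ "2 * K / \<eta>"]) simp
qed

text \<open>The integrand X a is compared with its value frozen at the left end of each grid
  interval. \<open>ito_block_lenglart\<close> reduces the error to a weighted integral of squared
  oscillations, which tends to 0 on each path by uniform continuity.\<close>

lemma ito_noise_vanishes: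
  fixes a :: "real^'n" and W X :: "real \<Rightarrow> 'w \<Rightarrow> real" and lab :: "nat \<Rightarrow> nat"
  assumes I: "has_ito_integral M F Z (\<lambda>s \<omega>. X s \<omega> *\<^sub>R a) I" and X: "continuous_adapted M F X"
    and T: "0 < T" and L: "\<And>n. finite (L n)"
    and Wm: "\<And>t. 0 \<le> t \<Longrightarrow> W t \<in> borel_measurable (F t)"
    and Wc: "AE \<omega> in M. continuous_on {0..} (\<lambda>t. W t \<omega>)"
  shows "vanishing_prob (\<lambda>n \<omega>. \<Sum>l\<in>L n. (\<Sum>i\<in>{i. i < Suc n \<and> lab i = l}. W (grid T n i) \<omega> *
     (I (grid T n (Suc i)) \<omega> - I (grid T n i) \<omega> - X (grid T n i) \<omega> * (a \<bullet> dZ (grid T n i) (grid T n (Suc i)) \<omega>)))\<^sup>2)"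
proof -
  have Xm: "X t \<in> borel_measurable (F t)" if "0 \<le> t" for t using X that by (auto simp: continuous_adapted_def)
  have g: "0 \<le> grid T n i" for n i using T by (auto simp: grid_nonneg)
  have vm: "(\<lambda>(\<omega>, x). indicator {0..} x *\<^sub>R (X x \<omega> *\<^sub>R a)) \<in> borel_measurable (M \<Otimes>\<^sub>M lborel)"
  proof -
    have "(\<lambda>p. X (max 0 (snd p)) (fst p)) \<in> borel_measurable (M \<Otimes>\<^sub>M lborel)"
      using continuous_adapted_measurable[OF X] by (simp cong: measurable_cong_sets add: sets_pair_measure_cong[OF refl sets_lborel])
    then have "(\<lambda>p. indicator {0..} (snd p) *\<^sub>R (X (max 0 (snd p)) (fst p) *\<^sub>R a)) \<in> borel_measurable (M \<Otimes>\<^sub>M lborel)"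
      by measurable
    also have "(\<lambda>p. indicator {0..} (snd p) *\<^sub>R (X (max 0 (snd p)) (fst p) *\<^sub>R a)) = (\<lambda>(\<omega>, x). indicator {0..} x *\<^sub>R (X x \<omega> *\<^sub>R a))"
      by (auto simp: fun_eq_iff indicator_def)
    finally show ?thesis .
  qed
  have um: "(\<lambda>\<omega>. X (grid T n i) \<omega> *\<^sub>R a) \<in> borel_measurable (F (grid T n i))" for n i
    using Xm[OF g] by (intro borel_measurable_scaleR) auto
  note blk = ito_block_lenglart[OF I vm grid_strict_mono[OF T] _ Wm[OF g] um, unfolded grid_simps(1), OF order.refl]
  have IM: "I t \<in> borel_measurable M" if "0 \<le> t" for t
    using ito_integral_measurable[OF I that] by (rule F_imp_M)
  have "vanishing_prob (\<lambda>n \<omega>. \<Sum>l\<in>L n. (\<Sum>i\<in>{i. i < Suc n \<and> lab i = l}. W (grid T n i) \<omega> *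
     (I (grid T n (Suc i)) \<omega> - I (grid T n i) \<omega> - (X (grid T n i) \<omega> *\<^sub>R a) \<bullet> dZ (grid T n i) (grid T n (Suc i)) \<omega>))\<^sup>2)"
  proof (rule vanishing_prob_lenglart[where C=16 and Q="\<lambda>n \<omega>. \<Sum>i<Suc n. ennreal ((W (grid T n i) \<omega>)\<^sup>2) *
            (\<integral>\<^sup>+x\<in>{grid T n i<..grid T n (Suc i)}. ennreal ((norm (X x \<omega> *\<^sub>R a - X (grid T n i) \<omega> *\<^sub>R a))\<^sup>2) \<partial>lborel)"])
    fix n
    show "(\<lambda>\<omega>. \<Sum>l\<in>L n. (\<Sum>i\<in>{i. i < Suc n \<and> lab i = l}. W (grid T n i) \<omega> *
     (I (grid T n (Suc i)) \<omega> - I (grid T n i) \<omega> - (X (grid T n i) \<omega> *\<^sub>R a) \<bullet> dZ (grid T n i) (grid T n (Suc i)) \<omega>))\<^sup>2) \<in> borel_measurable M"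
      by (intro borel_measurable_sum borel_measurable_power borel_measurable_times borel_measurable_diff
          borel_measurable_inner F_imp_M[OF Wm[OF g]] F_imp_M[OF um] IM g Z_measurable_M)
    show "(\<lambda>\<omega>. \<Sum>i<Suc n. ennreal ((W (grid T n i) \<omega>)\<^sup>2) *
            (\<integral>\<^sup>+x\<in>{grid T n i<..grid T n (Suc i)}. ennreal ((norm (X x \<omega> *\<^sub>R a - X (grid T n i) \<omega> *\<^sub>R a))\<^sup>2) \<partial>lborel)) \<in> borel_measurable M"
      by (rule blk(2)[OF L zero_less_one zero_less_one])
    fix \<delta> \<epsilon> :: real assume de: "0 < \<delta>" "0 < \<epsilon>"
    show "prob {\<omega>\<in>space M. \<epsilon> < (\<Sum>l\<in>L n. (\<Sum>i\<in>{i. i < Suc n \<and> lab i = l}. W (grid T n i) \<omega> *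
     (I (grid T n (Suc i)) \<omega> - I (grid T n i) \<omega> - (X (grid T n i) \<omega> *\<^sub>R a) \<bullet> dZ (grid T n i) (grid T n (Suc i)) \<omega>))\<^sup>2)}
      \<le> prob {\<omega>\<in>space M. ennreal \<delta> < (\<Sum>i<Suc n. ennreal ((W (grid T n i) \<omega>)\<^sup>2) *
            (\<integral>\<^sup>+x\<in>{grid T n i<..grid T n (Suc i)}. ennreal ((norm (X x \<omega> *\<^sub>R a - X (grid T n i) \<omega> *\<^sub>R a))\<^sup>2) \<partial>lborel))} + 16 * \<delta> / \<epsilon>"
      by (rule blk(1)[OF L de])
  next
    show "AE \<omega> in M. \<forall>e>0. \<forall>\<^sub>F n in sequentially. (\<Sum>i<Suc n. ennreal ((W (grid T n i) \<omega>)\<^sup>2) *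
            (\<integral>\<^sup>+x\<in>{grid T n i<..grid T n (Suc i)}. ennreal ((norm (X x \<omega> *\<^sub>R a - X (grid T n i) \<omega> *\<^sub>R a))\<^sup>2) \<partial>lborel)) \<le> ennreal e"
      using Wc AE_space
    proof eventually_elim
      case (elim \<omega>)
      then have "continuous_on {0..T} (\<lambda>t. W t \<omega>)" by (intro continuous_on_subset[OF elim(1)]) auto
      then obtain K where K: "0 < K" "\<And>x. x \<in> {0..T} \<Longrightarrow> \<bar>W x \<omega>\<bar> \<le> K"
        using continuous_on_bounded_real by blast
      have "continuous_on {0..} (\<lambda>t. X t \<omega>)" using X elim(2) by (auto simp: continuous_adapted_def)
      then have cX: "continuous_on {0..T} (\<lambda>t. X t \<omega> *\<^sub>R a)"
        by (intro continuous_intros) (auto elim: continuous_on_subset)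
      show ?case
        using weighted_oscillation_tendsto[OF T cX, of _ "\<lambda>n i. W (grid T n i) \<omega>" K] K(2)[OF grid_in] T by auto
    qed
  qed (auto intro!: sum_nonneg)
  then show ?thesis by simp
qed

text \<open>The product rule for \<open>X\<close> and the exponential martingale, in discrete form. The factor
  \<open>expZ a\<close> is exact on every grid interval, so only the fluctuations of \<open>X\<close> inside the
  intervals and second order Gaussian remainders have to be shown negligible.\<close>

lemma exponential_product_vanishes:
  fixes a :: "real^'n" and X :: "real \<Rightarrow> 'w \<Rightarrow> real"
  assumes I: "has_ito_integral M F Z (\<lambda>s \<omega>. X s \<omega> *\<^sub>R a) I" and X: "continuous_adapted M F X"
    and T: "0 < T"
  shows "vanishing_prob (\<lambda>n \<omega>. X T \<omega> * expZ a T \<omega> - X 0 \<omega> * expZ a 0 \<omega> -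
     (\<Sum>i<Suc n. expZ a (grid T n (Suc i)) \<omega> *
        ((X (grid T n (Suc i)) \<omega> - X (grid T n i) \<omega>) - (I (grid T n (Suc i)) \<omega> - I (grid T n i) \<omega>))))"
proof -
  define D where "D n i = expZ a (grid T n i)" for n i
  define x where "x n i \<omega> = X (grid T n i) \<omega>" for n i \<omega>
  define dI where "dI n i \<omega> = I (grid T n (Suc i)) \<omega> - I (grid T n i) \<omega>" for n i \<omega>
  define z where "z n i \<omega> = a \<bullet> dZ (grid T n i) (grid T n (Suc i)) \<omega>" for n i \<omega>
  define h where "h n = T / real (Suc n)" for n
  \<comment> \<open>There are three sources of error: A from freezing X on a grid interval, rho from
    the first order expansion of the exponential martingale over one step, and sg, the relative
    increment of \<open>expZ a\<close>.\<close>
  define A where "A n i \<omega> = dI n i \<omega> - x n i \<omega> * z n i \<omega>" for n i \<omega>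
  define rho where "rho n i \<omega> = exp (z n i \<omega> - (norm a)\<^sup>2 * h n / 2) - 1 - z n i \<omega>" for n i \<omega>
  define sg where "sg n i \<omega> = exp (- z n i \<omega> + (norm a)\<^sup>2 * h n / 2) - 1" for n i \<omega>
  have g: "0 \<le> grid T n i" for n i using T by (auto simp: grid_nonneg)
  have Xm: "X t \<in> borel_measurable (F t)" if "0 \<le> t" for t using X that by (auto simp: continuous_adapted_def)
  have Xc: "AE \<omega> in M. continuous_on {0..} (\<lambda>t. X t \<omega>)" using X by (auto simp: continuous_adapted_def)
  have DXc: "AE \<omega> in M. continuous_on {0..} (\<lambda>t. expZ a t \<omega> * X t \<omega>)"
    using expZ_continuous[of a] Xc by eventually_elim (intro continuous_intros)
  have DXm: "(\<lambda>\<omega>. expZ a t \<omega> * X t \<omega>) \<in> borel_measurable (F t)" if "0 \<le> t" for t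
    using expZ_measurable[OF that] Xm[OF that] by (rule borel_measurable_times)
  have IM: "I t \<in> borel_measurable M" if "0 \<le> t" for t
    using ito_integral_measurable[OF I that] by (rule F_imp_M)
  have meas[measurable]: "D n i \<in> borel_measurable M" "x n i \<in> borel_measurable M" "dI n i \<in> borel_measurable M" "z n i \<in> borel_measurable M" for n i
    using F_imp_M[OF expZ_measurable[OF g]] F_imp_M[OF Xm[OF g]] IM[OF g] dZ_measurable_M[OF g g]
    by (auto simp: D_def x_def[abs_def] dI_def[abs_def] z_def[abs_def])
  have [measurable]: "A n i \<in> borel_measurable M" "rho n i \<in> borel_measurable M" "sg n i \<in> borel_measurable M" for n i
    unfolding A_def[abs_def] rho_def[abs_def] sg_def[abs_def] by measurable
  have diag: "(\<Sum>l<Suc n. (\<Sum>i\<in>{i. i < Suc n \<and> i = l}. f i)\<^sup>2) = (\<Sum>i<Suc n. (f i)\<^sup>2)" for f :: "nat \<Rightarrow> real" and n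
  proof (intro sum.cong refl)
    fix l assume "l \<in> {..<Suc n}"
    then have "{i. i < Suc n \<and> i = l} = {l}" by auto
    then show "(\<Sum>i\<in>{i. i < Suc n \<and> i = l}. f i)\<^sup>2 = (f l)\<^sup>2" by simp
  qed
  have T2: "vanishing_prob (\<lambda>n \<omega>. \<Sum>i<Suc n. D n i \<omega> * A n i \<omega>)"
  proof (rule vanishing_prob_root)
    show "vanishing_prob (\<lambda>n \<omega>. (\<Sum>i<Suc n. D n i \<omega> * A n i \<omega>)\<^sup>2)"
      using ito_noise_vanishes[OF I X T, where L="\<lambda>_. {0}" and W="expZ a" and lab="\<lambda>_. 0", OF _ expZ_measurable expZ_continuous]
      by (simp add: D_def A_def dI_def x_def z_def lessThan_def del: sum.lessThan_Suc)
  qed measurable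
  have T3: "vanishing_prob (\<lambda>n \<omega>. \<Sum>i<Suc n. D n i \<omega> * x n i \<omega> * rho n i \<omega>)"
  proof (rule vanishing_prob_root)
    show "vanishing_prob (\<lambda>n \<omega>. (\<Sum>i<Suc n. D n i \<omega> * x n i \<omega> * rho n i \<omega>)\<^sup>2)"
      using scalar_noise_vanishes[OF T, where L="\<lambda>_. {0}" and W="\<lambda>t \<omega>. expZ a t \<omega> * X t \<omega>" and lab="\<lambda>_. 0" and a=a, OF _ DXm DXc]
      by (simp add: D_def rho_def h_def x_def z_def lessThan_def del: sum.lessThan_Suc)
  qed measurable
  have V1: "vanishing_prob (\<lambda>n \<omega>. \<Sum>i<Suc n. (A n i \<omega>)\<^sup>2)"
    using ito_noise_vanishes[OF I X T, where L="\<lambda>n. {..<Suc n}" and W="\<lambda>_ _. 1" and lab="\<lambda>i. i", unfolded diag]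
    by (simp add: A_def dI_def x_def z_def del: sum.lessThan_Suc)
  have V2: "vanishing_prob (\<lambda>n \<omega>. \<Sum>i<Suc n. (x n i \<omega> * rho n i \<omega>)\<^sup>2)"
    using scalar_noise_vanishes[OF T, where L="\<lambda>n. {..<Suc n}" and W=X and lab="\<lambda>i. i" and a=a, unfolded diag, OF _ Xm Xc]
    by (simp add: rho_def h_def x_def z_def del: sum.lessThan_Suc)
  have V: "vanishing_prob (\<lambda>n \<omega>. (\<Sum>i<Suc n. (A n i \<omega>)\<^sup>2) + (\<Sum>i<Suc n. (A n i \<omega>)\<^sup>2) +
      ((\<Sum>i<Suc n. (x n i \<omega> * rho n i \<omega>)\<^sup>2) + (\<Sum>i<Suc n. (x n i \<omega> * rho n i \<omega>)\<^sup>2)))"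
    by (intro vanishing_prob_add V1 V2)
  \<comment> \<open>After removal of the drift, the increment of the product is exactly D n (Suc i)
    times J n i. The factor D n (Suc i) is not known at the start of the interval, so it is split as
    D n i (1 + sg n i): the first part gives the martingale sums T2 and T3, the second the
    correction T4.\<close>
  define J where "J n i \<omega> = A n i \<omega> - x n i \<omega> * rho n i \<omega>" for n i \<omega>
  have [measurable]: "J n i \<in> borel_measurable M" for n i unfolding J_def[abs_def] by measurable
  \<comment> \<open>The correction has no martingale structure and is handled by Cauchy-Schwarz: the
    sum of the squares of D sg is tight, the sum of the squares of J vanishes in
    probability.\<close>
  have T4: "vanishing_prob (\<lambda>n \<omega>. \<Sum>i<Suc n. (D n i \<omega> * sg n i \<omega>) * J n i \<omega>)"
  proof (rule vanishing_prob_root, rule vanishing_prob_bound)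
    show "vanishing_prob (\<lambda>n \<omega>. (\<Sum>i<Suc n. (D n i \<omega> * sg n i \<omega>)\<^sup>2) * ((\<Sum>i<Suc n. (A n i \<omega>)\<^sup>2) + (\<Sum>i<Suc n. (A n i \<omega>)\<^sup>2) +
      ((\<Sum>i<Suc n. (x n i \<omega> * rho n i \<omega>)\<^sup>2) + (\<Sum>i<Suc n. (x n i \<omega> * rho n i \<omega>)\<^sup>2))))"
    proof (rule vanishing_prob_mult_tight[OF _ _ V])
      fix \<eta> :: real assume "0 < \<eta>"
      from inverse_noise_tight[OF T this expZ_measurable expZ_continuous, of a a]
      obtain K where K: "0 < K" "\<And>n. prob {\<omega>\<in>space M. K < (\<Sum>i<Suc n. (D n i \<omega> * sg n i \<omega>)\<^sup>2)} < \<eta>"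
        unfolding D_def sg_def z_def h_def by blast
      have "\<bar>\<Sum>i<Suc n. (D n i \<omega> * sg n i \<omega>)\<^sup>2\<bar> = (\<Sum>i<Suc n. (D n i \<omega> * sg n i \<omega>)\<^sup>2)" for n \<omega>
        by (rule abs_of_nonneg, rule sum_nonneg) simp
      then show "\<exists>K>0. \<forall>\<^sub>F n in sequentially. prob {\<omega>\<in>space M. K < \<bar>\<Sum>i<Suc n. (D n i \<omega> * sg n i \<omega>)\<^sup>2\<bar>} < \<eta>"
        using K by (intro exI[of _ K]) simp
    qed measurable
    fix n \<omega>
    have "(\<Sum>i<Suc n. (D n i \<omega> * sg n i \<omega>) * J n i \<omega>)\<^sup>2 \<le> (\<Sum>i<Suc n. (D n i \<omega> * sg n i \<omega>)\<^sup>2) * (\<Sum>i<Suc n. (J n i \<omega>)\<^sup>2)"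
      by (rule Cauchy_Schwarz_ineq_sum)
    also have "\<dots> \<le> (\<Sum>i<Suc n. (D n i \<omega> * sg n i \<omega>)\<^sup>2) * ((\<Sum>i<Suc n. (A n i \<omega>)\<^sup>2) + (\<Sum>i<Suc n. (A n i \<omega>)\<^sup>2) +
      ((\<Sum>i<Suc n. (x n i \<omega> * rho n i \<omega>)\<^sup>2) + (\<Sum>i<Suc n. (x n i \<omega> * rho n i \<omega>)\<^sup>2)))"
    proof (intro mult_left_mono)
      have "(J n i \<omega>)\<^sup>2 \<le> (A n i \<omega>)\<^sup>2 + (A n i \<omega>)\<^sup>2 + ((x n i \<omega> * rho n i \<omega>)\<^sup>2 + (x n i \<omega> * rho n i \<omega>)\<^sup>2)" for i
        using square_sum_bound[of "A n i \<omega>" "- (x n i \<omega> * rho n i \<omega>)"] by (simp add: J_def)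
      then show "(\<Sum>i<Suc n. (J n i \<omega>)\<^sup>2) \<le> (\<Sum>i<Suc n. (A n i \<omega>)\<^sup>2) + (\<Sum>i<Suc n. (A n i \<omega>)\<^sup>2) +
        ((\<Sum>i<Suc n. (x n i \<omega> * rho n i \<omega>)\<^sup>2) + (\<Sum>i<Suc n. (x n i \<omega> * rho n i \<omega>)\<^sup>2))"
        unfolding sum.distrib[symmetric] by (rule sum_mono)
    qed (rule sum_nonneg, simp)
    finally show "\<bar>(\<Sum>i<Suc n. (D n i \<omega> * sg n i \<omega>) * J n i \<omega>)\<^sup>2\<bar> \<le>
       \<bar>(\<Sum>i<Suc n. (D n i \<omega> * sg n i \<omega>)\<^sup>2) * ((\<Sum>i<Suc n. (A n i \<omega>)\<^sup>2) + (\<Sum>i<Suc n. (A n i \<omega>)\<^sup>2) +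
      ((\<Sum>i<Suc n. (x n i \<omega> * rho n i \<omega>)\<^sup>2) + (\<Sum>i<Suc n. (x n i \<omega> * rho n i \<omega>)\<^sup>2)))\<bar>"
      by (subst abs_of_nonneg[OF zero_le_power2], elim order_trans[OF _ abs_ge_self])
  qed measurable
  \<comment> \<open>Both identities are exact, since 1 + sg and 1 + z + rho are the step of the
    exponential and its reciprocal.\<close>
  have Dstep: "D n (Suc i) \<omega> = D n i \<omega> * (1 + sg n i \<omega>)" "D n (Suc i) \<omega> * (rho n i \<omega> + 1 + z n i \<omega>) = D n i \<omega>" for n i \<omega>
  proof -
    have e: "- (a \<bullet> Z (grid T n (Suc i)) \<omega>) + (norm a)\<^sup>2 * grid T n (Suc i) / 2 =
      (- (a \<bullet> Z (grid T n i) \<omega>) + (norm a)\<^sup>2 * grid T n i / 2) + (- z n i \<omega> + (norm a)\<^sup>2 * h n / 2)"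
      using grid_simps(3)[of T n i] unfolding h_def[symmetric]
      by (simp add: z_def inner_diff_right field_simps)
    show 1: "D n (Suc i) \<omega> = D n i \<omega> * (1 + sg n i \<omega>)"
      unfolding D_def expZ_def e exp_add[of "- (a \<bullet> Z (grid T n i) \<omega>) + (norm a)\<^sup>2 * grid T n i / 2"] sg_def by simp
    have "(1 + sg n i \<omega>) * (rho n i \<omega> + 1 + z n i \<omega>) = 1"
      unfolding sg_def rho_def by (simp add: mult_exp_exp)
    then show "D n (Suc i) \<omega> * (rho n i \<omega> + 1 + z n i \<omega>) = D n i \<omega>"
      unfolding 1 by (simp add: mult.assoc)
  qed
  have step: "X (grid T n (Suc i)) \<omega> * D n (Suc i) \<omega> - X (grid T n i) \<omega> * D n i \<omega> -
      D n (Suc i) \<omega> * ((X (grid T n (Suc i)) \<omega> - X (grid T n i) \<omega>) - dI n i \<omega>) =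
      D n i \<omega> * A n i \<omega> - D n i \<omega> * x n i \<omega> * rho n i \<omega> + (D n i \<omega> * sg n i \<omega>) * J n i \<omega>" for n i \<omega>
  proof -
    have "X (grid T n (Suc i)) \<omega> * D n (Suc i) \<omega> - X (grid T n i) \<omega> * D n i \<omega> -
      D n (Suc i) \<omega> * ((X (grid T n (Suc i)) \<omega> - X (grid T n i) \<omega>) - dI n i \<omega>) =
      D n (Suc i) \<omega> * dI n i \<omega> + x n i \<omega> * (D n (Suc i) \<omega> - D n i \<omega>)"
      by (simp add: x_def algebra_simps)
    also have "D n (Suc i) \<omega> - D n i \<omega> = - D n (Suc i) \<omega> * (rho n i \<omega> + z n i \<omega>)"
      by (subst Dstep(2)[symmetric]) (simp add: algebra_simps)
    also have "D n (Suc i) \<omega> * dI n i \<omega> + x n i \<omega> * (- D n (Suc i) \<omega> * (rho n i \<omega> + z n i \<omega>)) = D n (Suc i) \<omega> * J n i \<omega>"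
      by (simp add: J_def A_def algebra_simps)
    also have "\<dots> = D n i \<omega> * J n i \<omega> + (D n i \<omega> * sg n i \<omega>) * J n i \<omega>"
      unfolding Dstep(1) by (simp add: algebra_simps)
    finally show ?thesis by (simp add: J_def algebra_simps)
  qed
  have eq: "X T \<omega> * expZ a T \<omega> - X 0 \<omega> * expZ a 0 \<omega> -
     (\<Sum>i<Suc n. expZ a (grid T n (Suc i)) \<omega> *
        ((X (grid T n (Suc i)) \<omega> - X (grid T n i) \<omega>) - (I (grid T n (Suc i)) \<omega> - I (grid T n i) \<omega>))) =
     (\<Sum>i<Suc n. D n i \<omega> * A n i \<omega>) - (\<Sum>i<Suc n. D n i \<omega> * x n i \<omega> * rho n i \<omega>) + (\<Sum>i<Suc n. (D n i \<omega> * sg n i \<omega>) * J n i \<omega>)" for n \<omega>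
  proof -
    have "X T \<omega> * expZ a T \<omega> - X 0 \<omega> * expZ a 0 \<omega> =
      (\<Sum>i<Suc n. X (grid T n (Suc i)) \<omega> * D n (Suc i) \<omega> - X (grid T n i) \<omega> * D n i \<omega>)"
      by (subst sum_lessThan_telescope) (simp add: D_def grid_simps)
    then show ?thesis
      by (simp only: D_def[symmetric] dI_def[symmetric] sum_subtractf[symmetric] sum.distrib[symmetric] step)
  qed
  show ?thesis unfolding eq by (intro vanishing_prob_add vanishing_prob_diff T2 T3 T4)
qed

end

section \<open>Stieltjes sums and integrating factors\<close>

lemma set_integral_diff_interval:
  fixes f :: "real \<Rightarrow> real"
  assumes f: "set_integrable lborel {0..t} f" and s: "0 \<le> s" "s \<le> t"
  shows "(LBINT u:{0..t}. f u) - (LBINT u:{0..s}. f u) = (LBINT u:{s<..t}. f u)"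
proof -
  have "{0..t} = {0..s} \<union> {s<..t}" using s by auto
  moreover have "(LBINT u:{0..s} \<union> {s<..t}. f u) = (LBINT u:{0..s}. f u) + (LBINT u:{s<..t}. f u)"
    using s by (intro set_integral_Un set_integrable_subset[OF f]) auto
  ultimately show ?thesis by simp
qed

lemma set_integrable_mult_continuous:
  fixes f D :: "real \<Rightarrow> real"
  assumes f: "set_integrable lborel {a..b} f" and D: "continuous_on {a..b} D"
  shows "set_integrable lborel {a..b} (\<lambda>u. D u * f u)"
proof -
  obtain K where K: "0 < K" "\<And>x. x \<in> {a..b} \<Longrightarrow> \<bar>D x\<bar> \<le> K"
    using continuous_on_bounded_real[OF D] by blast
  have D': "(\<lambda>x. indicator {a..b} x *\<^sub>R D x) \<in> borel_measurable borel"
    using D by (intro borel_measurable_continuous_on_indicator) auto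
  have f': "integrable lborel (\<lambda>x. indicator {a..b} x *\<^sub>R f x)"
    using f by (simp add: set_integrable_def)
  have "integrable lborel (\<lambda>x. (indicator {a..b} x *\<^sub>R D x) * (indicator {a..b} x *\<^sub>R f x))"
  proof (rule Bochner_Integration.integrable_bound)
    show "integrable lborel (\<lambda>x. K * (indicator {a..b} x *\<^sub>R f x))" using f' by simp
    show "(\<lambda>x. (indicator {a..b} x *\<^sub>R D x) * (indicator {a..b} x *\<^sub>R f x)) \<in> borel_measurable lborel"
      using D' f' by (intro borel_measurable_times) auto
    show "AE x in lborel. norm ((indicator {a..b} x *\<^sub>R D x) * (indicator {a..b} x *\<^sub>R f x)) \<le> norm (K * (indicator {a..b} x *\<^sub>R f x))"
      using K by (intro AE_I2) (auto simp: indicator_def abs_mult intro!: mult_right_mono)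
  qed
  then show ?thesis unfolding set_integrable_def
    by (rule Bochner_Integration.integrable_cong[THEN iffD1, rotated 2]) (auto simp: indicator_def)
qed

lemma set_integral_singleton: "(LBINT u:{a..a}. f u :: real) = 0" for a :: real
proof -
  have "AE u in lborel. u \<noteq> a" by (rule AE_lborel_singleton)
  then have "AE u in lborel. indicator {a..a} u *\<^sub>R f u = 0" by eventually_elim (auto simp: indicator_def)
  then show ?thesis unfolding set_lebesgue_integral_def by (rule integral_eq_zero_AE)
qed

text \<open>The tags are arbitrary because right end points are needed for the exponential formula,
  while summation by parts uses left and right ones together. The error is at most the oscillation
  of D on the grid times the integral of |b|.\<close>

lemma tagged_stieltjes_sum:
  fixes b D :: "real \<Rightarrow> real"
  assumes T: "0 < T" and b: "set_integrable lborel {0..T} b" and D: "continuous_on {0..T} D"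
    and tag: "\<And>n i. i < Suc n \<Longrightarrow> \<tau> n i \<in> {grid T n i..grid T n (Suc i)}"
  shows "(\<lambda>n. \<Sum>i<Suc n. D (\<tau> n i) * ((LBINT u:{0..grid T n (Suc i)}. b u) - (LBINT u:{0..grid T n i}. b u)))
     \<longlonglongrightarrow> (LBINT u:{0..T}. D u * b u)"
proof -
  define B where "B t = (LBINT u:{0..t}. b u)" for t
  define P where "P t = (LBINT u:{0..t}. D u * b u)" for t
  \<comment> \<open>Dominates the variation of the integrator B, so that the local errors add up to
    at most e times \<open>Gm T\<close>.\<close>
  define Gm where "Gm t = (LBINT u:{0..t}. \<bar>b u\<bar>)" for t
  have Db: "set_integrable lborel {0..T} (\<lambda>u. D u * b u)" by (rule set_integrable_mult_continuous[OF b D])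
  have ab: "set_integrable lborel {0..T} (\<lambda>u. \<bar>b u\<bar>)" using b by (rule set_integrable_abs)
  have Gm0: "0 \<le> Gm T" unfolding Gm_def set_lebesgue_integral_def by (intro integral_nonneg_AE) auto
  have bound: "\<bar>D (\<tau> n i) * (B (grid T n (Suc i)) - B (grid T n i)) - (P (grid T n (Suc i)) - P (grid T n i))\<bar>
      \<le> e * (Gm (grid T n (Suc i)) - Gm (grid T n i))"
    if i: "i < Suc n" and e: "\<And>x y. x \<in> {grid T n i..grid T n (Suc i)} \<Longrightarrow> y \<in> {grid T n i..grid T n (Suc i)} \<Longrightarrow> norm (D x - D y) < e"
    for n i e
  proof -
    let ?A = "{grid T n i<..grid T n (Suc i)}"
    have g: "0 \<le> grid T n i" "grid T n i \<le> grid T n (Suc i)" "grid T n (Suc i) \<le> T"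
      using T i grid_less[OF T, of n i] by (auto simp: grid_nonneg intro: grid_le less_imp_le)
    have sub: "set_integrable lborel {0..grid T n (Suc i)} f" if "set_integrable lborel {0..T} f" for f :: "real \<Rightarrow> real"
      using g by (intro set_integrable_subset[OF that]) auto
    have subA: "set_integrable lborel ?A f" if "set_integrable lborel {0..T} f" for f :: "real \<Rightarrow> real"
      using g by (intro set_integrable_subset[OF that]) auto
    have Dc: "set_integrable lborel {0..T} (\<lambda>u. D (\<tau> n i) * b u)" using b by simp
    have "D (\<tau> n i) * (B (grid T n (Suc i)) - B (grid T n i)) - (P (grid T n (Suc i)) - P (grid T n i)) =
       (LBINT u:?A. D (\<tau> n i) * b u) - (LBINT u:?A. D u * b u)"
      unfolding B_def P_def set_integral_diff_interval[OF sub[OF b] g(1,2)] set_integral_diff_interval[OF sub[OF Db] g(1,2)]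
      by simp
    also have "\<dots> = (LBINT u:?A. D (\<tau> n i) * b u - D u * b u)"
      by (rule set_integral_diff(2)[symmetric, OF subA[OF Dc] subA[OF Db]])
    also have "\<bar>\<dots>\<bar> \<le> (LBINT u:?A. \<bar>D (\<tau> n i) * b u - D u * b u\<bar>)"
      using set_integral_norm_bound[OF set_integral_diff(1)[OF subA[OF Dc] subA[OF Db]]] by simp
    also have "\<dots> \<le> (LBINT u:?A. e * \<bar>b u\<bar>)"
    proof (rule set_integral_mono)
      show "set_integrable lborel ?A (\<lambda>u. \<bar>D (\<tau> n i) * b u - D u * b u\<bar>)"
        by (intro set_integrable_abs set_integral_diff(1) subA Dc Db)
      show "set_integrable lborel ?A (\<lambda>u. e * \<bar>b u\<bar>)" using subA[OF ab] by simp
      fix u assume u: "u \<in> ?A"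
      have "\<bar>D (\<tau> n i) - D u\<bar> \<le> e" using e[OF tag[OF i], of u] u by (auto intro: less_imp_le)
      then show "\<bar>D (\<tau> n i) * b u - D u * b u\<bar> \<le> e * \<bar>b u\<bar>"
        unfolding left_diff_distrib[symmetric] abs_mult by (rule mult_right_mono) simp
    qed
    also have "\<dots> = e * (Gm (grid T n (Suc i)) - Gm (grid T n i))"
      unfolding Gm_def set_integral_diff_interval[OF sub[OF ab] g(1,2)] by simp
    finally show ?thesis .
  qed
  have tel: "(\<Sum>i<Suc n. f (grid T n (Suc i)) - f (grid T n i)) = f T - f 0" for f :: "real \<Rightarrow> real" and n
    by (subst sum_lessThan_telescope) (simp add: grid_simps)
  have z: "P 0 = 0" "Gm 0 = 0" unfolding P_def Gm_def by (rule set_integral_singleton)+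
  show ?thesis
    unfolding B_def[symmetric] P_def[symmetric]
  proof (rule LIMSEQ_I)
    fix r :: real assume r: "0 < r"
    define e where "e = r / (Gm T + 1)"
    have e0: "0 < e" unfolding e_def using r Gm0 by simp
    from grid_oscillation[OF T D e0]
    have "\<forall>\<^sub>F n in sequentially. norm ((\<Sum>i<Suc n. D (\<tau> n i) * (B (grid T n (Suc i)) - B (grid T n i))) - P T) < r"
    proof eventually_elim
      case (elim n)
      have "(\<Sum>i<Suc n. D (\<tau> n i) * (B (grid T n (Suc i)) - B (grid T n i))) - P T =
        (\<Sum>i<Suc n. D (\<tau> n i) * (B (grid T n (Suc i)) - B (grid T n i)) - (P (grid T n (Suc i)) - P (grid T n i)))"
        unfolding sum_subtractf[where f="\<lambda>i. D (\<tau> n i) * (B (grid T n (Suc i)) - B (grid T n i))"] tel z by simp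
      also have "\<bar>\<dots>\<bar> \<le> (\<Sum>i<Suc n. e * (Gm (grid T n (Suc i)) - Gm (grid T n i)))"
        using elim by (intro order_trans[OF sum_abs] sum_mono bound) auto
      also have "\<dots> = e * Gm T" unfolding sum_distrib_left[symmetric] tel z by simp
      also have "\<dots> < r"
      proof -
        have "e * Gm T < e * (Gm T + 1)" using e0 by simp
        also have "\<dots> = r" using Gm0 by (simp add: e_def)
        finally show ?thesis .
      qed
      finally show ?case by simp
    qed
    then show "\<exists>no. \<forall>n\<ge>no. norm ((\<Sum>i<Suc n. D (\<tau> n i) * (B (grid T n (Suc i)) - B (grid T n i))) - P T) < r"
      by (simp add: eventually_sequentially)
  qed
qed

lemma set_integral_continuous:
  fixes f :: "real \<Rightarrow> real"
  assumes "set_integrable lborel {0..T} f"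
  shows "continuous_on {0..T} (\<lambda>t. LBINT u:{0..t}. f u)"
proof -
  have *: "continuous_on {0..T} (\<lambda>t. integral {0..t} f)"
    using set_borel_integral_eq_integral(1)[OF assms] by (rule indefinite_integral_continuous_1)
  have "(LBINT u:{0..t}. f u) = integral {0..t} f" if "t \<in> {0..T}" for t
    using that by (intro set_borel_integral_eq_integral(2) set_integrable_subset[OF assms]) auto
  then show ?thesis by (intro continuous_on_eq[OF *]) simp
qed

lemma set_integral_continuous_half_line:
  fixes f :: "real \<Rightarrow> real"
  assumes "\<And>t. 0 \<le> t \<Longrightarrow> set_integrable lborel {0..t} f"
  shows "continuous_on {0..} (\<lambda>t. LBINT u:{0..t}. f u)"
  unfolding continuous_on_eq_continuous_within
proof
  fix t :: real assume "t \<in> {0..}"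
  then have "continuous (at t within {0..t + 1}) (\<lambda>t. LBINT u:{0..t}. f u)"
    using set_integral_continuous[OF assms[of "t + 1"]] by (simp add: continuous_on_eq_continuous_within)
  moreover have "at t within {0..} = at t within {0..t + 1}"
    by (rule at_within_nhd[of _ "{..<t + 1}"]) auto
  ultimately show "continuous (at t within {0..}) (\<lambda>t. LBINT u:{0..t}. f u)" by simp
qed

text \<open>The integrating factor exp (- m t), for an f that is only an indefinite integral of an
  integrable function. In place of a product rule for derivatives, summation by parts along a grid
  is passed to the limit.\<close>

lemma linear_integral_equation:
  fixes f \<Psi> :: "real \<Rightarrow> real"
  assumes int: "\<And>t. 0 \<le> t \<Longrightarrow> set_integrable lborel {0..t} (\<lambda>u. m * f u + \<Psi> u)"
    and eq: "\<And>t. 0 \<le> t \<Longrightarrow> f t = x0 + (LBINT u:{0..t}. m * f u + \<Psi> u)"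
    and t: "0 \<le> t"
  shows "set_integrable lborel {0..t} (\<lambda>u. exp (- m * u) * \<Psi> u)"
    "exp (- m * t) * f t = x0 + (LBINT u:{0..t}. exp (- m * u) * \<Psi> u)"
proof -
  define k where "k u = m * f u + \<Psi> u" for u
  define E where "E u = exp (- m * u)" for u
  have f_cont: "continuous_on {0..} f"
  proof -
    have "continuous_on {0..} (\<lambda>t. x0 + (LBINT u:{0..t}. m * f u + \<Psi> u))"
      by (intro continuous_intros set_integral_continuous_half_line int)
    then show ?thesis by (rule continuous_on_eq) (simp add: eq)
  qed
  have fc: "continuous_on {0..t} f" using f_cont by (rule continuous_on_subset) auto
  have E_cont: "continuous_on {0..t} E" unfolding E_def by (intro continuous_intros)
  have k: "set_integrable lborel {0..t} k" using int[OF t] by (simp add: k_def[abs_def])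
  have Ek: "set_integrable lborel {0..t} (\<lambda>u. E u * k u)" using k E_cont by (rule set_integrable_mult_continuous)
  have mE: "set_integrable lborel {0..s} (\<lambda>u. - m * E u)" for s
    unfolding E_def by (intro borel_integrable_atLeastAtMost' continuous_intros)
  have fE: "set_integrable lborel {0..t} (\<lambda>u. f u * (- m * E u))"
    by (rule set_integrable_mult_continuous[OF mE fc])
  have E\<Psi>: "E u * \<Psi> u = E u * k u + f u * (- m * E u)" for u
    by (simp add: k_def algebra_simps)
  show "set_integrable lborel {0..t} (\<lambda>u. exp (- m * u) * \<Psi> u)"
    unfolding E_def[symmetric] E\<Psi> by (intro set_integral_add Ek fE)
  have f0: "f 0 = x0" using eq[of 0] by (simp only: set_integral_singleton)
  have E_int: "(LBINT u:{0..s}. - m * E u) = E s - 1" if "0 \<le> s" for s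
  proof -
    have "(LBINT u:{0..s}. - m * E u) = integral {0..s} (\<lambda>u. - m * E u)"
      by (rule set_borel_integral_eq_integral(2)[OF mE])
    also have "((\<lambda>u. - m * E u) has_integral (E s - E 0)) {0..s}"
      using that unfolding E_def
      by (intro fundamental_theorem_of_calculus)
         (auto intro!: derivative_eq_intros simp: has_real_derivative_iff_has_vector_derivative[symmetric])
    then have "integral {0..s} (\<lambda>u. - m * E u) = E s - E 0" by (rule integral_unique)
    finally show ?thesis by (simp add: E_def)
  qed
  have "E t * f t - x0 = (LBINT u:{0..t}. E u * k u) + (LBINT u:{0..t}. f u * (- m * E u))"
  proof (cases "t = 0")
    case True
    then show ?thesis using f0 by (simp only: set_integral_singleton) (simp add: E_def)
  next
    case False
    then have t0: "0 < t" using t by simp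
    \<comment> \<open>Right end points go with E and left ones with f, so the two sums combine into
      the telescoping increments of the product E f.\<close>
    have tags: "grid t n i \<in> {grid t n i..grid t n (Suc i)}" "grid t n (Suc i) \<in> {grid t n i..grid t n (Suc i)}" for n i
      using grid_less[OF t0, of n i] by auto
    have g0: "0 \<le> grid t n i" for n i using t by (rule grid_nonneg)
    note l1 = tagged_stieltjes_sum[OF t0 k E_cont tags(2)]
    note l2 = tagged_stieltjes_sum[OF t0 mE fc tags(1)]
    have f_eq: "f s = x0 + (LBINT u:{0..s}. k u)" if "0 \<le> s" for s using eq[OF that] by (simp add: k_def)
    have "(\<Sum>i<Suc n. E (grid t n (Suc i)) * ((LBINT u:{0..grid t n (Suc i)}. k u) - (LBINT u:{0..grid t n i}. k u))) +
       (\<Sum>i<Suc n. f (grid t n i) * ((LBINT u:{0..grid t n (Suc i)}. - m * E u) - (LBINT u:{0..grid t n i}. - m * E u)))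
       = E t * f t - x0" for n
    proof -
      have "(\<Sum>i<Suc n. E (grid t n (Suc i)) * ((LBINT u:{0..grid t n (Suc i)}. k u) - (LBINT u:{0..grid t n i}. k u))) +
       (\<Sum>i<Suc n. f (grid t n i) * ((LBINT u:{0..grid t n (Suc i)}. - m * E u) - (LBINT u:{0..grid t n i}. - m * E u))) =
       (\<Sum>i<Suc n. E (grid t n (Suc i)) * f (grid t n (Suc i)) - E (grid t n i) * f (grid t n i))"
        unfolding sum.distrib[symmetric]
      proof (intro sum.cong refl)
        fix i
        have dk: "(LBINT u:{0..grid t n (Suc i)}. k u) - (LBINT u:{0..grid t n i}. k u) = f (grid t n (Suc i)) - f (grid t n i)"
          using f_eq[OF g0[of n "Suc i"]] f_eq[OF g0[of n i]] by simp
        show "E (grid t n (Suc i)) * ((LBINT u:{0..grid t n (Suc i)}. k u) - (LBINT u:{0..grid t n i}. k u)) +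
          f (grid t n i) * ((LBINT u:{0..grid t n (Suc i)}. - m * E u) - (LBINT u:{0..grid t n i}. - m * E u)) =
          E (grid t n (Suc i)) * f (grid t n (Suc i)) - E (grid t n i) * f (grid t n i)"
          unfolding E_int[OF g0] dk by (simp add: algebra_simps)
      qed
      also have "\<dots> = E t * f t - E 0 * f 0"
        by (subst sum_lessThan_telescope) (simp add: grid_simps)
      finally show ?thesis using f0 by (simp add: E_def)
    qed
    with tendsto_add[OF l1 l2] have "(\<lambda>n. E t * f t - x0) \<longlonglongrightarrow> (LBINT u:{0..t}. E u * k u) + (LBINT u:{0..t}. f u * (- m * E u))"
      by simp
    then show ?thesis by (rule LIMSEQ_unique[OF tendsto_const])
  qed
  also have "\<dots> = (LBINT u:{0..t}. E u * \<Psi> u)"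
    unfolding E\<Psi> by (rule set_integral_add(2)[symmetric, OF Ek fE])
  finally show "exp (- m * t) * f t = x0 + (LBINT u:{0..t}. exp (- m * u) * \<Psi> u)"
    by (simp add: E_def)
qed

context brownian
begin

text \<open>All jump times are nonnegative, so every approximating simple integral vanishes at time
  0.\<close>

lemma ito_integral_zero:
  assumes "has_ito_integral M F Z v I"
  shows "AE \<omega> in M. I 0 \<omega> = 0"
proof (rule vanishing_prob_const)
  from assms obtain k t \<eta> where sd: "\<And>m. simple_data M F (k m) (t m) (\<eta> m)"
    and convI: "\<And>T \<epsilon>. T \<ge> 0 \<Longrightarrow> \<epsilon> > 0 \<Longrightarrow> (\<lambda>m. prob {\<omega> \<in> space M.
              \<bar>I T \<omega> - simple_integral Z (k m) (t m) (\<eta> m) T \<omega>\<bar> > \<epsilon>}) \<longlonglongrightarrow> 0"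
    unfolding has_ito_integral_def by blast
  have "simple_integral Z (k m) (t m) (\<eta> m) 0 \<omega> = 0" for m \<omega>
    unfolding simple_integral_def
  proof (intro sum.neutral ballI)
    fix i assume "i \<in> {..<k m}"
    then have "min (t m (Suc i)) 0 = 0" "min (t m i) 0 = 0"
      using simple_data_nonneg[OF sd[of m], of i] simple_data_nonneg[OF sd[of m], of "Suc i"] by auto
    then show "\<eta> m i \<omega> \<bullet> (Z (min (t m (Suc i)) 0) \<omega> - Z (min (t m i) 0) \<omega>) = 0" by simp
  qed
  then show "vanishing_prob (\<lambda>_. I 0)"
    using convI[of 0] F_imp_M[OF ito_integral_measurable[OF assms order.refl]] by (simp add: vanishing_prob_def)
qed

lemma Z_zero: "AE \<omega> in M. Z 0 \<omega> = 0"
  using bm by (auto simp: standard_brownian_motion_def)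

text \<open>For fixed T the discrete remainder of \<open>exponential_product_vanishes\<close> tends
  to 0 in probability, while on almost every path its Stieltjes sums converge; the two limits must
  agree. Continuity of both sides then gives one exceptional null set for all times.\<close>

lemma exponential_ito_formula:
  fixes a :: "real^'n"
  assumes X: "has_ito_differential M F Z X x0 b (\<lambda>s \<omega>. X s \<omega> *\<^sub>R a)"
  shows "AE \<omega> in M. \<forall>t\<ge>0. set_integrable lborel {0..t} (\<lambda>u. expZ a u \<omega> * b u \<omega>) \<and>
     X t \<omega> * expZ a t \<omega> = x0 + (LBINT u:{0..t}. expZ a u \<omega> * b u \<omega>)"
proof -
  from X obtain I where XA: "continuous_adapted M F X" and b: "AE \<omega> in M. \<forall>t\<ge>0. set_integrable lborel {0..t} (\<lambda>s. b s \<omega>)"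
    and I: "has_ito_integral M F Z (\<lambda>s \<omega>. X s \<omega> *\<^sub>R a) I"
    and eq: "AE \<omega> in M. \<forall>t\<ge>0. X t \<omega> = x0 + (LBINT s:{0..t}. b s \<omega>) + I t \<omega>"
    unfolding has_ito_differential_def by blast
  have fixed: "AE \<omega> in M. X T \<omega> * expZ a T \<omega> = x0 + (LBINT u:{0..T}. expZ a u \<omega> * b u \<omega>)" if T: "0 < T" for T
  proof -
    define R where "R n \<omega> = X T \<omega> * expZ a T \<omega> - X 0 \<omega> * expZ a 0 \<omega> -
     (\<Sum>i<Suc n. expZ a (grid T n (Suc i)) \<omega> *
        ((X (grid T n (Suc i)) \<omega> - X (grid T n i) \<omega>) - (I (grid T n (Suc i)) \<omega> - I (grid T n i) \<omega>)))" for n \<omega>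
    have R: "vanishing_prob R" unfolding R_def[abs_def] by (rule exponential_product_vanishes[OF I XA T])
    have lim: "AE \<omega> in M. (\<lambda>n. R n \<omega>) \<longlonglongrightarrow> X T \<omega> * expZ a T \<omega> - x0 - (LBINT u:{0..T}. expZ a u \<omega> * b u \<omega>)"
      using b eq expZ_continuous[of a] ito_integral_zero[OF I] Z_zero
    proof eventually_elim
      case (elim \<omega>)
      have g0: "0 \<le> grid T n i" for n i using T by (simp add: grid_nonneg)
      have dX: "(X (grid T n (Suc i)) \<omega> - X (grid T n i) \<omega>) - (I (grid T n (Suc i)) \<omega> - I (grid T n i) \<omega>) =
         (LBINT s:{0..grid T n (Suc i)}. b s \<omega>) - (LBINT s:{0..grid T n i}. b s \<omega>)" for n i
      proof -
        have "X (grid T n (Suc i)) \<omega> = x0 + (LBINT s:{0..grid T n (Suc i)}. b s \<omega>) + I (grid T n (Suc i)) \<omega>"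
          "X (grid T n i) \<omega> = x0 + (LBINT s:{0..grid T n i}. b s \<omega>) + I (grid T n i) \<omega>"
          using elim(2) g0 by blast+
        then show ?thesis by linarith
      qed
      have "X 0 \<omega> = x0 + (LBINT s:{0..0}. b s \<omega>) + I 0 \<omega>" using elim(2) by blast
      then have X0: "X 0 \<omega> = x0" using elim(4) by (simp add: set_integral_singleton del: atLeastAtMost_singleton)
      have D0: "expZ a 0 \<omega> = 1" using elim(5) by (simp add: expZ_def)
      have Dc: "continuous_on {0..T} (\<lambda>t. expZ a t \<omega>)" by (rule continuous_on_subset[OF elim(3)]) auto
      have bi: "set_integrable lborel {0..T} (\<lambda>s. b s \<omega>)" using elim(1) T by simp
      have "(\<lambda>n. \<Sum>i<Suc n. expZ a (grid T n (Suc i)) \<omega> *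
           ((LBINT s:{0..grid T n (Suc i)}. b s \<omega>) - (LBINT s:{0..grid T n i}. b s \<omega>))) \<longlonglongrightarrow> (LBINT u:{0..T}. expZ a u \<omega> * b u \<omega>)"
        using grid_less[OF T] by (intro tagged_stieltjes_sum[OF T bi Dc]) (auto intro: less_imp_le)
      then show ?case unfolding R_def dX X0 D0 mult_1_right by (intro tendsto_diff tendsto_const)
    qed
    \<comment> \<open>The pathwise limit contains an integral of b whose measurability in \<omega>
      is not given; the limit of the measurable \<open>R n\<close> is a measurable function equal to
      it almost surely.\<close>
    define Rm where "Rm \<omega> = lim (\<lambda>n. R n \<omega>)" for \<omega>
    have Rn: "R n \<in> borel_measurable M" for n using vanishing_probD(1)[OF R] .
    have RmM: "Rm \<in> borel_measurable M" unfolding Rm_def using Rn by (rule borel_measurable_lim_metric)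
    have lim': "AE \<omega> in M. Rm \<omega> = X T \<omega> * expZ a T \<omega> - x0 - (LBINT u:{0..T}. expZ a u \<omega> * b u \<omega>) \<and> (\<lambda>n. R n \<omega> - Rm \<omega>) \<longlonglongrightarrow> 0"
      using lim
    proof eventually_elim
      case (elim \<omega>)
      from limI[OF elim] have "Rm \<omega> = X T \<omega> * expZ a T \<omega> - x0 - (LBINT u:{0..T}. expZ a u \<omega> * b u \<omega>)" by (simp add: Rm_def)
      moreover have "(\<lambda>n. R n \<omega> - Rm \<omega>) \<longlonglongrightarrow> Rm \<omega> - Rm \<omega>"
        using elim unfolding calculation by (intro tendsto_diff tendsto_const)
      ultimately show ?case by simp
    qed
    have "vanishing_prob (\<lambda>n \<omega>. R n \<omega> - Rm \<omega>)"
      using Rn RmM lim' by (intro vanishing_prob_AE borel_measurable_diff) auto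
    from vanishing_prob_diff[OF R this] have "vanishing_prob (\<lambda>_. Rm)" by simp
    from vanishing_prob_const[OF this] lim' show ?thesis by eventually_elim simp
  qed
  \<comment> \<open>Countably many times share one null set, and the positive rationals are dense in
    the half line.\<close>
  have "AE \<omega> in M. \<forall>T\<in>\<rat>. 0 < T \<longrightarrow> X T \<omega> * expZ a T \<omega> = x0 + (LBINT u:{0..T}. expZ a u \<omega> * b u \<omega>)"
    using fixed by (subst AE_ball_countable[OF countable_rat]) auto
  with b expZ_continuous[of a] AE_space show ?thesis
  proof eventually_elim
    case (elim \<omega>)
    have Dc: "continuous_on {0..t} (\<lambda>t. expZ a t \<omega>)" for t by (rule continuous_on_subset[OF elim(2)]) auto
    have int: "set_integrable lborel {0..t} (\<lambda>u. expZ a u \<omega> * b u \<omega>)" if "0 \<le> t" for t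
      using elim(1) that by (intro set_integrable_mult_continuous[OF _ Dc]) auto
    define f where "f t = X t \<omega> * expZ a t \<omega> - (LBINT u:{0..t}. expZ a u \<omega> * b u \<omega>)" for t
    have "continuous_on {0..} (\<lambda>t. X t \<omega>)" using XA elim(3) by (auto simp: continuous_adapted_def)
    then have fc: "continuous_on {0..} f" unfolding f_def
      by (intro continuous_intros elim(2) set_integral_continuous_half_line int)
    have cl: "closure ({0<..} \<inter> \<rat>) = {0::real..}"
      by (subst closure_open_Int_superset) (auto simp: Rats_closure_real)
    have "f t = x0" if "0 \<le> t" for t
    proof (rule continuous_constant_on_closure[where S="{0<..} \<inter> \<rat>" and f=f and a=x0 and x=t])
      show "continuous_on (closure ({0<..} \<inter> \<rat>)) f" using fc unfolding cl .
      show "f x = x0" if "x \<in> {0<..} \<inter> \<rat>" for x using elim(4) that by (simp add: f_def)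
      show "t \<in> closure ({0<..} \<inter> \<rat>)" using \<open>0 \<le> t\<close> unfolding cl by simp
    qed
    with int show ?case by (auto simp: f_def algebra_simps)
  qed
qed

end

text \<open>With the weight exp (- 2 c2 t) the integral operator contracts the supremum by the
  factor 1/2. The a priori bound K serves only to make this supremum finite and does not enter the
  conclusion, so the estimate is uniform over the localizing events.\<close>

lemma gronwall_ennreal:
  fixes f :: "real \<Rightarrow> ennreal" and c1 c2 K T :: real
  assumes bdd: "\<And>t. t \<in> {0..T} \<Longrightarrow> f t \<le> ennreal K"
    and ineq: "\<And>t. t \<in> {0..T} \<Longrightarrow> f t \<le> ennreal c1 + ennreal c2 * (\<integral>\<^sup>+v\<in>{0..t}. f v \<partial>lborel)"
    and c: "0 \<le> c1" "0 < c2" and t: "t \<in> {0..T}"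
  shows "f t \<le> ennreal (2 * c1 * exp (2 * c2 * T))"
proof -
  \<comment> \<open>Integrating exp (l v) up to t costs a factor 1 / l, and c2 / l = 1 / 2.\<close>
  define l where "l = 2 * c2"
  define S where "S = (SUP t\<in>{0..T}. ennreal (exp (- l * t)) * f t)"
  have l: "0 < l" using c by (simp add: l_def)
  have e: "ennreal (exp (l * t)) * ennreal (exp (- l * t)) = 1" for t
    by (simp add: ennreal_mult'[symmetric] mult_exp_exp)
  have fS: "f t \<le> ennreal (exp (l * t)) * S" if "t \<in> {0..T}" for t
  proof -
    have "f t = ennreal (exp (l * t)) * (ennreal (exp (- l * t)) * f t)"
      unfolding mult.assoc[symmetric] e by simp
    also have "\<dots> \<le> ennreal (exp (l * t)) * S"
      unfolding S_def using that by (intro mult_left_mono SUP_upper) auto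
    finally show ?thesis .
  qed
  have "S \<le> ennreal \<bar>K\<bar>"
    unfolding S_def
  proof (rule SUP_least)
    fix t assume t: "t \<in> {0..T}"
    have "ennreal (exp (- l * t)) * f t \<le> ennreal 1 * ennreal \<bar>K\<bar>"
      using t l bdd[OF t] by (intro mult_mono ennreal_leI order_trans[OF bdd[OF t]]) auto
    then show "ennreal (exp (- l * t)) * f t \<le> ennreal \<bar>K\<bar>" by simp
  qed
  then have "S < \<top>" by (rule le_less_trans) simp
  then obtain s where s: "S = ennreal s" "0 \<le> s" by (cases S) auto
  have key: "ennreal (exp (- l * t)) * f t \<le> ennreal (c1 + s / 2)" if t: "t \<in> {0..T}" for t
  proof -
    have "(\<integral>\<^sup>+v\<in>{0..t}. f v \<partial>lborel) \<le> (\<integral>\<^sup>+v. ennreal (exp (l * v) * s) * indicator {0..t} v \<partial>lborel)"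
      using fS t s by (intro nn_integral_mono) (auto simp: indicator_def ennreal_mult')
    also have "\<dots> = ennreal (exp (l * t) * s / l - exp (l * 0) * s / l)"
      using t l s by (intro nn_integral_FTC_Icc) (auto intro!: derivative_eq_intros)
    also have "\<dots> \<le> ennreal (exp (l * t) * s / l)" using s l by (intro ennreal_leI) simp
    finally have "f t \<le> ennreal c1 + ennreal c2 * ennreal (exp (l * t) * s / l)"
      by (intro order_trans[OF ineq[OF t]] add_left_mono mult_left_mono) auto
    also have "\<dots> = ennreal (c1 + c2 * (exp (l * t) * s / l))"
      using c s l by (simp add: ennreal_mult'[symmetric] ennreal_plus[symmetric] del: ennreal_plus)
    also have "c2 * (exp (l * t) * s / l) = exp (l * t) * (s / 2)" using c by (simp add: l_def)
    finally have "ennreal (exp (- l * t)) * f t \<le> ennreal (exp (- l * t)) * ennreal (c1 + exp (l * t) * (s / 2))"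
      by (rule mult_left_mono) simp
    also have "\<dots> = ennreal (exp (- l * t) * c1 + (exp (- l * t) * exp (l * t)) * (s / 2))"
      by (simp add: ennreal_mult'[symmetric] distrib_left mult.assoc)
    also have "exp (- l * t) * exp (l * t) = 1" by (simp add: mult_exp_exp)
    also have "ennreal (exp (- l * t) * c1 + 1 * (s / 2)) \<le> ennreal (c1 + s / 2)"
    proof (rule ennreal_leI)
      have "exp (- l * t) * c1 \<le> 1 * c1" using t l c by (intro mult_right_mono) auto
      then show "exp (- l * t) * c1 + 1 * (s / 2) \<le> c1 + s / 2" by simp
    qed
    finally show ?thesis .
  qed
  have "S \<le> ennreal (c1 + s / 2)" unfolding S_def by (rule SUP_least) (rule key)
  then have "s \<le> c1 + s / 2" using s c ennreal_le_iff[of "c1 + s / 2" s] by (simp del: ennreal_plus)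
  then have "s \<le> 2 * c1" by simp
  have "f t \<le> ennreal (exp (l * t)) * ennreal s" using fS[OF t] s by simp
  also have "\<dots> \<le> ennreal (exp (l * T)) * ennreal (2 * c1)"
    using t l \<open>s \<le> 2 * c1\<close> by (intro mult_mono ennreal_leI) auto
  also have "\<dots> = ennreal (2 * c1 * exp (2 * c2 * T))"
    using c by (simp add: ennreal_mult'[symmetric] l_def mult_ac)
  finally show ?thesis .
qed

section \<open>The income equation\<close>

text \<open>\<open>\<rho>\<close> stands for r + \<delta>. Of \<phi> and of the history
  integrability over the delay window is recorded, since the estimates below are convolution bounds
  in L1; in the theorem it follows from square integrability.\<close>

locale income_process = brownian M Z F
  for M :: "'w measure" and Z :: "real \<Rightarrow> 'w \<Rightarrow> real^'n" and F +
  fixes \<rho> \<mu>y d x0 \<beta> :: real and \<kappa> \<sigma>y :: "real^'n" and \<phi> x1 :: "real \<Rightarrow> real"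
    and y \<xi> :: "real \<Rightarrow> 'w \<Rightarrow> real"
  assumes d_pos: "0 < d"
    and phi_int: "set_integrable lborel {-d<..<0} \<phi>"
    and hist_int: "set_integrable lborel {-d<..<0} x1"
    and y_hist: "\<And>\<omega> \<zeta>. \<omega> \<in> space M \<Longrightarrow> \<zeta> \<in> {-d..<0} \<Longrightarrow> y \<zeta> \<omega> = x1 \<zeta>"
    and y_ito: "has_ito_differential M F Z y x0
       (\<lambda>s \<omega>. \<mu>y * y s \<omega> + (LBINT \<zeta>:{-d<..<0}. \<phi> \<zeta> * y (s + \<zeta>) \<omega>)) (\<lambda>s \<omega>. y s \<omega> *\<^sub>R \<sigma>y)"
    and xi_ito: "has_ito_differential M F Z \<xi> 1 (\<lambda>s \<omega>. - \<xi> s \<omega> * \<rho>) (\<lambda>s \<omega>. - \<xi> s \<omega> *\<^sub>R \<kappa>)"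
    and beta_eq: "\<beta> = \<rho> - \<mu>y + \<sigma>y \<bullet> \<kappa>" and beta_pos: "0 < \<beta>"
begin

text \<open>The explicit solution of the equation for the state-price density, a geometric Brownian
  motion. It is positive everywhere, and the given process agrees with it almost surely by
  \<open>xi_explicit\<close>.\<close>

definition xi :: "real \<Rightarrow> 'w \<Rightarrow> real" where
  "xi t \<omega> = exp (- (\<kappa> \<bullet> Z t \<omega>) - (\<rho> + (norm \<kappa>)\<^sup>2 / 2) * t)"

text \<open>The set of discontinuous paths of Z need not be measurable. A null set containing it is
  fixed instead; by augmentation it belongs to every \<open>F t\<close>, so modifying a process
  there does not spoil adaptedness.\<close>

definition discontinuous :: "'w set" where
  "discontinuous = (SOME N. N \<in> null_sets M \<and> (\<forall>\<omega>\<in>space M - N. continuous_on {0..} (\<lambda>t. Z t \<omega>)))"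

text \<open>\<open>es\<close> is the reciprocal of the fundamental solution of the undelayed income equation,
  set to \<open>0\<close> on a null set in order to have continuous paths everywhere, and \<open>gG\<close> is the
  fundamental solution multiplied by the state-price density.\<close>

definition es :: "real \<Rightarrow> 'w \<Rightarrow> real" where
  "es t \<omega> = (if \<omega> \<in> discontinuous then 0 else exp (- \<mu>y * t) * expZ \<sigma>y t \<omega>)"

definition gG :: "real \<Rightarrow> 'w \<Rightarrow> real" where
  "gG t \<omega> = exp ((\<sigma>y - \<kappa>) \<bullet> Z t \<omega> + (\<mu>y - (norm \<sigma>y)\<^sup>2 / 2 - \<rho> - (norm \<kappa>)\<^sup>2 / 2) * t)"

text \<open>The values of \<phi> outside the open delay window are arbitrary; the cut-off is Borel
  and integrable over the whole line, which allows Fubini without restricted domains.\<close>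

definition phi0 :: "real \<Rightarrow> real" where
  "phi0 \<zeta> = indicator {-d<..<0} \<zeta> * \<phi> \<zeta>"

text \<open>Income joined with its history, and 0 up to time - d. In contrast to y at arbitrary
  negative times it is jointly measurable in time and \<omega>.\<close>

definition yh :: "real \<Rightarrow> 'w \<Rightarrow> real" where
  "yh v \<omega> = (if 0 \<le> v then y v \<omega> else indicator {-d<..<0} v * x1 v)"

definition drift :: "real \<Rightarrow> 'w \<Rightarrow> real" where
  "drift u \<omega> = (LBINT \<zeta>. phi0 \<zeta> * yh (u + \<zeta>) \<omega>)"

lemma discontinuous_null: "discontinuous \<in> null_sets M" and not_discontinuous: "\<omega> \<in> space M \<Longrightarrow> \<omega> \<notin> discontinuous \<Longrightarrow> continuous_on {0..} (\<lambda>t. Z t \<omega>)"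
proof -
  obtain N where "N \<in> null_sets M" "{\<omega>\<in>space M. \<not> continuous_on {0..} (\<lambda>t. Z t \<omega>)} \<subseteq> N"
    using Z_continuous by (auto elim!: AE_E)
  then have "\<exists>N. N \<in> null_sets M \<and> (\<forall>\<omega>\<in>space M - N. continuous_on {0..} (\<lambda>t. Z t \<omega>))" by blast
  then have *: "discontinuous \<in> null_sets M \<and> (\<forall>\<omega>\<in>space M - discontinuous. continuous_on {0..} (\<lambda>t. Z t \<omega>))"
    unfolding discontinuous_def by (rule someI_ex)
  then show "discontinuous \<in> null_sets M" by blast
  show "\<omega> \<in> space M \<Longrightarrow> \<omega> \<notin> discontinuous \<Longrightarrow> continuous_on {0..} (\<lambda>t. Z t \<omega>)" using * by blast
qed

lemma AE_not_discontinuous: "AE \<omega> in M. \<omega> \<notin> discontinuous"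
  using discontinuous_null by (rule AE_not_in)

lemma es_nonneg: "0 \<le> es t \<omega>"
  by (simp add: es_def expZ_def)

lemma gG_pos: "0 < gG t \<omega>"
  by (simp add: gG_def)

lemma xi_pos: "0 < xi t \<omega>"
  by (simp add: xi_def)

lemma y_ca: "continuous_adapted M F y" and xi_ca: "continuous_adapted M F \<xi>"
  using y_ito xi_ito by (auto simp: has_ito_differential_def)

lemma y_F: "0 \<le> t \<Longrightarrow> y t \<in> borel_measurable (F t)" and xi_F: "0 \<le> t \<Longrightarrow> \<xi> t \<in> borel_measurable (F t)"
  using y_ca xi_ca by (auto simp: continuous_adapted_def)

lemma es_F: "0 \<le> t \<Longrightarrow> es t \<in> borel_measurable (F t)"
  unfolding es_def[abs_def]
  using null_in_F[OF discontinuous_null, of t] sets.Int_space_eq2[OF null_in_F[OF discontinuous_null, of t]] expZ_measurable[of t \<sigma>y]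
  by (intro measurable_If_set) auto

lemma gG_M: "0 \<le> t \<Longrightarrow> gG t \<in> borel_measurable M"
proof -
  assume "0 \<le> t"
  note [measurable] = Z_measurable_M[OF this]
  show ?thesis unfolding gG_def[abs_def] by measurable
qed

lemma es_continuous: "\<omega> \<in> space M \<Longrightarrow> continuous_on {0..} (\<lambda>t. es t \<omega>)"
  by (cases "\<omega> \<in> discontinuous") (auto simp: es_def expZ_def intro!: continuous_intros not_discontinuous)

lemma clamped_measurable:
  fixes X :: "real \<Rightarrow> 'w \<Rightarrow> real"
  assumes "\<And>t. 0 \<le> t \<Longrightarrow> X t \<in> borel_measurable M" "\<And>\<omega>. \<omega> \<in> space M \<Longrightarrow> continuous_on {0..} (\<lambda>t. X t \<omega>)"
  shows "(\<lambda>p. X (max 0 (snd p)) (fst p)) \<in> borel_measurable (M \<Otimes>\<^sub>M borel)"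
  using assms by (intro caratheodory_measurable[where f="\<lambda>t. X (max 0 t)"] continuous_on_clamped) auto

lemma phi0_measurable [measurable]: "phi0 \<in> borel_measurable borel"
  and phi0_integrable: "integrable lborel phi0"
  using phi_int unfolding set_integrable_def phi0_def[abs_def] by auto

lemma hist_integrable: "integrable lborel (\<lambda>v. indicator {-d<..<0} v * x1 v)"
  using hist_int unfolding set_integrable_def by auto

lemma hist_measurable [measurable]: "(\<lambda>v. indicator {-d<..<0} v * x1 v) \<in> borel_measurable borel"
  using hist_integrable by auto

lemma yh_measurable: "(\<lambda>p. yh (snd p) (fst p)) \<in> borel_measurable (M \<Otimes>\<^sub>M borel)"
proof -
  have [measurable]: "(\<lambda>p. y (max 0 (snd p)) (fst p)) \<in> borel_measurable (M \<Otimes>\<^sub>M borel)"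
    by (rule continuous_adapted_measurable[OF y_ca])
  have "(\<lambda>p. if 0 \<le> snd p then y (max 0 (snd p)) (fst p) else indicator {-d<..<0} (snd p) * x1 (snd p))
     \<in> borel_measurable (M \<Otimes>\<^sub>M borel)" by measurable
  also have "(\<lambda>p. if 0 \<le> snd p then y (max 0 (snd p)) (fst p) else indicator {-d<..<0} (snd p) * x1 (snd p)) =
     (\<lambda>p. yh (snd p) (fst p))" by (auto simp: yh_def fun_eq_iff)
  finally show ?thesis .
qed

lemma yh_F: "yh v \<in> borel_measurable (F (max v 0))"
  using y_F[of v] by (cases "0 \<le> v") (auto simp: yh_def[abs_def] max_def)

lemma drift_eq: "(LBINT \<zeta>:{-d<..<0}. \<phi> \<zeta> * y (u + \<zeta>) \<omega>) = drift u \<omega>" if "\<omega> \<in> space M" "0 \<le> u"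
  unfolding drift_def set_lebesgue_integral_def
proof (rule Bochner_Integration.integral_cong[OF refl])
  fix \<zeta>
  show "indicator {-d<..<0} \<zeta> *\<^sub>R (\<phi> \<zeta> * y (u + \<zeta>) \<omega>) = phi0 \<zeta> * yh (u + \<zeta>) \<omega>"
  proof (cases "\<zeta> \<in> {-d<..<0} \<and> u + \<zeta> < 0")
    case True
    then have "u + \<zeta> \<in> {-d..<0}" "u + \<zeta> \<in> {-d<..<0}" using that(2) by auto
    then show ?thesis using True y_hist[OF that(1), of "u + \<zeta>"] by (simp add: phi0_def yh_def)
  next
    case False
    then show ?thesis by (auto simp: phi0_def yh_def indicator_def)
  qed
qed

text \<open>With a = - \<kappa> the exponential formula leaves the noiseless equation f' = - \<rho>
  f for the product of \<xi> with \<open>expZ (- \<kappa>)\<close>, solved by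
  \<open>linear_integral_equation\<close> with inhomogeneity 0.\<close>

lemma xi_explicit: "AE \<omega> in M. \<forall>t\<ge>0. \<xi> t \<omega> = xi t \<omega>"
proof -
  have "has_ito_differential M F Z \<xi> 1 (\<lambda>s \<omega>. - \<xi> s \<omega> * \<rho>) (\<lambda>s \<omega>. \<xi> s \<omega> *\<^sub>R (- \<kappa>))"
    using xi_ito by simp
  from exponential_ito_formula[OF this] show ?thesis
  proof eventually_elim
    case (elim \<omega>)
    show ?case
    proof (intro allI impI)
      fix t :: real assume t: "0 \<le> t"
      have *: "expZ (- \<kappa>) u \<omega> * (- \<xi> u \<omega> * \<rho>) = - \<rho> * (\<xi> u \<omega> * expZ (- \<kappa>) u \<omega>) + 0" for u by simp
      have "exp (- (- \<rho>) * t) * (\<xi> t \<omega> * expZ (- \<kappa>) t \<omega>) = 1 + (LBINT u:{0..t}. exp (- (- \<rho>) * u) * 0)"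
        using elim unfolding * by (intro linear_integral_equation(2)[OF _ _ t]) auto
      then have 1: "\<xi> t \<omega> * (exp (\<rho> * t) * expZ (- \<kappa>) t \<omega>) = 1" by (simp add: mult_ac)
      have 2: "xi t \<omega> * (exp (\<rho> * t) * expZ (- \<kappa>) t \<omega>) = 1"
        by (simp add: xi_def expZ_def mult_exp_exp algebra_simps)
      have 3: "exp (\<rho> * t) * expZ (- \<kappa>) t \<omega> \<noteq> 0" by (simp add: expZ_def)
      show "\<xi> t \<omega> = xi t \<omega>"
        using 1 2 3 by (metis mult_right_cancel)
    qed
  qed
qed

text \<open>Variation of constants: \<open>expZ \<sigma>y\<close> removes the noise, the factor exp
  (- \<mu>y t) the undelayed drift, and only the delayed drift is left under the integral.\<close>

lemma income_identity0:
  "AE \<omega> in M. \<forall>t\<ge>0. set_integrable lborel {0..t} (\<lambda>u. es u \<omega> * drift u \<omega>) \<and>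
     y t \<omega> * es t \<omega> = x0 + (LBINT u:{0..t}. es u \<omega> * drift u \<omega>)"
  using exponential_ito_formula[OF y_ito] AE_not_discontinuous AE_space
proof eventually_elim
  case (elim \<omega>)
  have dr: "(LBINT \<zeta>:{-d<..<0}. \<phi> \<zeta> * y (u + \<zeta>) \<omega>) = drift u \<omega>" if "0 \<le> u" for u
    using drift_eq elim(3) that by blast
  have *: "expZ \<sigma>y u \<omega> * (\<mu>y * y u \<omega> + (LBINT \<zeta>:{-d<..<0}. \<phi> \<zeta> * y (u + \<zeta>) \<omega>)) =
      \<mu>y * (y u \<omega> * expZ \<sigma>y u \<omega>) + expZ \<sigma>y u \<omega> * (LBINT \<zeta>:{-d<..<0}. \<phi> \<zeta> * y (u + \<zeta>) \<omega>)" for u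
    by (simp add: algebra_simps)
  show ?case
  proof (intro allI impI)
    fix t :: real assume t: "0 \<le> t"
    have e: "set_integrable lborel {0..t} (\<lambda>u. \<mu>y * (y u \<omega> * expZ \<sigma>y u \<omega>) + expZ \<sigma>y u \<omega> * (LBINT \<zeta>:{-d<..<0}. \<phi> \<zeta> * y (u + \<zeta>) \<omega>))"
      "y t \<omega> * expZ \<sigma>y t \<omega> = x0 + (LBINT u:{0..t}. \<mu>y * (y u \<omega> * expZ \<sigma>y u \<omega>) + expZ \<sigma>y u \<omega> * (LBINT \<zeta>:{-d<..<0}. \<phi> \<zeta> * y (u + \<zeta>) \<omega>))"
      if "0 \<le> t" for t
      using elim(1) that unfolding * by blast+
    have "set_integrable lborel {0..t} (\<lambda>u. exp (- \<mu>y * u) * (expZ \<sigma>y u \<omega> * (LBINT \<zeta>:{-d<..<0}. \<phi> \<zeta> * y (u + \<zeta>) \<omega>)))"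
      and "exp (- \<mu>y * t) * (y t \<omega> * expZ \<sigma>y t \<omega>) =
         x0 + (LBINT u:{0..t}. exp (- \<mu>y * u) * (expZ \<sigma>y u \<omega> * (LBINT \<zeta>:{-d<..<0}. \<phi> \<zeta> * y (u + \<zeta>) \<omega>)))"
      using linear_integral_equation[where f="\<lambda>t. y t \<omega> * expZ \<sigma>y t \<omega>" and m=\<mu>y
          and \<Psi>="\<lambda>u. expZ \<sigma>y u \<omega> * (LBINT \<zeta>:{-d<..<0}. \<phi> \<zeta> * y (u + \<zeta>) \<omega>)", OF e t] by blast+
    moreover have "set_integrable lborel {0..t} (\<lambda>u. exp (- \<mu>y * u) * (expZ \<sigma>y u \<omega> * (LBINT \<zeta>:{-d<..<0}. \<phi> \<zeta> * y (u + \<zeta>) \<omega>)))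
        \<longleftrightarrow> set_integrable lborel {0..t} (\<lambda>u. es u \<omega> * drift u \<omega>)"
      using elim(2) dr by (intro set_integrable_cong) (auto simp: es_def)
    moreover have "(LBINT u:{0..t}. exp (- \<mu>y * u) * (expZ \<sigma>y u \<omega> * (LBINT \<zeta>:{-d<..<0}. \<phi> \<zeta> * y (u + \<zeta>) \<omega>)))
        = (LBINT u:{0..t}. es u \<omega> * drift u \<omega>)"
      using elim(2) dr by (intro set_lebesgue_integral_cong) (auto simp: es_def)
    ultimately show "set_integrable lborel {0..t} (\<lambda>u. es u \<omega> * drift u \<omega>) \<and>
        y t \<omega> * es t \<omega> = x0 + (LBINT u:{0..t}. es u \<omega> * drift u \<omega>)"
      using elim(2) by (simp add: es_def mult_ac)
  qed
qed

lemma income_identity: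
  "AE \<omega> in M. \<forall>s t. 0 \<le> s \<longrightarrow> s \<le> t \<longrightarrow> set_integrable lborel {s<..t} (\<lambda>u. es u \<omega> * drift u \<omega>) \<and>
     y t \<omega> * es t \<omega> = y s \<omega> * es s \<omega> + (LBINT u:{s<..t}. es u \<omega> * drift u \<omega>)"
  using income_identity0
proof eventually_elim
  case (elim \<omega>)
  show ?case
  proof (intro allI impI)
    fix s t :: real assume st: "0 \<le> s" "s \<le> t"
    have t: "set_integrable lborel {0..t} (\<lambda>u. es u \<omega> * drift u \<omega>)" using elim st by auto
    have "set_integrable lborel {s<..t} (\<lambda>u. es u \<omega> * drift u \<omega>)"
      using st by (intro set_integrable_subset[OF t]) auto
    moreover have "y t \<omega> * es t \<omega> = x0 + (LBINT u:{0..t}. es u \<omega> * drift u \<omega>)"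
      "y s \<omega> * es s \<omega> = x0 + (LBINT u:{0..s}. es u \<omega> * drift u \<omega>)" using elim st by auto
    ultimately show "set_integrable lborel {s<..t} (\<lambda>u. es u \<omega> * drift u \<omega>) \<and>
       y t \<omega> * es t \<omega> = y s \<omega> * es s \<omega> + (LBINT u:{s<..t}. es u \<omega> * drift u \<omega>)"
      using set_integral_diff_interval[OF t st] by simp
  qed
qed

section \<open>Conditional means of the state-price density and of the weighted fundamental
  solution\<close>

lemma exp_shift_moment:
  fixes b :: "real^'n"
  assumes "0 \<le> u" "u < t"
  shows "integrable M (\<lambda>\<omega>. exp (b \<bullet> dZ u t \<omega> + k))"
    "expectation (\<lambda>\<omega>. exp (b \<bullet> dZ u t \<omega> + k)) = exp ((norm b)\<^sup>2 * (t - u) / 2 + k)"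
  using dZ_exp[OF assms, of b] by (simp_all add: exp_add)

lemma nn_shift:
  fixes b :: "real^'n"
  assumes ut: "0 \<le> u" "u \<le> t" and w: "w \<in> borel_measurable (F u)"
  shows "(\<integral>\<^sup>+\<omega>. w \<omega> * ennreal (exp (b \<bullet> dZ u t \<omega> + k)) \<partial>M) = ennreal (exp ((norm b)\<^sup>2 * (t - u) / 2 + k)) * (\<integral>\<^sup>+\<omega>. w \<omega> \<partial>M)"
proof (cases "u = t")
  case True
  then show ?thesis using F_imp_M[OF w] by (simp add: nn_integral_multc mult.commute)
next
  case False
  then have ut': "u < t" using ut by simp
  have "(\<integral>\<^sup>+\<omega>. w \<omega> * ennreal (exp (b \<bullet> dZ u t \<omega> + k)) \<partial>M) = (\<integral>\<^sup>+\<omega>. w \<omega> \<partial>M) * (\<integral>\<^sup>+\<omega>. ennreal (exp (b \<bullet> dZ u t \<omega> + k)) \<partial>M)"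
    by (rule nn_expectation_dZ_mult[where G="\<lambda>x. ennreal (exp (b \<bullet> x + k))", OF ut(1) ut' w]) measurable
  also have "(\<integral>\<^sup>+\<omega>. ennreal (exp (b \<bullet> dZ u t \<omega> + k)) \<partial>M) = ennreal (exp ((norm b)\<^sup>2 * (t - u) / 2 + k))"
    using exp_shift_moment[OF ut(1) ut'] by (subst nn_integral_eq_integral) auto
  finally show ?thesis by (simp add: mult.commute)
qed

lemma real_shift:
  fixes b :: "real^'n"
  assumes ut: "0 \<le> u" "u \<le> t" and w: "w \<in> borel_measurable (F u)" and int: "integrable M w"
  shows "integrable M (\<lambda>\<omega>. w \<omega> * exp (b \<bullet> dZ u t \<omega> + k))"
   "expectation (\<lambda>\<omega>. w \<omega> * exp (b \<bullet> dZ u t \<omega> + k)) = exp ((norm b)\<^sup>2 * (t - u) / 2 + k) * expectation w"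
proof -
  have "integrable M (\<lambda>\<omega>. w \<omega> * exp (b \<bullet> dZ u t \<omega> + k)) \<and>
   expectation (\<lambda>\<omega>. w \<omega> * exp (b \<bullet> dZ u t \<omega> + k)) = exp ((norm b)\<^sup>2 * (t - u) / 2 + k) * expectation w"
  proof (cases "u = t")
    case True
    then show ?thesis using int by (simp add: mult.commute)
  next
    case False
    then have ut': "u < t" using ut by simp
    have "(\<lambda>x. exp (b \<bullet> x + k)) \<in> borel_measurable borel" by measurable
    note e = expectation_dZ_mult[where G="\<lambda>x. exp (b \<bullet> x + k)", OF ut(1) ut' w this int exp_shift_moment(1)[OF ut(1) ut']]
    show ?thesis using e exp_shift_moment(2)[OF ut(1) ut'] by (simp add: mult.commute)
  qed
  then show "integrable M (\<lambda>\<omega>. w \<omega> * exp (b \<bullet> dZ u t \<omega> + k))"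
   "expectation (\<lambda>\<omega>. w \<omega> * exp (b \<bullet> dZ u t \<omega> + k)) = exp ((norm b)\<^sup>2 * (t - u) / 2 + k) * expectation w" by auto
qed

lemma xi_step: "xi t \<omega> = xi u \<omega> * exp ((- \<kappa>) \<bullet> dZ u t \<omega> + (- (\<rho> + (norm \<kappa>)\<^sup>2 / 2) * (t - u)))"
  unfolding xi_def exp_add[symmetric] by (simp add: inner_diff_right algebra_simps diff_divide_distrib)

lemma xi_step_exponent: "(norm (- \<kappa>))\<^sup>2 * (t - u) / 2 + (- (\<rho> + (norm \<kappa>)\<^sup>2 / 2) * (t - u)) = - \<rho> * (t - u)"
proof -
  define n where "n = (norm \<kappa>)\<^sup>2 / 2"
  then have "(norm (- \<kappa>))\<^sup>2 = 2 * n" by simp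
  then show ?thesis unfolding n_def[symmetric] by (simp add: algebra_simps diff_divide_distrib)
qed

lemma growth_step: "\<omega> \<notin> discontinuous \<Longrightarrow> gG t \<omega> * es u \<omega> = xi u \<omega> *
    exp ((\<sigma>y - \<kappa>) \<bullet> dZ u t \<omega> + (\<mu>y - (norm \<sigma>y)\<^sup>2 / 2 - \<rho> - (norm \<kappa>)\<^sup>2 / 2) * (t - u))"
  by (simp add: gG_def es_def expZ_def xi_def exp_add[symmetric] inner_diff_right inner_diff_left algebra_simps
      diff_divide_distrib add_divide_distrib)

text \<open>The origin of \<beta>. Half of |\<sigma>y - \<kappa>|^2 cancels the corrections of both
  exponentials and leaves - \<sigma>y . \<kappa>, so the fundamental solution weighted with the
  state-price density decays in conditional mean at the rate \<rho> - \<mu>y + \<sigma>y .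
  \<kappa>.\<close>

lemma growth_step_exponent:
  "(norm (\<sigma>y - \<kappa>))\<^sup>2 * (t - u) / 2 + (\<mu>y - (norm \<sigma>y)\<^sup>2 / 2 - \<rho> - (norm \<kappa>)\<^sup>2 / 2) * (t - u) = - \<beta> * (t - u)"
proof -
  have "(norm (\<sigma>y - \<kappa>))\<^sup>2 = (norm \<sigma>y)\<^sup>2 + (norm \<kappa>)\<^sup>2 - 2 * (\<sigma>y \<bullet> \<kappa>)"
    by (simp add: power2_norm_eq_inner inner_diff_left inner_diff_right inner_commute)
  then show ?thesis by (simp only:) (simp add: beta_eq algebra_simps diff_divide_distrib add_divide_distrib)
qed

text \<open>The weak form of the martingale property of exp (\<rho> t) \<xi>(t), tested with
  nonnegative \<open>F u\<close>-measurable weights. The increment of Z after u is independent of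
  the weight and of \<xi>(u).\<close>

lemma nn_xi_shift:
  assumes ut: "0 \<le> u" "u \<le> t" and w: "w \<in> borel_measurable (F u)"
  shows "(\<integral>\<^sup>+\<omega>. w \<omega> * ennreal (\<xi> t \<omega>) \<partial>M) = ennreal (exp (- \<rho> * (t - u))) * (\<integral>\<^sup>+\<omega>. w \<omega> * ennreal (\<xi> u \<omega>) \<partial>M)"
proof -
  have "(\<integral>\<^sup>+\<omega>. w \<omega> * ennreal (\<xi> t \<omega>) \<partial>M) =
    (\<integral>\<^sup>+\<omega>. (w \<omega> * ennreal (\<xi> u \<omega>)) * ennreal (exp ((- \<kappa>) \<bullet> dZ u t \<omega> + (- (\<rho> + (norm \<kappa>)\<^sup>2 / 2) * (t - u)))) \<partial>M)"
  proof (rule nn_integral_cong_AE)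
    show "AE \<omega> in M. w \<omega> * ennreal (\<xi> t \<omega>) =
       (w \<omega> * ennreal (\<xi> u \<omega>)) * ennreal (exp ((- \<kappa>) \<bullet> dZ u t \<omega> + (- (\<rho> + (norm \<kappa>)\<^sup>2 / 2) * (t - u))))"
      using xi_explicit
    proof eventually_elim
      case (elim \<omega>)
      then have "\<xi> t \<omega> = \<xi> u \<omega> * exp ((- \<kappa>) \<bullet> dZ u t \<omega> + (- (\<rho> + (norm \<kappa>)\<^sup>2 / 2) * (t - u)))" "0 < \<xi> u \<omega>"
        using ut xi_step[of t \<omega> u] xi_pos[of u \<omega>] by auto
      then show ?case by (simp add: ennreal_mult mult.assoc)
    qed
  qed
  also have "\<dots> = ennreal (exp (- \<rho> * (t - u))) * (\<integral>\<^sup>+\<omega>. w \<omega> * ennreal (\<xi> u \<omega>) \<partial>M)"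
    using w xi_F[OF ut(1)] by (subst nn_shift[OF ut]) (auto simp only: xi_step_exponent intro!: borel_measurable_times_ennreal measurable_compose[OF _ measurable_ennreal])
  finally show ?thesis .
qed

lemma nn_growth_shift:
  assumes ut: "0 \<le> u" "u \<le> t" and w: "w \<in> borel_measurable (F u)"
  shows "(\<integral>\<^sup>+\<omega>. w \<omega> * ennreal (gG t \<omega> * es u \<omega>) \<partial>M) = ennreal (exp (- \<beta> * (t - u))) * (\<integral>\<^sup>+\<omega>. w \<omega> * ennreal (\<xi> u \<omega>) \<partial>M)"
proof -
  have "(\<integral>\<^sup>+\<omega>. w \<omega> * ennreal (gG t \<omega> * es u \<omega>) \<partial>M) =
    (\<integral>\<^sup>+\<omega>. (w \<omega> * ennreal (\<xi> u \<omega>)) * ennreal (exp ((\<sigma>y - \<kappa>) \<bullet> dZ u t \<omega> + (\<mu>y - (norm \<sigma>y)\<^sup>2 / 2 - \<rho> - (norm \<kappa>)\<^sup>2 / 2) * (t - u))) \<partial>M)"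
  proof (rule nn_integral_cong_AE)
    show "AE \<omega> in M. w \<omega> * ennreal (gG t \<omega> * es u \<omega>) =
       (w \<omega> * ennreal (\<xi> u \<omega>)) * ennreal (exp ((\<sigma>y - \<kappa>) \<bullet> dZ u t \<omega> + (\<mu>y - (norm \<sigma>y)\<^sup>2 / 2 - \<rho> - (norm \<kappa>)\<^sup>2 / 2) * (t - u)))"
      using xi_explicit AE_not_discontinuous
    proof eventually_elim
      case (elim \<omega>)
      then have "\<xi> u \<omega> = xi u \<omega>" using ut by auto
      then show ?case using growth_step[OF elim(2), of t u] xi_pos[of u \<omega>] by (simp add: ennreal_mult mult.assoc)
    qed
  qed
  also have "\<dots> = ennreal (exp (- \<beta> * (t - u))) * (\<integral>\<^sup>+\<omega>. w \<omega> * ennreal (\<xi> u \<omega>) \<partial>M)"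
    using w xi_F[OF ut(1)] by (subst nn_shift[OF ut]) (auto simp only: growth_step_exponent intro!: borel_measurable_times_ennreal measurable_compose[OF _ measurable_ennreal])
  finally show ?thesis .
qed

lemma nn_xi_zero: "(\<integral>\<^sup>+\<omega>. ennreal (\<xi> 0 \<omega>) \<partial>M) = 1"
proof -
  have "AE \<omega> in M. ennreal (\<xi> 0 \<omega>) = 1"
    using xi_explicit Z_zero by eventually_elim (simp add: xi_def)
  then have "(\<integral>\<^sup>+\<omega>. ennreal (\<xi> 0 \<omega>) \<partial>M) = (\<integral>\<^sup>+\<omega>. 1 \<partial>M)" by (rule nn_integral_cong_AE)
  then show ?thesis by (simp add: emeasure_space_1)
qed

lemma nn_xi: "0 \<le> t \<Longrightarrow> (\<integral>\<^sup>+\<omega>. ennreal (\<xi> t \<omega>) \<partial>M) = ennreal (exp (- \<rho> * t))"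
  using nn_xi_shift[of 0 t "\<lambda>_. 1"] nn_xi_zero by simp

text \<open>The indicator of \<open>Bset n v\<close> is adapted and decreasing in \<open>v\<close>; it replaces a localizing
  sequence of stopping times.\<close>

definition Bset :: "nat \<Rightarrow> real \<Rightarrow> 'w set" where
  "Bset n v = {\<omega>\<in>space M. \<forall>q::rat. 0 \<le> q \<and> real_of_rat q \<le> v \<longrightarrow> \<bar>y (real_of_rat q) \<omega>\<bar> \<le> real n}"

lemma Bset_F: "Bset n v \<in> sets (F (max v 0))"
proof -
  have "{\<omega>\<in>space (F (max v 0)). 0 \<le> q \<and> real_of_rat q \<le> v \<longrightarrow> \<bar>y (real_of_rat q) \<omega>\<bar> \<le> real n} \<in> sets (F (max v 0))" for q :: rat
  proof (cases "0 \<le> q \<and> real_of_rat q \<le> v")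
    case True
    then have [measurable]: "y (real_of_rat q) \<in> borel_measurable (F (max v 0))"
      by (intro F_measurable_mono[OF y_F]) auto
    have "{\<omega>\<in>space (F (max v 0)). \<bar>y (real_of_rat q) \<omega>\<bar> \<le> real n} \<in> sets (F (max v 0))" by measurable
    then show ?thesis using True by simp
  next
    case False
    then have "{\<omega>\<in>space (F (max v 0)). 0 \<le> q \<and> real_of_rat q \<le> v \<longrightarrow> \<bar>y (real_of_rat q) \<omega>\<bar> \<le> real n} = space (F (max v 0))"
      by blast
    then show ?thesis by (simp only: sets.top)
  qed
  then have "{\<omega>\<in>space (F (max v 0)). \<forall>q::rat. 0 \<le> q \<and> real_of_rat q \<le> v \<longrightarrow> \<bar>y (real_of_rat q) \<omega>\<bar> \<le> real n} \<in> sets (F (max v 0))"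
    by (rule sets.sets_Collect_countable_All)
  then show ?thesis unfolding Bset_def space_F .
qed

lemma Bset_measurable: "(\<lambda>p. indicator (Bset n (snd p)) (fst p) :: ennreal) \<in> borel_measurable (M \<Otimes>\<^sub>M borel)"
proof -
  have "{p\<in>space (M \<Otimes>\<^sub>M borel). \<forall>q::rat. 0 \<le> q \<and> real_of_rat q \<le> snd p \<longrightarrow> \<bar>y (real_of_rat q) (fst p)\<bar> \<le> real n} \<in> sets (M \<Otimes>\<^sub>M borel)"
  proof (rule sets.sets_Collect_countable_All)
    fix q :: rat
    show "{p\<in>space (M \<Otimes>\<^sub>M borel). 0 \<le> q \<and> real_of_rat q \<le> snd p \<longrightarrow> \<bar>y (real_of_rat q) (fst p)\<bar> \<le> real n} \<in> sets (M \<Otimes>\<^sub>M borel)"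
    proof (cases "0 \<le> q")
      case True
      then have [measurable]: "y (real_of_rat q) \<in> borel_measurable M" by (intro F_imp_M[OF y_F]) simp
      show ?thesis by measurable
    qed simp
  qed
  then have "(indicator {p\<in>space (M \<Otimes>\<^sub>M borel). \<forall>q::rat. 0 \<le> q \<and> real_of_rat q \<le> snd p \<longrightarrow> \<bar>y (real_of_rat q) (fst p)\<bar> \<le> real n} :: _ \<Rightarrow> ennreal)
     \<in> borel_measurable (M \<Otimes>\<^sub>M borel)" by (rule borel_measurable_indicator)
  then show ?thesis
    by (rule measurable_cong[THEN iffD1, rotated]) (auto simp: Bset_def indicator_def space_pair_measure)
qed

lemma Bset_antimono: "v \<le> v' \<Longrightarrow> Bset n v' \<subseteq> Bset n v"
  unfolding Bset_def by force

text \<open>\<open>Bset\<close> tests rational times only, which keeps it measurable; continuity of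
  the paths extends the bound to real times. For v = 0 there are no rationals in the open interval
  below v, so time 0 itself is used.\<close>

lemma Bset_bound: "\<omega> \<in> Bset n v \<Longrightarrow> 0 \<le> v \<Longrightarrow> \<bar>y v \<omega>\<bar> \<le> real n"
proof -
  assume \<omega>: "\<omega> \<in> Bset n v" and v: "0 \<le> v"
  then have sp: "\<omega> \<in> space M" by (simp add: Bset_def)
  show ?thesis
  proof (cases "v = 0")
    case True
    then show ?thesis using \<omega> by (auto simp: Bset_def dest: spec[of _ 0])
  next
    case False
    then have v0: "0 < v" using v by simp
    have cl: "closure ({0<..<v} \<inter> \<rat>) = {0..v}"
      using v0 by (subst closure_open_Int_superset) (auto simp: Rats_closure_real closure_greaterThanLessThan)
    have c: "continuous_on {0..v} (\<lambda>t. y t \<omega>)"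
      using y_ca sp by (auto simp: continuous_adapted_def intro: continuous_on_subset)
    have "norm (y v \<omega>) \<le> real n"
    proof (rule continuous_on_closure_norm_le[where s="{0<..<v} \<inter> \<rat>" and f="\<lambda>t. y t \<omega>"])
      show "\<forall>t\<in>{0<..<v} \<inter> \<rat>. norm (y t \<omega>) \<le> real n"
        using \<omega> by (auto simp: Bset_def Rats_def)
    qed (use c cl v in auto)
    then show ?thesis by simp
  qed
qed

lemma Bset_eventually: "\<omega> \<in> space M \<Longrightarrow> \<forall>\<^sub>F n in sequentially. \<omega> \<in> Bset n v"
proof -
  assume \<omega>: "\<omega> \<in> space M"
  have "continuous_on {0..v} (\<lambda>t. y t \<omega>)"
    using y_ca \<omega> by (auto simp: continuous_adapted_def intro: continuous_on_subset)
  then obtain K where K: "\<And>x. x \<in> {0..v} \<Longrightarrow> \<bar>y x \<omega>\<bar> \<le> K" using continuous_on_bounded_real by blast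
  obtain m where m: "K \<le> real m" using real_arch_simple by blast
  show ?thesis
  proof (rule eventually_sequentiallyI[of m])
    fix n assume "m \<le> n"
    then have "K \<le> real n" using m by linarith
    then show "\<omega> \<in> Bset n v" using \<omega> by (auto simp: Bset_def intro!: order_trans[OF K \<open>K \<le> real n\<close>])
  qed
qed

end

section \<open>Moment bounds\<close>

context income_process
begin

text \<open>The factor in front of the expectation, which is \<open>1\<close> for \<open>0 \<le> v\<close>, makes \<open>H_shift\<close> hold
  also for the deterministic history at \<open>v < 0\<close>.\<close>

definition H :: "(real \<Rightarrow> 'w \<Rightarrow> ennreal) \<Rightarrow> real \<Rightarrow> ennreal" where
  "H w v = ennreal (exp (\<rho> * (max v 0 - v))) * (\<integral>\<^sup>+\<omega>. w v \<omega> * ennreal (\<xi> (max v 0) \<omega>) \<partial>M)"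

definition good_weight :: "(real \<Rightarrow> 'w \<Rightarrow> ennreal) \<Rightarrow> bool" where
  "good_weight w \<longleftrightarrow> (\<forall>v. w v \<in> borel_measurable (F (max v 0))) \<and>
     (\<lambda>p. w (snd p) (fst p)) \<in> borel_measurable (M \<Otimes>\<^sub>M borel)"

text \<open>A weighted modulus of the delay term of the income identity, as a function of the pair
  of time u and lag \<zeta>, multiplied by \<open>gG t\<close>. The maximum with 0 changes nothing
  where the indicator lives and makes the kernel jointly measurable.\<close>

definition KN :: "(real \<Rightarrow> 'w \<Rightarrow> ennreal) \<Rightarrow> real \<Rightarrow> real \<Rightarrow> 'w \<Rightarrow> real \<times> real \<Rightarrow> ennreal" where
  "KN w s t \<omega> p = ennreal \<bar>phi0 (snd p)\<bar> * indicator {s<..t} (fst p) *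
     (w (fst p + snd p) \<omega> * ennreal (gG t \<omega> * es (max 0 (fst p)) \<omega>))"

lemma H_measurable:
  assumes "good_weight w" shows "H w \<in> borel_measurable borel"
proof -
  have 1: "(\<lambda>p. w (snd p) (fst p)) \<in> borel_measurable (M \<Otimes>\<^sub>M borel)" using assms by (simp add: good_weight_def)
  have 2: "(\<lambda>p. \<xi> (max 0 (snd p)) (fst p)) \<in> borel_measurable (M \<Otimes>\<^sub>M borel)"
    by (rule continuous_adapted_measurable[OF xi_ca])
  have "(\<lambda>p. w (snd p) (fst p) * ennreal (\<xi> (max 0 (snd p)) (fst p))) \<in> borel_measurable (M \<Otimes>\<^sub>M borel)"
    using 1 2 by (intro borel_measurable_times_ennreal measurable_compose[OF _ measurable_ennreal])
  from measurable_pair_swap[OF this]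
  have "(\<lambda>(v, \<omega>). w v \<omega> * ennreal (\<xi> (max v 0) \<omega>)) \<in> borel_measurable (borel \<Otimes>\<^sub>M M)"
    by (simp add: case_prod_beta max.commute)
  from borel_measurable_nn_integral[OF this] show ?thesis
    unfolding H_def[abs_def] by measurable
qed

lemma H_shift:
  assumes w: "good_weight w" and uv: "0 \<le> u" "v \<le> u"
  shows "(\<integral>\<^sup>+\<omega>. w v \<omega> * ennreal (\<xi> u \<omega>) \<partial>M) = ennreal (exp (- \<rho> * (u - v))) * H w v"
proof -
  have "(\<integral>\<^sup>+\<omega>. w v \<omega> * ennreal (\<xi> u \<omega>) \<partial>M) =
     ennreal (exp (- \<rho> * (u - max v 0))) * (\<integral>\<^sup>+\<omega>. w v \<omega> * ennreal (\<xi> (max v 0) \<omega>) \<partial>M)"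
    using w uv by (intro nn_xi_shift) (auto simp: good_weight_def)
  also have "exp (- \<rho> * (u - max v 0)) = exp (- \<rho> * (u - v)) * exp (\<rho> * (max v 0 - v))"
    by (simp add: mult_exp_exp algebra_simps)
  finally show ?thesis by (simp add: H_def ennreal_mult' mult.assoc)
qed

text \<open>Two stages with two rates: from u to t the weighted fundamental solution decays at the
  rate \<beta>; from u + \<zeta> to u only \<xi> evolves, at the rate \<rho>.\<close>

lemma H_growth_shift:
  assumes w: "good_weight w" and ut: "0 \<le> u" "u \<le> t" and z: "\<zeta> \<le> 0"
  shows "(\<integral>\<^sup>+\<omega>. w (u + \<zeta>) \<omega> * ennreal (gG t \<omega> * es u \<omega>) \<partial>M) =
    ennreal (exp (- \<beta> * (t - u))) * (ennreal (exp (\<rho> * \<zeta>)) * H w (u + \<zeta>))"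
proof -
  have "w (u + \<zeta>) \<in> borel_measurable (F (max (u + \<zeta>) 0))" using w by (simp add: good_weight_def)
  then have "w (u + \<zeta>) \<in> borel_measurable (F u)" using ut z by (elim F_measurable_mono) auto
  from nn_growth_shift[OF ut this] H_shift[OF w ut(1), of "u + \<zeta>"] z show ?thesis by simp
qed

lemma KN_measurable:
  assumes w: "good_weight w" and t: "0 \<le> t"
  shows "(\<lambda>q. KN w s t (fst q) (snd q)) \<in> borel_measurable (M \<Otimes>\<^sub>M lborel)"
proof -
  have w1: "(\<lambda>p. w (snd p) (fst p)) \<in> borel_measurable (M \<Otimes>\<^sub>M borel)" using w by (simp add: good_weight_def)
  have "(\<lambda>q. (fst q, fst (snd q) + snd (snd q))) \<in> (M \<Otimes>\<^sub>M (borel :: (real \<times> real) measure)) \<rightarrow>\<^sub>M (M \<Otimes>\<^sub>M borel)"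
    unfolding borel_prod[symmetric] by measurable
  from measurable_compose[OF this w1] have [measurable]: "(\<lambda>q. w (fst (snd q) + snd (snd q)) (fst q)) \<in> borel_measurable (M \<Otimes>\<^sub>M (borel :: (real \<times> real) measure))"
    by simp
  have e1: "(\<lambda>p. es (max 0 (snd p)) (fst p)) \<in> borel_measurable (M \<Otimes>\<^sub>M borel)"
    by (rule clamped_measurable[OF F_imp_M[OF es_F] es_continuous])
  have "(\<lambda>q. (fst q, fst (snd q))) \<in> (M \<Otimes>\<^sub>M (borel :: (real \<times> real) measure)) \<rightarrow>\<^sub>M (M \<Otimes>\<^sub>M borel)"
    unfolding borel_prod[symmetric] by measurable
  from measurable_compose[OF this e1] have [measurable]: "(\<lambda>q. es (max 0 (fst (snd q))) (fst q)) \<in> borel_measurable (M \<Otimes>\<^sub>M (borel :: (real \<times> real) measure))"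
    by simp
  have [measurable]: "(\<lambda>q. phi0 (snd (snd q))) \<in> borel_measurable (M \<Otimes>\<^sub>M (borel :: (real \<times> real) measure))"
    "(\<lambda>q. indicator {s<..t} (fst (snd q)) :: ennreal) \<in> borel_measurable (M \<Otimes>\<^sub>M (borel :: (real \<times> real) measure))"
    unfolding borel_prod[symmetric] by measurable
  note [measurable] = gG_M[OF t]
  have "(\<lambda>q. KN w s t (fst q) (snd q)) \<in> borel_measurable (M \<Otimes>\<^sub>M borel)"
    unfolding KN_def by measurable
  then show ?thesis by (simp cong: measurable_cong_sets add: sets_pair_measure_cong[OF refl sets_lborel])
qed

lemma phi0_outside: "\<not> (- d < \<zeta> \<and> \<zeta> < 0) \<Longrightarrow> phi0 \<zeta> = 0"
  by (auto simp: phi0_def indicator_def)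

text \<open>By Tonelli the expectation is taken for fixed u and \<zeta>, where
  \<open>H_growth_shift\<close> turns the random kernel into a deterministic one. Nonnegativity
  makes this legitimate before any integrability is known.\<close>

lemma KN_integral:
  assumes w: "good_weight w" and st: "0 \<le> s" "s \<le> t"
  shows "(\<integral>\<^sup>+\<omega>. (\<integral>\<^sup>+p. KN w s t \<omega> p \<partial>lborel) \<partial>M) =
    (\<integral>\<^sup>+p. ennreal \<bar>phi0 (snd p)\<bar> * indicator {s<..t} (fst p) *
       (ennreal (exp (- \<beta> * (t - fst p))) * (ennreal (exp (\<rho> * snd p)) * H w (fst p + snd p))) \<partial>lborel)"
proof -
  interpret pr: pair_sigma_finite M "lborel :: (real \<times> real) measure" ..
  have t: "0 \<le> t" using st by simp
  have "(\<integral>\<^sup>+\<omega>. (\<integral>\<^sup>+p. KN w s t \<omega> p \<partial>lborel) \<partial>M) = (\<integral>\<^sup>+p. (\<integral>\<^sup>+\<omega>. KN w s t \<omega> p \<partial>M) \<partial>lborel)"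
    using pr.Fubini[OF KN_measurable[OF w t, of s]] by simp
  also have "\<dots> = (\<integral>\<^sup>+p. ennreal \<bar>phi0 (snd p)\<bar> * indicator {s<..t} (fst p) *
       (ennreal (exp (- \<beta> * (t - fst p))) * (ennreal (exp (\<rho> * snd p)) * H w (fst p + snd p))) \<partial>lborel)"
  proof (rule nn_integral_cong)
    fix p :: "real \<times> real"
    obtain u \<zeta> where p: "p = (u, \<zeta>)" by (cases p)
    show "(\<integral>\<^sup>+\<omega>. KN w s t \<omega> p \<partial>M) = ennreal \<bar>phi0 (snd p)\<bar> * indicator {s<..t} (fst p) *
       (ennreal (exp (- \<beta> * (t - fst p))) * (ennreal (exp (\<rho> * snd p)) * H w (fst p + snd p)))"
    proof (cases "s < u \<and> u \<le> t \<and> - d < \<zeta> \<and> \<zeta> < 0")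
      case True
      then have u: "0 \<le> u" "u \<le> t" "\<zeta> \<le> 0" using st by auto
      have "w (u + \<zeta>) \<in> borel_measurable M" "es u \<in> borel_measurable M"
        using w F_imp_M[OF es_F[OF u(1)]] by (auto simp: good_weight_def intro: F_imp_M)
      then have [measurable]: "(\<lambda>\<omega>. w (u + \<zeta>) \<omega> * ennreal (gG t \<omega> * es u \<omega>)) \<in> borel_measurable M"
        using gG_M[OF t] by (intro borel_measurable_times_ennreal measurable_compose[OF _ measurable_ennreal] borel_measurable_times)
      have "(\<integral>\<^sup>+\<omega>. KN w s t \<omega> p \<partial>M) = (\<integral>\<^sup>+\<omega>. ennreal \<bar>phi0 \<zeta>\<bar> * (w (u + \<zeta>) \<omega> * ennreal (gG t \<omega> * es u \<omega>)) \<partial>M)"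
        using True u by (simp add: KN_def p max_def)
      also have "\<dots> = ennreal \<bar>phi0 \<zeta>\<bar> * (\<integral>\<^sup>+\<omega>. w (u + \<zeta>) \<omega> * ennreal (gG t \<omega> * es u \<omega>) \<partial>M)"
        by (rule nn_integral_cmult) measurable
      finally show ?thesis using H_growth_shift[OF w u] True by (simp add: p)
    next
      case False
      then have "phi0 \<zeta> = 0 \<or> u \<notin> {s<..t}" using phi0_outside[of \<zeta>] by auto
      then show ?thesis by (auto simp: KN_def p)
    qed
  qed
  finally show ?thesis .
qed

text \<open>The norm of \<phi> in L1, enlarged by a bound for exp (\<rho> \<zeta>) over the delay
  window, whatever the sign of \<rho>.\<close>

definition cK :: real where
  "cK = exp (\<bar>\<rho>\<bar> * d) * (\<integral>\<zeta>. \<bar>phi0 \<zeta>\<bar> \<partial>lborel)"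

lemma cK_nonneg: "0 \<le> cK"
  unfolding cK_def by (intro mult_nonneg_nonneg integral_nonneg_AE) auto

lemma nn_integral_pair_lborel:
  fixes f :: "real \<times> real \<Rightarrow> ennreal"
  assumes "f \<in> borel_measurable borel"
  shows "(\<integral>\<^sup>+p. f p \<partial>lborel) = (\<integral>\<^sup>+\<zeta>. (\<integral>\<^sup>+u. f (u, \<zeta>) \<partial>lborel) \<partial>lborel)"
    "(\<integral>\<^sup>+p. f p \<partial>lborel) = (\<integral>\<^sup>+u. (\<integral>\<^sup>+\<zeta>. f (u, \<zeta>) \<partial>lborel) \<partial>lborel)"
proof -
  have f: "f \<in> borel_measurable (lborel \<Otimes>\<^sub>M lborel)" using assms by (simp add: lborel_prod)
  show "(\<integral>\<^sup>+p. f p \<partial>lborel) = (\<integral>\<^sup>+\<zeta>. (\<integral>\<^sup>+u. f (u, \<zeta>) \<partial>lborel) \<partial>lborel)"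
    using lborel_pair.nn_integral_snd[OF f] by (simp add: lborel_prod)
  show "(\<integral>\<^sup>+p. f p \<partial>lborel) = (\<integral>\<^sup>+u. (\<integral>\<^sup>+\<zeta>. f (u, \<zeta>) \<partial>lborel) \<partial>lborel)"
    using lborel.nn_integral_fst[OF f] by (simp add: lborel_prod)
qed

lemma exp_rho_bound: "- d < \<zeta> \<Longrightarrow> \<zeta> < 0 \<Longrightarrow> exp (\<rho> * \<zeta>) \<le> exp (\<bar>\<rho>\<bar> * d)" "- d < \<zeta> \<Longrightarrow> \<zeta> < 0 \<Longrightarrow> exp (- \<rho> * \<zeta>) \<le> exp (\<bar>\<rho>\<bar> * d)"
proof -
  assume z: "- d < \<zeta>" "\<zeta> < 0"
  have "\<bar>\<rho> * \<zeta>\<bar> \<le> \<bar>\<rho>\<bar> * d" unfolding abs_mult using z by (intro mult_left_mono) auto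
  then show "exp (\<rho> * \<zeta>) \<le> exp (\<bar>\<rho>\<bar> * d)" "exp (- \<rho> * \<zeta>) \<le> exp (\<bar>\<rho>\<bar> * d)" by auto
qed

text \<open>Young's inequality for the convolution of two functions in L1, with the domain of h
  enlarged by the delay d. It is stated for a general h because it serves the moment bound as well
  as the duality argument.\<close>

lemma delay_convolution_bound:
  assumes h: "h \<in> borel_measurable borel"
  shows "(\<integral>\<^sup>+p. ennreal \<bar>phi0 (snd p)\<bar> * indicator {s<..t} (fst p) * (ennreal (exp (\<rho> * snd p)) * h (fst p + snd p)) \<partial>lborel)
    \<le> ennreal cK * (\<integral>\<^sup>+v\<in>{s - d..t}. h v \<partial>lborel)"
proof -
  note [measurable] = h
  have "(\<lambda>p. ennreal \<bar>phi0 (snd p)\<bar> * indicator {s<..t} (fst p) * (ennreal (exp (\<rho> * snd p)) * h (fst p + snd p))) \<in> borel_measurable (borel \<Otimes>\<^sub>M borel)"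
    by measurable
  then have "(\<integral>\<^sup>+p. ennreal \<bar>phi0 (snd p)\<bar> * indicator {s<..t} (fst p) * (ennreal (exp (\<rho> * snd p)) * h (fst p + snd p)) \<partial>lborel) =
     (\<integral>\<^sup>+\<zeta>. (\<integral>\<^sup>+u. ennreal \<bar>phi0 \<zeta>\<bar> * indicator {s<..t} u * (ennreal (exp (\<rho> * \<zeta>)) * h (u + \<zeta>)) \<partial>lborel) \<partial>lborel)"
    by (subst nn_integral_pair_lborel(1)) (auto simp: borel_prod)
  also have "\<dots> \<le> (\<integral>\<^sup>+\<zeta>. ennreal (exp (\<bar>\<rho>\<bar> * d) * \<bar>phi0 \<zeta>\<bar>) * (\<integral>\<^sup>+v\<in>{s - d..t}. h v \<partial>lborel) \<partial>lborel)"
  proof (rule nn_integral_mono)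
    fix \<zeta> :: real
    show "(\<integral>\<^sup>+u. ennreal \<bar>phi0 \<zeta>\<bar> * indicator {s<..t} u * (ennreal (exp (\<rho> * \<zeta>)) * h (u + \<zeta>)) \<partial>lborel) \<le>
      ennreal (exp (\<bar>\<rho>\<bar> * d) * \<bar>phi0 \<zeta>\<bar>) * (\<integral>\<^sup>+v\<in>{s - d..t}. h v \<partial>lborel)"
    proof (cases "- d < \<zeta> \<and> \<zeta> < 0")
      case True
      have e: "ennreal (exp (\<rho> * \<zeta>)) \<le> ennreal (exp (\<bar>\<rho>\<bar> * d))" using True exp_rho_bound(1) by (intro ennreal_leI) auto
      have "(\<integral>\<^sup>+u. ennreal \<bar>phi0 \<zeta>\<bar> * indicator {s<..t} u * (ennreal (exp (\<rho> * \<zeta>)) * h (u + \<zeta>)) \<partial>lborel) \<le>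
        (\<integral>\<^sup>+u. ennreal (exp (\<bar>\<rho>\<bar> * d) * \<bar>phi0 \<zeta>\<bar>) * (h (\<zeta> + 1 * u) * indicator {s - d..t} (\<zeta> + 1 * u)) \<partial>lborel)"
      proof (rule nn_integral_mono)
        fix u :: real
        have "ennreal \<bar>phi0 \<zeta>\<bar> * indicator {s<..t} u * (ennreal (exp (\<rho> * \<zeta>)) * h (u + \<zeta>)) \<le>
          ennreal \<bar>phi0 \<zeta>\<bar> * indicator {s - d..t} (\<zeta> + 1 * u) * (ennreal (exp (\<bar>\<rho>\<bar> * d)) * h (u + \<zeta>))"
          using True e by (intro mult_mono) (auto simp: indicator_def)
        also have "\<dots> = ennreal (exp (\<bar>\<rho>\<bar> * d) * \<bar>phi0 \<zeta>\<bar>) * (h (\<zeta> + 1 * u) * indicator {s - d..t} (\<zeta> + 1 * u))"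
          by (simp add: ennreal_mult' mult_ac add.commute)
        finally show "ennreal \<bar>phi0 \<zeta>\<bar> * indicator {s<..t} u * (ennreal (exp (\<rho> * \<zeta>)) * h (u + \<zeta>)) \<le>
          ennreal (exp (\<bar>\<rho>\<bar> * d) * \<bar>phi0 \<zeta>\<bar>) * (h (\<zeta> + 1 * u) * indicator {s - d..t} (\<zeta> + 1 * u))" .
      qed
      also have "\<dots> = ennreal (exp (\<bar>\<rho>\<bar> * d) * \<bar>phi0 \<zeta>\<bar>) * (\<integral>\<^sup>+u. h (\<zeta> + 1 * u) * indicator {s - d..t} (\<zeta> + 1 * u) \<partial>lborel)"
        by (rule nn_integral_cmult) measurable
      also have "(\<integral>\<^sup>+u. h (\<zeta> + 1 * u) * indicator {s - d..t} (\<zeta> + 1 * u) \<partial>lborel) = (\<integral>\<^sup>+v\<in>{s - d..t}. h v \<partial>lborel)"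
        using nn_integral_real_affine[of "\<lambda>v. h v * indicator {s - d..t} v" 1 \<zeta>] by simp
      finally show ?thesis .
    next
      case False
      then show ?thesis using phi0_outside[of \<zeta>] by simp
    qed
  qed
  also have "\<dots> = (\<integral>\<^sup>+\<zeta>. ennreal (exp (\<bar>\<rho>\<bar> * d) * \<bar>phi0 \<zeta>\<bar>) \<partial>lborel) * (\<integral>\<^sup>+v\<in>{s - d..t}. h v \<partial>lborel)"
    by (rule nn_integral_multc) measurable
  also have "(\<integral>\<^sup>+\<zeta>. ennreal (exp (\<bar>\<rho>\<bar> * d) * \<bar>phi0 \<zeta>\<bar>) \<partial>lborel) = ennreal cK"
    unfolding cK_def using phi0_integrable by (subst nn_integral_eq_integral) auto
  finally show ?thesis .
qed

text \<open>Positivity of \<beta> bounds the factor exp (- \<beta> (t - u)) by 1; what remains is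
  the convolution estimate.\<close>

lemma KN_bound:
  assumes w: "good_weight w" and st: "0 \<le> s" "s \<le> t"
  shows "(\<integral>\<^sup>+\<omega>. (\<integral>\<^sup>+p. KN w s t \<omega> p \<partial>lborel) \<partial>M) \<le> ennreal cK * (\<integral>\<^sup>+v\<in>{s - d..t}. H w v \<partial>lborel)"
  unfolding KN_integral[OF w st]
proof (rule order_trans[OF _ delay_convolution_bound[OF H_measurable[OF w]]], rule nn_integral_mono)
  fix p :: "real \<times> real"
  show "ennreal \<bar>phi0 (snd p)\<bar> * indicator {s<..t} (fst p) *
       (ennreal (exp (- \<beta> * (t - fst p))) * (ennreal (exp (\<rho> * snd p)) * H w (fst p + snd p))) \<le>
     ennreal \<bar>phi0 (snd p)\<bar> * indicator {s<..t} (fst p) * (ennreal (exp (\<rho> * snd p)) * H w (fst p + snd p))"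
  proof (cases "fst p \<in> {s<..t}")
    case True
    then have "exp (- \<beta> * (t - fst p)) \<le> 1" using beta_pos by simp
    then have "ennreal (exp (- \<beta> * (t - fst p))) * (ennreal (exp (\<rho> * snd p)) * H w (fst p + snd p)) \<le>
       1 * (ennreal (exp (\<rho> * snd p)) * H w (fst p + snd p))"
      using ennreal_leI by (intro mult_right_mono) auto
    then show ?thesis by (intro mult_left_mono) auto
  qed simp
qed

text \<open>If f is not integrable its Bochner integral is 0 by convention, so the estimate can be
  used before integrability is established.\<close>

lemma abs_integral_le_nn: "ennreal \<bar>\<integral>x. f x \<partial>N\<bar> \<le> (\<integral>\<^sup>+x. ennreal \<bar>f x\<bar> \<partial>N)" for f :: "'x \<Rightarrow> real"
  using integral_norm_bound_ennreal[of N f] not_integrable_integral_eq[of N f]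
  by (cases "integrable N f") auto

text \<open>The income identity is multiplied by \<open>gG t\<close>, which turns
  \<open>es t\<close> into \<xi>(t), and estimated in absolute value by nonnegative
  integrals.\<close>

lemma income_path_bound:
  assumes st: "0 \<le> s" "s \<le> t"
  shows "AE \<omega> in M. ennreal \<bar>y t \<omega>\<bar> * ennreal (\<xi> t \<omega>) \<le>
    ennreal \<bar>y s \<omega>\<bar> * ennreal (gG t \<omega> * es s \<omega>) + (\<integral>\<^sup>+p. KN (\<lambda>v \<omega>. ennreal \<bar>yh v \<omega>\<bar>) s t \<omega> p \<partial>lborel)"
  using income_identity xi_explicit AE_not_discontinuous AE_space
proof eventually_elim
  case (elim \<omega>)
  have yhm: "(\<lambda>v. yh v \<omega>) \<in> borel_measurable borel"
    using measurable_compose[OF measurable_Pair1'[OF elim(4)] yh_measurable] by simp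
  have esm: "(\<lambda>u. es (max 0 u) \<omega>) \<in> borel_measurable borel"
    using continuous_on_clamped[OF es_continuous[OF elim(4)]] by (rule borel_measurable_continuous_onI)
  note [measurable] = yhm esm
  have KNm: "(\<lambda>p. KN (\<lambda>v \<omega>. ennreal \<bar>yh v \<omega>\<bar>) s t \<omega> p) \<in> borel_measurable borel"
  proof -
    have [measurable]: "(\<lambda>p. yh (fst p + snd p) \<omega>) \<in> borel_measurable (borel \<Otimes>\<^sub>M borel)"
      by (rule measurable_compose[OF _ yhm]) measurable
    show ?thesis unfolding KN_def borel_prod[symmetric] by measurable
  qed
  have yid: "y t \<omega> * es t \<omega> = y s \<omega> * es s \<omega> + (LBINT u:{s<..t}. es u \<omega> * drift u \<omega>)"
    using elim(1) st by blast
  have xt: "\<xi> t \<omega> = gG t \<omega> * es t \<omega>"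
    using elim(2) st growth_step[OF elim(3), of t t] by simp
  have "ennreal \<bar>y t \<omega>\<bar> * ennreal (\<xi> t \<omega>) = ennreal (gG t \<omega> * \<bar>y t \<omega> * es t \<omega>\<bar>)"
    unfolding xt using es_nonneg[of t \<omega>] gG_pos[of t \<omega>]
    by (simp add: ennreal_mult'[symmetric] abs_mult mult_ac)
  also have "\<dots> \<le> ennreal (gG t \<omega> * (\<bar>y s \<omega> * es s \<omega>\<bar> + \<bar>LBINT u:{s<..t}. es u \<omega> * drift u \<omega>\<bar>))"
    unfolding yid using gG_pos[of t \<omega>] by (intro ennreal_leI mult_left_mono abs_triangle_ineq) simp
  also have "\<dots> = ennreal \<bar>y s \<omega>\<bar> * ennreal (gG t \<omega> * es s \<omega>) + ennreal (gG t \<omega>) * ennreal \<bar>LBINT u:{s<..t}. es u \<omega> * drift u \<omega>\<bar>"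
    using es_nonneg[of s \<omega>] gG_pos[of t \<omega>]
    by (simp add: ennreal_mult'[symmetric] distrib_left abs_mult mult_ac)
  also have "ennreal (gG t \<omega>) * ennreal \<bar>LBINT u:{s<..t}. es u \<omega> * drift u \<omega>\<bar> \<le>
      (\<integral>\<^sup>+p. KN (\<lambda>v \<omega>. ennreal \<bar>yh v \<omega>\<bar>) s t \<omega> p \<partial>lborel)"
  proof -
    have "ennreal \<bar>LBINT u:{s<..t}. es u \<omega> * drift u \<omega>\<bar> \<le> (\<integral>\<^sup>+u. ennreal \<bar>indicator {s<..t} u *\<^sub>R (es u \<omega> * drift u \<omega>)\<bar> \<partial>lborel)"
      unfolding set_lebesgue_integral_def by (rule abs_integral_le_nn)
    also have "\<dots> \<le> (\<integral>\<^sup>+u. indicator {s<..t} u * (ennreal (es (max 0 u) \<omega>) * (\<integral>\<^sup>+\<zeta>. ennreal \<bar>phi0 \<zeta> * yh (u + \<zeta>) \<omega>\<bar> \<partial>lborel)) \<partial>lborel)"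
    proof (rule nn_integral_mono)
      fix u :: real
      show "ennreal \<bar>indicator {s<..t} u *\<^sub>R (es u \<omega> * drift u \<omega>)\<bar> \<le>
         indicator {s<..t} u * (ennreal (es (max 0 u) \<omega>) * (\<integral>\<^sup>+\<zeta>. ennreal \<bar>phi0 \<zeta> * yh (u + \<zeta>) \<omega>\<bar> \<partial>lborel))"
      proof (cases "u \<in> {s<..t}")
        case True
        then have "max 0 u = u" using st by auto
        then show ?thesis using True es_nonneg[of u \<omega>] abs_integral_le_nn[of lborel "\<lambda>\<zeta>. phi0 \<zeta> * yh (u + \<zeta>) \<omega>"]
          unfolding drift_def by (auto simp: abs_mult ennreal_mult intro!: mult_left_mono)
      qed simp
    qed
    finally have "ennreal (gG t \<omega>) * ennreal \<bar>LBINT u:{s<..t}. es u \<omega> * drift u \<omega>\<bar> \<le> ennreal (gG t \<omega>) *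
       (\<integral>\<^sup>+u. indicator {s<..t} u * (ennreal (es (max 0 u) \<omega>) * (\<integral>\<^sup>+\<zeta>. ennreal \<bar>phi0 \<zeta> * yh (u + \<zeta>) \<omega>\<bar> \<partial>lborel)) \<partial>lborel)"
      by (rule mult_left_mono) simp
    also have "\<dots> = (\<integral>\<^sup>+u. (\<integral>\<^sup>+\<zeta>. KN (\<lambda>v \<omega>. ennreal \<bar>yh v \<omega>\<bar>) s t \<omega> (u, \<zeta>) \<partial>lborel) \<partial>lborel)"
    proof -
      have "(\<integral>\<^sup>+\<zeta>. KN (\<lambda>v \<omega>. ennreal \<bar>yh v \<omega>\<bar>) s t \<omega> (u, \<zeta>) \<partial>lborel) =
         ennreal (gG t \<omega>) * (indicator {s<..t} u * (ennreal (es (max 0 u) \<omega>) * (\<integral>\<^sup>+\<zeta>. ennreal \<bar>phi0 \<zeta> * yh (u + \<zeta>) \<omega>\<bar> \<partial>lborel)))" for u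
      proof -
        have "(\<integral>\<^sup>+\<zeta>. KN (\<lambda>v \<omega>. ennreal \<bar>yh v \<omega>\<bar>) s t \<omega> (u, \<zeta>) \<partial>lborel) =
          (\<integral>\<^sup>+\<zeta>. (ennreal (gG t \<omega>) * indicator {s<..t} u * ennreal (es (max 0 u) \<omega>)) * ennreal \<bar>phi0 \<zeta> * yh (u + \<zeta>) \<omega>\<bar> \<partial>lborel)"
          using es_nonneg gG_pos[of t \<omega>]
          by (intro nn_integral_cong) (simp add: KN_def abs_mult ennreal_mult mult_ac)
        also have "\<dots> = (ennreal (gG t \<omega>) * indicator {s<..t} u * ennreal (es (max 0 u) \<omega>)) * (\<integral>\<^sup>+\<zeta>. ennreal \<bar>phi0 \<zeta> * yh (u + \<zeta>) \<omega>\<bar> \<partial>lborel)"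
          by (rule nn_integral_cmult) measurable
        finally show ?thesis by (simp add: mult_ac)
      qed
      moreover have "(\<lambda>u. indicator {s<..t} u * (ennreal (es (max 0 u) \<omega>) * (\<integral>\<^sup>+\<zeta>. ennreal \<bar>phi0 \<zeta> * yh (u + \<zeta>) \<omega>\<bar> \<partial>lborel))) \<in> borel_measurable lborel"
        by measurable
      ultimately show ?thesis by (simp add: nn_integral_cmult)
    qed
    also have "\<dots> = (\<integral>\<^sup>+p. KN (\<lambda>v \<omega>. ennreal \<bar>yh v \<omega>\<bar>) s t \<omega> p \<partial>lborel)"
      by (rule nn_integral_pair_lborel(2)[OF KNm, symmetric])
    finally show ?thesis .
  qed
  finally show ?case by (simp add: add_left_mono)
qed

definition wB :: "nat \<Rightarrow> real \<Rightarrow> 'w \<Rightarrow> ennreal" where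
  "wB n v \<omega> = indicator (Bset n v) \<omega> * ennreal \<bar>yh v \<omega>\<bar>"

definition wY :: "real \<Rightarrow> 'w \<Rightarrow> ennreal" where
  "wY v \<omega> = ennreal \<bar>yh v \<omega>\<bar>"

lemma good_wY: "good_weight wY"
  unfolding good_weight_def wY_def[abs_def]
  using yh_F yh_measurable by (auto intro!: measurable_compose[OF _ measurable_ennreal] borel_measurable_abs)

lemma good_wB: "good_weight (wB n)"
  unfolding good_weight_def wB_def[abs_def]
proof (intro conjI allI)
  fix v show "(\<lambda>\<omega>. indicator (Bset n v) \<omega> * ennreal \<bar>yh v \<omega>\<bar>) \<in> borel_measurable (F (max v 0))"
    using yh_F Bset_F by (intro borel_measurable_times_ennreal borel_measurable_indicator measurable_compose[OF _ measurable_ennreal] borel_measurable_abs)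
next
  show "(\<lambda>p. indicator (Bset n (snd p)) (fst p) * ennreal \<bar>yh (snd p) (fst p)\<bar>) \<in> borel_measurable (M \<Otimes>\<^sub>M borel)"
    using Bset_measurable yh_measurable by (intro borel_measurable_times_ennreal measurable_compose[OF _ measurable_ennreal] borel_measurable_abs)
qed

text \<open>Bounds the integral of \<open>H wY\<close> over negative times, that is, the
  contribution of the history to the Gronwall inequality.\<close>

definition cH :: real where
  "cH = exp (\<bar>\<rho>\<bar> * d) * (\<integral>v. \<bar>indicator {-d<..<0} v * x1 v\<bar> \<partial>lborel)"

lemma H_mono: "(\<And>\<omega>. \<omega> \<in> space M \<Longrightarrow> w v \<omega> \<le> w' v \<omega>) \<Longrightarrow> H w v \<le> H w' v"
  unfolding H_def by (intro mult_left_mono nn_integral_mono mult_right_mono) auto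

lemma H_history: "v < 0 \<Longrightarrow> H wY v \<le> ennreal (exp (\<bar>\<rho>\<bar> * d) * \<bar>indicator {-d<..<0} v * x1 v\<bar>)"
proof -
  assume v: "v < 0"
  have m: "(\<lambda>\<omega>. ennreal (\<xi> 0 \<omega>)) \<in> borel_measurable M"
    using F_imp_M[OF xi_F[of 0]] by measurable
  have "H wY v = ennreal (exp (- \<rho> * v)) * (ennreal \<bar>indicator {-d<..<0} v * x1 v\<bar> * (\<integral>\<^sup>+\<omega>. ennreal (\<xi> 0 \<omega>) \<partial>M))"
    using v m by (simp add: H_def wY_def yh_def max_def nn_integral_cmult)
  also have "\<dots> = ennreal (exp (- \<rho> * v) * \<bar>indicator {-d<..<0} v * x1 v\<bar>)"
    by (simp add: nn_xi_zero ennreal_mult')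
  also have "\<dots> \<le> ennreal (exp (\<bar>\<rho>\<bar> * d) * \<bar>indicator {-d<..<0} v * x1 v\<bar>)"
    using exp_rho_bound(2)[of v] by (intro ennreal_leI) (auto simp: indicator_def intro!: mult_right_mono)
  finally show ?thesis .
qed

lemma H_history_integral: "(\<integral>\<^sup>+v\<in>{..<0}. H wY v \<partial>lborel) \<le> ennreal cH"
proof -
  have "(\<integral>\<^sup>+v\<in>{..<0}. H wY v \<partial>lborel) \<le> (\<integral>\<^sup>+v. ennreal (exp (\<bar>\<rho>\<bar> * d) * \<bar>indicator {-d<..<0} v * x1 v\<bar>) \<partial>lborel)"
    using H_history by (intro nn_integral_mono) (auto simp: indicator_def)
  also have "\<dots> = ennreal cH"
    unfolding cH_def using hist_integrable by (subst nn_integral_eq_integral) auto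
  finally show ?thesis .
qed

lemma H_nonneg_time: "0 \<le> t \<Longrightarrow> H w t = (\<integral>\<^sup>+\<omega>. w t \<omega> * ennreal (\<xi> t \<omega>) \<partial>M)"
  by (simp add: H_def max_def)

text \<open>On \<open>Bset n t\<close> income is at most n, which gives the finiteness that
  Gronwall's inequality presupposes. The resulting bound does not depend on n, and Fatou's lemma
  removes the localization.\<close>

lemma moment_bound:
  assumes T: "0 \<le> T"
  shows "\<exists>C\<ge>0. \<forall>t\<in>{0..T}. H wY t \<le> ennreal C"
proof -
  \<comment> \<open>The initial value plus the contribution of the history through the delay; in c2
    the 1 ensures strict positivity.\<close>
  define c1 where "c1 = \<bar>x0\<bar> + cK * cH"
  define c2 where "c2 = cK + 1"
  have cH0: "0 \<le> cH" unfolding cH_def by (intro mult_nonneg_nonneg integral_nonneg_AE) auto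
  have c: "0 \<le> c1" "0 < c2" using cK_nonneg cH0 by (auto simp: c1_def c2_def)
  have bnd: "H (wB n) t \<le> ennreal (2 * c1 * exp (2 * c2 * T))" if t: "t \<in> {0..T}" for n t
  proof (rule gronwall_ennreal[OF _ _ c t])
    fix t assume t: "t \<in> {0..T}"
    then have t0: "0 \<le> t" by simp
    have "H (wB n) t \<le> (\<integral>\<^sup>+\<omega>. ennreal (real n) * ennreal (\<xi> t \<omega>) \<partial>M)"
      unfolding H_nonneg_time[OF t0]
    proof (intro nn_integral_mono mult_right_mono)
      fix \<omega>
      show "wB n t \<omega> \<le> ennreal (real n)"
        using Bset_bound[of \<omega> n t] t0 by (cases "\<omega> \<in> Bset n t") (auto simp: wB_def yh_def intro!: ennreal_leI)
    qed simp
    also have "\<dots> = ennreal (real n) * ennreal (exp (- \<rho> * t))"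
      using F_imp_M[OF xi_F[OF t0]] by (subst nn_integral_cmult) (auto simp: nn_xi[OF t0])
    also have "\<dots> \<le> ennreal (real n * exp (\<bar>\<rho>\<bar> * T))"
    proof -
      have "- \<rho> * t \<le> \<bar>\<rho>\<bar> * T" using t by (intro mult_mono) auto
      then show ?thesis by (subst ennreal_mult[symmetric]) (auto intro!: ennreal_leI mult_left_mono)
    qed
    finally show "H (wB n) t \<le> ennreal (real n * exp (\<bar>\<rho>\<bar> * T))" .
    have wBle: "H (wB n) v \<le> H wY v" for v
      by (rule H_mono) (auto simp: wB_def wY_def indicator_def)
    have "H (wB n) t \<le> (\<integral>\<^sup>+\<omega>. ennreal \<bar>x0\<bar> * ennreal (gG t \<omega> * es 0 \<omega>) + (\<integral>\<^sup>+p. KN (wB n) 0 t \<omega> p \<partial>lborel) \<partial>M)"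
      unfolding H_nonneg_time[OF t0]
    proof (rule nn_integral_mono_AE)
      show "AE \<omega> in M. wB n t \<omega> * ennreal (\<xi> t \<omega>) \<le>
         ennreal \<bar>x0\<bar> * ennreal (gG t \<omega> * es 0 \<omega>) + (\<integral>\<^sup>+p. KN (wB n) 0 t \<omega> p \<partial>lborel)"
        using income_path_bound[OF order.refl t0] income_identity0 Z_zero AE_not_discontinuous
      proof eventually_elim
        case (elim \<omega>)
        have "es 0 \<omega> = 1" using elim(3,4) by (simp add: es_def expZ_def)
        moreover have "y 0 \<omega> * es 0 \<omega> = x0 + (LBINT u:{0..0}. es u \<omega> * drift u \<omega>)" using elim(2) by blast
        ultimately have y0: "y 0 \<omega> = x0" by (simp add: set_integral_singleton del: atLeastAtMost_singleton)
        show ?case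
        proof (cases "\<omega> \<in> Bset n t")
          case True
          have "(\<integral>\<^sup>+p. KN (\<lambda>v \<omega>. ennreal \<bar>yh v \<omega>\<bar>) 0 t \<omega> p \<partial>lborel) \<le> (\<integral>\<^sup>+p. KN (wB n) 0 t \<omega> p \<partial>lborel)"
          proof (rule nn_integral_mono)
            fix p :: "real \<times> real"
            show "KN (\<lambda>v \<omega>. ennreal \<bar>yh v \<omega>\<bar>) 0 t \<omega> p \<le> KN (wB n) 0 t \<omega> p"
            \<comment> \<open>The delayed time u + \<zeta> lies before t and the sets
              \<open>Bset n\<close> decrease in time, so membership at t carries over to the delayed
              time and the indicator may be moved under the integral.\<close>
            proof (cases "fst p \<le> t \<and> snd p < 0")
              case True2: True
              then have "\<omega> \<in> Bset n (fst p + snd p)" using True Bset_antimono[of "fst p + snd p" t n] by auto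
              then show ?thesis by (simp add: KN_def wB_def)
            next
              case False
              then show ?thesis using phi0_outside[of "snd p"] by (auto simp: KN_def)
            qed
          qed
          then show ?thesis using elim(1) True t0 y0
            by (auto simp: wB_def yh_def intro: order_trans add_left_mono)
        qed (simp add: wB_def)
      qed
    qed
    also have "\<dots> = ennreal \<bar>x0\<bar> * (\<integral>\<^sup>+\<omega>. 1 * ennreal (gG t \<omega> * es 0 \<omega>) \<partial>M) + (\<integral>\<^sup>+\<omega>. (\<integral>\<^sup>+p. KN (wB n) 0 t \<omega> p \<partial>lborel) \<partial>M)"
    proof -
      have [measurable]: "gG t \<in> borel_measurable M" "es 0 \<in> borel_measurable M"
        using gG_M[OF t0] F_imp_M[OF es_F[of 0]] by auto
      have "(\<lambda>\<omega>. \<integral>\<^sup>+p. KN (wB n) 0 t \<omega> p \<partial>lborel) \<in> borel_measurable M"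
        using KN_measurable[OF good_wB t0, of n 0] by (intro lborel.borel_measurable_nn_integral) (simp add: case_prod_beta)
      then show ?thesis by (subst nn_integral_add) (auto simp: nn_integral_cmult)
    qed
    also have "\<dots> \<le> ennreal \<bar>x0\<bar> * 1 + ennreal cK * (\<integral>\<^sup>+v\<in>{0 - d..t}. H (wB n) v \<partial>lborel)"
    proof (intro add_mono mult_left_mono KN_bound good_wB order.refl t0)
      have "(\<integral>\<^sup>+\<omega>. 1 * ennreal (gG t \<omega> * es 0 \<omega>) \<partial>M) = ennreal (exp (- \<beta> * (t - 0))) * (\<integral>\<^sup>+\<omega>. 1 * ennreal (\<xi> 0 \<omega>) \<partial>M)"
        by (rule nn_growth_shift[OF order.refl t0]) simp
      also have "\<dots> \<le> 1" using beta_pos t0 by (simp add: nn_xi_zero)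
      finally show "(\<integral>\<^sup>+\<omega>. 1 * ennreal (gG t \<omega> * es 0 \<omega>) \<partial>M) \<le> 1" .
    qed simp
    also have "(\<integral>\<^sup>+v\<in>{0 - d..t}. H (wB n) v \<partial>lborel) \<le> ennreal cH + (\<integral>\<^sup>+v\<in>{0..t}. H (wB n) v \<partial>lborel)"
    proof -
      note [measurable] = H_measurable[OF good_wB] H_measurable[OF good_wY]
      have "(\<integral>\<^sup>+v\<in>{0 - d..t}. H (wB n) v \<partial>lborel) \<le> (\<integral>\<^sup>+v. H wY v * indicator {..<0} v + H (wB n) v * indicator {0..t} v \<partial>lborel)"
        using wBle by (intro nn_integral_mono) (auto simp: indicator_def)
      also have "\<dots> = (\<integral>\<^sup>+v\<in>{..<0}. H wY v \<partial>lborel) + (\<integral>\<^sup>+v\<in>{0..t}. H (wB n) v \<partial>lborel)"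
        by (rule nn_integral_add) measurable
      also have "\<dots> \<le> ennreal cH + (\<integral>\<^sup>+v\<in>{0..t}. H (wB n) v \<partial>lborel)"
        by (intro add_right_mono H_history_integral)
      finally show ?thesis .
    qed
    also have "ennreal \<bar>x0\<bar> * 1 + ennreal cK * (ennreal cH + (\<integral>\<^sup>+v\<in>{0..t}. H (wB n) v \<partial>lborel)) =
       ennreal c1 + ennreal cK * (\<integral>\<^sup>+v\<in>{0..t}. H (wB n) v \<partial>lborel)"
      using cK_nonneg cH0 by (simp add: c1_def distrib_left ennreal_mult' add.assoc)
    also have "\<dots> \<le> ennreal c1 + ennreal c2 * (\<integral>\<^sup>+v\<in>{0..t}. H (wB n) v \<partial>lborel)"
      by (intro add_left_mono mult_right_mono ennreal_leI) (auto simp: c2_def)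
    finally show "H (wB n) t \<le> ennreal c1 + ennreal c2 * (\<integral>\<^sup>+v\<in>{0..t}. H (wB n) v \<partial>lborel)"
      by (simp add: mult_left_mono add_left_mono)
  qed
  have "H wY t \<le> ennreal (2 * c1 * exp (2 * c2 * T))" if t: "t \<in> {0..T}" for t
  proof -
    have t0: "0 \<le> t" using t by simp
    have "H wY t = (\<integral>\<^sup>+\<omega>. liminf (\<lambda>n. wB n t \<omega> * ennreal (\<xi> t \<omega>)) \<partial>M)"
      unfolding H_nonneg_time[OF t0]
    proof (rule nn_integral_cong)
      fix \<omega> assume "\<omega> \<in> space M"
      from Bset_eventually[OF this, of t]
      have "(\<lambda>n. wB n t \<omega> * ennreal (\<xi> t \<omega>)) \<longlonglongrightarrow> wY t \<omega> * ennreal (\<xi> t \<omega>)"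
        by (intro tendsto_eventually) (auto elim!: eventually_mono simp: wB_def wY_def)
      then show "wY t \<omega> * ennreal (\<xi> t \<omega>) = liminf (\<lambda>n. wB n t \<omega> * ennreal (\<xi> t \<omega>))"
        by (intro lim_imp_Liminf[symmetric]) auto
    qed
    also have "\<dots> \<le> liminf (\<lambda>n. \<integral>\<^sup>+\<omega>. wB n t \<omega> * ennreal (\<xi> t \<omega>) \<partial>M)"
    proof (rule nn_integral_liminf)
      fix n
      have "wB n t \<in> borel_measurable M" using good_wB by (auto simp: good_weight_def intro: F_imp_M)
      then show "(\<lambda>\<omega>. wB n t \<omega> * ennreal (\<xi> t \<omega>)) \<in> borel_measurable M"
        using F_imp_M[OF xi_F[OF t0]] by (intro borel_measurable_times_ennreal) auto
    qed
    also have "\<dots> \<le> limsup (\<lambda>n. H (wB n) t)"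
      unfolding H_nonneg_time[OF t0] by (rule Liminf_le_Limsup) simp
    also have "\<dots> \<le> ennreal (2 * c1 * exp (2 * c2 * T))"
      by (rule Limsup_bounded) (simp add: bnd[OF t])
    finally show ?thesis .
  qed
  then show ?thesis using c by (intro exI[of _ "2 * c1 * exp (2 * c2 * T)"]) auto
qed

lemma H_finite: "H wY v < \<top>"
proof (cases "0 \<le> v")
  case True
  from moment_bound[OF True] obtain C where "\<forall>t\<in>{0..v}. H wY t \<le> ennreal C" by blast
  then have "H wY v \<le> ennreal C" using True by simp
  then show ?thesis by (rule le_less_trans) simp
next
  case False
  then have "H wY v \<le> ennreal (exp (\<bar>\<rho>\<bar> * d) * \<bar>indicator {-d<..<0} v * x1 v\<bar>)" by (intro H_history) simp
  then show ?thesis by (rule le_less_trans) simp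
qed

text \<open>At negative times the history is merely integrable, so a bound uniform in v is available
  only from time 0 on and the two ranges are treated separately.\<close>

lemma H_integral_finite: "(\<integral>\<^sup>+v\<in>{a..b}. H wY v \<partial>lborel) < \<top>"
proof -
  from moment_bound[of "max b 0"] obtain C where C: "\<forall>t\<in>{0..max b 0}. H wY t \<le> ennreal C" by auto
  note [measurable] = H_measurable[OF good_wY]
  have "(\<integral>\<^sup>+v\<in>{a..b}. H wY v \<partial>lborel) \<le> (\<integral>\<^sup>+v. H wY v * indicator {..<0} v + ennreal C * indicator {0..max b 0} v \<partial>lborel)"
    using C by (intro nn_integral_mono) (auto simp: indicator_def)
  also have "\<dots> = (\<integral>\<^sup>+v\<in>{..<0}. H wY v \<partial>lborel) + (\<integral>\<^sup>+v. ennreal C * indicator {0..max b 0} v \<partial>lborel)"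
    by (rule nn_integral_add) measurable
  also have "\<dots> \<le> ennreal cH + ennreal C * ennreal (max b 0)"
    using H_history_integral by (intro add_mono) (simp_all add: nn_integral_cmult)
  also have "\<dots> < \<top>" by (simp add: ennreal_mult_less_top)
  finally show ?thesis .
qed

end

section \<open>The Volterra equation for conditional expectations\<close>

lemma integrable_pair_nn:
  fixes f :: "'a \<times> 'b \<Rightarrow> real"
  assumes "pair_sigma_finite N1 N2" and f: "f \<in> borel_measurable (N1 \<Otimes>\<^sub>M N2)"
    and fin: "(\<integral>\<^sup>+x. (\<integral>\<^sup>+z. ennreal \<bar>f (x, z)\<bar> \<partial>N2) \<partial>N1) < \<top>"
  shows "integrable (N1 \<Otimes>\<^sub>M N2) f"
proof -
  interpret pr: pair_sigma_finite N1 N2 by fact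
  have "(\<lambda>p. ennreal \<bar>f p\<bar>) \<in> borel_measurable (N1 \<Otimes>\<^sub>M N2)" using f by measurable
  from pr.M2.nn_integral_fst[OF this] fin show ?thesis
    using f by (intro integrableI_bounded) auto
qed

context income_process
begin

text \<open>For \<open>s \<le> v\<close> this is the expectation of \<open>\<xi>\<^sub>v y\<^sub>v\<close> on \<open>A\<close>; the factor for \<open>v < s\<close> is the one
  with which \<open>P_volterra\<close> takes the same form before and after \<open>s\<close>.\<close>

definition P :: "real \<Rightarrow> 'w set \<Rightarrow> real \<Rightarrow> real" where
  "P s A v = exp (\<rho> * (max v s - v)) * expectation (\<lambda>\<omega>. indicator A \<omega> * yh v \<omega> * \<xi> (max v s) \<omega>)"

lemma state_price_pos: "AE \<omega> in M. \<forall>t\<ge>0. 0 < \<xi> t \<omega>"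
  using xi_explicit by eventually_elim (auto simp: xi_pos)

lemma yh_M: "yh v \<in> borel_measurable M"
  using yh_F by (rule F_imp_M)

lemma yh_F': "v \<le> u \<Longrightarrow> 0 \<le> u \<Longrightarrow> yh v \<in> borel_measurable (F u)"
  by (rule F_measurable_mono[OF yh_F]) simp

lemma weighted_integrable:
  assumes u: "0 \<le> u" "v \<le> u" and A: "A \<in> sets M"
  shows "integrable M (\<lambda>\<omega>. indicator A \<omega> * yh v \<omega> * \<xi> u \<omega>)"
    "(\<integral>\<^sup>+\<omega>. ennreal \<bar>indicator A \<omega> * yh v \<omega> * \<xi> u \<omega>\<bar> \<partial>M) \<le> ennreal (exp (- \<rho> * (u - v))) * H wY v"
proof -
  have "(\<integral>\<^sup>+\<omega>. ennreal \<bar>indicator A \<omega> * yh v \<omega> * \<xi> u \<omega>\<bar> \<partial>M) \<le> (\<integral>\<^sup>+\<omega>. wY v \<omega> * ennreal (\<xi> u \<omega>) \<partial>M)"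
  proof (rule nn_integral_mono_AE)
    show "AE \<omega> in M. ennreal \<bar>indicator A \<omega> * yh v \<omega> * \<xi> u \<omega>\<bar> \<le> wY v \<omega> * ennreal (\<xi> u \<omega>)"
      using state_price_pos
    proof eventually_elim
      case (elim \<omega>)
      then have "0 < \<xi> u \<omega>" using u by blast
      then show ?case by (auto simp: wY_def indicator_def abs_mult ennreal_mult)
    qed
  qed
  also have "\<dots> = ennreal (exp (- \<rho> * (u - v))) * H wY v"
    by (rule H_shift[OF good_wY u])
  finally show *: "(\<integral>\<^sup>+\<omega>. ennreal \<bar>indicator A \<omega> * yh v \<omega> * \<xi> u \<omega>\<bar> \<partial>M) \<le> ennreal (exp (- \<rho> * (u - v))) * H wY v" .
  have "ennreal (exp (- \<rho> * (u - v))) * H wY v < \<top>"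
    using H_finite by (simp add: ennreal_mult_less_top)
  with * have "(\<integral>\<^sup>+\<omega>. ennreal \<bar>indicator A \<omega> * yh v \<omega> * \<xi> u \<omega>\<bar> \<partial>M) < \<top>" by (rule le_less_trans)
  then show "integrable M (\<lambda>\<omega>. indicator A \<omega> * yh v \<omega> * \<xi> u \<omega>)"
    using yh_M F_imp_M[OF xi_F[OF u(1)]] A
    by (intro integrableI_bounded borel_measurable_times borel_measurable_indicator) auto
qed

text \<open>For v before s the income at v is known at s, and the expectation on A evolves only
  through \<xi> after the later of the two times; the factor in the definition of P makes one
  formula cover both cases.\<close>

lemma weighted_expectation:
  assumes s: "0 \<le> s" and A: "A \<in> sets (F s)" and u: "s \<le> u" "v \<le> u"
  shows "expectation (\<lambda>\<omega>. indicator A \<omega> * yh v \<omega> * \<xi> u \<omega>) = exp (- \<rho> * (u - v)) * P s A v"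
proof -
  define m where "m = max v s"
  have m: "0 \<le> m" "m \<le> u" "v \<le> m" "s \<le> m" using s u by (auto simp: m_def)
  have AM: "A \<in> sets M" using A sets_F_subset by blast
  define X where "X \<omega> = indicator A \<omega> * yh v \<omega> * \<xi> m \<omega>" for \<omega>
  have X: "X \<in> borel_measurable (F m)"
    unfolding X_def[abs_def] using A F_mono[OF m(4)] yh_F'[OF m(3,1)] xi_F[OF m(1)]
    by (intro borel_measurable_times borel_measurable_indicator) auto
  have Xi: "integrable M X" unfolding X_def by (rule weighted_integrable(1)[OF m(1,3) AM])
  have "expectation (\<lambda>\<omega>. indicator A \<omega> * yh v \<omega> * \<xi> u \<omega>) =
     expectation (\<lambda>\<omega>. X \<omega> * exp ((- \<kappa>) \<bullet> dZ m u \<omega> + (- (\<rho> + (norm \<kappa>)\<^sup>2 / 2) * (u - m))))"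
  proof (rule integral_cong_AE)
    show "(\<lambda>\<omega>. indicator A \<omega> * yh v \<omega> * \<xi> u \<omega>) \<in> borel_measurable M"
      using weighted_integrable(1)[of u v A] m u AM by auto
    show "(\<lambda>\<omega>. X \<omega> * exp ((- \<kappa>) \<bullet> dZ m u \<omega> + (- (\<rho> + (norm \<kappa>)\<^sup>2 / 2) * (u - m)))) \<in> borel_measurable M"
      by (rule borel_measurable_integrable[OF real_shift(1)[OF m(1,2) X Xi]])
    show "AE \<omega> in M. indicator A \<omega> * yh v \<omega> * \<xi> u \<omega> = X \<omega> * exp ((- \<kappa>) \<bullet> dZ m u \<omega> + (- (\<rho> + (norm \<kappa>)\<^sup>2 / 2) * (u - m)))"
      using xi_explicit
    proof eventually_elim
      case (elim \<omega>)
      then have "\<xi> u \<omega> = xi u \<omega>" "\<xi> m \<omega> = xi m \<omega>" using m by auto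
      then show ?case using xi_step[of u \<omega> m] by (simp add: X_def mult_ac)
    qed
  qed
  also have "\<dots> = exp (- \<rho> * (u - m)) * expectation X"
    using real_shift(2)[OF m(1,2) X Xi] by (simp only: xi_step_exponent)
  also have "exp (- \<rho> * (u - m)) = exp (- \<rho> * (u - v)) * exp (\<rho> * (m - v))"
    by (simp add: mult_exp_exp algebra_simps)
  finally show ?thesis by (simp add: P_def X_def m_def)
qed

lemma weighted_growth_expectation:
  assumes s: "0 \<le> s" and A: "A \<in> sets (F s)" and u: "s \<le> u" "v \<le> u" "u \<le> t"
  shows "integrable M (\<lambda>\<omega>. indicator A \<omega> * yh v \<omega> * (gG t \<omega> * es u \<omega>))"
    "expectation (\<lambda>\<omega>. indicator A \<omega> * yh v \<omega> * (gG t \<omega> * es u \<omega>)) = exp (- \<beta> * (t - u)) * (exp (- \<rho> * (u - v)) * P s A v)"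
proof -
  have u0: "0 \<le> u" and t0: "0 \<le> t" using s u by auto
  have AM: "A \<in> sets M" using A sets_F_subset by blast
  define X where "X \<omega> = indicator A \<omega> * yh v \<omega> * \<xi> u \<omega>" for \<omega>
  have X: "X \<in> borel_measurable (F u)"
    unfolding X_def[abs_def] using A F_mono[OF u(1)] yh_F'[OF u(2) u0] xi_F[OF u0]
    by (intro borel_measurable_times borel_measurable_indicator) auto
  have Xi: "integrable M X" unfolding X_def by (rule weighted_integrable(1)[OF u0 u(2) AM])
  define E where "E \<omega> = exp ((\<sigma>y - \<kappa>) \<bullet> dZ u t \<omega> + (\<mu>y - (norm \<sigma>y)\<^sup>2 / 2 - \<rho> - (norm \<kappa>)\<^sup>2 / 2) * (t - u))" for \<omega>
  note sh = real_shift[OF u0 u(3) X Xi, of "\<sigma>y - \<kappa>" "(\<mu>y - (norm \<sigma>y)\<^sup>2 / 2 - \<rho> - (norm \<kappa>)\<^sup>2 / 2) * (t - u)", folded E_def]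
  have ae: "AE \<omega> in M. X \<omega> * E \<omega> = indicator A \<omega> * yh v \<omega> * (gG t \<omega> * es u \<omega>)"
    using xi_explicit AE_not_discontinuous
  proof eventually_elim
    case (elim \<omega>)
    then have "\<xi> u \<omega> = xi u \<omega>" using u0 by auto
    then show ?case using growth_step[OF elim(2), of t u] by (simp add: X_def E_def mult_ac)
  qed
  have meas: "(\<lambda>\<omega>. indicator A \<omega> * yh v \<omega> * (gG t \<omega> * es u \<omega>)) \<in> borel_measurable M"
    using AM yh_M gG_M[OF t0] F_imp_M[OF es_F[OF u0]]
    by (intro borel_measurable_times borel_measurable_indicator) auto
  show "integrable M (\<lambda>\<omega>. indicator A \<omega> * yh v \<omega> * (gG t \<omega> * es u \<omega>))"
    using integrable_cong_AE_imp[OF sh(1) meas] ae by (simp add: eq_commute)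
  have "expectation (\<lambda>\<omega>. indicator A \<omega> * yh v \<omega> * (gG t \<omega> * es u \<omega>)) = expectation (\<lambda>\<omega>. X \<omega> * E \<omega>)"
    using ae sh(1) meas by (intro integral_cong_AE) (auto simp: eq_commute)
  also have "\<dots> = exp (- \<beta> * (t - u)) * expectation X"
    using sh(2) by (simp only: growth_step_exponent)
  also have "expectation X = exp (- \<rho> * (u - v)) * P s A v"
    unfolding X_def by (rule weighted_expectation[OF s A u(1,2)])
  finally show "expectation (\<lambda>\<omega>. indicator A \<omega> * yh v \<omega> * (gG t \<omega> * es u \<omega>)) = exp (- \<beta> * (t - u)) * (exp (- \<rho> * (u - v)) * P s A v)" .
qed

lemma yh_xi_measurable:
  "(\<lambda>q. yh (snd q) (fst q) * \<xi> (max (snd q) s) (fst q)) \<in> borel_measurable (M \<Otimes>\<^sub>M borel)" if "0 \<le> s" for s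
proof -
  have "(\<lambda>q. (fst q, max (snd q) s)) \<in> M \<Otimes>\<^sub>M borel \<rightarrow>\<^sub>M M \<Otimes>\<^sub>M borel" by measurable
  from measurable_compose[OF this continuous_adapted_measurable[OF xi_ca]]
  have "(\<lambda>q. \<xi> (max 0 (max (snd q) s)) (fst q)) \<in> borel_measurable (M \<Otimes>\<^sub>M borel)" by simp
  moreover have "max 0 (max r s) = max r s" for r using that by auto
  ultimately show ?thesis using yh_measurable by (intro borel_measurable_times) auto
qed

lemma P_measurable:
  assumes s: "0 \<le> s" and A: "A \<in> sets M"
  shows "P s A \<in> borel_measurable borel"
proof -
  note [measurable] = yh_xi_measurable[OF s] A
  have "(\<lambda>q. indicator A (fst q) * (yh (snd q) (fst q) * \<xi> (max (snd q) s) (fst q))) \<in> borel_measurable (M \<Otimes>\<^sub>M borel)"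
    by measurable
  from measurable_pair_swap[OF this]
  have "(\<lambda>(v, \<omega>). indicator A \<omega> * yh v \<omega> * \<xi> (max v s) \<omega>) \<in> borel_measurable (borel \<Otimes>\<^sub>M M)"
    by (simp add: case_prod_beta mult.assoc)
  from borel_measurable_lebesgue_integral[OF this] show ?thesis
    unfolding P_def[abs_def] by measurable
qed

lemma P_bound:
  assumes s: "0 \<le> s" and A: "A \<in> sets M"
  shows "ennreal \<bar>P s A v\<bar> \<le> H wY v"
proof -
  have m: "0 \<le> max v s" "v \<le> max v s" using s by auto
  have "ennreal \<bar>P s A v\<bar> \<le> ennreal (exp (\<rho> * (max v s - v))) * (ennreal (exp (- \<rho> * (max v s - v))) * H wY v)"
    unfolding P_def abs_mult
    using order_trans[OF abs_integral_le_nn weighted_integrable(2)[OF m A]]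
    by (simp add: ennreal_mult mult_left_mono)
  also have "\<dots> = H wY v"
    unfolding mult.assoc[symmetric] ennreal_mult'[OF exp_ge_zero, symmetric] mult_exp_exp by simp
  finally show ?thesis .
qed

lemma P_integrable:
  assumes s: "0 \<le> s" and A: "A \<in> sets M"
  shows "set_integrable lborel {a..b} (P s A)"
  unfolding set_integrable_def
proof (rule integrableI_bounded)
  show "(\<lambda>x. indicator {a..b} x *\<^sub>R P s A x) \<in> borel_measurable lborel"
    using P_measurable[OF s A] by measurable
  have "(\<integral>\<^sup>+x. ennreal (norm (indicator {a..b} x *\<^sub>R P s A x)) \<partial>lborel) \<le> (\<integral>\<^sup>+v\<in>{a..b}. H wY v \<partial>lborel)"
    using P_bound[OF s A] by (intro nn_integral_mono) (auto simp: indicator_def)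
  also note H_integral_finite
  finally show "(\<integral>\<^sup>+x. ennreal (norm (indicator {a..b} x *\<^sub>R P s A x)) \<partial>lborel) < \<infinity>" by simp
qed

text \<open>The income identity from s to t, multiplied by the indicator of A and by
  \<open>gG t\<close>, in expectation. Fubini's theorem, justified by \<open>KN_bound\<close> and
  \<open>H_integral_finite\<close>, replaces the random kernel by exp (- \<beta> (t - u)) exp
  (\<rho> \<zeta>). Lags reaching back before s need no separate treatment, by the form of
  P.\<close>

lemma P_volterra:
  assumes s: "0 \<le> s" and A: "A \<in> sets (F s)" and t: "s \<le> t"
  shows "P s A t = exp (- \<beta> * (t - s)) * P s A s +
    (\<integral>p. indicator {s<..t} (fst p) * (phi0 (snd p) * exp (- \<beta> * (t - fst p)) * exp (\<rho> * snd p) * P s A (fst p + snd p)) \<partial>lborel)"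
proof -
  have t0: "0 \<le> t" using s t by simp
  have AM: "A \<in> sets M" using A sets_F_subset by blast
  interpret pr: pair_sigma_finite M "lborel :: (real \<times> real) measure" ..
  define f where "f = (\<lambda>q. indicator A (fst q) * (indicator {s<..t} (fst (snd q)) * phi0 (snd (snd q)) *
     (yh (fst (snd q) + snd (snd q)) (fst q) * (gG t (fst q) * es (max 0 (fst (snd q))) (fst q)))))"
  have fm: "f \<in> borel_measurable (M \<Otimes>\<^sub>M lborel)"
  proof -
    have "(\<lambda>q. (fst q, fst (snd q) + snd (snd q))) \<in> (M \<Otimes>\<^sub>M (borel :: (real \<times> real) measure)) \<rightarrow>\<^sub>M (M \<Otimes>\<^sub>M borel)"
      unfolding borel_prod[symmetric] by measurable
    from measurable_compose[OF this yh_measurable] have [measurable]: "(\<lambda>q. yh (fst (snd q) + snd (snd q)) (fst q)) \<in> borel_measurable (M \<Otimes>\<^sub>M (borel :: (real \<times> real) measure))"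
      by simp
    have e1: "(\<lambda>p. es (max 0 (snd p)) (fst p)) \<in> borel_measurable (M \<Otimes>\<^sub>M borel)"
      by (rule clamped_measurable[OF F_imp_M[OF es_F] es_continuous])
    have "(\<lambda>q. (fst q, fst (snd q))) \<in> (M \<Otimes>\<^sub>M (borel :: (real \<times> real) measure)) \<rightarrow>\<^sub>M (M \<Otimes>\<^sub>M borel)"
      unfolding borel_prod[symmetric] by measurable
    from measurable_compose[OF this e1] have [measurable]: "(\<lambda>q. es (max 0 (fst (snd q))) (fst q)) \<in> borel_measurable (M \<Otimes>\<^sub>M (borel :: (real \<times> real) measure))"
      by simp
    have [measurable]: "(\<lambda>q. phi0 (snd (snd q))) \<in> borel_measurable (M \<Otimes>\<^sub>M (borel :: (real \<times> real) measure))"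
      "(\<lambda>q. indicator {s<..t} (fst (snd q)) :: real) \<in> borel_measurable (M \<Otimes>\<^sub>M (borel :: (real \<times> real) measure))"
      unfolding borel_prod[symmetric] by measurable
    note [measurable] = gG_M[OF t0] AM
    have "f \<in> borel_measurable (M \<Otimes>\<^sub>M borel)" unfolding f_def by measurable
    then show ?thesis by (simp cong: measurable_cong_sets add: sets_pair_measure_cong[OF refl sets_lborel])
  qed
  have fi: "integrable (M \<Otimes>\<^sub>M lborel) f"
  proof (rule integrable_pair_nn[OF _ fm])
    have "(\<integral>\<^sup>+\<omega>. (\<integral>\<^sup>+p. ennreal \<bar>f (\<omega>, p)\<bar> \<partial>lborel) \<partial>M) \<le> (\<integral>\<^sup>+\<omega>. (\<integral>\<^sup>+p. KN wY s t \<omega> p \<partial>lborel) \<partial>M)"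
    proof (intro nn_integral_mono)
      fix \<omega> and p :: "real \<times> real"
      have "\<bar>f (\<omega>, p)\<bar> \<le> \<bar>phi0 (snd p)\<bar> * indicator {s<..t} (fst p) * (\<bar>yh (fst p + snd p) \<omega>\<bar> * (gG t \<omega> * es (max 0 (fst p)) \<omega>))"
        using es_nonneg[of "max 0 (fst p)" \<omega>] gG_pos[of t \<omega>]
        by (auto simp: f_def abs_mult indicator_def)
      then have "ennreal \<bar>f (\<omega>, p)\<bar> \<le> ennreal (\<bar>phi0 (snd p)\<bar> * indicator {s<..t} (fst p) * (\<bar>yh (fst p + snd p) \<omega>\<bar> * (gG t \<omega> * es (max 0 (fst p)) \<omega>)))"
        by (rule ennreal_leI)
      also have "\<dots> = KN wY s t \<omega> p"
        using es_nonneg[of "max 0 (fst p)" \<omega>] gG_pos[of t \<omega>]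
        by (simp add: KN_def wY_def ennreal_mult' indicator_def)
      finally show "ennreal \<bar>f (\<omega>, p)\<bar> \<le> KN wY s t \<omega> p" .
    qed
    also have "\<dots> \<le> ennreal cK * (\<integral>\<^sup>+v\<in>{s - d..t}. H wY v \<partial>lborel)" by (rule KN_bound[OF good_wY s t])
    also have "\<dots> < \<top>" using H_integral_finite by (simp add: ennreal_mult_less_top)
    finally show "(\<integral>\<^sup>+\<omega>. (\<integral>\<^sup>+p. ennreal \<bar>f (\<omega>, p)\<bar> \<partial>lborel) \<partial>M) < \<top>" .
  qed unfold_locales
  have fi': "integrable (M \<Otimes>\<^sub>M lborel) (case_prod (\<lambda>\<omega> p. f (\<omega>, p)))" using fi by simp
  \<comment> \<open>For almost every \<omega> the section of f is integrable, so the integral over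
    the pair (u, \<zeta>) may be iterated; its inner integral is the delayed drift.\<close>
  have path: "AE \<omega> in M. indicator A \<omega> * yh t \<omega> * \<xi> t \<omega> =
     indicator A \<omega> * yh s \<omega> * (gG t \<omega> * es s \<omega>) + (\<integral>p. f (\<omega>, p) \<partial>lborel)"
    using income_identity xi_explicit AE_not_discontinuous pr.AE_integrable_fst'[OF fi] AE_space
  proof eventually_elim
    case (elim \<omega>)
    have yid: "y t \<omega> * es t \<omega> = y s \<omega> * es s \<omega> + (LBINT u:{s<..t}. es u \<omega> * drift u \<omega>)"
      using elim(1) s t by blast
    have xt: "\<xi> t \<omega> = gG t \<omega> * es t \<omega>"
      using elim(2) t0 growth_step[OF elim(3), of t t] by simp
    have "integrable (lborel \<Otimes>\<^sub>M lborel) (\<lambda>p. f (\<omega>, p))" using elim(4) by (simp add: lborel_prod)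
    from lborel_pair.integral_fst'[OF this]
    have "(\<integral>p. f (\<omega>, p) \<partial>lborel) = (\<integral>u. (\<integral>\<zeta>. f (\<omega>, (u, \<zeta>)) \<partial>lborel) \<partial>lborel)" by (simp add: lborel_prod)
    also have "\<dots> = (\<integral>u. (indicator A \<omega> * gG t \<omega>) * (indicator {s<..t} u *\<^sub>R (es u \<omega> * drift u \<omega>)) \<partial>lborel)"
    proof (rule Bochner_Integration.integral_cong[OF refl])
      fix u :: real
      have "(\<integral>\<zeta>. f (\<omega>, (u, \<zeta>)) \<partial>lborel) =
        (\<integral>\<zeta>. (indicator A \<omega> * indicator {s<..t} u * gG t \<omega> * es (max 0 u) \<omega>) * (phi0 \<zeta> * yh (u + \<zeta>) \<omega>) \<partial>lborel)"
        by (simp add: f_def mult_ac)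
      also have "\<dots> = (indicator A \<omega> * indicator {s<..t} u * gG t \<omega> * es (max 0 u) \<omega>) * drift u \<omega>"
        by (simp add: drift_def)
      also have "\<dots> = (indicator A \<omega> * gG t \<omega>) * (indicator {s<..t} u *\<^sub>R (es u \<omega> * drift u \<omega>))"
        using s by (auto simp: indicator_def max_def)
      finally show "(\<integral>\<zeta>. f (\<omega>, (u, \<zeta>)) \<partial>lborel) = (indicator A \<omega> * gG t \<omega>) * (indicator {s<..t} u *\<^sub>R (es u \<omega> * drift u \<omega>))" .
    qed
    also have "\<dots> = (indicator A \<omega> * gG t \<omega>) * (LBINT u:{s<..t}. es u \<omega> * drift u \<omega>)"
      unfolding set_lebesgue_integral_def by simp
    finally have pf: "(\<integral>p. f (\<omega>, p) \<partial>lborel) = (indicator A \<omega> * gG t \<omega>) * (LBINT u:{s<..t}. es u \<omega> * drift u \<omega>)" .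
    have "indicator A \<omega> * yh t \<omega> * \<xi> t \<omega> = indicator A \<omega> * gG t \<omega> * (y t \<omega> * es t \<omega>)"
      using t0 xt by (simp add: yh_def)
    also have "\<dots> = indicator A \<omega> * gG t \<omega> * (y s \<omega> * es s \<omega>) + (indicator A \<omega> * gG t \<omega>) * (LBINT u:{s<..t}. es u \<omega> * drift u \<omega>)"
      unfolding yid by (rule distrib_left)
    finally show ?case using s unfolding pf by (simp add: yh_def mult_ac)
  qed
  have w: "integrable M (\<lambda>\<omega>. indicator A \<omega> * yh s \<omega> * (gG t \<omega> * es s \<omega>))"
    by (rule weighted_growth_expectation(1)[OF s A order.refl order.refl t])
  have "P s A t = expectation (\<lambda>\<omega>. indicator A \<omega> * yh t \<omega> * \<xi> t \<omega>)"
    using t by (simp add: P_def max_def)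
  also have "\<dots> = expectation (\<lambda>\<omega>. indicator A \<omega> * yh s \<omega> * (gG t \<omega> * es s \<omega>) + (\<integral>p. f (\<omega>, p) \<partial>lborel))"
  proof (rule integral_cong_AE[OF _ _ path])
    show "(\<lambda>\<omega>. indicator A \<omega> * yh t \<omega> * \<xi> t \<omega>) \<in> borel_measurable M"
      using weighted_integrable(1)[OF t0 order.refl AM] by auto
    show "(\<lambda>\<omega>. indicator A \<omega> * yh s \<omega> * (gG t \<omega> * es s \<omega>) + (\<integral>p. f (\<omega>, p) \<partial>lborel)) \<in> borel_measurable M"
      using w pr.integrable_fst'[OF fi] by (intro borel_measurable_add) auto
  qed
  also have "\<dots> = expectation (\<lambda>\<omega>. indicator A \<omega> * yh s \<omega> * (gG t \<omega> * es s \<omega>)) + expectation (\<lambda>\<omega>. \<integral>p. f (\<omega>, p) \<partial>lborel)"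
    by (rule Bochner_Integration.integral_add[OF w pr.integrable_fst'[OF fi]])
  also have "expectation (\<lambda>\<omega>. indicator A \<omega> * yh s \<omega> * (gG t \<omega> * es s \<omega>)) = exp (- \<beta> * (t - s)) * P s A s"
    using weighted_growth_expectation(2)[OF s A order.refl order.refl t] by simp
  also have "expectation (\<lambda>\<omega>. \<integral>p. f (\<omega>, p) \<partial>lborel) = (\<integral>p. expectation (\<lambda>\<omega>. f (\<omega>, p)) \<partial>lborel)"
    by (rule pr.Fubini_integral[OF fi', symmetric])
  also have "\<dots> = (\<integral>p. indicator {s<..t} (fst p) * (phi0 (snd p) * exp (- \<beta> * (t - fst p)) * exp (\<rho> * snd p) * P s A (fst p + snd p)) \<partial>lborel)"
  proof (rule Bochner_Integration.integral_cong[OF refl])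
    fix p :: "real \<times> real"
    obtain u \<zeta> where p: "p = (u, \<zeta>)" by (cases p)
    show "expectation (\<lambda>\<omega>. f (\<omega>, p)) = indicator {s<..t} (fst p) * (phi0 (snd p) * exp (- \<beta> * (t - fst p)) * exp (\<rho> * snd p) * P s A (fst p + snd p))"
    proof (cases "s < u \<and> u \<le> t \<and> - d < \<zeta> \<and> \<zeta> < 0")
      case True
      then have u: "s \<le> u" "u + \<zeta> \<le> u" "u \<le> t" "max 0 u = u" using s by auto
      have "expectation (\<lambda>\<omega>. f (\<omega>, p)) = expectation (\<lambda>\<omega>. phi0 \<zeta> * (indicator A \<omega> * yh (u + \<zeta>) \<omega> * (gG t \<omega> * es u \<omega>)))"
        using True u by (simp add: f_def p mult_ac)
      also have "\<dots> = phi0 \<zeta> * (exp (- \<beta> * (t - u)) * (exp (- \<rho> * (u - (u + \<zeta>))) * P s A (u + \<zeta>)))"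
        using weighted_growth_expectation(2)[OF s A u(1-3)] by simp
      finally show ?thesis using True by (simp add: p mult_ac)
    next
      case False
      then have "phi0 \<zeta> = 0 \<or> u \<notin> {s<..t}" using phi0_outside[of \<zeta>] by auto
      then show ?thesis by (auto simp: f_def p)
    qed
  qed
  finally show ?thesis .
qed

text \<open>The half-open interval is the set of times at which 1 - R(u) equals 1: retirement begins
  at \<tau> itself.\<close>

lemma expectation_time_integral:
  assumes s: "0 \<le> s" and A: "A \<in> sets (F s)"
  shows "integrable M (\<lambda>\<omega>. indicator A \<omega> * (LBINT u:{s..<\<tau>}. \<xi> u \<omega> * y u \<omega>))"
    "expectation (\<lambda>\<omega>. indicator A \<omega> * (LBINT u:{s..<\<tau>}. \<xi> u \<omega> * y u \<omega>)) = (LBINT u:{s..<\<tau>}. P s A u)"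
proof -
  have AM: "A \<in> sets M" using A sets_F_subset by blast
  interpret pr: pair_sigma_finite M "lborel :: real measure" ..
  define f where "f = (\<lambda>q. indicator A (fst q) * (indicator {s..<\<tau>} (snd q) * (yh (snd q) (fst q) * \<xi> (max (snd q) s) (fst q))))"
  note [measurable] = yh_xi_measurable[OF s] AM
  have "f \<in> borel_measurable (M \<Otimes>\<^sub>M borel)" unfolding f_def by measurable
  then have fm: "f \<in> borel_measurable (M \<Otimes>\<^sub>M lborel)"
    by (simp cong: measurable_cong_sets add: sets_pair_measure_cong[OF refl sets_lborel])
  have f_eq: "f (\<omega>, u) = indicator {s..<\<tau>} u * (indicator A \<omega> * yh u \<omega> * \<xi> u \<omega>)" for \<omega> u
    by (auto simp: f_def indicator_def max_def)
  have fi: "integrable (M \<Otimes>\<^sub>M lborel) f"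
  proof (rule integrable_pair_nn[OF _ fm])
    have "(\<integral>\<^sup>+\<omega>. (\<integral>\<^sup>+u. ennreal \<bar>f (\<omega>, u)\<bar> \<partial>lborel) \<partial>M) = (\<integral>\<^sup>+u. (\<integral>\<^sup>+\<omega>. ennreal \<bar>f (\<omega>, u)\<bar> \<partial>M) \<partial>lborel)"
      by (rule pr.Fubini[where f="\<lambda>q. ennreal \<bar>f q\<bar>", symmetric])
         (rule measurable_compose[OF borel_measurable_abs[OF fm] measurable_ennreal])
    also have "\<dots> \<le> (\<integral>\<^sup>+u\<in>{s..\<tau>}. H wY u \<partial>lborel)"
    proof (rule nn_integral_mono)
      fix u :: real
      show "(\<integral>\<^sup>+\<omega>. ennreal \<bar>f (\<omega>, u)\<bar> \<partial>M) \<le> H wY u * indicator {s..\<tau>} u"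
      proof (cases "u \<in> {s..<\<tau>}")
        case True
        then have "0 \<le> u" using s by simp
        from weighted_integrable(2)[OF this order.refl AM] show ?thesis
          using True by (simp add: f_eq)
      next
        case False
        then show ?thesis by (simp add: f_eq)
      qed
    qed
    also note H_integral_finite
    finally show "(\<integral>\<^sup>+\<omega>. (\<integral>\<^sup>+u. ennreal \<bar>f (\<omega>, u)\<bar> \<partial>lborel) \<partial>M) < \<top>" .
  qed unfold_locales
  have fi': "integrable (M \<Otimes>\<^sub>M lborel) (case_prod (\<lambda>\<omega> u. f (\<omega>, u)))" using fi by simp
  have inner: "(\<integral>u. f (\<omega>, u) \<partial>lborel) = indicator A \<omega> * (LBINT u:{s..<\<tau>}. \<xi> u \<omega> * y u \<omega>)" for \<omega>
  proof -
    have "(\<integral>u. f (\<omega>, u) \<partial>lborel) = (\<integral>u. indicator A \<omega> * (indicator {s..<\<tau>} u *\<^sub>R (\<xi> u \<omega> * y u \<omega>)) \<partial>lborel)"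
      using s by (intro Bochner_Integration.integral_cong refl) (auto simp: f_eq indicator_def yh_def)
    then show ?thesis unfolding set_lebesgue_integral_def by simp
  qed
  show "integrable M (\<lambda>\<omega>. indicator A \<omega> * (LBINT u:{s..<\<tau>}. \<xi> u \<omega> * y u \<omega>))"
    using pr.integrable_fst'[OF fi] unfolding inner .
  have "expectation (\<lambda>\<omega>. indicator A \<omega> * (LBINT u:{s..<\<tau>}. \<xi> u \<omega> * y u \<omega>)) = (\<integral>u. expectation (\<lambda>\<omega>. f (\<omega>, u)) \<partial>lborel)"
    unfolding inner[symmetric] by (rule pr.Fubini_integral[OF fi', symmetric])
  also have "\<dots> = (LBINT u:{s..<\<tau>}. P s A u)"
    unfolding set_lebesgue_integral_def
  proof (rule Bochner_Integration.integral_cong[OF refl])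
    fix u :: real
    show "expectation (\<lambda>\<omega>. f (\<omega>, u)) = indicator {s..<\<tau>} u *\<^sub>R P s A u"
      by (cases "u \<in> {s..<\<tau>}") (auto simp: f_eq P_def max_def)
  qed
  finally show "expectation (\<lambda>\<omega>. indicator A \<omega> * (LBINT u:{s..<\<tau>}. \<xi> u \<omega> * y u \<omega>)) = (LBINT u:{s..<\<tau>}. P s A u)" .
qed

text \<open>Measurability with respect to \<open>F s\<close> requires that the path is used only up
  to s. With the time argument clamped to [0, s], \<open>caratheodory_measurable\<close> applies
  over \<open>F s\<close> in place of M.\<close>

lemma history_functional_measurable:
  assumes s: "0 \<le> s" and k: "k \<in> borel_measurable borel"
  shows "(\<lambda>\<omega>. LBINT \<zeta>:{-d<..<0}. k \<zeta> * yh (s + \<zeta>) \<omega>) \<in> borel_measurable (F s)"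
proof -
  have "(\<lambda>p. y (min (max 0 (snd p)) s) (fst p)) \<in> borel_measurable (F s \<Otimes>\<^sub>M borel)"
  proof (rule caratheodory_measurable[where f="\<lambda>t. y (min (max 0 t) s)"])
    show "y (min (max 0 t) s) \<in> borel_measurable (F s)" for t
      using s by (intro F_measurable_mono[OF y_F]) auto
    show "continuous_on UNIV (\<lambda>t. y (min (max 0 t) s) \<omega>)" if "\<omega> \<in> space (F s)" for \<omega>
    proof (rule continuous_on_compose2[where f="\<lambda>t. min (max 0 t) s"])
      show "continuous_on {0..} (\<lambda>t. y t \<omega>)" using y_ca that by (auto simp: continuous_adapted_def)
    qed (use s in \<open>auto intro!: continuous_intros\<close>)
  qed
  note yc = this
  have "(\<lambda>p. (fst p, s + snd p)) \<in> F s \<Otimes>\<^sub>M borel \<rightarrow>\<^sub>M F s \<Otimes>\<^sub>M borel" by measurable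
  from measurable_compose[OF this yc]
  have [measurable]: "(\<lambda>p. y (min (max 0 (s + snd p)) s) (fst p)) \<in> borel_measurable (F s \<Otimes>\<^sub>M borel)" by simp
  have [measurable]: "(\<lambda>p. indicator {-d<..<0} (s + snd p) * x1 (s + snd p)) \<in> borel_measurable (F s \<Otimes>\<^sub>M borel)"
    by (rule measurable_compose[OF _ hist_measurable]) measurable
  note [measurable] = k
  define e where "e = (\<lambda>p. indicator {-d<..<0} (snd p) *\<^sub>R (k (snd p) *
     (if 0 \<le> s + snd p then y (min (max 0 (s + snd p)) s) (fst p) else indicator {-d<..<0} (s + snd p) * x1 (s + snd p))))"
  have "e \<in> borel_measurable (F s \<Otimes>\<^sub>M borel)" unfolding e_def by measurable
  then have "(\<lambda>(\<omega>, \<zeta>). e (\<omega>, \<zeta>)) \<in> borel_measurable (F s \<Otimes>\<^sub>M lborel)"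
    by (simp cong: measurable_cong_sets add: sets_pair_measure_cong[OF refl sets_lborel])
  from lborel.borel_measurable_lebesgue_integral[OF this]
  have "(\<lambda>\<omega>. \<integral>\<zeta>. e (\<omega>, \<zeta>) \<partial>lborel) \<in> borel_measurable (F s)" .
  also have "(\<lambda>\<omega>. \<integral>\<zeta>. e (\<omega>, \<zeta>) \<partial>lborel) = (\<lambda>\<omega>. LBINT \<zeta>:{-d<..<0}. k \<zeta> * yh (s + \<zeta>) \<omega>)"
    unfolding set_lebesgue_integral_def
    by (intro ext Bochner_Integration.integral_cong refl) (auto simp: e_def yh_def indicator_def max_def min_def)
  finally show ?thesis .
qed

text \<open>By \<open>weighted_expectation\<close> with u = s, the product of exp (\<rho> \<zeta>)
  and P s A (s + \<zeta>) is the expectation on A of the income at s + \<zeta> times \<xi>(s).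
  Boundedness of k makes Fubini applicable.\<close>

lemma expectation_history_integral:
  assumes s: "0 \<le> s" and A: "A \<in> sets (F s)" and k: "k \<in> borel_measurable borel"
    and kb: "\<And>\<zeta>. \<zeta> \<in> {-d<..<0} \<Longrightarrow> \<bar>k \<zeta>\<bar> \<le> K"
  shows "integrable M (\<lambda>\<omega>. indicator A \<omega> * (\<xi> s \<omega> * (LBINT \<zeta>:{-d<..<0}. k \<zeta> * yh (s + \<zeta>) \<omega>)))"
    "expectation (\<lambda>\<omega>. indicator A \<omega> * (\<xi> s \<omega> * (LBINT \<zeta>:{-d<..<0}. k \<zeta> * yh (s + \<zeta>) \<omega>))) =
      (LBINT \<zeta>:{-d<..<0}. k \<zeta> * (exp (\<rho> * \<zeta>) * P s A (s + \<zeta>)))"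
proof -
  have AM: "A \<in> sets M" using A sets_F_subset by blast
  have K0: "0 \<le> K" using kb[of "- d / 2"] d_pos by auto
  interpret pr: pair_sigma_finite M "lborel :: real measure" ..
  define f where "f = (\<lambda>q. indicator {-d<..<0} (snd q) * (k (snd q) * (indicator A (fst q) * yh (s + snd q) (fst q) * \<xi> s (fst q))))"
  have "(\<lambda>q. (fst q, s + snd q)) \<in> M \<Otimes>\<^sub>M borel \<rightarrow>\<^sub>M M \<Otimes>\<^sub>M borel" by measurable
  from measurable_compose[OF this yh_measurable]
  have [measurable]: "(\<lambda>q. yh (s + snd q) (fst q)) \<in> borel_measurable (M \<Otimes>\<^sub>M borel)" by simp
  note [measurable] = k AM F_imp_M[OF xi_F[OF s]]
  have "f \<in> borel_measurable (M \<Otimes>\<^sub>M borel)" unfolding f_def by measurable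
  then have fm: "f \<in> borel_measurable (M \<Otimes>\<^sub>M lborel)"
    by (simp cong: measurable_cong_sets add: sets_pair_measure_cong[OF refl sets_lborel])
  have fi: "integrable (M \<Otimes>\<^sub>M lborel) f"
  proof (rule integrable_pair_nn[OF _ fm])
    have "(\<integral>\<^sup>+\<omega>. (\<integral>\<^sup>+\<zeta>. ennreal \<bar>f (\<omega>, \<zeta>)\<bar> \<partial>lborel) \<partial>M) = (\<integral>\<^sup>+\<zeta>. (\<integral>\<^sup>+\<omega>. ennreal \<bar>f (\<omega>, \<zeta>)\<bar> \<partial>M) \<partial>lborel)"
      by (rule pr.Fubini[where f="\<lambda>q. ennreal \<bar>f q\<bar>", symmetric])
         (rule measurable_compose[OF borel_measurable_abs[OF fm] measurable_ennreal])
    also have "\<dots> \<le> (\<integral>\<^sup>+\<zeta>. ennreal (K * exp (\<bar>\<rho>\<bar> * d)) * (H wY (s + 1 * \<zeta>) * indicator {s - d..s} (s + 1 * \<zeta>)) \<partial>lborel)"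
    proof (rule nn_integral_mono)
      fix \<zeta> :: real
      show "(\<integral>\<^sup>+\<omega>. ennreal \<bar>f (\<omega>, \<zeta>)\<bar> \<partial>M) \<le> ennreal (K * exp (\<bar>\<rho>\<bar> * d)) * (H wY (s + 1 * \<zeta>) * indicator {s - d..s} (s + 1 * \<zeta>))"
      proof (cases "\<zeta> \<in> {-d<..<0}")
        case True
        have m: "(\<lambda>\<omega>. ennreal \<bar>indicator A \<omega> * yh (s + \<zeta>) \<omega> * \<xi> s \<omega>\<bar>) \<in> borel_measurable M"
          using yh_M[of "s + \<zeta>"] by measurable
        have "(\<integral>\<^sup>+\<omega>. ennreal \<bar>f (\<omega>, \<zeta>)\<bar> \<partial>M) = ennreal \<bar>k \<zeta>\<bar> * (\<integral>\<^sup>+\<omega>. ennreal \<bar>indicator A \<omega> * yh (s + \<zeta>) \<omega> * \<xi> s \<omega>\<bar> \<partial>M)"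
          using True by (subst nn_integral_cmult[OF m, symmetric]) (simp add: f_def abs_mult ennreal_mult mult.assoc)
        also have "\<dots> \<le> ennreal K * (ennreal (exp (- \<rho> * (s - (s + \<zeta>)))) * H wY (s + \<zeta>))"
          using True kb[OF True] by (intro mult_mono weighted_integrable(2)[OF s _ AM] ennreal_leI) auto
        also have "\<dots> \<le> ennreal K * (ennreal (exp (\<bar>\<rho>\<bar> * d)) * H wY (s + \<zeta>))"
          using True exp_rho_bound(1)[of \<zeta>] by (intro mult_left_mono mult_right_mono ennreal_leI) auto
        also have "\<dots> = ennreal (K * exp (\<bar>\<rho>\<bar> * d)) * (H wY (s + 1 * \<zeta>) * indicator {s - d..s} (s + 1 * \<zeta>))"
          using True K0 by (simp add: ennreal_mult' mult.assoc)
        finally show ?thesis .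
      next
        case False
        then show ?thesis by (simp add: f_def)
      qed
    qed
    also have "\<dots> = ennreal (K * exp (\<bar>\<rho>\<bar> * d)) * (\<integral>\<^sup>+v\<in>{s - d..s}. H wY v \<partial>lborel)"
    proof -
      note [measurable] = H_measurable[OF good_wY]
      have "(\<integral>\<^sup>+v\<in>{s - d..s}. H wY v \<partial>lborel) = (\<integral>\<^sup>+\<zeta>. H wY (s + 1 * \<zeta>) * indicator {s - d..s} (s + 1 * \<zeta>) \<partial>lborel)"
        using nn_integral_real_affine[of "\<lambda>v. H wY v * indicator {s - d..s} v" 1 s] by simp
      then show ?thesis by (subst nn_integral_cmult) auto
    qed
    also have "\<dots> < \<top>" using H_integral_finite by (simp add: ennreal_mult_less_top)
    finally show "(\<integral>\<^sup>+\<omega>. (\<integral>\<^sup>+\<zeta>. ennreal \<bar>f (\<omega>, \<zeta>)\<bar> \<partial>lborel) \<partial>M) < \<top>" .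
  qed unfold_locales
  have fi': "integrable (M \<Otimes>\<^sub>M lborel) (case_prod (\<lambda>\<omega> \<zeta>. f (\<omega>, \<zeta>)))" using fi by simp
  have inner: "(\<integral>\<zeta>. f (\<omega>, \<zeta>) \<partial>lborel) = indicator A \<omega> * (\<xi> s \<omega> * (LBINT \<zeta>:{-d<..<0}. k \<zeta> * yh (s + \<zeta>) \<omega>))" for \<omega>
  proof -
    have "(\<integral>\<zeta>. f (\<omega>, \<zeta>) \<partial>lborel) = (\<integral>\<zeta>. (indicator A \<omega> * \<xi> s \<omega>) * (indicator {-d<..<0} \<zeta> *\<^sub>R (k \<zeta> * yh (s + \<zeta>) \<omega>)) \<partial>lborel)"
      by (intro Bochner_Integration.integral_cong refl) (simp add: f_def mult_ac)
    then show ?thesis unfolding set_lebesgue_integral_def by simp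
  qed
  show "integrable M (\<lambda>\<omega>. indicator A \<omega> * (\<xi> s \<omega> * (LBINT \<zeta>:{-d<..<0}. k \<zeta> * yh (s + \<zeta>) \<omega>)))"
    using pr.integrable_fst'[OF fi] unfolding inner .
  have "expectation (\<lambda>\<omega>. indicator A \<omega> * (\<xi> s \<omega> * (LBINT \<zeta>:{-d<..<0}. k \<zeta> * yh (s + \<zeta>) \<omega>))) =
     (\<integral>\<zeta>. expectation (\<lambda>\<omega>. f (\<omega>, \<zeta>)) \<partial>lborel)"
    unfolding inner[symmetric] by (rule pr.Fubini_integral[OF fi', symmetric])
  also have "\<dots> = (LBINT \<zeta>:{-d<..<0}. k \<zeta> * (exp (\<rho> * \<zeta>) * P s A (s + \<zeta>)))"
    unfolding set_lebesgue_integral_def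
  proof (rule Bochner_Integration.integral_cong[OF refl])
    fix \<zeta> :: real
    show "expectation (\<lambda>\<omega>. f (\<omega>, \<zeta>)) = indicator {-d<..<0} \<zeta> *\<^sub>R (k \<zeta> * (exp (\<rho> * \<zeta>) * P s A (s + \<zeta>)))"
      using weighted_expectation[OF s A order.refl, of "s + \<zeta>"]
      by (cases "\<zeta> \<in> {-d<..<0}") (auto simp: f_def)
  qed
  finally show "expectation (\<lambda>\<omega>. indicator A \<omega> * (\<xi> s \<omega> * (LBINT \<zeta>:{-d<..<0}. k \<zeta> * yh (s + \<zeta>) \<omega>))) =
      (LBINT \<zeta>:{-d<..<0}. k \<zeta> * (exp (\<rho> * \<zeta>) * P s A (s + \<zeta>)))" .
qed

end

section \<open>Human capital\<close>

lemma L2_fun_integrable: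
  assumes "f \<in> L2_fun d"
  shows "set_integrable lborel {-d<..<0} f"
proof -
  have m: "set_borel_measurable lborel {-d<..<0} f" and i: "set_integrable lborel {-d<..<0} (\<lambda>\<zeta>. (f \<zeta>)\<^sup>2)"
    using assms by (auto simp: L2_fun_def)
  have c: "set_integrable lborel {-d<..<0} (\<lambda>_. 1 :: real)"
    unfolding set_integrable_def real_scaleR_def mult_1_right
    by (intro integrable_real_indicator emeasure_bounded_finite) auto
  show ?thesis
  proof (rule set_integrable_bound[OF set_integral_add(1)[OF c i] m], rule AE_I2, rule impI)
    fix x
    have "2 * 1 * \<bar>f x\<bar> \<le> 1\<^sup>2 + \<bar>f x\<bar>\<^sup>2" by (rule sum_squares_bound)
    then have "\<bar>f x\<bar> \<le> 1 + (f x)\<^sup>2" by simp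
    then show "norm (f x) \<le> norm (1 + (f x)\<^sup>2)" by simp
  qed
qed

context income_process
begin

text \<open>The Volterra equation is multiplied by q and integrated over [s, \<tau>]. Integration
  over t first turns q into g by \<open>geq\<close>; the substitution v = u + \<zeta> then moves the
  delay from Pf to g. So k is the adjoint delay operator applied to g, cut off at s, and it reaches
  back to s - d because the delay does.\<close>

lemma volterra_duality:
  fixes g q Pf :: "real \<Rightarrow> real" and s \<tau> :: real
  defines "k \<equiv> (\<lambda>v. \<integral>\<zeta>. phi0 \<zeta> * exp (\<rho> * \<zeta>) * (indicator {s<..\<tau>} (v - \<zeta>) * g (v - \<zeta>)) \<partial>lborel)"
  assumes s\<tau>: "s < \<tau>" and Pm: "Pf \<in> borel_measurable borel" and Pi: "\<And>a b. set_integrable lborel {a..b} Pf"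
    and g: "continuous_on {s..\<tau>} g" and q: "continuous_on {s..\<tau>} q"
    and geq: "\<And>u. u \<in> {s..\<tau>} \<Longrightarrow> g u = (LBINT t:{u..\<tau>}. exp (- \<beta> * (t - u)) * q t)"
    and volt: "\<And>t. t \<in> {s..\<tau>} \<Longrightarrow> Pf t = exp (- \<beta> * (t - s)) * Pf s +
      (\<integral>p. indicator {s<..t} (fst p) * (phi0 (snd p) * exp (- \<beta> * (t - fst p)) * exp (\<rho> * snd p) * Pf (fst p + snd p)) \<partial>lborel)"
  shows "(LBINT t:{s..\<tau>}. q t * Pf t) = g s * Pf s + (\<integral>v. Pf v * k v \<partial>lborel)"
    "integrable lborel (\<lambda>v. Pf v * k v)"
proof -
  obtain Kq where Kq: "0 < Kq" "\<And>x. x \<in> {s..\<tau>} \<Longrightarrow> \<bar>q x\<bar> \<le> Kq" using continuous_on_bounded_real[OF q] by blast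
  obtain Kg where Kg: "0 < Kg" "\<And>x. x \<in> {s..\<tau>} \<Longrightarrow> \<bar>g x\<bar> \<le> Kg" using continuous_on_bounded_real[OF g] by blast
  define q0 where "q0 t = indicator {s..\<tau>} t * q t" for t
  define g0 where "g0 t = indicator {s..\<tau>} t * g t" for t
  have q0m[measurable]: "q0 \<in> borel_measurable borel"
    using borel_measurable_continuous_on_indicator[OF _ q] by (simp add: q0_def[abs_def])
  have g0m[measurable]: "g0 \<in> borel_measurable borel"
    using borel_measurable_continuous_on_indicator[OF _ g] by (simp add: g0_def[abs_def])
  have q0b: "\<bar>q0 t\<bar> \<le> Kq * indicator {s..\<tau>} t" for t using Kq by (auto simp: q0_def indicator_def)
  have g0b: "\<bar>g0 t\<bar> \<le> Kg" for t using Kg by (auto simp: g0_def indicator_def)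
  note [measurable] = Pm
  define F1 where "F1 p = indicator {s<..\<tau>} (fst p) * (phi0 (snd p) * exp (\<rho> * snd p) * Pf (fst p + snd p))" for p
  have F1m: "F1 \<in> borel_measurable (borel \<Otimes>\<^sub>M borel)" unfolding F1_def[abs_def] by measurable
  have Pfin: "(\<integral>\<^sup>+v\<in>{a..b}. ennreal \<bar>Pf v\<bar> \<partial>lborel) < \<top>" for a b
  proof -
    have "(\<integral>\<^sup>+v. ennreal \<bar>indicator {a..b} v *\<^sub>R Pf v\<bar> \<partial>lborel) < \<top>"
      using Pi[of a b] unfolding set_integrable_def integrable_iff_bounded by simp
    also have "(\<integral>\<^sup>+v. ennreal \<bar>indicator {a..b} v *\<^sub>R Pf v\<bar> \<partial>lborel) = (\<integral>\<^sup>+v\<in>{a..b}. ennreal \<bar>Pf v\<bar> \<partial>lborel)"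
      by (intro nn_integral_cong) (auto simp: indicator_def)
    finally show ?thesis .
  qed
  have F1fin: "(\<integral>\<^sup>+p. ennreal \<bar>F1 p\<bar> \<partial>lborel) < \<top>"
  proof -
    have "(\<integral>\<^sup>+p. ennreal \<bar>F1 p\<bar> \<partial>lborel) = (\<integral>\<^sup>+p. ennreal \<bar>phi0 (snd p)\<bar> * indicator {s<..\<tau>} (fst p) * (ennreal (exp (\<rho> * snd p)) * ennreal \<bar>Pf (fst p + snd p)\<bar>) \<partial>lborel)"
      by (intro nn_integral_cong) (auto simp: F1_def abs_mult ennreal_mult mult_ac indicator_def)
    also have "\<dots> \<le> ennreal cK * (\<integral>\<^sup>+v\<in>{s - d..\<tau>}. ennreal \<bar>Pf v\<bar> \<partial>lborel)"
      by (rule delay_convolution_bound) measurable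
    also have "\<dots> < \<top>" using Pfin by (simp add: ennreal_mult_less_top)
    finally show ?thesis .
  qed
  have F1i: "integrable lborel F1"
    using F1m F1fin by (intro integrableI_bounded) (auto simp: borel_prod)
  \<comment> \<open>One integrand, evaluated in both orders: integration over t produces g,
    integration over the pair p recovers the Volterra equation.\<close>
  define Ph where "Ph = (\<lambda>t p. q0 t * (indicator {fst p..} t * exp (- \<beta> * (t - fst p))) * F1 p)"
  have Phb: "\<bar>Ph t p\<bar> \<le> (Kq * indicator {s..\<tau>} t) * \<bar>F1 p\<bar>" for t p
  proof -
    have "\<bar>indicator {fst p..} t * exp (- \<beta> * (t - fst p))\<bar> \<le> 1"
      using beta_pos by (auto simp: indicator_def)
    then have "\<bar>q0 t\<bar> * \<bar>indicator {fst p..} t * exp (- \<beta> * (t - fst p))\<bar> \<le> (Kq * indicator {s..\<tau>} t) * 1"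
      using q0b[of t] by (intro mult_mono) auto
    then show ?thesis unfolding Ph_def abs_mult by (intro mult_right_mono) auto
  qed
  have Phm: "case_prod Ph \<in> borel_measurable (lborel \<Otimes>\<^sub>M lborel)"
  proof -
    have "(\<lambda>x :: real \<times> real \<times> real. indicator {fst (snd x)..} (fst x) :: real) \<in> borel_measurable (borel \<Otimes>\<^sub>M (borel \<Otimes>\<^sub>M borel))"
      unfolding atLeast_def by measurable
    note [measurable] = this F1m
    have "case_prod Ph \<in> borel_measurable (borel \<Otimes>\<^sub>M (borel \<Otimes>\<^sub>M borel))"
      unfolding Ph_def case_prod_beta by measurable
    moreover have "sets (lborel \<Otimes>\<^sub>M lborel) = sets (borel \<Otimes>\<^sub>M (borel \<Otimes>\<^sub>M borel) :: (real \<times> real \<times> real) measure)"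
      unfolding sets_pair_measure_cong[OF sets_lborel sets_lborel] borel_prod ..
    ultimately show ?thesis using measurable_cong_sets by blast
  qed
  have Phi: "integrable (lborel \<Otimes>\<^sub>M lborel) (case_prod Ph)"
  proof (rule integrable_pair_nn[OF _ Phm])
    have "(\<integral>\<^sup>+t. (\<integral>\<^sup>+p. ennreal \<bar>case_prod Ph (t, p)\<bar> \<partial>lborel) \<partial>lborel) \<le>
       (\<integral>\<^sup>+t. ennreal Kq * indicator {s..\<tau>} t * (\<integral>\<^sup>+p. ennreal \<bar>F1 p\<bar> \<partial>lborel) \<partial>lborel)"
    proof (rule nn_integral_mono)
      fix t :: real
      have F1m': "(\<lambda>p. ennreal \<bar>F1 p\<bar>) \<in> borel_measurable lborel" using F1i by measurable
      have "(\<integral>\<^sup>+p. ennreal \<bar>case_prod Ph (t, p)\<bar> \<partial>lborel) \<le> (\<integral>\<^sup>+p. (ennreal Kq * indicator {s..\<tau>} t) * ennreal \<bar>F1 p\<bar> \<partial>lborel)"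
      proof (rule nn_integral_mono)
        fix p
        have "ennreal \<bar>case_prod Ph (t, p)\<bar> \<le> ennreal ((Kq * indicator {s..\<tau>} t) * \<bar>F1 p\<bar>)"
          using Phb[of t p] by (intro ennreal_leI) simp
        also have "\<dots> = (ennreal Kq * indicator {s..\<tau>} t) * ennreal \<bar>F1 p\<bar>"
          using Kq(1) by (simp add: ennreal_mult indicator_def)
        finally show "ennreal \<bar>case_prod Ph (t, p)\<bar> \<le> (ennreal Kq * indicator {s..\<tau>} t) * ennreal \<bar>F1 p\<bar>" .
      qed
      also have "\<dots> = ennreal Kq * indicator {s..\<tau>} t * (\<integral>\<^sup>+p. ennreal \<bar>F1 p\<bar> \<partial>lborel)"
        by (rule nn_integral_cmult[OF F1m'])
      finally show "(\<integral>\<^sup>+p. ennreal \<bar>case_prod Ph (t, p)\<bar> \<partial>lborel) \<le> ennreal Kq * indicator {s..\<tau>} t * (\<integral>\<^sup>+p. ennreal \<bar>F1 p\<bar> \<partial>lborel)" .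
    qed
    also have "\<dots> = ennreal Kq * ennreal (\<tau> - s) * (\<integral>\<^sup>+p. ennreal \<bar>F1 p\<bar> \<partial>lborel)"
      using s\<tau> by (subst nn_integral_multc) (auto simp: nn_integral_cmult)
    also have "\<dots> < \<top>" using F1fin by (simp add: ennreal_mult_less_top)
    finally show "(\<integral>\<^sup>+t. (\<integral>\<^sup>+p. ennreal \<bar>case_prod Ph (t, p)\<bar> \<partial>lborel) \<partial>lborel) < \<top>" .
  qed unfold_locales
  have inner_t: "(\<integral>t. Ph t p \<partial>lborel) = F1 p * g0 (fst p)" for p
  proof (cases "fst p \<in> {s<..\<tau>}")
    case True
    have "(\<integral>t. Ph t p \<partial>lborel) = (\<integral>t. F1 p * (indicator {fst p..\<tau>} t *\<^sub>R (exp (- \<beta> * (t - fst p)) * q t)) \<partial>lborel)"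
      using True by (intro Bochner_Integration.integral_cong refl) (auto simp: Ph_def q0_def indicator_def)
    also have "\<dots> = F1 p * (LBINT t:{fst p..\<tau>}. exp (- \<beta> * (t - fst p)) * q t)"
      unfolding set_lebesgue_integral_def by simp
    also have "(LBINT t:{fst p..\<tau>}. exp (- \<beta> * (t - fst p)) * q t) = g0 (fst p)"
      using geq[of "fst p"] True by (simp add: g0_def)
    finally show ?thesis .
  next
    case False
    then show ?thesis by (simp add: Ph_def F1_def)
  qed
  \<comment> \<open>What the Volterra equation says about the delay term: q Pf minus the part driven
    by the value at s, whose integral over t is g s times Pf s.\<close>
  have inner_p: "(\<integral>p. Ph t p \<partial>lborel) = indicator {s..\<tau>} t *\<^sub>R (q t * Pf t) - Pf s * (indicator {s..\<tau>} t *\<^sub>R (exp (- \<beta> * (t - s)) * q t))" for t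
  proof (cases "t \<in> {s..\<tau>}")
    case True
    have "(\<integral>p. Ph t p \<partial>lborel) = (\<integral>p. q t * (indicator {s<..t} (fst p) * (phi0 (snd p) * exp (- \<beta> * (t - fst p)) * exp (\<rho> * snd p) * Pf (fst p + snd p))) \<partial>lborel)"
      using True by (intro Bochner_Integration.integral_cong refl) (auto simp: Ph_def F1_def q0_def indicator_def)
    also have "\<dots> = q t * (Pf t - exp (- \<beta> * (t - s)) * Pf s)"
      using volt[OF True] by simp
    finally show ?thesis using True by (simp add: algebra_simps)
  next
    case False
    then show ?thesis by (simp add: Ph_def q0_def)
  qed
  have qPi: "integrable lborel (\<lambda>t. indicator {s..\<tau>} t *\<^sub>R (q t * Pf t))"
    using set_integrable_mult_continuous[OF Pi q] by (simp add: set_integrable_def)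
  have eqi: "integrable lborel (\<lambda>t. indicator {s..\<tau>} t *\<^sub>R (exp (- \<beta> * (t - s)) * q t))"
    unfolding set_integrable_def[symmetric]
    by (intro borel_integrable_atLeastAtMost' continuous_intros q)
  have eq1: "(LBINT t:{s..\<tau>}. q t * Pf t) - Pf s * g s = (\<integral>p. F1 p * g0 (fst p) \<partial>lborel)"
  proof -
    have "(\<integral>p. F1 p * g0 (fst p) \<partial>lborel) = (\<integral>t. (\<integral>p. Ph t p \<partial>lborel) \<partial>lborel)"
      unfolding inner_t[symmetric] by (rule lborel_pair.Fubini_integral[OF Phi])
    also have "\<dots> = (\<integral>t. indicator {s..\<tau>} t *\<^sub>R (q t * Pf t) \<partial>lborel) - Pf s * (\<integral>t. indicator {s..\<tau>} t *\<^sub>R (exp (- \<beta> * (t - s)) * q t) \<partial>lborel)"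
      unfolding inner_p using qPi eqi by simp
    also have "\<dots> = (LBINT t:{s..\<tau>}. q t * Pf t) - Pf s * g s"
      using geq[of s] s\<tau> by (simp add: set_lebesgue_integral_def)
    finally show ?thesis by simp
  qed
  \<comment> \<open>The same integrand in the variables v = u + \<zeta> and \<zeta>, with Pf no
    longer under the inner integral.\<close>
  define Ps where "Ps = (\<lambda>v \<zeta>. Pf v * (phi0 \<zeta> * exp (\<rho> * \<zeta>) * (indicator {s<..\<tau>} (v - \<zeta>) * g0 (v - \<zeta>))))"
  have Psm: "case_prod Ps \<in> borel_measurable (lborel \<Otimes>\<^sub>M lborel)"
  proof -
    have "case_prod Ps \<in> borel_measurable (borel \<Otimes>\<^sub>M borel)"
      unfolding Ps_def case_prod_beta by measurable
    then show ?thesis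
      by (simp cong: measurable_cong_sets add: sets_pair_measure_cong[OF sets_lborel sets_lborel])
  qed
  have Psi: "integrable (lborel \<Otimes>\<^sub>M lborel) (case_prod Ps)"
  proof (rule integrable_pair_nn[OF _ Psm])
    have "(\<integral>\<^sup>+v. (\<integral>\<^sup>+\<zeta>. ennreal \<bar>case_prod Ps (v, \<zeta>)\<bar> \<partial>lborel) \<partial>lborel) \<le>
       (\<integral>\<^sup>+v. (ennreal \<bar>Pf v\<bar> * indicator {s - d..\<tau>} v) * (\<integral>\<^sup>+\<zeta>. ennreal (Kg * exp (\<bar>\<rho>\<bar> * d) * \<bar>phi0 \<zeta>\<bar>) \<partial>lborel) \<partial>lborel)"
    proof (rule nn_integral_mono)
      fix v :: real
      have "(\<integral>\<^sup>+\<zeta>. ennreal \<bar>case_prod Ps (v, \<zeta>)\<bar> \<partial>lborel) \<le>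
         (\<integral>\<^sup>+\<zeta>. (ennreal \<bar>Pf v\<bar> * indicator {s - d..\<tau>} v) * ennreal (Kg * exp (\<bar>\<rho>\<bar> * d) * \<bar>phi0 \<zeta>\<bar>) \<partial>lborel)"
      proof (rule nn_integral_mono)
        fix \<zeta> :: real
        show "ennreal \<bar>case_prod Ps (v, \<zeta>)\<bar> \<le> (ennreal \<bar>Pf v\<bar> * indicator {s - d..\<tau>} v) * ennreal (Kg * exp (\<bar>\<rho>\<bar> * d) * \<bar>phi0 \<zeta>\<bar>)"
        proof (cases "- d < \<zeta> \<and> \<zeta> < 0 \<and> v - \<zeta> \<in> {s<..\<tau>}")
          case True
          then have v: "v \<in> {s - d..\<tau>}" by auto
          have "\<bar>phi0 \<zeta>\<bar> * exp (\<rho> * \<zeta>) * \<bar>g0 (v - \<zeta>)\<bar> \<le> \<bar>phi0 \<zeta>\<bar> * exp (\<bar>\<rho>\<bar> * d) * Kg"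
            using exp_rho_bound(1)[of \<zeta>] True g0b by (intro mult_mono) auto
          from mult_left_mono[OF this abs_ge_zero[of "Pf v"]]
          have "\<bar>case_prod Ps (v, \<zeta>)\<bar> \<le> \<bar>Pf v\<bar> * (Kg * exp (\<bar>\<rho>\<bar> * d) * \<bar>phi0 \<zeta>\<bar>)"
            using True by (simp add: Ps_def abs_mult mult_ac)
          then have "ennreal \<bar>case_prod Ps (v, \<zeta>)\<bar> \<le> ennreal (\<bar>Pf v\<bar> * (Kg * exp (\<bar>\<rho>\<bar> * d) * \<bar>phi0 \<zeta>\<bar>))"
            by (rule ennreal_leI)
          also have "\<dots> = (ennreal \<bar>Pf v\<bar> * indicator {s - d..\<tau>} v) * ennreal (Kg * exp (\<bar>\<rho>\<bar> * d) * \<bar>phi0 \<zeta>\<bar>)"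
            using v by (simp add: ennreal_mult')
          finally show ?thesis .
        next
          case False
          then have "phi0 \<zeta> = 0 \<or> v - \<zeta> \<notin> {s<..\<tau>}" using phi0_outside[of \<zeta>] by auto
          then have "Ps v \<zeta> = 0" by (auto simp: Ps_def)
          then show ?thesis by simp
        qed
      qed
      also have "\<dots> = (ennreal \<bar>Pf v\<bar> * indicator {s - d..\<tau>} v) * (\<integral>\<^sup>+\<zeta>. ennreal (Kg * exp (\<bar>\<rho>\<bar> * d) * \<bar>phi0 \<zeta>\<bar>) \<partial>lborel)"
        by (rule nn_integral_cmult) measurable
      finally show "(\<integral>\<^sup>+\<zeta>. ennreal \<bar>case_prod Ps (v, \<zeta>)\<bar> \<partial>lborel) \<le> \<dots>" .
    qed
    also have "\<dots> = (\<integral>\<^sup>+v\<in>{s - d..\<tau>}. ennreal \<bar>Pf v\<bar> \<partial>lborel) * (\<integral>\<^sup>+\<zeta>. ennreal (Kg * exp (\<bar>\<rho>\<bar> * d) * \<bar>phi0 \<zeta>\<bar>) \<partial>lborel)"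
      by (rule nn_integral_multc) measurable
    also have "\<dots> < \<top>"
    proof -
      have "(\<integral>\<^sup>+\<zeta>. ennreal (Kg * exp (\<bar>\<rho>\<bar> * d) * \<bar>phi0 \<zeta>\<bar>) \<partial>lborel) < \<top>"
        using phi0_integrable Kg(1) by (subst nn_integral_eq_integral) auto
      then show ?thesis using Pfin by (simp add: ennreal_mult_less_top)
    qed
    finally show "(\<integral>\<^sup>+v. (\<integral>\<^sup>+\<zeta>. ennreal \<bar>case_prod Ps (v, \<zeta>)\<bar> \<partial>lborel) \<partial>lborel) < \<top>" .
  qed unfold_locales
  have k_eq: "(\<integral>\<zeta>. Ps v \<zeta> \<partial>lborel) = Pf v * k v" for v
  proof -
    have "(\<integral>\<zeta>. Ps v \<zeta> \<partial>lborel) = (\<integral>\<zeta>. Pf v * (phi0 \<zeta> * exp (\<rho> * \<zeta>) * (indicator {s<..\<tau>} (v - \<zeta>) * g (v - \<zeta>))) \<partial>lborel)"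
      by (intro Bochner_Integration.integral_cong refl) (auto simp: Ps_def g0_def indicator_def)
    then show ?thesis by (simp add: k_def)
  qed
  show "integrable lborel (\<lambda>v. Pf v * k v)"
    using lborel_pair.integrable_fst[OF Psi] unfolding k_eq .
  have "integrable lborel (\<lambda>p. F1 p * g0 (fst p))"
  proof (rule Bochner_Integration.integrable_bound)
    show "integrable lborel (\<lambda>p. Kg * F1 p)" using F1i by simp
    have "(\<lambda>p. F1 p * g0 (fst p)) \<in> borel_measurable (borel \<Otimes>\<^sub>M borel)" using F1m by measurable
    then show "(\<lambda>p. F1 p * g0 (fst p)) \<in> borel_measurable lborel" by (simp add: borel_prod)
    show "AE p in lborel. norm (F1 p * g0 (fst p)) \<le> norm (Kg * F1 p)"
      using g0b Kg(1) by (intro AE_I2) (simp add: abs_mult mult.commute[of Kg] mult_left_mono)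
  qed
  then have i2: "integrable (lborel \<Otimes>\<^sub>M lborel) (case_prod (\<lambda>u \<zeta>. F1 (u, \<zeta>) * g0 u))"
    by (simp add: lborel_prod case_prod_unfold)
  have "(\<integral>p. F1 p * g0 (fst p) \<partial>lborel) = (\<integral>\<zeta>. (\<integral>u. F1 (u, \<zeta>) * g0 u \<partial>lborel) \<partial>lborel)"
    using lborel_pair.integral_snd[OF i2] by (simp add: lborel_prod case_prod_unfold)
  also have "\<dots> = (\<integral>\<zeta>. (\<integral>v. Ps v \<zeta> \<partial>lborel) \<partial>lborel)"
  proof (rule Bochner_Integration.integral_cong[OF refl])
    fix \<zeta> :: real
    have "(\<integral>v. Ps v \<zeta> \<partial>lborel) = (\<integral>u. Ps (\<zeta> + 1 * u) \<zeta> \<partial>lborel)"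
      using lborel_integral_real_affine[of 1 "\<lambda>v. Ps v \<zeta>" \<zeta>] by simp
    also have "\<dots> = (\<integral>u. F1 (u, \<zeta>) * g0 u \<partial>lborel)"
      by (intro Bochner_Integration.integral_cong refl) (simp add: Ps_def F1_def add.commute mult_ac)
    finally show "(\<integral>u. F1 (u, \<zeta>) * g0 u \<partial>lborel) = (\<integral>v. Ps v \<zeta> \<partial>lborel)" by simp
  qed
  also have "\<dots> = (\<integral>v. (\<integral>\<zeta>. Ps v \<zeta> \<partial>lborel) \<partial>lborel)"
    by (rule lborel_pair.Fubini_integral[OF Psi])
  also have "\<dots> = (\<integral>v. Pf v * k v \<partial>lborel)" unfolding k_eq ..
  finally show "(LBINT t:{s..\<tau>}. q t * Pf t) = g s * Pf s + (\<integral>v. Pf v * k v \<partial>lborel)"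
    using eq1 by (simp add: mult.commute)
qed

text \<open>Duality with q = h(., 0) + 1, the function that g integrates. The equation for h says
  that k(v) = h(v, 0) for v from s up to \<tau>, and k(s + \<zeta>) = exp (\<rho> \<zeta>) h(s,
  \<zeta>) on the history. The integral of h(., 0) against P over [s, \<tau>] therefore occurs on
  both sides and cancels, leaving the integral of P alone.\<close>

lemma time_integral_representation:
  assumes gh: "gh_solution r \<delta> \<beta> \<tau> d \<phi> g h" and \<rho>: "\<rho> = r + \<delta>"
    and s: "0 \<le> s" "s < \<tau>" and A: "A \<in> sets (F s)"
  shows "(LBINT u:{s..<\<tau>}. P s A u) = g s * P s A s + (LBINT \<zeta>:{-d<..<0}. h s \<zeta> * (exp (\<rho> * \<zeta>) * P s A (s + \<zeta>)))"
proof -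
  have AM: "A \<in> sets M" using A sets_F_subset by blast
  have gc: "continuous_on {0..} g" and hc: "continuous_on ({0..} \<times> {-d..0}) (\<lambda>(t, \<zeta>). h t \<zeta>)"
    and g_eq: "\<And>t. 0 \<le> t \<Longrightarrow> g t = (if t < \<tau> then LBINT u:{t..\<tau>}. exp (- \<beta> * (u - t)) * (h u 0 + 1) else 0)"
    and h_eq: "\<And>t \<zeta>. 0 \<le> t \<Longrightarrow> \<zeta> \<in> {-d..0} \<Longrightarrow> h t \<zeta> = (if t < \<tau>
        then LBINT u:{max (\<zeta> + t - \<tau>) (-d)..\<zeta>}. exp (- (r + \<delta>) * (\<zeta> - u)) * g (t + \<zeta> - u) * \<phi> u else 0)"
    using gh unfolding gh_solution_def by blast+
  define k where "k v = (\<integral>\<zeta>. phi0 \<zeta> * exp (\<rho> * \<zeta>) * (indicator {s<..\<tau>} (v - \<zeta>) * g (v - \<zeta>)) \<partial>lborel)" for v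
  define q where "q t = h t 0 + 1" for t
  have "continuous_on {s..\<tau>} (\<lambda>t. (\<lambda>(t, \<zeta>). h t \<zeta>) (t, 0))"
    by (rule continuous_on_compose2[OF hc]) (use s d_pos in \<open>auto intro!: continuous_intros\<close>)
  then have h0c: "continuous_on {s..\<tau>} (\<lambda>t. h t 0)" by simp
  have qc: "continuous_on {s..\<tau>} q" unfolding q_def by (intro continuous_intros h0c)
  have gc': "continuous_on {s..\<tau>} g" using gc s by (auto intro: continuous_on_subset)
  have geq: "g u = (LBINT t:{u..\<tau>}. exp (- \<beta> * (t - u)) * q t)" if "u \<in> {s..\<tau>}" for u
  proof (cases "u < \<tau>")
    case True
    then show ?thesis using g_eq[of u] that s by (simp add: q_def)
  next
    case False
    then have "u = \<tau>" using that by simp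
    then show ?thesis using g_eq[of u] s by (simp only: set_integral_singleton) simp
  qed
  have Pm: "P s A \<in> borel_measurable borel" by (rule P_measurable[OF s(1) AM])
  have Pi: "set_integrable lborel {a..b} (P s A)" for a b by (rule P_integrable[OF s(1) AM])
  have volt: "P s A t = exp (- \<beta> * (t - s)) * P s A s +
      (\<integral>p. indicator {s<..t} (fst p) * (phi0 (snd p) * exp (- \<beta> * (t - fst p)) * exp (\<rho> * snd p) * P s A (fst p + snd p)) \<partial>lborel)"
    if "t \<in> {s..\<tau>}" for t using P_volterra[OF s(1) A, of t] that by simp
  note dual = volterra_duality[OF s(2) Pm Pi gc' qc geq volt, folded k_def]
  \<comment> \<open>The two cases in \<open>tz\<close> are those where the ranges of integration
    agree. For t > s and \<zeta> < 0 the cut-off of k at s would also admit lags between \<zeta> and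
    0, which the integral defining h(t, \<zeta>) excludes.\<close>
  have k_h: "k (t + \<zeta>) = exp (\<rho> * \<zeta>) * h t \<zeta>" if t: "s \<le> t" "t < \<tau>" and z: "\<zeta> \<in> {-d..0}" and tz: "t = s \<or> \<zeta> = 0" for t \<zeta>
  proof -
    have "exp (\<rho> * \<zeta>) * h t \<zeta> = (\<integral>u. exp (\<rho> * \<zeta>) * (indicator {max (\<zeta> + t - \<tau>) (-d)..\<zeta>} u *\<^sub>R (exp (- \<rho> * (\<zeta> - u)) * g (t + \<zeta> - u) * \<phi> u)) \<partial>lborel)"
      using h_eq[of t \<zeta>] t z s \<rho> by (simp add: set_lebesgue_integral_def)
    also have "\<dots> = k (t + \<zeta>)"
      unfolding k_def
    proof (rule integral_cong_AE)
      \<comment> \<open>The closed range in the equation for h and the open ranges in k differ only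
        at these two points.\<close>
      have ae: "AE u in lborel. u \<noteq> \<zeta> \<and> u \<noteq> - d"
        using AE_lborel_singleton[of \<zeta>] AE_lborel_singleton[of "- d"] by eventually_elim simp
      show "AE u in lborel. exp (\<rho> * \<zeta>) * (indicator {max (\<zeta> + t - \<tau>) (-d)..\<zeta>} u *\<^sub>R (exp (- \<rho> * (\<zeta> - u)) * g (t + \<zeta> - u) * \<phi> u)) =
         phi0 u * exp (\<rho> * u) * (indicator {s<..\<tau>} (t + \<zeta> - u) * g (t + \<zeta> - u))"
        using ae
      proof eventually_elim
        case (elim u)
        have e: "exp (\<rho> * \<zeta>) * exp (- \<rho> * (\<zeta> - u)) = exp (\<rho> * u)"
          by (simp add: mult_exp_exp algebra_simps)
        have iff: "u \<in> {max (\<zeta> + t - \<tau>) (-d)..\<zeta>} \<longleftrightarrow> u \<in> {-d<..<0} \<and> t + \<zeta> - u \<in> {s<..\<tau>}"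
          using elim t z tz by auto
        show ?case
        proof (cases "u \<in> {max (\<zeta> + t - \<tau>) (-d)..\<zeta>}")
          case True
          then have "u \<in> {-d<..<0}" "t + \<zeta> - u \<in> {s<..\<tau>}" using iff by blast+
          with True show ?thesis by (simp add: phi0_def e[symmetric] mult_ac)
        next
          case False
          then have "u \<notin> {-d<..<0} \<or> t + \<zeta> - u \<notin> {s<..\<tau>}" using iff by blast
          with False show ?thesis by (auto simp: phi0_def)
        qed
      qed
      have g0m: "(\<lambda>x. indicator {0..} x *\<^sub>R g x) \<in> borel_measurable borel"
        using gc by (intro borel_measurable_continuous_on_indicator) auto
      have gm: "(\<lambda>u. indicator {s<..\<tau>} (t + \<zeta> - u) * g (t + \<zeta> - u)) \<in> borel_measurable borel"
      proof -
        have "(\<lambda>u. indicator {s<..\<tau>} (t + \<zeta> - u) * (indicator {0..} (t + \<zeta> - u) *\<^sub>R g (t + \<zeta> - u))) \<in> borel_measurable borel"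
          by (intro borel_measurable_times measurable_compose[OF _ g0m]) measurable
        also have "(\<lambda>u. indicator {s<..\<tau>} (t + \<zeta> - u) * (indicator {0..} (t + \<zeta> - u) *\<^sub>R g (t + \<zeta> - u))) =
           (\<lambda>u. indicator {s<..\<tau>} (t + \<zeta> - u) * g (t + \<zeta> - u))"
          using s by (auto simp: fun_eq_iff indicator_def)
        finally show ?thesis .
      qed
      show m2: "(\<lambda>u. phi0 u * exp (\<rho> * u) * (indicator {s<..\<tau>} (t + \<zeta> - u) * g (t + \<zeta> - u))) \<in> borel_measurable lborel"
        using gm by measurable
      \<comment> \<open>The range in the equation for h may contain - d and 0, where
        \<open>phi0\<close> vanishes but \<phi> is arbitrary; adding the two point values restores
        \<phi> measurably on the closed window.\<close>
      have phiz: "(\<lambda>u. indicator {- d} u * \<phi> u + indicator {0} u * \<phi> u + phi0 u) \<in> borel_measurable borel"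
      proof -
        have "(\<lambda>u. indicator {- d} u * \<phi> (- d) + indicator {0} u * \<phi> 0 + phi0 u) \<in> borel_measurable borel"
          by measurable
        also have "(\<lambda>u. indicator {- d} u * \<phi> (- d) + indicator {0} u * \<phi> 0 + phi0 u) =
            (\<lambda>u. indicator {- d} u * \<phi> u + indicator {0} u * \<phi> u + phi0 u)"
          by (auto simp: indicator_def)
        finally show ?thesis .
      qed
      have "(\<lambda>u. exp (\<rho> * \<zeta>) * (indicator {max (\<zeta> + t - \<tau>) (-d)..\<zeta>} u * (exp (- \<rho> * (\<zeta> - u)) * (indicator {0..} (t + \<zeta> - u) *\<^sub>R g (t + \<zeta> - u)) *
          (indicator {- d} u * \<phi> u + indicator {0} u * \<phi> u + phi0 u)))) \<in> borel_measurable borel"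
      proof -
        have "(\<lambda>u. indicator {0..} (t + \<zeta> - u) *\<^sub>R g (t + \<zeta> - u)) \<in> borel_measurable borel"
          by (rule measurable_compose[OF _ g0m]) measurable
        then show ?thesis using phiz by measurable
      qed
      also have "(\<lambda>u. exp (\<rho> * \<zeta>) * (indicator {max (\<zeta> + t - \<tau>) (-d)..\<zeta>} u * (exp (- \<rho> * (\<zeta> - u)) * (indicator {0..} (t + \<zeta> - u) *\<^sub>R g (t + \<zeta> - u)) *
          (indicator {- d} u * \<phi> u + indicator {0} u * \<phi> u + phi0 u)))) =
         (\<lambda>u. exp (\<rho> * \<zeta>) * (indicator {max (\<zeta> + t - \<tau>) (-d)..\<zeta>} u *\<^sub>R (exp (- \<rho> * (\<zeta> - u)) * g (t + \<zeta> - u) * \<phi> u)))"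
        using s t z d_pos by (auto simp: fun_eq_iff indicator_def phi0_def)
      finally show "(\<lambda>u. exp (\<rho> * \<zeta>) * (indicator {max (\<zeta> + t - \<tau>) (-d)..\<zeta>} u *\<^sub>R (exp (- \<rho> * (\<zeta> - u)) * g (t + \<zeta> - u) * \<phi> u))) \<in> borel_measurable lborel"
        by simp
    qed
    finally show ?thesis by simp
  qed
  have k_zero: "k v = 0" if "v \<le> s - d \<or> \<tau> \<le> v" for v
  proof -
    have "phi0 \<zeta> * exp (\<rho> * \<zeta>) * (indicator {s<..\<tau>} (v - \<zeta>) * g (v - \<zeta>)) = 0" for \<zeta>
      using that phi0_outside[of \<zeta>] by (cases "- d < \<zeta> \<and> \<zeta> < 0") (auto simp: indicator_def)
    then show ?thesis unfolding k_def by (simp only: Bochner_Integration.integral_zero)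
  qed
  have h_end: "h \<tau> 0 = 0" using h_eq[of \<tau> 0] s d_pos by simp
  \<comment> \<open>k is supported in (s - d, \<tau>): the part from s on is h(., 0), the part
    before s pairs with the history. At v = \<tau> both k and h(., 0) vanish.\<close>
  have split: "P s A v * k v = indicator {s..\<tau>} v *\<^sub>R (h v 0 * P s A v) + indicator {s - d<..<s} v *\<^sub>R (P s A v * k v)" for v
  proof -
    consider "v \<in> {s..<\<tau>}" | "v = \<tau>" | "v \<in> {s - d<..<s}" | "v \<le> s - d" | "\<tau> < v"
      by (cases "v < s"; cases "v < \<tau>"; cases "v \<le> s - d") fastforce+
    then show ?thesis
    proof cases
      case 1
      then show ?thesis using k_h[of v 0] d_pos by simp
    next
      case 2
      then show ?thesis using k_zero[of v] h_end s by simp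
    next
      case 3
      then show ?thesis by simp
    next
      case 4
      then show ?thesis using k_zero[of v] d_pos by simp
    next
      case 5
      then show ?thesis using k_zero[of v] s by simp
    qed
  qed
  have i1: "integrable lborel (\<lambda>v. indicator {s..\<tau>} v *\<^sub>R (h v 0 * P s A v))"
    using set_integrable_mult_continuous[OF Pi h0c] by (simp add: set_integrable_def)
  have i2: "integrable lborel (\<lambda>v. indicator {s - d<..<s} v *\<^sub>R (P s A v * k v))"
    by (intro integrable_mult_indicator dual(2)) simp
  have "(\<integral>v. P s A v * k v \<partial>lborel) = (LBINT v:{s..\<tau>}. h v 0 * P s A v) + (\<integral>v. indicator {s - d<..<s} v *\<^sub>R (P s A v * k v) \<partial>lborel)"
    unfolding set_lebesgue_integral_def by (subst split, rule Bochner_Integration.integral_add[OF i1 i2])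
  also have "(\<integral>v. indicator {s - d<..<s} v *\<^sub>R (P s A v * k v) \<partial>lborel) =
      (\<integral>\<zeta>. indicator {s - d<..<s} (s + 1 * \<zeta>) *\<^sub>R (P s A (s + 1 * \<zeta>) * k (s + 1 * \<zeta>)) \<partial>lborel)"
    using lborel_integral_real_affine[of 1 "\<lambda>v. indicator {s - d<..<s} v *\<^sub>R (P s A v * k v)" s] by simp
  also have "\<dots> = (LBINT \<zeta>:{-d<..<0}. h s \<zeta> * (exp (\<rho> * \<zeta>) * P s A (s + \<zeta>)))"
    unfolding set_lebesgue_integral_def
  proof (rule Bochner_Integration.integral_cong[OF refl])
    fix \<zeta> :: real
    show "indicator {s - d<..<s} (s + 1 * \<zeta>) *\<^sub>R (P s A (s + 1 * \<zeta>) * k (s + 1 * \<zeta>)) =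
       indicator {-d<..<0} \<zeta> *\<^sub>R (h s \<zeta> * (exp (\<rho> * \<zeta>) * P s A (s + \<zeta>)))"
      using k_h[of s \<zeta>] s by (cases "\<zeta> \<in> {-d<..<0}") (auto simp: indicator_def)
  qed
  finally have kk: "(\<integral>v. P s A v * k v \<partial>lborel) = (LBINT v:{s..\<tau>}. h v 0 * P s A v) +
     (LBINT \<zeta>:{-d<..<0}. h s \<zeta> * (exp (\<rho> * \<zeta>) * P s A (s + \<zeta>)))" .
  have "(LBINT t:{s..\<tau>}. q t * P s A t) = (LBINT t:{s..\<tau>}. h t 0 * P s A t + P s A t)"
    by (simp add: q_def distrib_right)
  also have "\<dots> = (LBINT t:{s..\<tau>}. h t 0 * P s A t) + (LBINT t:{s..\<tau>}. P s A t)"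
    by (intro set_integral_add(2) Pi) (use i1 in \<open>simp add: set_integrable_def\<close>)
  finally have "(LBINT t:{s..\<tau>}. P s A t) = g s * P s A s + (LBINT \<zeta>:{-d<..<0}. h s \<zeta> * (exp (\<rho> * \<zeta>) * P s A (s + \<zeta>)))"
    using dual(1) kk by linarith
  moreover have "(LBINT u:{s..<\<tau>}. P s A u) = (LBINT u:{s..\<tau>}. P s A u)"
    unfolding set_lebesgue_integral_def
  proof (rule integral_cong_AE)
    show "AE u in lborel. indicator {s..<\<tau>} u *\<^sub>R P s A u = indicator {s..\<tau>} u *\<^sub>R P s A u"
      using AE_lborel_singleton[of \<tau>] by eventually_elim (auto simp: indicator_def)
  qed (use Pm in measurable)
  ultimately show ?thesis by simp
qed

text \<open>The candidate, multiplied by \<xi>(s), is \<open>F s\<close>-measurable, and by the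
  representation of the time integral it has the correct integral over every A in
  \<open>F s\<close>; this characterizes the conditional expectation. After retirement g(s) and h(s)
  vanish together with the remaining income. Division by \<xi>(s) uses that it is almost surely
  positive.\<close>

lemma conditional_human_capital:
  assumes gh: "gh_solution r \<delta> \<beta> \<tau> d \<phi> g h" and \<rho>: "\<rho> = r + \<delta>" and s: "0 \<le> s"
  shows "AE \<omega> in M. human_capital M F \<tau> \<xi> y s \<omega> = g s * X0 y s \<omega> + L2_inner d (h s) (X1 y s \<omega>)"
proof -
  have hc: "continuous_on ({0..} \<times> {-d..0}) (\<lambda>(t, \<zeta>). h t \<zeta>)"
    and g_end: "\<tau> \<le> s \<Longrightarrow> g s = 0" and h_end: "\<And>\<zeta>. \<tau> \<le> s \<Longrightarrow> \<zeta> \<in> {-d..0} \<Longrightarrow> h s \<zeta> = 0"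
    using gh s unfolding gh_solution_def by auto
  \<comment> \<open>The kernel h(s) is known to be continuous only on [- d, 0]; cut off there it is
    Borel on the line and bounded on the delay window.\<close>
  define k where "k \<zeta> = indicator {-d..0} \<zeta> * h s \<zeta>" for \<zeta>
  have "continuous_on {-d..0} (\<lambda>\<zeta>. (\<lambda>(t, \<zeta>). h t \<zeta>) (s, \<zeta>))"
    by (rule continuous_on_compose2[OF hc]) (use s in \<open>auto intro!: continuous_intros\<close>)
  then have hs: "continuous_on {-d..0} (\<lambda>\<zeta>. h s \<zeta>)" by simp
  have km: "k \<in> borel_measurable borel"
    using borel_measurable_continuous_on_indicator[OF _ hs] by (simp add: k_def[abs_def])
  obtain K where K: "\<And>x. x \<in> {-d..0} \<Longrightarrow> \<bar>h s x\<bar> \<le> K" using continuous_on_bounded_real[OF hs] by blast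
  have kb: "\<bar>k \<zeta>\<bar> \<le> K" if "\<zeta> \<in> {-d<..<0}" for \<zeta> using K[of \<zeta>] that by (simp add: k_def)
  define R where "R \<omega> = (LBINT \<zeta>:{-d<..<0}. k \<zeta> * yh (s + \<zeta>) \<omega>)" for \<omega>
  define rhs where "rhs \<omega> = \<xi> s \<omega> * (g s * y s \<omega> + R \<omega>)" for \<omega>
  define lhs where "lhs \<omega> = (LBINT u:{s..<\<tau>}. \<xi> u \<omega> * y u \<omega>)" for \<omega>
  interpret sub: finite_measure_subalgebra M "F s"
    by unfold_locales (rule subalgebra_F)
  have split: "indicator A \<omega> * rhs \<omega> = g s * (indicator A \<omega> * yh s \<omega> * \<xi> s \<omega>) + indicator A \<omega> * (\<xi> s \<omega> * R \<omega>)" for A \<omega>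
    using s by (simp add: rhs_def yh_def algebra_simps)
  have w: "integrable M (\<lambda>\<omega>. indicator A \<omega> * yh s \<omega> * \<xi> s \<omega>)" if "A \<in> sets (F s)" for A
    using that sets_F_subset by (intro weighted_integrable(1)[OF s order.refl]) auto
  note hist = expectation_history_integral[OF s _ km kb, folded R_def]
  have top: "space M \<in> sets (F s)" using sets.top[of "F s"] by simp
  have hc_lhs: "(LBINT u:{s..}. \<xi> u \<omega> * (1 - retired \<tau> u) * y u \<omega>) = lhs \<omega>" for \<omega>
    unfolding lhs_def set_lebesgue_integral_def
    by (intro Bochner_Integration.integral_cong refl) (auto simp: retired_def indicator_def)
  have "AE \<omega> in M. real_cond_exp M (F s) lhs \<omega> = rhs \<omega>"
  proof (rule sub.real_cond_exp_charact)
    show "integrable M lhs"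
      using expectation_time_integral(1)[OF s top, of \<tau>]
      by (rule Bochner_Integration.integrable_cong[THEN iffD1, rotated 2]) (auto simp: lhs_def)
    have "integrable M (\<lambda>\<omega>. indicator (space M) \<omega> * rhs \<omega>)"
      unfolding split using w[OF top] hist(1)[OF top] by auto
    then show "integrable M rhs"
      by (rule Bochner_Integration.integrable_cong[THEN iffD1, rotated 2]) auto
    show "rhs \<in> borel_measurable (F s)"
      unfolding rhs_def[abs_def] R_def
      using xi_F[OF s] y_F[OF s] history_functional_measurable[OF s km]
      by (intro borel_measurable_times borel_measurable_add) auto
    fix A assume A: "A \<in> sets (F s)"
    have "(LINT \<omega>:A|M. lhs \<omega>) = (LBINT u:{s..<\<tau>}. P s A u)"
      using expectation_time_integral(2)[OF s A, of \<tau>] by (simp add: set_lebesgue_integral_def lhs_def)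
    also have "\<dots> = g s * P s A s + (LBINT \<zeta>:{-d<..<0}. k \<zeta> * (exp (\<rho> * \<zeta>) * P s A (s + \<zeta>)))"
    proof (cases "s < \<tau>")
      case True
      have "(LBINT \<zeta>:{-d<..<0}. k \<zeta> * (exp (\<rho> * \<zeta>) * P s A (s + \<zeta>))) = (LBINT \<zeta>:{-d<..<0}. h s \<zeta> * (exp (\<rho> * \<zeta>) * P s A (s + \<zeta>)))"
        by (intro set_lebesgue_integral_cong) (auto simp: k_def)
      then show ?thesis using time_integral_representation[OF gh \<rho> s True A] by simp
    next
      case False
      then have "k = (\<lambda>_. 0)" using h_end by (auto simp: k_def indicator_def fun_eq_iff)
      then show ?thesis using False g_end by (simp add: set_lebesgue_integral_def)
    qed
    also have "\<dots> = g s * expectation (\<lambda>\<omega>. indicator A \<omega> * yh s \<omega> * \<xi> s \<omega>) + expectation (\<lambda>\<omega>. indicator A \<omega> * (\<xi> s \<omega> * R \<omega>))"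
      using hist(2)[OF A] by (simp add: P_def)
    also have "\<dots> = expectation (\<lambda>\<omega>. indicator A \<omega> * rhs \<omega>)"
      unfolding split using w[OF A] hist(1)[OF A] by simp
    finally show "(LINT \<omega>:A|M. lhs \<omega>) = (LINT \<omega>:A|M. rhs \<omega>)"
      by (simp add: set_lebesgue_integral_def)
  qed
  then show ?thesis using state_price_pos AE_space
  proof eventually_elim
    case (elim \<omega>)
    have "L2_inner d (h s) (X1 y s \<omega>) = R \<omega>"
      unfolding L2_inner_def X1_def R_def
    proof (rule set_lebesgue_integral_cong)
      show "\<forall>\<zeta>. \<zeta> \<in> {-d<..<0} \<longrightarrow> h s \<zeta> * y (s + \<zeta>) \<omega> = k \<zeta> * yh (s + \<zeta>) \<omega>"
      proof (intro allI impI)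
        fix \<zeta> assume z: "\<zeta> \<in> {-d<..<0}"
        have "y (s + \<zeta>) \<omega> = yh (s + \<zeta>) \<omega>"
        proof (cases "0 \<le> s + \<zeta>")
          case False
          then have "s + \<zeta> \<in> {-d..<0}" "s + \<zeta> \<in> {-d<..<0}" using z s by auto
          then show ?thesis using False y_hist[OF elim(3), of "s + \<zeta>"] by (simp add: yh_def)
        qed (simp add: yh_def)
        then show "h s \<zeta> * y (s + \<zeta>) \<omega> = k \<zeta> * yh (s + \<zeta>) \<omega>" using z by (simp add: k_def)
      qed
    qed simp
    moreover have "0 < \<xi> s \<omega>" using elim(2) s by blast
    ultimately show ?case
      using elim(1) by (simp add: human_capital_def hc_lhs[abs_def] rhs_def X0_def)
  qed
qed

end

theorem corollary3p5:
  fixes M :: "'w measure" and Z :: "real \<Rightarrow> 'w \<Rightarrow> real^'n" and F :: "real \<Rightarrow> 'w measure"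
    and r \<delta> \<tau>R d \<mu>y w :: real
    and \<mu> \<sigma>y :: "real^'n" and \<sigma> :: "real^'n^'n"
    and \<phi> :: "real \<Rightarrow> real" and x :: "real \<times> (real \<Rightarrow> real)"
    and c B W y \<xi> :: "real \<Rightarrow> 'w \<Rightarrow> real" and \<theta> :: "real \<Rightarrow> 'w \<Rightarrow> real^'n"
    and g :: "real \<Rightarrow> real" and h :: "real \<Rightarrow> real \<Rightarrow> real"
    and s :: real
  assumes "prob_space M"
    and "standard_brownian_motion M Z"
    and "F = augmented_filtration M Z"
    and "invertible \<sigma>" and "\<delta> > 0" and "\<tau>R > 0" and "d > 0"
    and "\<phi> \<in> L2_fun d"
    and "beta r \<delta> \<mu> \<sigma> \<mu>y \<sigma>y > 0"
    and "x \<in> M2 d"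
    and "admissible_control M F c B \<theta>"
    and "income_equation M F Z d \<mu>y \<sigma>y \<phi> x y"
    and "wealth_equation M F Z r \<delta> \<tau>R \<mu> \<sigma> c B \<theta> y w W"
    and "state_price_density M F Z r \<delta> \<mu> \<sigma> \<xi>"
    and "gh_solution r \<delta> (beta r \<delta> \<mu> \<sigma> \<mu>y \<sigma>y) \<tau>R d \<phi> g h"
    and "s \<ge> 0"
  shows "AE \<omega> in M.
      W s \<omega> + human_capital M F \<tau>R \<xi> y s \<omega> \<ge> 0 \<longleftrightarrow>
      W s \<omega> + g s * X0 y s \<omega> + L2_inner d (h s) (X1 y s \<omega>) \<ge> 0"
proof -
  interpret prob_space M by fact
  interpret income_process M Z F "r + \<delta>" \<mu>y d "fst x" "beta r \<delta> \<mu> \<sigma> \<mu>y \<sigma>y" "kappa r \<mu> \<sigma>" \<sigma>y \<phi> "snd x" y \<xi>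
  proof unfold_locales
    show "standard_brownian_motion M Z" "F = augmented_filtration M Z" "0 < d" "0 < beta r \<delta> \<mu> \<sigma> \<mu>y \<sigma>y"
      by fact+
    show "set_integrable lborel {- d<..<0} \<phi>" using assms(8) by (rule L2_fun_integrable)
    show "set_integrable lborel {- d<..<0} (snd x)"
      using assms(10) by (intro L2_fun_integrable) (auto simp: M2_def)
    show "beta r \<delta> \<mu> \<sigma> \<mu>y \<sigma>y = r + \<delta> - \<mu>y + \<sigma>y \<bullet> kappa r \<mu> \<sigma>" by (simp add: beta_def)
  qed (use assms in \<open>auto simp: income_equation_def state_price_density_def\<close>)
  \<comment> \<open>Financial wealth is the same summand in both constraints, so the almost sure
    identity for human capital makes their left sides equal.\<close>
  show ?thesis
    using conditional_human_capital[OF assms(15) refl assms(16)] by eventually_elim (simp add: add.assoc)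
qed

end
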